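(* Let $i : X \hookrightarrow \mathbb{P}^3$ be a smooth quartic hypersurface over $\mathbb{C}$, and let $d \geq 0$ be an integer. Then the dimensions of the spaces of sections that define foliations on $X$ with tangent sheaf $\mathcal{L}_d = i^{*}\mathcal{O}_{\mathbb{P}^3}(1-d)$ are given by $$h^0\left(X,\Omega^1_X \otimes i^{*}\mathcal{O}_{\mathbb{P}^3}(d-1)\right) = \begin{cases} 0, & \text{if } d < 3,\\ 6, & \text{if } d = 3,\\ 20, & \text{if } d = 4,\\ 45, & \text{if } d = 5,\\ 4d^2-8d-16, & \text{if } d > 5. \end{cases}$$
   Context: $\Omega^1_X$ and $\Theta_X$ denote the cotangent and tangent sheaves of $X$, and $h^0 = \dim_{\mathbb{C}} H^0$. A foliation on $X$ with tangent sheaf $\mathcal{L}$ (an invertible sheaf) is a class, up to non-zero scalars, of a non-zero section in $H^0(X,\mathscr{H}om(\mathcal{L},\Theta_X))$. Since $X$ is a K3 surface ($\omega_X \cong \mathcal{O}_X$), one has $\Theta_X \cong \Omega^1_X$, so for $\mathcal{L} = \mathcal{L}_d$ the space of sections defining foliations is $H^0(X,\Theta_X \otimes i^{*}\mathcal{O}_{\mathbb{P}^3}(d-1)) \cong H^0(X,\Omega^1_X \otimes i^{*}\mathcal{O}_{\mathbb{P}^3}(d-1))$. *)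

theory Defs
  imports
    "HOL-Analysis.Analysis"
    "HOL-Library.Poly_Mapping"
    "HOL-Algebra.AbelCoset"
    "Jordan_Normal_Form.Missing_VectorSpace"
begin

section \<open>Modules given by generators and relations\<close>

text \<open>Modules are \<^const>\<open>Module.module\<close> records of HOL-Algebra. The fields \<open>mult\<close> and \<open>one\<close>
  of such a record play no role for a module and are filled with a dummy value.\<close>

definition free_module :: "('a, 'r) ring_scheme \<Rightarrow> 's set \<Rightarrow> ('a, 's \<Rightarrow> 'a) module" where
  "free_module A S =
    \<lparr>carrier = {f. finite {s. f s \<noteq> \<zero>\<^bsub>A\<^esub>} \<and> (\<forall>s\<in>S. f s \<in> carrier A) \<and> (\<forall>s. s \<notin> S \<longrightarrow> f s = \<zero>\<^bsub>A\<^esub>)},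
     mult = (\<lambda>_ _ _. \<zero>\<^bsub>A\<^esub>), one = (\<lambda>_. \<zero>\<^bsub>A\<^esub>), zero = (\<lambda>_. \<zero>\<^bsub>A\<^esub>),
     add = (\<lambda>f g s. f s \<oplus>\<^bsub>A\<^esub> g s), smult = (\<lambda>a f s. a \<otimes>\<^bsub>A\<^esub> f s)\<rparr>"

definition free_gen :: "('a, 'r) ring_scheme \<Rightarrow> 's \<Rightarrow> 's \<Rightarrow> 'a" where
  "free_gen A s = (\<lambda>t. if t = s then \<one>\<^bsub>A\<^esub> else \<zero>\<^bsub>A\<^esub>)"

text \<open>\<open>\<Sum> f\<^sub>s s \<mapsto> \<Sum> \<rho> (f\<^sub>s) \<sigma> (s)\<close>, semilinear over a ring homomorphism \<open>\<rho> : A \<rightarrow> B\<close>.\<close>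

definition free_map ::
  "('a, 'r) ring_scheme \<Rightarrow> ('b, 'q) ring_scheme \<Rightarrow> ('a \<Rightarrow> 'b) \<Rightarrow> ('s \<Rightarrow> 't) \<Rightarrow> ('s \<Rightarrow> 'a) \<Rightarrow> 't \<Rightarrow> 'b" where
  "free_map A B \<rho> \<sigma> f = (\<lambda>t. \<Oplus>\<^bsub>B\<^esub> s\<in>{s. f s \<noteq> \<zero>\<^bsub>A\<^esub> \<and> \<sigma> s = t}. \<rho> (f s))"

definition quotient_module :: "('a, 'm) module \<Rightarrow> 'm set \<Rightarrow> ('a, 'm set) module" where
  "quotient_module M N =
    \<lparr>carrier = a_rcosets\<^bsub>M\<^esub> N, mult = (\<lambda>_ _. N), one = N, zero = N,
     add = set_add M, smult = (\<lambda>a C. \<Union>m\<in>C. N +>\<^bsub>M\<^esub> (a \<odot>\<^bsub>M\<^esub> m))\<rparr>"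

definition relation_module :: "('a, 'r) ring_scheme \<Rightarrow> 's set \<Rightarrow> ('s \<Rightarrow> 'a) set \<Rightarrow> ('s \<Rightarrow> 'a) set" where
  "relation_module A S R = LinearCombinations.module.span A (free_module A S) R"

definition presented_module ::
  "('a, 'r) ring_scheme \<Rightarrow> 's set \<Rightarrow> ('s \<Rightarrow> 'a) set \<Rightarrow> ('a, ('s \<Rightarrow> 'a) set) module" where
  "presented_module A S R = quotient_module (free_module A S) (relation_module A S R)"

text \<open>The map induced on presented modules, when \<open>(\<rho>, \<sigma>)\<close> carries the relations over \<open>A\<close>
  into the relation module \<open>N\<close> of \<open>free_module B S'\<close>.\<close>

definition presented_map ::
  "('a, 'r) ring_scheme \<Rightarrow> ('b, 'q) ring_scheme \<Rightarrow> ('a \<Rightarrow> 'b) \<Rightarrow> ('s \<Rightarrow> 't) \<Rightarrow> 't set \<Rightarrow> ('t \<Rightarrow> 'b) set \<Rightarrow>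
    ('s \<Rightarrow> 'a) set \<Rightarrow> ('t \<Rightarrow> 'b) set" where
  "presented_map A B \<rho> \<sigma> S' N C = (\<Union>f\<in>C. N +>\<^bsub>free_module B S'\<^esub> free_map A B \<rho> \<sigma> f)"

text \<open>Kaehler differentials of an algebra \<open>A\<close> with structure map \<open>\<kappa>\<close>: generators \<open>da\<close> for
  \<open>a \<in> A\<close>.\<close>

definition kaehler_relations :: "('a, 'r) ring_scheme \<Rightarrow> ('k \<Rightarrow> 'a) \<Rightarrow> ('a \<Rightarrow> 'a) set" where
  "kaehler_relations A \<kappa> = (let F = free_module A (carrier A); d = free_gen A in
      {d (a \<oplus>\<^bsub>A\<^esub> b) \<ominus>\<^bsub>F\<^esub> (d a \<oplus>\<^bsub>F\<^esub> d b) | a b. a \<in> carrier A \<and> b \<in> carrier A}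
    \<union> {d (a \<otimes>\<^bsub>A\<^esub> b) \<ominus>\<^bsub>F\<^esub> (a \<odot>\<^bsub>F\<^esub> d b \<oplus>\<^bsub>F\<^esub> b \<odot>\<^bsub>F\<^esub> d a) | a b. a \<in> carrier A \<and> b \<in> carrier A}
    \<union> {d (\<kappa> c) | c. True})"

definition kaehler_module :: "('a, 'r) ring_scheme \<Rightarrow> ('k \<Rightarrow> 'a) \<Rightarrow> ('a, ('a \<Rightarrow> 'a) set) module" where
  "kaehler_module A \<kappa> = presented_module A (carrier A) (kaehler_relations A \<kappa>)"

definition tensor_relations ::
  "('a, 'r) ring_scheme \<Rightarrow> ('a, 'm) module \<Rightarrow> ('a, 'n) module \<Rightarrow> ('m \<times> 'n \<Rightarrow> 'a) set" where
  "tensor_relations A M N = (let F = free_module A (carrier M \<times> carrier N); e = free_gen A in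
      {e (m \<oplus>\<^bsub>M\<^esub> m', n) \<ominus>\<^bsub>F\<^esub> (e (m, n) \<oplus>\<^bsub>F\<^esub> e (m', n)) | m m' n.
          m \<in> carrier M \<and> m' \<in> carrier M \<and> n \<in> carrier N}
    \<union> {e (m, n \<oplus>\<^bsub>N\<^esub> n') \<ominus>\<^bsub>F\<^esub> (e (m, n) \<oplus>\<^bsub>F\<^esub> e (m, n')) | m n n'.
          m \<in> carrier M \<and> n \<in> carrier N \<and> n' \<in> carrier N}
    \<union> {e (a \<odot>\<^bsub>M\<^esub> m, n) \<ominus>\<^bsub>F\<^esub> a \<odot>\<^bsub>F\<^esub> e (m, n) | a m n.
          a \<in> carrier A \<and> m \<in> carrier M \<and> n \<in> carrier N}
    \<union> {e (m, a \<odot>\<^bsub>N\<^esub> n) \<ominus>\<^bsub>F\<^esub> a \<odot>\<^bsub>F\<^esub> e (m, n) | a m n.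
          a \<in> carrier A \<and> m \<in> carrier M \<and> n \<in> carrier N})"

definition tensor_module ::
  "('a, 'r) ring_scheme \<Rightarrow> ('a, 'm) module \<Rightarrow> ('a, 'n) module \<Rightarrow> ('a, ('m \<times> 'n \<Rightarrow> 'a) set) module" where
  "tensor_module A M N = presented_module A (carrier M \<times> carrier N) (tensor_relations A M N)"


section \<open>Sheaves of modules on a ringed space over the complex numbers\<close>

record ('p, 'a, 'm) presheaf =
  sec :: "'p set \<Rightarrow> ('a, 'm) module"
  res :: "'p set \<Rightarrow> 'p set \<Rightarrow> 'm \<Rightarrow> 'm"  \<comment> \<open>\<open>res F U V : F(U) \<rightarrow> F(V)\<close> for \<open>V \<subseteq> U\<close>\<close>

text \<open>The structure sheaf is stored as a module over itself, so that \<open>sec (str X) U\<close> is also a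
  ring (here \<open>mult\<close> and \<open>one\<close> are meaningful); \<open>cst X U : \<complex> \<rightarrow> \<O>\<^sub>X(U)\<close> is the structure map.\<close>

record ('p, 'a) ringed_space =
  pts :: "'p topology"
  str :: "('p, 'a, 'a) presheaf"
  cst :: "'p set \<Rightarrow> complex \<Rightarrow> 'a"

definition germ ::
  "('p, 'a) ringed_space \<Rightarrow> ('p, 'a, 'm) presheaf \<Rightarrow> 'p \<Rightarrow> 'p set \<Rightarrow> 'm \<Rightarrow> ('p set \<times> 'm) set" where
  "germ X F p U m = {(V, n). openin (pts X) V \<and> p \<in> V \<and> n \<in> carrier (sec F V) \<and>
     (\<exists>W. openin (pts X) W \<and> p \<in> W \<and> W \<subseteq> U \<inter> V \<and> res F U W m = res F V W n)}"

text \<open>Sections of the associated sheaf are the families of germs that locally come from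
  sections of the presheaf (extended by the empty set off \<open>U\<close>).\<close>

definition sheafify ::
  "('p, 'a) ringed_space \<Rightarrow> ('p, 'a, 'm) presheaf \<Rightarrow> ('p, 'a, 'p \<Rightarrow> ('p set \<times> 'm) set) presheaf" where
  "sheafify X F =
    \<lparr>sec = (\<lambda>U.
       \<lparr>carrier = {s. (\<forall>p. p \<notin> U \<longrightarrow> s p = {}) \<and>
          (\<forall>p\<in>U. \<exists>V m. openin (pts X) V \<and> p \<in> V \<and> V \<subseteq> U \<and> m \<in> carrier (sec F V) \<and>
             (\<forall>q\<in>V. s q = germ X F q V m))},
        mult = (\<lambda>_ _ _. {}), one = (\<lambda>_. {}),
        zero = (\<lambda>p. if p \<in> U then germ X F p U \<zero>\<^bsub>sec F U\<^esub> else {}),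
        add = (\<lambda>s t p. \<Union>(V, m)\<in>s p. \<Union>(W, n)\<in>t p.
          germ X F p (V \<inter> W) (res F V (V \<inter> W) m \<oplus>\<^bsub>sec F (V \<inter> W)\<^esub> res F W (V \<inter> W) n)),
        smult = (\<lambda>a s p. \<Union>(V, m)\<in>s p.
          germ X F p (U \<inter> V) (res (str X) U (U \<inter> V) a \<odot>\<^bsub>sec F (U \<inter> V)\<^esub> res F V (U \<inter> V) m))\<rparr>),
     res = (\<lambda>U V s p. if p \<in> V then s p else {})\<rparr>"

definition kaehler_presheaf ::
  "('p, 'a) ringed_space \<Rightarrow> ('p, 'a, ('a \<Rightarrow> 'a) set) presheaf" where
  "kaehler_presheaf X = (let A = sec (str X) in
    \<lparr>sec = (\<lambda>U. kaehler_module (A U) (cst X U)),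
     res = (\<lambda>U V. presented_map (A U) (A V) (res (str X) U V) (res (str X) U V) (carrier (A V))
              (relation_module (A V) (carrier (A V)) (kaehler_relations (A V) (cst X V))))\<rparr>)"

definition cotangent_sheaf ::
  "('p, 'a) ringed_space \<Rightarrow> ('p, 'a, 'p \<Rightarrow> ('p set \<times> ('a \<Rightarrow> 'a) set) set) presheaf" where
  "cotangent_sheaf X = sheafify X (kaehler_presheaf X)"

definition tensor_presheaf ::
  "('p, 'a) ringed_space \<Rightarrow> ('p, 'a, 'm) presheaf \<Rightarrow> ('p, 'a, 'n) presheaf \<Rightarrow>
    ('p, 'a, ('m \<times> 'n \<Rightarrow> 'a) set) presheaf" where
  "tensor_presheaf X M N = (let A = sec (str X); S = (\<lambda>U. carrier (sec M U) \<times> carrier (sec N U)) in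
    \<lparr>sec = (\<lambda>U. tensor_module (A U) (sec M U) (sec N U)),
     res = (\<lambda>U V. presented_map (A U) (A V) (res (str X) U V) (map_prod (res M U V) (res N U V)) (S V)
              (relation_module (A V) (S V) (tensor_relations (A V) (sec M V) (sec N V))))\<rparr>)"

definition tensor_sheaf ::
  "('p, 'a) ringed_space \<Rightarrow> ('p, 'a, 'm) presheaf \<Rightarrow> ('p, 'a, 'n) presheaf \<Rightarrow>
    ('p, 'a, 'p \<Rightarrow> ('p set \<times> ('m \<times> 'n \<Rightarrow> 'a) set) set) presheaf" where
  "tensor_sheaf X M N = sheafify X (tensor_presheaf X M N)"

text \<open>Sections over \<open>U\<close> of the sheaf of homomorphisms are the morphisms \<open>M|U \<rightarrow> N|U\<close>, i.e. the
  compatible families \<open>h V : M(V) \<rightarrow> N(V)\<close>, \<open>V \<subseteq> U\<close> open; outside its domain such a family is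
  \<open>undefined\<close>, so that distinct families are distinct sections.\<close>

definition hom_sheaf ::
  "('p, 'a) ringed_space \<Rightarrow> ('p, 'a, 'm) presheaf \<Rightarrow> ('p, 'a, 'n) presheaf \<Rightarrow>
    ('p, 'a, 'p set \<Rightarrow> 'm \<Rightarrow> 'n) presheaf" where
  "hom_sheaf X M N = (let
      dom = (\<lambda>U V m. openin (pts X) V \<and> V \<subseteq> U \<and> m \<in> carrier (sec M V));
      ext = (\<lambda>U h V m. if dom U V m then h V m else undefined)
    in
    \<lparr>sec = (\<lambda>U.
       \<lparr>carrier = {h. h = ext U h \<and>
          (\<forall>V. openin (pts X) V \<and> V \<subseteq> U \<longrightarrow>
             h V \<in> LinearCombinations.module_hom (sec (str X) V) (sec M V) (sec N V)) \<and>
          (\<forall>V W m. dom U V m \<and> openin (pts X) W \<and> W \<subseteq> V \<longrightarrow>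
             h W (res M V W m) = res N V W (h V m))},
        mult = (\<lambda>_ _. undefined), one = undefined,
        zero = ext U (\<lambda>V m. \<zero>\<^bsub>sec N V\<^esub>),
        add = (\<lambda>h k. ext U (\<lambda>V m. h V m \<oplus>\<^bsub>sec N V\<^esub> k V m)),
        smult = (\<lambda>a h. ext U (\<lambda>V m. res (str X) U V a \<odot>\<^bsub>sec N V\<^esub> h V m))\<rparr>),
     res = (\<lambda>U V h. ext V h)\<rparr>)"

definition tangent_sheaf where
  "tangent_sheaf X = hom_sheaf X (cotangent_sheaf X) (str X)"

definition complex_field :: "complex ring" where
  "complex_field = \<lparr>carrier = UNIV, mult = (*), one = 1, zero = 0, add = (+)\<rparr>"

definition H0 :: "('p, 'a) ringed_space \<Rightarrow> ('p, 'a, 'm) presheaf \<Rightarrow> (complex, 'm) module" where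
  "H0 X F = (let U = topspace (pts X); M = sec F U in
    \<lparr>carrier = carrier M, mult = mult M, one = one M, zero = zero M, add = add M,
     smult = (\<lambda>c m. cst X U c \<odot>\<^bsub>M\<^esub> m)\<rparr>)"

definition fin_dim_space :: "(complex, 'm) module \<Rightarrow> bool" where
  "fin_dim_space V \<longleftrightarrow> vectorspace complex_field V \<and> vectorspace.fin_dim complex_field V"

definition h0 :: "('p, 'a) ringed_space \<Rightarrow> ('p, 'a, 'm) presheaf \<Rightarrow> nat" where
  "h0 X F = vectorspace.dim complex_field (H0 X F)"

text \<open>A foliation with tangent sheaf \<open>L\<close> is a non-zero global section of \<open>Hom(L, \<Theta>\<^sub>X)\<close>, up to scalars.\<close>

definition foliation_sheaf where
  "foliation_sheaf X L = hom_sheaf X L (tangent_sheaf X)"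


section \<open>Hypersurfaces in complex projective 3-space\<close>

text \<open>The polynomial ring \<open>\<complex>[x\<^sub>0, \<dots>, x\<^sub>3]\<close>, with the variables indexed by the four-element type
  \<open>4\<close>.\<close>

type_synonym form = "(4 \<Rightarrow>\<^sub>0 nat) \<Rightarrow>\<^sub>0 complex"

definition peval :: "form \<Rightarrow> complex ^ 4 \<Rightarrow> complex" where
  "peval f x = (\<Sum>m\<in>Poly_Mapping.keys f. Poly_Mapping.lookup f m * (\<Prod>i\<in>UNIV. (x $ i) ^ Poly_Mapping.lookup m i))"

definition homogeneous :: "nat \<Rightarrow> form \<Rightarrow> bool" where
  "homogeneous n f \<longleftrightarrow> (\<forall>m\<in>Poly_Mapping.keys f. (\<Sum>i\<in>UNIV. Poly_Mapping.lookup m i) = n)"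

definition partial :: "4 \<Rightarrow> form \<Rightarrow> form" where
  "partial i f = (\<Sum>m\<in>Poly_Mapping.keys f.
     Poly_Mapping.single (m - Poly_Mapping.single i 1) (of_nat (Poly_Mapping.lookup m i) * Poly_Mapping.lookup f m))"

text \<open>Points of \<open>\<P>\<^sup>3\<close> are punctured lines through the origin. Hence \<open>\<Union>U\<close> is the punctured cone
  over a set \<open>U\<close> of points.\<close>

type_synonym point = "(complex ^ 4) set"

definition proj_space :: "point set" where
  "proj_space = {{c *s x | c. c \<noteq> 0} | x. x \<noteq> 0}"

definition zero_locus :: "form \<Rightarrow> point set" where
  "zero_locus f = {p \<in> proj_space. \<forall>x\<in>p. peval f x = 0}"

definition zariski :: "point topology" where
  "zariski = topology_generated_by {proj_space - zero_locus f | f n. homogeneous n f}"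

definition smooth_hypersurface :: "nat \<Rightarrow> form \<Rightarrow> bool" where
  "smooth_hypersurface n F \<longleftrightarrow> homogeneous n F \<and> F \<noteq> 0 \<and>
     (\<forall>x. x \<noteq> 0 \<and> peval F x = 0 \<longrightarrow> (\<exists>i. peval (partial i F) x \<noteq> 0))"

text \<open>Sections of \<open>\<O>(k)\<close> over an open \<open>U \<subseteq> \<P>\<^sup>3\<close> are the functions on the cone over \<open>U\<close> that are
  locally quotients of forms with difference of degrees \<open>k\<close>; they are extended by \<open>0\<close> off the
  cone.\<close>

definition proj_twist_sections :: "int \<Rightarrow> point set \<Rightarrow> (complex ^ 4 \<Rightarrow> complex) set" where
  "proj_twist_sections k U = {s. (\<forall>x. x \<notin> \<Union>U \<longrightarrow> s x = 0) \<and>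
     (\<forall>p\<in>U. \<exists>V f g m n. openin zariski V \<and> p \<in> V \<and> V \<subseteq> U \<and>
        homogeneous m f \<and> homogeneous n g \<and> int m - int n = k \<and>
        (\<forall>x\<in>\<Union>V. peval g x \<noteq> 0 \<and> s x = peval f x / peval g x))}"

text \<open>The pull-back \<open>i\<^sup>*\<O>(k)\<close> to the closed subvariety \<open>X = zero_locus F\<close>: its sections are the
  functions on the cone over an open subset of \<open>X\<close> that are locally restrictions of sections of
  \<open>\<O>(k)\<close>. This is the usual pull-back, because \<open>X\<close> carries the reduced structure (a smooth
  hypersurface is reduced) and so \<open>i\<^sup>*\<O>(k)\<close> is \<open>\<O>(k)\<close> modulo the sections vanishing on \<open>X\<close>. For
  \<open>k = 0\<close> it is the structure sheaf of \<open>X\<close>; only in that case \<open>mult\<close> and \<open>one\<close> are meaningful.\<close>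

definition twist :: "form \<Rightarrow> int \<Rightarrow> (point, complex ^ 4 \<Rightarrow> complex, complex ^ 4 \<Rightarrow> complex) presheaf" where
  "twist F k =
    \<lparr>sec = (\<lambda>U.
       \<lparr>carrier = {s. (\<forall>x. x \<notin> \<Union>U \<longrightarrow> s x = 0) \<and>
          (\<forall>p\<in>U. \<exists>V t. openin zariski V \<and> p \<in> V \<and> t \<in> proj_twist_sections k V \<and>
             (\<forall>x\<in>\<Union>(U \<inter> V). s x = t x))},
        mult = (\<lambda>s t x. s x * t x), one = (\<lambda>x. if x \<in> \<Union>U then 1 else 0), zero = (\<lambda>x. 0),
        add = (\<lambda>s t x. s x + t x), smult = (\<lambda>a s x. a x * s x)\<rparr>),
     res = (\<lambda>U V s x. if x \<in> \<Union>V then s x else 0)\<rparr>"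

definition hypersurface :: "form \<Rightarrow> (point, complex ^ 4 \<Rightarrow> complex) ringed_space" where
  "hypersurface F =
    \<lparr>pts = subtopology zariski (zero_locus F),
     str = twist F 0,
     cst = (\<lambda>U c x. if x \<in> \<Union>U then c else 0)\<rparr>"

end

theory Submission
 imports
  Defs
  "HOL-Computational_Algebra.Polynomial_Factorial"
  "HOL-Computational_Algebra.Field_as_Ring"
  "HOL-Computational_Algebra.Fundamental_Theorem_Algebra"
begin

text \<open>Write \<open>k = d - 1\<close> and let \<open>K\<close> be the punctured cone over the quartic. Everything is
  computed with functions on \<open>K\<close>. A differential form \<open>\<omega>\<close> with values in \<open>\<O>(k)\<close> is encoded by
  the antisymmetric matrix \<open>\<eta> = \<omega> \<and> dF\<close>: its entries are regular of degree \<open>k + 2\<close>, it is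
  annihilated by contraction with the Euler vector \<open>x\<close>, and its cyclic product with \<open>dF\<close> vanishes.
  Where \<open>x\<^sub>j \<partial>\<^sub>lF\<close> is non-zero, such matrices are the combinations of \<open>du\<^sub>a \<and> dF\<close> and
  \<open>du\<^sub>b \<and> dF\<close> for the two remaining affine coordinates, while the Kaehler module is generated by
  \<open>du\<^sub>a\<close> and \<open>du\<^sub>b\<close>; therefore the sheafified tensor product has exactly these matrices as
  sections (\<open>tensor_dim\<close>). A section of the foliation sheaf is evaluated on the \<open>du\<^sub>i\<close>, which gives a
  matrix \<open>P\<close> with the roles of \<open>x\<close> and \<open>dF\<close> exchanged; the Hodge star of four-space exchanges
  them again, so that both spaces have the same dimension (\<open>foliation_dim\<close>).

  For the dimension let \<open>A(n)\<close> be the space of global sections of \<open>\<O>(n)\<close>. It consists of polynomials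
  (\<open>global_section_polynomial\<close>) and has dimension \<open>2n\<^sup>2 + 2\<close> for \<open>n > 0\<close>, \<open>1\<close> for \<open>n = 0\<close> and
  \<open>0\<close> for \<open>n < 0\<close>. Exactness of the Koszul complex of the gradient of \<open>F\<close> on \<open>K\<close> writes every global
  \<open>\<eta>\<close> as \<open>w \<and> dF\<close> with \<open>w\<close> in \<open>A(k - 1)\<^sup>4\<close> and \<open>\<Sum> x\<^sub>i w\<^sub>i = 0\<close>; here \<open>w\<close> is unique up to
  \<open>u dF\<close> with \<open>u\<close> in \<open>A(k - 4)\<close>. For \<open>k > 0\<close> the contraction with \<open>x\<close> maps \<open>A(k - 1)\<^sup>4\<close> onto
  \<open>A(k)\<close>, so the dimension is \<open>4 dim A(k - 1) - dim A(k) - dim A(k - 4)\<close>; for \<open>k \<le> 0\<close> it is \<open>0\<close>.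

  The Koszul argument needs powers of linear forms in the Jacobian ideal. Smoothness gives them through
  \<open>projective_nullstellensatz\<close>. It also needs unique normal forms for polynomials on \<open>K\<close>
  (\<open>reduced_unique\<close>), which rest on the fact that \<open>F\<close> has no multiple factors.\<close>

section \<open>Polynomial functions, degrees and derivatives\<close>

abbreviation plookup where "plookup \<equiv> Poly_Mapping.lookup"
abbreviation psingle where "psingle \<equiv> Poly_Mapping.single"
abbreviation pkeys where "pkeys \<equiv> Poly_Mapping.keys"

definition mon_eval :: "(4 \<Rightarrow>\<^sub>0 nat) => complex ^ 4 => complex" where
 "mon_eval m x = (\<Prod>i\<in>UNIV. (x $ i) ^ plookup m i)"

definition mon_degree :: "(4 \<Rightarrow>\<^sub>0 nat) => nat" where
 "mon_degree m = (\<Sum>i\<in>UNIV. plookup m i)"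

definition form_const :: "complex => form" where
 "form_const c = psingle 0 c"

definition form_var :: "4 => form" where
 "form_var i = psingle (psingle i 1) 1"

lemma mon_eval_add: "mon_eval (m + n) x = mon_eval m x * mon_eval n x"
 by (simp add: mon_eval_def lookup_add power_add prod.distrib)

lemma mon_eval_zero [simp]: "mon_eval 0 x = 1"
 by (simp add: mon_eval_def)

lemma mon_degree_add: "mon_degree (m + n) = mon_degree m + mon_degree n"
 by (simp add: mon_degree_def lookup_add sum.distrib)

lemma homogeneous_alt: "homogeneous n f \<longleftrightarrow> (\<forall>m. plookup f m ~= 0 --> mon_degree m = n)"
 by (auto simp: homogeneous_def mon_degree_def in_keys_iff)

lemma peval_superset:
 assumes "finite T" "pkeys f \<subseteq> T"
 shows "peval f x = (\<Sum>m\<in>T. plookup f m * mon_eval m x)"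
 unfolding peval_def mon_eval_def
 by (rule sum.mono_neutral_left) (use assms in "auto simp: in_keys_iff")

lemma peval_zero [simp]: "peval 0 x = 0"
 by (simp add: peval_def)

lemma peval_add [simp]: "peval (f + g) x = peval f x + peval g x"
proof -
 let ?T = "pkeys f \<union> pkeys g"
 have "pkeys (f + g) \<subseteq> ?T" by (rule keys_add)
 then show ?thesis
  by (simp add: peval_superset[of ?T] lookup_add algebra_simps sum.distrib)
qed

lemma peval_single [simp]: "peval (psingle m c) x = c * mon_eval m x"
 by (subst peval_superset[of "{m}"]) auto

lemma form_sum_monomials:
 "f = (\<Sum>m\<in>pkeys f. psingle m (plookup f m))"
 by (rule poly_mapping_eqI) (auto simp: lookup_sum lookup_single when_def in_keys_iff)

lemma form_induct [case_names zero single add]: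
 fixes f :: form
 assumes "P 0" "!!m c. P (psingle m c)" "!!f g. P f ==> P g ==> P (f + g)"
 shows "P f"
proof -
 have "finite T ==> P (\<Sum>m\<in>T. psingle m (plookup f m))" for T
  by (induction T rule: finite_induct) (use assms in auto)
 from this[of "pkeys f"] show ?thesis
  using form_sum_monomials[of f] by simp
qed

lemma peval_mult [simp]: "peval (f * g) x = peval f x * peval g x"
proof (induction f rule: form_induct)
 case (single m c)
 show ?case
  by (induction g rule: form_induct) (simp_all add: mult_single mon_eval_add algebra_simps)
qed (simp_all add: algebra_simps)

lemma peval_one [simp]: "peval 1 x = 1"
 using peval_single[of 0 1 x] by (simp del: peval_single)

lemma peval_const [simp]: "peval (form_const c) x = c"
 by (simp add: form_const_def)

lemma peval_uminus [simp]: "peval (- f) x = - peval f x"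
 by (metis add_eq_0_iff peval_add peval_zero)

lemma peval_diff [simp]: "peval (f - g) x = peval f x - peval g x"
 by (metis add_uminus_conv_diff peval_add peval_uminus)

lemma peval_sum [simp]: "peval (sum f A) x = (\<Sum>a\<in>A. peval (f a) x)"
 by (induction A rule: infinite_finite_induct) auto

lemma peval_prod [simp]: "peval (prod f A) x = (\<Prod>a\<in>A. peval (f a) x)"
 by (induction A rule: infinite_finite_induct) auto

lemma peval_power [simp]: "peval (f ^ n) x = peval f x ^ n"
 by (induction n) auto

lemma peval_var [simp]: "peval (form_var i) x = x $ i"
proof -
 have "mon_eval (psingle i 1) x = x $ i"
  unfolding mon_eval_def
  by (subst prod.remove[of _ i]) (auto simp: lookup_single when_def intro!: prod.neutral)
 then show ?thesis by (simp add: form_var_def)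
qed

lemma form_monomial: "psingle m c = form_const c * (\<Prod>i\<in>UNIV. form_var i ^ plookup m i)"
proof -
 have p: "form_var i ^ n = psingle (psingle i n) 1" for i n
  by (induction n) (simp_all add: form_var_def mult_single flip: single_add)
 have s: "(\<Prod>i\<in>A. psingle (k i) (1::complex)) = psingle (\<Sum>i\<in>A. k i) 1" for A :: "4 set" and k :: "4 => 4 \<Rightarrow>\<^sub>0 nat"
  by (induction A rule: infinite_finite_induct) (simp_all add: mult_single)
 have "(\<Sum>i\<in>UNIV. psingle i (plookup m i)) = m"
  by (rule poly_mapping_eqI) (simp add: lookup_sum lookup_single when_def)
 then show ?thesis by (simp add: p s form_const_def mult_single)
qed

text \<open>Polynomials are generated as a ring by the constants and the variables; this is the
  induction that the chain rule for Kaehler differentials needs.\<close>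

lemma form_ring_induct [case_names const var add mult]:
 fixes f :: form
 assumes "!!c. P (form_const c)" "!!i. P (form_var i)"
  "!!f g. P f ==> P g ==> P (f + g)" "!!f g. P f ==> P g ==> P (f * g)"
 shows "P f"
proof (induction f rule: form_induct)
 case zero
 show ?case using assms(1)[of 0] by (simp add: form_const_def)
next
 case (single m c)
 have 1: "P 1" using assms(1)[of 1] by (simp add: form_const_def)
 have pow: "P (form_var i ^ n)" for i n
  by (induction n) (use 1 assms in auto)
 have "finite A ==> P (\<Prod>i\<in>A. form_var i ^ plookup m i)" for A
  by (induction A rule: finite_induct) (use 1 pow assms in auto)
 then show ?case by (simp add: form_monomial assms)
qed (use assms in auto)

lemma homogeneous_0 [simp]: "homogeneous n 0"
 by (simp add: homogeneous_alt)

lemma homogeneous_single: "mon_degree m = n ==> homogeneous n (psingle m c)"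
 by (simp add: homogeneous_alt lookup_single when_def)

lemma homogeneous_const [simp]: "homogeneous 0 (form_const c)"
 unfolding form_const_def by (rule homogeneous_single) (simp add: mon_degree_def)

lemma homogeneous_1 [simp]: "homogeneous 0 1"
 using homogeneous_const[of 1] by (simp add: form_const_def)

lemma homogeneous_var [simp]: "homogeneous 1 (form_var i)"
 unfolding form_var_def by (rule homogeneous_single) (simp add: mon_degree_def lookup_single when_def)

lemma homogeneous_add: "homogeneous n f ==> homogeneous n g ==> homogeneous n (f + g)"
 unfolding homogeneous_alt lookup_add by (metis add.right_neutral)

lemma homogeneous_uminus: "homogeneous n f ==> homogeneous n (- f)"
 by (auto simp: homogeneous_alt)

lemma homogeneous_diff: "homogeneous n f ==> homogeneous n g ==> homogeneous n (f - g)"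
 by (metis add_uminus_conv_diff homogeneous_add homogeneous_uminus)

lemma homogeneous_sum: "(!!a. a \<in> A ==> homogeneous n (f a)) ==> homogeneous n (sum f A)"
 by (induction A rule: infinite_finite_induct) (auto intro: homogeneous_add)

lemma homogeneous_mult:
 assumes "homogeneous m f" "homogeneous n g"
 shows "homogeneous (m + n) (f * g)"
proof -
 have "f * g = (\<Sum>k\<in>pkeys f. \<Sum>l\<in>pkeys g. psingle k (plookup f k) *
   psingle l (plookup g l))"
  by (subst form_sum_monomials[of f], subst form_sum_monomials[of g]) (rule sum_product)
 also have "homogeneous (m + n) \<dots>"
  using assms by (intro homogeneous_sum)
   (auto simp: mult_single homogeneous_alt in_keys_iff lookup_single when_def mon_degree_add)
 finally show ?thesis .
qed

lemma homogeneous_mult_eq: "homogeneous m f ==> homogeneous n g ==> k = m + n ==> homogeneous k (f * g)"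
 using homogeneous_mult by blast

lemma homogeneous_const_mult: "homogeneous n g ==> homogeneous n (form_const c * g)"
 using homogeneous_mult[of 0 "form_const c" n g] by simp

lemma homogeneous_power: "homogeneous m f ==> homogeneous (m * n) (f ^ n)"
 by (induction n) (auto dest: homogeneous_mult)

lemma homogeneous_prod:
 "(!!a. a \<in> A ==> homogeneous (d a) (f a)) ==> homogeneous (\<Sum>a\<in>A. d a) (prod f A)"
 by (induction A rule: infinite_finite_induct) (auto dest: homogeneous_mult)

lemma peval_scale:
 assumes "homogeneous n f"
 shows "peval f (c *s x) = c ^ n * peval f x"
proof -
 have "mon_eval m (c *s x) = c ^ mon_degree m * mon_eval m x" for m
  by (simp add: mon_eval_def mon_degree_def power_mult_distrib prod.distrib power_sum)
 then show ?thesis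
  using assms by (auto simp: peval_superset[of "pkeys f"] sum_distrib_left homogeneous_alt in_keys_iff
    intro!: sum.cong)
qed

lemma partial_superset:
 assumes "finite T" "pkeys f \<subseteq> T"
 shows "partial i f = (\<Sum>m\<in>T. psingle (m - psingle i 1) (of_nat (plookup m i) * plookup f m))"
 unfolding partial_def
 by (rule sum.mono_neutral_left) (use assms in "auto simp: in_keys_iff")

lemma partial_add: "partial i (f + g) = partial i f + partial i g"
proof -
 let ?T = "pkeys f \<union> pkeys g"
 have "pkeys (f + g) \<subseteq> ?T" by (rule keys_add)
 then show ?thesis
  by (simp add: partial_superset[of ?T] lookup_add algebra_simps sum.distrib single_add)
qed

lemma partial_single: "partial i (psingle m c) = psingle (m - psingle i 1) (of_nat (plookup m i) * c)"
 by (subst partial_superset[of "{m}"]) auto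

lemma mon_eval_partial:
 "of_nat (plookup m i) * mon_eval (m - psingle i 1) x
  = of_nat (plookup m i) * (x $ i) ^ (plookup m i - 1) * (\<Prod>j\<in>UNIV - {i}. (x $ j) ^ plookup m j)"
 unfolding mon_eval_def
 by (subst prod.remove[of _ i]) (auto simp: lookup_minus lookup_single when_def intro!: prod.cong)

lemma homogeneous_partial:
 assumes "homogeneous n f" shows "homogeneous (n - 1) (partial i f)"
 unfolding partial_def
proof (rule homogeneous_sum)
 fix m assume m: "m \<in> pkeys f"
 show "homogeneous (n - 1) (psingle (m - psingle i 1) (of_nat (plookup m i) * plookup f m))"
 proof (cases "plookup m i = 0")
  case False
  have "m - psingle i 1 + psingle i 1 = m"
   by (rule poly_mapping_eqI) (use False in "auto simp: lookup_add lookup_minus lookup_single when_def")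
  then have "mon_degree (m - psingle i 1) + mon_degree (psingle i 1) = mon_degree m"
   by (metis mon_degree_add)
  moreover have "mon_degree (psingle i 1) = 1"
   by (simp add: mon_degree_def lookup_single when_def)
  ultimately show ?thesis
   using assms m by (intro homogeneous_single) (auto simp: homogeneous_alt in_keys_iff)
 qed simp
qed

text \<open>The formal derivative is the derivative along a coordinate axis. All rules of differentiation
  for values of \<open>partial\<close> follow from this, and so does the fact that they depend only on the
  polynomial function.\<close>

lemma DERIV_peval:
 "((%t. peval f (x + t *s axis i 1)) has_field_derivative peval (partial i f) x) (at 0)"
proof (induction f rule: form_induct)
 case (single m c)
 let ?C = "\<Prod>j\<in>UNIV - {i}. (x $ j) ^ plookup m j"
 have e: "mon_eval m (x + t *s axis i 1) = (x $ i + t) ^ plookup m i * ?C" for t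
  unfolding mon_eval_def
  by (subst prod.remove[of _ i]) (auto simp: axis_def intro!: prod.cong)
 show ?case
  unfolding peval_single partial_single e
  by (rule derivative_eq_intros refl)+ (use mon_eval_partial[of m i x] in "auto simp: algebra_simps")
next
 case (add f g)
 then show ?case by (simp add: partial_add DERIV_add)
qed (simp add: partial_def)

lemma peval_partial_mult:
 "peval (partial i (f * g)) x = peval f x * peval (partial i g) x + peval g x * peval (partial i f) x"
proof -
 have "((%t. peval f (x + t *s axis i 1) * peval g (x + t *s axis i 1)) has_field_derivative
   peval (partial i f) x * peval g (x + 0 *s axis i 1) + peval (partial i g) x * peval f (x + 0 *s axis i 1)) (at 0)"
  by (rule DERIV_mult DERIV_peval)+
 then show ?thesis
  using DERIV_peval[of "f * g" x i] by (auto dest: DERIV_unique simp: algebra_simps)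
qed

lemma peval_partial_const [simp]: "peval (partial i (form_const c)) x = 0"
 by (simp add: form_const_def partial_single)

lemma peval_partial_var [simp]: "peval (partial i (form_var j)) x = (if i = j then 1 else 0)"
 by (auto simp: form_var_def partial_single lookup_single when_def)

lemma peval_partial_cong:
 assumes "!!x. peval f x = peval g x" shows "peval (partial i f) x = peval (partial i g) x"
 using DERIV_peval[of f x i] DERIV_peval[of g x i] assms by (auto dest: DERIV_unique)

lemma euler_identity:
 assumes "homogeneous n f"
 shows "(\<Sum>i\<in>UNIV. x $ i * peval (partial i f) x) = of_nat n * peval f x"
proof -
 let ?l = "%m i. of_nat (plookup m i) :: complex"
 have e: "x $ i * (?l m i * mon_eval (m - psingle i 1) x) = ?l m i * mon_eval m x" for m i
 proof (cases "plookup m i")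
  case (Suc k)
  have "mon_eval m x = (x $ i) ^ plookup m i * (\<Prod>j\<in>UNIV - {i}. (x $ j) ^ plookup m j)"
   unfolding mon_eval_def by (subst prod.remove[of _ i]) auto
  then show ?thesis unfolding mon_eval_partial by (simp add: Suc algebra_simps)
 qed simp
 have "(\<Sum>i\<in>UNIV. x $ i * peval (partial i f) x)
   = (\<Sum>i\<in>UNIV. \<Sum>m\<in>pkeys f. plookup f m * (x $ i * (?l m i * mon_eval (m - psingle i 1) x)))"
  by (simp add: partial_def sum_distrib_left algebra_simps)
 also have "\<dots> = (\<Sum>m\<in>pkeys f. \<Sum>i\<in>UNIV. plookup f m * (?l m i * mon_eval m x))"
  unfolding e by (rule sum.swap)
 also have "\<dots> = (\<Sum>m\<in>pkeys f. of_nat (mon_degree m) * (plookup f m * mon_eval m x))"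
  by (simp add: mon_degree_def sum_distrib_left sum_distrib_right algebra_simps)
 also have "\<dots> = of_nat n * peval f x"
  using assms by (auto simp: homogeneous_alt in_keys_iff sum_distrib_left peval_superset[of "pkeys f"] intro!: sum.cong)
 finally show ?thesis .
qed

definition subst_form :: "form => (4 => form) => form" where
 "subst_form f L = (\<Sum>m\<in>pkeys f.
   form_const (plookup f m) * (\<Prod>i\<in>UNIV. L i ^ plookup m i))"

lemma peval_subst_form: "peval (subst_form f L) u = peval f (\<chi> i. peval (L i) u)"
 unfolding subst_form_def
 by (simp only: peval_sum peval_mult peval_const peval_prod peval_power peval_def[of f] vec_lambda_beta)

lemma homogeneous_subst_form:
 assumes "homogeneous n f" "!!i. homogeneous 1 (L i)"
 shows "homogeneous n (subst_form f L)"
 unfolding subst_form_def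
proof (rule homogeneous_sum, rule homogeneous_const_mult)
 fix m assume "m \<in> pkeys f"
 then have "n = (\<Sum>i\<in>UNIV. 1 * plookup m i)"
  using assms(1) by (simp add: homogeneous_def)
 then show "homogeneous n (\<Prod>i\<in>UNIV. L i ^ plookup m i)"
  using homogeneous_prod[of UNIV "%i. 1 * plookup m i" "%i. L i ^ plookup m i"]
   homogeneous_power[OF assms(2)] by simp
qed

definition hcomp :: "nat => form => form" where
 "hcomp d f = (\<Sum>m\<in>pkeys f. if mon_degree m = d then psingle m (plookup f m) else 0)"

lemma lookup_hcomp: "plookup (hcomp d f) m = (if mon_degree m = d then plookup f m else 0)"
proof -
 have "plookup (hcomp d f) m = (\<Sum>k\<in>pkeys f. if k = m then (if mon_degree m = d then plookup f m else 0) else 0)"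
  unfolding hcomp_def lookup_sum by (rule sum.cong) (auto simp: lookup_single when_def)
 then show ?thesis by (auto simp: in_keys_iff)
qed

lemma hcomp_sum: "hcomp d (sum f A) = (\<Sum>a\<in>A. hcomp d (f a))"
 by (rule poly_mapping_eqI) (simp add: lookup_hcomp lookup_sum)

lemma homogeneous_hcomp: "homogeneous d (hcomp d f)"
 by (auto simp: homogeneous_alt lookup_hcomp)

lemma hcomp_homogeneous: "homogeneous d f ==> hcomp e f = (if e = d then f else 0)"
 by (rule poly_mapping_eqI) (auto simp: lookup_hcomp homogeneous_alt)

lemma hcomp_decompose: "\<exists>D. f = (\<Sum>d\<le>D. hcomp d f)"
proof -
 define D where "D = Max (insert 0 (mon_degree ` pkeys f))"
 have "plookup f m = (if mon_degree m \<le> D then plookup f m else 0)" for m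
  by (auto simp: D_def in_keys_iff not_le intro!: Max_ge)
 then have "f = (\<Sum>d\<le>D. hcomp d f)"
  by (intro poly_mapping_eqI) (auto simp: lookup_sum lookup_hcomp)
 then show ?thesis ..
qed

lemma hcomp_mult:
 assumes g: "homogeneous e g"
 shows "hcomp N (h * g) = (if e \<le> N then hcomp (N - e) h * g else 0)"
proof -
 obtain D where D: "h = (\<Sum>d\<le>D. hcomp d h)" using hcomp_decompose by blast
 have h0: "hcomp d h = 0" if "d > D" for d
 proof -
  have "hcomp d h = (\<Sum>d'\<le>D. hcomp d (hcomp d' h))" by (subst D) (rule hcomp_sum)
  also have "\<dots> = 0" using that by (intro sum.neutral) (auto simp: hcomp_homogeneous[OF homogeneous_hcomp])
  finally show ?thesis .
 qed
 have "h * g = (\<Sum>d\<le>D. hcomp d h * g)" by (subst D) (rule sum_distrib_right)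
 then have "hcomp N (h * g) = (\<Sum>d\<le>D. hcomp N (hcomp d h * g))" by (simp add: hcomp_sum)
 also have "\<dots> = (\<Sum>d\<le>D. if N = d + e then hcomp d h * g else 0)"
  by (intro sum.cong refl hcomp_homogeneous homogeneous_mult homogeneous_hcomp g)
 also have "\<dots> = (\<Sum>d\<le>D. if d = N - e then (if e \<le> N then hcomp (N - e) h * g else 0) else 0)"
  by (rule sum.cong) auto
 also have "\<dots> = (if e \<le> N then hcomp (N - e) h * g else 0)"
  using h0[of "N - e"] by (auto simp: not_le)
 finally show ?thesis .
qed

section \<open>A projective Nullstellensatz\<close>

text \<open>More vectors than coordinates; the field is used through elimination of one coordinate at a time.\<close>

lemma nontrivial_linear_relation:
 fixes v :: "'a => 'b => complex"
 assumes "finite B" "finite T" "card B < card T"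
 shows "\<exists>c. (\<exists>a\<in>T. c a ~= 0) & (\<forall>b\<in>B. (\<Sum>a\<in>T. c a * v a b) = 0)"
 using assms
proof (induction B arbitrary: T v rule: finite_induct)
 case empty
 then obtain a where "a \<in> T" by fastforce
 then show ?case by (intro exI[of _ "%_. 1"]) auto
next
 case (insert b B)
 show ?case
 proof (cases "\<forall>a\<in>T. v a b = 0")
  case True
  obtain c where "\<exists>a\<in>T. c a ~= 0" "\<forall>b\<in>B. (\<Sum>a\<in>T. c a * v a b) = 0"
   using insert.IH[of T v] insert.prems insert.hyps by auto
  with True show ?thesis by (intro exI[of _ c]) auto
 next
  case False
  then obtain a0 where a0: "a0 \<in> T" "v a0 b ~= 0" by auto
  define v' where "v' a d = v a d - v a b / v a0 b * v a0 d" for a d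
  have "card B < card (T - {a0})" using insert a0 by simp
  then obtain c where c: "\<exists>a\<in>T - {a0}. c a ~= 0" "\<forall>d\<in>B. (\<Sum>a\<in>T - {a0}. c a * v' a d) = 0"
   using insert.IH[of "T - {a0}" v'] insert.prems by blast
  define c' where "c' = c(a0 := - (\<Sum>a\<in>T - {a0}. c a * (v a b / v a0 b)))"
  have sum: "(\<Sum>a\<in>T. c' a * v a d) = (\<Sum>a\<in>T - {a0}. c a * v' a d)" for d
  proof -
   have "(\<Sum>a\<in>T - {a0}. c' a * v a d) = (\<Sum>a\<in>T - {a0}. c a * v a d)"
    by (rule sum.cong) (auto simp: c'_def)
   then have "(\<Sum>a\<in>T. c' a * v a d) = c' a0 * v a0 d + (\<Sum>a\<in>T - {a0}. c a * v a d)"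
    using insert.prems a0 by (simp add: sum.remove[of T a0])
   also have "\<dots> = (\<Sum>a\<in>T - {a0}. c a * v' a d)"
    by (simp add: c'_def v'_def sum_distrib_right sum_distrib_left algebra_simps sum_subtractf)
   finally show ?thesis .
  qed
  have "v' a b = 0" for a using a0 by (simp add: v'_def)
  then have "\<forall>d\<in>insert b B. (\<Sum>a\<in>T. c' a * v a d) = 0" using c(2) by (auto simp: sum)
  moreover have "\<exists>a\<in>T. c' a ~= 0" using c(1) by (auto simp: c'_def)
  ultimately show ?thesis by blast
 qed
qed

lemma finite_mon_degree_le: "finite {m. mon_degree m \<le> D}"
proof (rule finite_subset)
 show "{m. mon_degree m \<le> D} \<subseteq> Abs_poly_mapping ` PiE UNIV (%_. {..D})"
 proof
  fix m assume m: "m \<in> {m. mon_degree m \<le> D}"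
  have "plookup m i \<le> D" for i
   using m member_le_sum[of i UNIV "plookup m"] by (auto simp: mon_degree_def)
  then have "plookup m \<in> PiE UNIV (%_. {..D})" by (auto simp: PiE_def)
  then show "m \<in> Abs_poly_mapping ` PiE UNIV (%_. {..D})"
   by (metis imageI lookup_inverse)
 qed
 show "finite (Abs_poly_mapping ` PiE UNIV (%_::4. {..D}))"
  by (intro finite_imageI finite_PiE) auto
qed

text \<open>An ideal of the polynomial ring, as a bare set of forms, so that the lemma of Zorn applies to
  inclusion.\<close>

definition form_ideal :: "form set => bool" where
 "form_ideal I \<longleftrightarrow> 0 \<in> I & (\<forall>f\<in>I. \<forall>g\<in>I. f + g \<in> I) & (\<forall>f\<in>I. \<forall>g. g * f \<in> I)"

lemma form_idealD:
 assumes "form_ideal I"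
 shows "0 \<in> I" "f \<in> I ==> g \<in> I ==> f + g \<in> I" "f \<in> I ==> g * f \<in> I" "f \<in> I ==> f * g \<in> I"
  "f \<in> I ==> - f \<in> I" "f \<in> I ==> g \<in> I ==> f - g \<in> I"
proof -
 have neg: "- f \<in> I" if "f \<in> I" for f
 proof -
  have "(- 1) * f \<in> I" using assms that unfolding form_ideal_def by blast
  then show ?thesis by simp
 qed
 show "0 \<in> I" "f \<in> I ==> g \<in> I ==> f + g \<in> I" "f \<in> I ==> g * f \<in> I" "f \<in> I ==> f * g \<in> I"
  "f \<in> I ==> - f \<in> I"
  using assms neg by (auto simp: form_ideal_def mult.commute)
 show "f - g \<in> I" if "f \<in> I" "g \<in> I"
 proof -
  have "f + - g \<in> I" using that neg assms unfolding form_ideal_def by blast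
  then show ?thesis by simp
 qed
qed

lemma lookup_const_mult: "plookup (form_const k * g) m = k * plookup g m"
 by (induction g rule: form_induct)
  (simp_all add: form_const_def mult_single lookup_single when_def lookup_add distrib_left)

text \<open>Homogenization of a polynomial in one variable, in degree \<open>d\<close> and with the forms \<open>x\<close>, \<open>l\<close>
  in place of the two variables.\<close>

definition homogenize :: "form => form => nat => complex poly => form" where
 "homogenize x l d p = (\<Sum>k\<le>d. form_const (coeff p k) * x ^ k * l ^ (d - k))"

lemma form_const_add: "form_const (a + b) = form_const a + form_const b"
 by (simp add: form_const_def single_add)

lemma form_const_mult: "form_const (a * b) = form_const a * form_const b"
 by (simp add: form_const_def mult_single)

lemma form_const_0 [simp]: "form_const 0 = 0" and form_const_1 [simp]: "form_const 1 = 1"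
 by (simp_all add: form_const_def)

lemma homogenize_add: "homogenize x l d (p + q) = homogenize x l d p + homogenize x l d q"
 by (simp add: homogenize_def form_const_add algebra_simps sum.distrib)

lemma homogenize_smult: "homogenize x l d (Polynomial.smult c p) = form_const c * homogenize x l d p"
 by (simp add: homogenize_def form_const_mult algebra_simps sum_distrib_left)

lemma homogenize_0 [simp]: "homogenize x l d 0 = 0"
 by (simp add: homogenize_def)

lemma homogenize_sum: "homogenize x l d (sum f A) = (\<Sum>a\<in>A. homogenize x l d (f a))"
 by (induction A rule: infinite_finite_induct) (auto simp: homogenize_add)

lemma homogenize_linear_factor:
 assumes "degree p \<le> d"
 shows "homogenize x l (Suc d) ([:- r, 1:] * p) = (x - form_const r * l) * homogenize x l d p"
proof -
 have 1: "homogenize x l (Suc d) (pCons 0 p) = x * homogenize x l d p"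
  unfolding homogenize_def by (subst sum.atMost_Suc_shift) (simp add: sum_distrib_left algebra_simps)
 have "coeff p (Suc d) = 0" using assms by (simp add: coeff_eq_0)
 then have 2: "homogenize x l (Suc d) p = l * homogenize x l d p"
  unfolding homogenize_def by (simp add: sum_distrib_left algebra_simps Suc_diff_le)
 have "[:- r, 1:] * p = pCons 0 p + Polynomial.smult (- r) p" by simp
 moreover have "form_const (- r) = - form_const r"
  by (simp add: form_const_def single_uminus)
 ultimately show ?thesis
  by (simp add: homogenize_add homogenize_smult 1 2 algebra_simps del: mult_pCons_left Polynomial.smult_minus_left)
qed

lemma degree_prod_linear: "finite T ==> degree (\<Prod>b\<in>T. [:- b, 1::complex:]) = card T"
 by (subst degree_prod_eq_sum_degree) auto

lemma homogenize_prod_linear: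
 "finite T ==> homogenize x l (card T) (\<Prod>b\<in>T. [:- b, 1:]) = (\<Prod>b\<in>T. x - form_const b * l)"
proof (induction T rule: finite_induct)
 case empty
 then show ?case by (simp add: homogenize_def)
next
 case (insert b T)
 then show ?case
  using homogenize_linear_factor[of "\<Prod>b\<in>T. [:- b, 1:]" "card T" x l b] degree_prod_linear[of T] by simp
qed

text \<open>If no power of \<open>l\<close> lay in \<open>I\<close>, there would be an ideal \<open>M \<supseteq> I\<close> maximal with this property;
  it is prime. The ring \<open>\<complex>[x]\<close> has countable dimension while \<open>\<complex>\<close> is uncountable, hence among
  the inverses of the elements \<open>x\<^sub>i - a l\<close> modulo \<open>M\<close> (up to powers of \<open>l\<close>) there would be a
  linear relation; it is a binary form in \<open>x\<^sub>i\<close> and \<open>l\<close>, which splits into linear factors. Thus some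
  \<open>x\<^sub>i - a\<^sub>i l\<close> lies in \<open>M\<close>, for every \<open>i\<close>, and \<open>a\<close> is a common zero of the forms in \<open>I\<close>.\<close>

theorem projective_nullstellensatz:
 assumes I: "form_ideal I"
  and zeros: "!!x. x ~= 0 ==> \<exists>f\<in>I. (\<exists>n. homogeneous n f) & peval f x ~= 0"
  and l: "homogeneous 1 l"
 shows "\<exists>N. l ^ N \<in> I"
proof (rule ccontr)
 assume no: "\<nexists>N. l ^ N \<in> I"
 define \<A> where "\<A> = {J. form_ideal J & I \<subseteq> J & (\<forall>N. l ^ N \<notin> J)}"
 have "I \<in> \<A>" using no I by (auto simp: \<A>_def)
 have "\<exists>M\<in>\<A>. \<forall>J\<in>\<A>. M \<subseteq> J --> J = M"
 proof (rule subset_Zorn_nonempty)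
  show "\<A> ~= {}" using \<open>I \<in> \<A>\<close> by auto
  fix C assume C: "C ~= {}" "subset.chain \<A> C"
  then have CA: "C \<subseteq> \<A>" and tot: "!!J J'. J \<in> C ==> J' \<in> C ==> J \<subseteq> J' \<or> J' \<subseteq> J"
   by (auto simp: subset_chain_def)
  have id: "form_ideal J" if "J \<in> C" for J using that CA by (auto simp: \<A>_def)
  have "form_ideal (\<Union>C)"
   unfolding form_ideal_def
  proof (intro conjI ballI allI)
   show "0 \<in> \<Union>C" using C(1) form_idealD(1)[OF id] by blast
  next
   fix f g assume fg: "f \<in> \<Union>C" "g \<in> \<Union>C"
   obtain J where J: "J \<in> C" "f \<in> J" "g \<in> J" using fg tot by blast
   then have "f + g \<in> J" using form_idealD(2)[OF id] by blast
   then show "f + g \<in> \<Union>C" using J by blast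
  next
   fix f g assume "f \<in> \<Union>C"
   then show "g * f \<in> \<Union>C" using form_idealD(3)[OF id] by blast
  qed
  then show "\<Union>C \<in> \<A>" using C(1) CA by (auto simp: \<A>_def)
 qed
 then obtain M where M: "M \<in> \<A>" and max: "!!J. J \<in> \<A> ==> M \<subseteq> J ==> J = M" by blast
 have idM: "form_ideal M" and IM: "I \<subseteq> M" and lM: "!!N. l ^ N \<notin> M" using M by (auto simp: \<A>_def)
 note idealM = form_idealD[OF idM]
 have inverse: "\<exists>N q. l ^ N - q * f \<in> M" if "f \<notin> M" for f
 proof (rule ccontr)
  assume contra: "\<nexists>N q. l ^ N - q * f \<in> M"
  define J where "J = {g. \<exists>q. g - q * f \<in> M}"
  have "form_ideal J"
   unfolding form_ideal_def
  proof (intro conjI ballI allI)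
   show "0 \<in> J" using idealM(1) by (auto simp: J_def intro: exI[of _ 0])
  next
   fix g h assume "g \<in> J" "h \<in> J"
   then obtain q r where "g - q * f \<in> M" "h - r * f \<in> M" by (auto simp: J_def)
   then have "(g - q * f) + (h - r * f) \<in> M" by (rule idealM)
   then show "g + h \<in> J" by (auto simp: J_def algebra_simps intro!: exI[of _ "q + r"])
  next
   fix g h assume "g \<in> J"
   then obtain q where "g - q * f \<in> M" by (auto simp: J_def)
   then have "h * (g - q * f) \<in> M" by (rule idealM)
   then show "h * g \<in> J" by (auto simp: J_def algebra_simps intro!: exI[of _ "h * q"])
  qed
  moreover have "M \<subseteq> J" by (auto simp: J_def intro: exI[of _ 0])
  moreover have "\<forall>N. l ^ N \<notin> J" using contra by (auto simp: J_def)
  ultimately have "J = M" using IM by (intro max) (auto simp: \<A>_def)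
  moreover have "f \<in> J" using idealM(1) by (auto simp: J_def intro: exI[of _ 1])
  ultimately show False using that by simp
 qed
 have prime: "f \<in> M \<or> g \<in> M" if "f * g \<in> M" for f g
 proof (rule ccontr)
  assume "\<not> (f \<in> M \<or> g \<in> M)"
  then obtain N q N' q' where a: "l ^ N - q * f \<in> M" and b: "l ^ N' - q' * g \<in> M" using inverse by metis
  have "l ^ N * (l ^ N' - q' * g) + (q' * g) * (l ^ N - q * f) + (q * q') * (f * g) \<in> M"
   by (intro idealM a b that)
  then have "l ^ (N + N') \<in> M" by (simp add: algebra_simps power_add)
  then show False using lM by simp
 qed
 have scalar: "g \<in> M" if "c ~= 0" "form_const c * g \<in> M" for c g
 proof -
  have "form_const (inverse c) * (form_const c * g) \<in> M" by (intro idealM that)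
  then show ?thesis using that(1) by (simp flip: mult.assoc form_const_mult)
 qed
 have split: "\<exists>r. x - form_const r * l \<in> M" if "p ~= 0" "degree p \<le> d" "homogenize x l d p \<in> M" for x p d
  using that
 proof (induction d arbitrary: p)
  case 0
  then have "form_const (coeff p 0) * l ^ 0 \<in> M" "coeff p 0 ~= 0"
   by (auto simp: homogenize_def elim!: degree_eq_zeroE)
  then show ?case using scalar lM by blast
 next
  case (Suc d)
  show ?case
  proof (cases "degree p = 0")
   case True
   then obtain c where "p = [:c:]" by (metis degree_eq_zeroE)
   then have "homogenize x l (Suc d) p = form_const c * l ^ Suc d" "c ~= 0"
    using Suc.prems unfolding homogenize_def by (subst sum.atMost_Suc_shift, auto)
   then show ?thesis using scalar lM Suc.prems by metis
  next
   case False
   then obtain r where "poly p r = 0"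
    using fundamental_theorem_of_algebra[of p] by (auto simp: constant_degree)
   then obtain q where q: "p = [:- r, 1:] * q" by (metis dvdE poly_eq_0_iff_dvd)
   then have "q ~= 0" using Suc.prems by auto
   then have dq: "degree q \<le> d" using Suc.prems(2) unfolding q by (subst (asm) degree_mult_eq) auto
   show ?thesis
    using Suc.IH[OF \<open>q ~= 0\<close> dq] Suc.prems(3) prime unfolding q homogenize_linear_factor[OF dq] by metis
  qed
 qed
 have "\<exists>a. form_var i - form_const a * l \<in> M" for i
 proof (rule ccontr)
  let ?x = "form_var i"
  assume contra: "\<nexists>a. ?x - form_const a * l \<in> M"
  then have "\<exists>N q. l ^ N - q * (?x - form_const a * l) \<in> M" for a using inverse by blast
  then obtain N q where q: "!!a. l ^ N a - q a * (?x - form_const a * l) \<in> M" by metis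
  define D where "D a = Max (insert 0 (mon_degree ` pkeys (q a)))" for a
  have D: "mon_degree m \<le> D a" if "m \<in> pkeys (q a)" for m a
   using that by (auto simp: D_def intro!: Max_ge)
  obtain n e where inf: "infinite {a. N a = n & D a = e}"
  proof (rule ccontr)
   assume "\<not> thesis"
   then have "finite {a. N a = n & D a = e}" for n e using that by blast
   then have "countable (\<Union>(n, e)\<in>UNIV. {a. N a = n & D a = e})"
    by (intro countable_UN) (auto intro: countable_finite)
   moreover have "(\<Union>(n, e)\<in>UNIV. {a. N a = n & D a = e}) = UNIV" by auto
   ultimately have "countable (UNIV :: complex set)" by simp
   then have "countable (range complex_of_real)" by (rule countable_subset[rotated]) simp
   then have "countable (UNIV :: real set)" by (rule countable_image_inj_on) (simp add: inj_def)
   then show False using uncountable_UNIV_real by blast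
  qed
  let ?B = "{m. mon_degree m \<le> e}"
  obtain T where T: "finite T" "card T = Suc (card ?B)" "T \<subseteq> {a. N a = n & D a = e}"
   using infinite_arbitrarily_large[OF inf] by metis
  obtain c where c: "\<exists>a\<in>T. c a ~= 0" "\<forall>m\<in>?B. (\<Sum>a\<in>T. c a * plookup (q a) m) = 0"
   using nontrivial_linear_relation[OF finite_mon_degree_le T(1), of e "%a. plookup (q a)"] T(2) by auto
  have rel: "(\<Sum>a\<in>T. form_const (c a) * q a) = 0"
  proof (rule poly_mapping_eqI)
   fix m
   show "plookup (\<Sum>a\<in>T. form_const (c a) * q a) m = plookup 0 m"
   proof (cases "m \<in> ?B")
    case True
    then show ?thesis using c(2) by (auto simp: lookup_sum lookup_const_mult)
   next
    case False
    then have "plookup (q a) m = 0" if "a \<in> T" for a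
     using D[of m a] T(3) that by (auto simp: in_keys_iff)
    then show ?thesis by (simp add: lookup_sum lookup_const_mult)
   qed
  qed
  define R where "R a = (\<Prod>b\<in>T - {a}. ?x - form_const b * l)" for a
  define P where "P = (\<Prod>b\<in>T. ?x - form_const b * l)"
  have R: "l ^ n * R a - q a * P \<in> M" if "a \<in> T" for a
  proof -
   have P: "P = (?x - form_const a * l) * R a"
    unfolding P_def R_def using T(1) that by (rule prod.remove)
   have "R a * (l ^ n - q a * (?x - form_const a * l)) \<in> M"
    using q[of a] T(3) that by (intro idealM(3)) auto
   also have "R a * (l ^ n - q a * (?x - form_const a * l)) = l ^ n * R a - q a * P"
    unfolding P by (simp add: algebra_simps)
   finally show ?thesis .
  qed
  have sumM: "finite S ==> (!!a. a \<in> S ==> g a \<in> M) ==> sum g S \<in> M" for S :: "complex set" and g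
   by (induction S rule: finite_induct) (auto intro: idealM)
  have "(\<Sum>a\<in>T. form_const (c a) * (l ^ n * R a - q a * P)) \<in> M"
   by (intro sumM T idealM(3) R)
  also have "(\<Sum>a\<in>T. form_const (c a) * (l ^ n * R a - q a * P)) =
    l ^ n * (\<Sum>a\<in>T. form_const (c a) * R a) - (\<Sum>a\<in>T. form_const (c a) * q a) * P"
   by (simp add: sum_distrib_left sum_distrib_right sum_subtractf algebra_simps)
  finally have "(\<Sum>a\<in>T. form_const (c a) * R a) \<in> M" using rel prime lM by fastforce
  moreover define p where "p = (\<Sum>a\<in>T. Polynomial.smult (c a) (\<Prod>b\<in>T - {a}. [:- b, 1:]))"
  have "R a = homogenize ?x l (card T - 1) (\<Prod>b\<in>T - {a}. [:- b, 1:])" if "a \<in> T" for a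
   using homogenize_prod_linear[of "T - {a}" ?x l] that T(1) by (simp add: R_def)
  then have "(\<Sum>a\<in>T. form_const (c a) * R a) = homogenize ?x l (card T - 1) p"
   by (simp add: p_def homogenize_sum homogenize_smult)
  moreover have "degree p \<le> card T - 1"
   unfolding p_def using T(1)
   by (intro degree_sum_le) (auto intro!: order.trans[OF degree_smult_le] simp: degree_prod_linear)
  moreover have "p ~= 0"
  proof
   obtain a where a: "a \<in> T" "c a ~= 0" using c(1) by blast
   assume "p = 0"
   then have "0 = poly p a" by simp
   also have "poly p a = (\<Sum>b\<in>T. c b * (\<Prod>d\<in>T - {b}. a - d))"
    by (simp add: p_def poly_sum poly_prod)
   also have "\<dots> = c a * (\<Prod>d\<in>T - {a}. a - d) + (\<Sum>b\<in>T - {a}. c b * (\<Prod>d\<in>T - {b}. a - d))"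
    using T(1) a(1) by (rule sum.remove)
   also have "(\<Sum>b\<in>T - {a}. c b * (\<Prod>d\<in>T - {b}. a - d)) = 0"
    using T(1) a(1) by (intro sum.neutral ballI) (auto simp: prod_zero_iff)
   finally show False using a T(1) by (simp add: prod_zero_iff)
  qed
  ultimately show False using split[of p "card T - 1" ?x] contra by simp
 qed
 then obtain a where a: "!!i. form_var i - form_const (a i) * l \<in> M" by metis
 define r :: "complex ^ 4" where "r = (\<chi> i. a i)"
 have cmult: "f * f' - g * g' \<in> M" if "f - g \<in> M" "f' - g' \<in> M" for f f' g g'
 proof -
  have "f * (f' - g') + g' * (f - g) \<in> M" by (intro idealM that)
  then show ?thesis by (simp add: algebra_simps)
 qed
 have cpow: "f ^ k - g ^ k \<in> M" if "f - g \<in> M" for f g k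
  by (induction k) (auto intro: cmult that idealM(1))
 have cprod: "(!!i. i \<in> S ==> f i - g i \<in> M) ==> prod f S - prod g S \<in> M" for S :: "4 set" and f g
  by (induction S rule: infinite_finite_induct) (auto intro: cmult idealM(1))
 have mono: "psingle m c - form_const (c * mon_eval m r) * l ^ mon_degree m \<in> M" for m c
 proof -
  have "form_const c * (\<Prod>i\<in>UNIV. form_var i ^ plookup m i)
    - form_const c * (\<Prod>i\<in>UNIV. (form_const (a i) * l) ^ plookup m i) \<in> M"
   by (intro cmult cprod cpow a) (simp add: idealM)
  moreover have "(\<Prod>i\<in>UNIV. (form_const (a i) * l) ^ plookup m i) = form_const (mon_eval m r) * l ^ mon_degree m"
  proof -
   have "form_const (b ^ k) = form_const b ^ k" for b k
    by (induction k) (simp_all add: form_const_mult)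
   moreover have "form_const (prod h S) = (\<Prod>i\<in>S. form_const (h i))" for h and S :: "4 set"
    by (induction S rule: infinite_finite_induct) (simp_all add: form_const_mult)
   ultimately show ?thesis
    by (simp add: power_mult_distrib prod.distrib mon_eval_def mon_degree_def power_sum r_def)
  qed
  ultimately show ?thesis by (simp add: form_monomial form_const_mult mult.assoc)
 qed
 have val: "f - form_const (peval f r) * l ^ n \<in> M" if "homogeneous n f" for f n
 proof -
  have "finite K ==> (!!m. m \<in> K ==> mon_degree m = n) ==>
   (\<Sum>m\<in>K. psingle m (plookup f m)) -
    form_const (\<Sum>m\<in>K. plookup f m * mon_eval m r) * l ^ n \<in> M" for K
  proof (induction K rule: finite_induct)
   case (insert m K)
   have "(psingle m (plookup f m) - form_const (plookup f m * mon_eval m r) * l ^ n)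
    + ((\<Sum>m\<in>K. psingle m (plookup f m)) -
    form_const (\<Sum>m\<in>K. plookup f m * mon_eval m r) * l ^ n) \<in> M"
    using insert mono[of m] by (intro idealM(2)) auto
   then show ?case using insert by (simp add: form_const_add algebra_simps)
  qed (simp add: idealM)
  from this[of "pkeys f"] show ?thesis
   using that form_sum_monomials[of f] by (auto simp: homogeneous_alt in_keys_iff peval_superset[of "pkeys f"])
 qed
 have "peval f r = 0" if "f \<in> I" "homogeneous n f" for f n
 proof (rule ccontr)
  assume nz: "peval f r ~= 0"
  have "f \<in> M" "f - form_const (peval f r) * l ^ n \<in> M" using that IM val by auto
  then have "f - (f - form_const (peval f r) * l ^ n) \<in> M" by (rule idealM(6))
  then have "form_const (peval f r) * l ^ n \<in> M" by simp
  then show False using scalar[OF nz] lM by blast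
 qed
 then have "r = 0" using zeros by blast
 have "(0::complex ^ 4) = 0 *s 0" by simp
 then have "peval l 0 = 0" using peval_scale[OF l, of 0 0] by simp
 then have "l ^ 1 \<in> M" using val[OF l] \<open>r = 0\<close> by simp
 then show False using lM by blast
qed

section \<open>Iterated univariate polynomials and Bezout relations\<close>

text \<open>A prime \<open>p\<close> of positive degree that does not divide \<open>q\<close> has with \<open>q\<close> a relation free of the
  main variable: a non-zero element \<open>d\<close> of least degree in the ideal \<open>(p, q)\<close> divides non-zero scalar
  multiples of \<open>p\<close> and \<open>q\<close> by pseudo-division, and so has degree zero.\<close>

lemma prime_bezout_poly:
 fixes p q :: "'a::{idom, factorial_ring_gcd, semiring_gcd_mult_normalize} poly"
 assumes p: "prime_elem p" "degree p > 0" and q: "\<not> p dvd q"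
 shows "\<exists>U V c. c ~= 0 & U * p + V * q = [:c:]"
proof -
 define S where "S = {d. d ~= 0 & (\<exists>U V. d = U * p + V * q)}"
 have "p = 1 * p + 0 * q" "p ~= 0" using p by auto
 then have "p \<in> S" unfolding S_def by blast
 define d where "d = arg_min degree (%d. d \<in> S)"
 have d: "d \<in> S" and least: "!!e. e \<in> S ==> degree d \<le> degree e"
  using arg_min_nat_lemma[of "%d. d \<in> S" p degree] \<open>p \<in> S\<close> by (auto simp: d_def)
 then obtain U V where UV: "d = U * p + V * q" and "d ~= 0" by (auto simp: S_def)
 have divides: "\<exists>a s. a ~= 0 & [:a:] * f = d * s" if "f = U' * p + V' * q" for f U' V'
 proof -
  obtain a s where a: "a ~= 0" and s: "Polynomial.smult a f = d * s + pseudo_mod f d"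
   using pseudo_mod(1)[OF \<open>d ~= 0\<close>, of f] by blast
  have "pseudo_mod f d = 0"
  proof (rule ccontr)
   assume nz: "pseudo_mod f d ~= 0"
   then have less: "degree (pseudo_mod f d) < degree d" using pseudo_mod(2)[OF \<open>d ~= 0\<close>, of f] by simp
   have "pseudo_mod f d = Polynomial.smult a f - d * s" using s by simp
   also have "\<dots> = ([:a:] * U' - U * s) * p + ([:a:] * V' - V * s) * q"
    unfolding that UV by (simp add: algebra_simps smult_add_right)
   finally have "pseudo_mod f d \<in> S" using nz by (auto simp: S_def)
   then show False using least less by fastforce
  qed
  then show ?thesis using a s by auto
 qed
 obtain a s where a: "a ~= 0" "[:a:] * p = d * s" using divides[of p 1 0] by auto
 obtain b t where b: "b ~= 0" "[:b:] * q = d * t" using divides[of q 0 1] by auto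
 have notdvd: "\<not> p dvd [:c:]" if "c ~= 0" for c
  using p(2) that dvd_imp_degree_le[of p "[:c:]"] by auto
 have "degree d = 0"
 proof -
  have "p dvd d * s" using a(2) by (metis dvd_triv_right)
  then consider "p dvd d" | "p dvd s" using p(1) prime_elem_dvd_multD by blast
  then show ?thesis
  proof cases
   case 1
   then have "p dvd [:b:] * q" using b by simp
   then show ?thesis using prime_elem_dvd_multD[OF p(1)] notdvd[OF b(1)] q by blast
  next
   case 2
   then obtain s' where "s = p * s'" by blast
   then have "p * [:a:] = p * (d * s')" using a(2) by (simp add: mult_ac)
   then have "[:a:] = d * s'" using mult_left_cancel[OF \<open>p ~= 0\<close>] by blast
   then have "d dvd [:a:]" by simp
   then show ?thesis using dvd_imp_degree_le[of d "[:a:]"] a(1) by simp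
  qed
 qed
 then obtain c where "d = [:c:]" by (metis degree_eq_zeroE)
 then show ?thesis using UV \<open>d ~= 0\<close> by auto
qed

text \<open>Evaluation of an element of \<open>\<complex>[x\<^sub>1][x\<^sub>2][x\<^sub>3][x\<^sub>4]\<close>; the innermost variable is \<open>x\<^sub>1\<close>.\<close>

definition eval3 :: "complex poly poly poly => complex => complex => complex => complex" where
 "eval3 a x y z = poly (poly (poly a [:[:z:]:]) [:y:]) x"

definition eval4 :: "complex poly poly poly poly => complex ^ 4 => complex" where
 "eval4 q u = eval3 (poly q [:[:[:u $ 4:]:]:]) (u $ 1) (u $ 2) (u $ 3)"

lemma eval3_simps [simp]:
 "eval3 0 x y z = 0" "eval3 1 x y z = 1" "eval3 (a + b) x y z = eval3 a x y z + eval3 b x y z"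
 "eval3 (a * b) x y z = eval3 a x y z * eval3 b x y z" "eval3 (a ^ n) x y z = eval3 a x y z ^ n"
 by (simp_all add: eval3_def poly_power)

lemma eval3_sum [simp]: "eval3 (sum f A) x y z = (\<Sum>a\<in>A. eval3 (f a) x y z)"
 by (induction A rule: infinite_finite_induct) auto

lemma eval4_simps [simp]:
 "eval4 0 u = 0" "eval4 (p + q) u = eval4 p u + eval4 q u" "eval4 (p * q) u = eval4 p u * eval4 q u"
 by (simp_all add: eval4_def)

lemma eval4_const: "eval4 [:a:] u = eval3 a (u $ 1) (u $ 2) (u $ 3)"
 by (simp add: eval4_def)

lemma eval4_sum [simp]: "eval4 (sum f A) u = (\<Sum>a\<in>A. eval4 (f a) u)"
 by (induction A rule: infinite_finite_induct) auto

lemma eval4_altdef: "eval4 q u = (\<Sum>i\<le>degree q. eval3 (coeff q i) (u $ 1) (u $ 2) (u $ 3) * (u $ 4) ^ i)"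
proof -
 have "eval3 [:[:[:t:]:]:] x y z = t" for t x y z by (simp add: eval3_def)
 then show ?thesis by (simp add: eval4_def poly_altdef)
qed

lemma poly_const_nonzero:
 fixes a :: "'a::idom poly"
 assumes "a ~= 0" "inj h" "infinite (range h)" "finite B"
 shows "\<exists>z. z \<notin> B & poly a (h z) ~= 0"
proof (rule ccontr)
 assume "\<not> ?thesis"
 then have "h ` (UNIV - B) \<subseteq> {x. poly a x = 0}" by auto
 then have "finite (h ` (UNIV - B))" using poly_roots_finite[OF assms(1)] finite_subset by blast
 then have "finite (h ` UNIV)"
  using assms(4) by (metis Diff_infinite_finite finite_imageD finite_imageI inj_on_subset assms(2) subset_UNIV)
 then show False using assms(3) by simp
qed

lemma eval3_nonzero:
 assumes "a ~= 0"
 shows "\<exists>x y z. x ~= 0 & eval3 a x y z ~= 0"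
proof -
 have inf: "infinite (range h)" if "inj h" for h :: "complex => 'b"
  using that infinite_UNIV_char_0 finite_imageD by blast
 have inj: "inj (%z. [:z:])" "inj (%z. [:[:z:]:])" "inj (%z. z)" for z :: complex
  by (auto simp: inj_def)
 obtain z where z: "poly a [:[:z:]:] ~= 0"
  using poly_const_nonzero[OF assms inj(2) inf[OF inj(2)], of "{}"] by auto
 obtain y where y: "poly (poly a [:[:z:]:]) [:y:] ~= 0"
  using poly_const_nonzero[OF z inj(1) inf[OF inj(1)], of "{}"] by auto
 obtain x where "x ~= 0" "poly (poly (poly a [:[:z:]:]) [:y:]) x ~= 0"
  using poly_const_nonzero[OF y inj(3) inf[OF inj(3)], of "{0}"] by auto
 then show ?thesis by (auto simp: eval3_def)
qed

definition to_poly :: "form => complex poly poly poly poly" where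
 "to_poly f = (\<Sum>m\<in>pkeys f. Polynomial.monom (Polynomial.monom (Polynomial.monom (Polynomial.monom
   (plookup f m) (plookup m 1)) (plookup m 2)) (plookup m 3)) (plookup m 4))"

lemma prod_4: "prod f (UNIV::4 set) = f 1 * f 2 * f 3 * f 4"
 unfolding UNIV_4 by (simp add: ac_simps)

lemma eval4_monom:
 "eval4 (Polynomial.monom (Polynomial.monom (Polynomial.monom (Polynomial.monom a i) j) k) l) u
  = a * (u $ 1 ^ i * u $ 2 ^ j * u $ 3 ^ k * u $ 4 ^ l)"
 by (simp add: eval4_def eval3_def poly_monom poly_const_pow)

lemma eval4_to_poly: "eval4 (to_poly f) u = peval f u"
 by (simp only: to_poly_def eval4_sum eval4_monom peval_def prod_4)

lemma coeff_to_poly: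
 "coeff (to_poly f) i = (\<Sum>m\<in>{m\<in>pkeys f. plookup m 4 = i}. Polynomial.monom (Polynomial.monom (Polynomial.monom
   (plookup f m) (plookup m 1)) (plookup m 2)) (plookup m 3))"
proof -
 have "coeff (to_poly f) i = (\<Sum>m\<in>pkeys f. if plookup m 4 = i then Polynomial.monom (Polynomial.monom (Polynomial.monom
   (plookup f m) (plookup m 1)) (plookup m 2)) (plookup m 3) else 0)"
  unfolding to_poly_def coeff_sum by (rule sum.cong) auto
 then show ?thesis by (simp add: sum.inter_filter)
qed

lemma form_of_poly: "\<exists>f. \<forall>u. peval f u = eval4 q u"
proof -
 have 1: "\<exists>f. \<forall>u. peval f u = poly p (u $ 1)" for p
 proof (induction p)
  case 0
  show ?case by (rule exI[of _ 0]) simp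
 next
  case (pCons a p)
  then obtain f where "\<forall>u. peval f u = poly p (u $ 1)" by blast
  then show ?case by (intro exI[of _ "form_const a + form_var 1 * f"]) simp
 qed
 have 2: "\<exists>f. \<forall>u. peval f u = poly (poly p [:u $ 2:]) (u $ 1)" for p
 proof (induction p)
  case 0
  show ?case by (rule exI[of _ 0]) simp
 next
  case (pCons a p)
  then obtain f where "\<forall>u. peval f u = poly (poly p [:u $ 2:]) (u $ 1)" by blast
  moreover obtain g where "\<forall>u. peval g u = poly a (u $ 1)" using 1 by blast
  ultimately show ?case by (intro exI[of _ "g + form_var 2 * f"]) simp
 qed
 have 3: "\<exists>f. \<forall>u. peval f u = eval3 p (u $ 1) (u $ 2) (u $ 3)" for p
 proof (induction p)
  case 0
  show ?case by (rule exI[of _ 0]) simp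
 next
  case (pCons a p)
  then obtain f where "\<forall>u. peval f u = eval3 p (u $ 1) (u $ 2) (u $ 3)" by blast
  moreover obtain g where "\<forall>u. peval g u = poly (poly a [:u $ 2:]) (u $ 1)" using 2 by blast
  ultimately show ?case by (intro exI[of _ "g + form_var 3 * f"]) (simp add: eval3_def)
 qed
 show ?thesis
 proof (induction q)
  case 0
  show ?case by (rule exI[of _ 0]) simp
 next
  case (pCons a q)
  then obtain f where "\<forall>u. peval f u = eval4 q u" by blast
  moreover obtain g where "\<forall>u. peval g u = eval3 a (u $ 1) (u $ 2) (u $ 3)" using 3 by blast
  ultimately show ?case by (intro exI[of _ "g + form_var 4 * f"]) (simp add: eval4_def eval3_def)
 qed
qed

section \<open>The coordinate ring of the cone over the quartic\<close>

locale smooth_quartic =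
 fixes F :: form
 assumes smooth: "smooth_hypersurface 4 F"
begin

definition K :: "(complex ^ 4) set" where
 "K = {x. x ~= 0 & peval F x = 0}"

lemma homogeneous_F: "homogeneous 4 F"
 using smooth by (simp add: smooth_hypersurface_def)

lemma gradient_nonzero: "x \<in> K ==> \<exists>i. peval (partial i F) x ~= 0"
 using smooth by (auto simp: smooth_hypersurface_def K_def)

lemma K_scale: "c ~= 0 ==> x \<in> K ==> c *s x \<in> K"
 by (auto simp: K_def peval_scale[OF homogeneous_F])

lemma F_nonzero_point: "\<exists>e. e $ 4 = 1 & peval F e ~= 0"
proof -
 have "\<exists>v. peval F v ~= 0"
 proof (rule ccontr)
  assume "\<not> ?thesis"
  then have F: "peval F x = peval 0 x" for x by simp
  have p0: "peval (partial i F) x = 0" for i x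
   unfolding peval_partial_cong[OF F] by (simp add: partial_def)
  have "axis 1 1 \<in> K" using F by (simp add: K_def)
  then show False using gradient_nonzero p0 by blast
 qed
 then obtain v where v: "peval F v ~= 0" by blast
 let ?w = "%t::complex. v + t *s axis 4 1"
 have "isCont (%t. peval F (?w t)) 0"
  using DERIV_peval[of F v 4] by (rule DERIV_isCont)
 then have "((%t. peval F (?w t)) \<longlongrightarrow> peval F v) (at 0)" by (simp add: isCont_def)
 then have "eventually (%t. peval F (?w t) ~= 0) (at 0)" using v by (rule tendsto_imp_eventually_ne)
 moreover have "eventually (%t. t ~= - (v $ 4)) (at (0::complex))"
  using tendsto_imp_eventually_ne[of "%t. t" 0 "at (0::complex)" "- (v $ 4)"]
  by (cases "v $ 4 = 0") (auto simp: eventually_at_filter)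
 ultimately have "eventually (%t. peval F (?w t) ~= 0 & t ~= - (v $ 4)) (at 0)"
  by eventually_elim simp
 then obtain t where t: "peval F (?w t) ~= 0" "t ~= - (v $ 4)"
  using eventually_happens[of _ "at (0::complex)"] by auto
 let ?e = "(1 / (v $ 4 + t)) *s ?w t"
 have "v $ 4 + t ~= 0" using t(2) by (metis add.commute eq_neg_iff_add_eq_0)
 then have "?e $ 4 = 1" "peval F ?e ~= 0"
  using t(1) by (simp_all add: peval_scale[OF homogeneous_F] del: vector_add_ldistrib vector_smult_assoc)
 then show ?thesis by blast
qed

text \<open>Coordinates in which \<open>F\<close> is monic in the fourth variable: \<open>base\<close> is a point off the surface,
  and \<open>shear\<close> moves the fourth coordinate axis to it. The new coordinates of \<open>x\<close> are \<open>coords x\<close>.\<close>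

definition base :: "complex ^ 4" where
 "base = (SOME e. e $ 4 = 1 & peval F e ~= 0)"

lemma base: "base $ 4 = 1" "peval F base ~= 0"
 using someI_ex[OF F_nonzero_point] by (auto simp: base_def)

definition coord_form :: "4 => form" where
 "coord_form i = (if i = 4 then form_var 4 else form_var i - form_const (base $ i) * form_var 4)"

definition shear_form :: "4 => form" where
 "shear_form i = (if i = 4 then form_var 4 else form_var i + form_const (base $ i) * form_var 4)"

definition coords :: "complex ^ 4 => complex ^ 4" where
 "coords x = (\<chi> i. peval (coord_form i) x)"

definition shear :: "complex ^ 4 => complex ^ 4" where
 "shear x = (\<chi> i. peval (shear_form i) x)"

lemma homogeneous_coord_form: "homogeneous 1 (coord_form i)"
 using homogeneous_var homogeneous_diff[OF homogeneous_var homogeneous_const_mult[OF homogeneous_var]]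
 by (simp only: coord_form_def split: if_split) blast

lemma homogeneous_shear_form: "homogeneous 1 (shear_form i)"
 using homogeneous_var homogeneous_add[OF homogeneous_var homogeneous_const_mult[OF homogeneous_var]]
 by (simp only: shear_form_def split: if_split) blast

lemma coords_shear [simp]: "coords (shear u) = u"
 by (simp add: coords_def shear_def coord_form_def shear_form_def vec_eq_iff)

lemma shear_coords [simp]: "shear (coords u) = u"
 by (simp add: coords_def shear_def coord_form_def shear_form_def vec_eq_iff)

lemma shear_0_iff [simp]: "shear u = 0 \<longleftrightarrow> u = 0"
proof -
 have "shear 0 = 0" by (simp add: shear_def shear_form_def vec_eq_iff)
 then show ?thesis by (metis coords_shear)
qed

lemma coords_scale: "coords (c *s x) = c *s coords x"
 using peval_scale[OF homogeneous_coord_form, of _ c x] by (simp add: coords_def vec_eq_iff)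

definition G :: form where
 "G = subst_form F shear_form"

lemma peval_G: "peval G u = peval F (shear u)"
 by (simp add: G_def peval_subst_form shear_def)

lemma homogeneous_G: "homogeneous 4 G"
 unfolding G_def by (rule homogeneous_subst_form[OF homogeneous_F homogeneous_shear_form])

abbreviation top_mon :: "4 \<Rightarrow>\<^sub>0 nat" where
 "top_mon \<equiv> psingle 4 4"

lemma mon_degree_4: "mon_degree m = plookup m 1 + plookup m 2 + plookup m 3 + plookup m 4"
 by (simp add: mon_degree_def sum_4)

lemma G_exponent:
 assumes "m \<in> pkeys G" shows "plookup m 4 < 4 \<or> m = top_mon"
proof -
 have d: "mon_degree m = 4" using homogeneous_G assms by (auto simp: homogeneous_alt in_keys_iff)
 have "m = top_mon" if "\<not> plookup m 4 < 4"
 proof (rule poly_mapping_eqI)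
  fix i :: 4
  have "plookup m 1 = 0 & plookup m 2 = 0 & plookup m 3 = 0 & plookup m 4 = 4"
   using that d by (auto simp: mon_degree_4)
  then show "plookup m i = plookup top_mon i"
   using exhaust_4[of i] by (auto simp: lookup_single when_def)
 qed
 then show ?thesis by blast
qed

lemma G_top: "plookup G top_mon ~= 0"
proof
 assume 0: "plookup G top_mon = 0"
 have "shear (axis 4 1) = base"
  using base(1) by (simp add: shear_def shear_form_def vec_eq_iff axis_def)
 then have "peval F base = peval G (axis 4 1)" by (simp add: peval_G)
 also have "\<dots> = (\<Sum>m\<in>pkeys G. plookup G m * mon_eval m (axis 4 1))"
  by (rule peval_superset) auto
 also have "\<dots> = 0"
 proof (intro sum.neutral ballI)
  fix m assume m: "m \<in> pkeys G"
  then have "plookup m 4 < 4" using 0 G_exponent[OF m] by (auto simp: in_keys_iff)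
  moreover have "mon_degree m = 4" using homogeneous_G m by (auto simp: homogeneous_alt in_keys_iff)
  ultimately have "plookup m 1 ~= 0 \<or> plookup m 2 ~= 0 \<or> plookup m 3 ~= 0"
   unfolding mon_degree_4 by auto
  then have "mon_eval m (axis 4 1) = 0" by (auto simp: mon_eval_def axis_def prod_4)
  then show "plookup G m * mon_eval m (axis 4 1) = 0" by simp
 qed
 finally show False using base by simp
qed

definition reduced :: "form => bool" where
 "reduced c \<longleftrightarrow> (\<forall>m. plookup c m ~= 0 --> plookup m 4 < 4)"

text \<open>A factorization of \<open>G\<close> cannot have two factors that vanish at the same point, because all
  partial derivatives of \<open>F\<close> would vanish there.\<close>

lemma no_double_zero:
 assumes "to_poly G = p * q * w" "u ~= 0" "eval4 p u = 0"
 shows "eval4 q u ~= 0"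
proof
 assume q0: "eval4 q u = 0"
 obtain fp fq fw where f: "!!u. peval fp u = eval4 p u" "!!u. peval fq u = eval4 q u" "!!u. peval fw u = eval4 w u"
  using form_of_poly by metis
 let ?s = "%f. subst_form f coord_form"
 have s: "peval (?s f) x = peval f (coords x)" for f x
  by (simp add: peval_subst_form coords_def)
 have F: "peval F x = peval (?s fp * (?s fq * ?s fw)) x" for x
 proof -
  have "peval F x = peval G (coords x)" by (simp add: peval_G)
  also have "\<dots> = eval4 (p * q * w) (coords x)" by (simp flip: assms(1) add: eval4_to_poly)
  finally show ?thesis by (simp add: s f)
 qed
 have "peval (?s fp) (shear u) = 0" "peval (?s fq) (shear u) = 0" by (simp_all add: s f assms q0)
 then have "peval (partial i F) (shear u) = 0" for i
  unfolding peval_partial_cong[OF F] by (simp only: peval_partial_mult peval_mult) simp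
 moreover have "shear u \<in> K" using assms(2) F[of "shear u"] \<open>peval (?s fp) (shear u) = 0\<close> by (simp add: K_def)
 ultimately show False using gradient_nonzero by blast
qed

lemma degree_to_poly_G: "degree (to_poly G) = 4" and lead_coeff_G: "lead_coeff (to_poly G) dvd 1"
proof -
 have set: "{m\<in>pkeys G. plookup m 4 = 4} = {top_mon}"
  using G_exponent G_top by (auto simp: in_keys_iff) fastforce
 have c4: "coeff (to_poly G) 4 = [:[:[:plookup G top_mon:]:]:]"
  unfolding coeff_to_poly set by (simp add: lookup_single when_def monom_0)
 have "coeff (to_poly G) i = 0" if "i > 4" for i
 proof -
  have "{m\<in>pkeys G. plookup m 4 = i} = {}"
   using G_exponent that by (fastforce simp: lookup_single)
  then show ?thesis unfolding coeff_to_poly by (simp only: sum.empty)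
 qed
 then show d: "degree (to_poly G) = 4"
  using c4 G_top by (intro antisym degree_le le_degree) auto
 show "lead_coeff (to_poly G) dvd 1"
  unfolding d c4 using G_top by (simp only: is_unit_const_poly_iff) (simp add: dvd_field_iff)
qed

text \<open>If \<open>r\<close> vanishes on the zeros of \<open>G\<close>, every divisor \<open>d\<close> of \<open>G\<close> divides it: for a further
  prime factor \<open>p\<close>, if \<open>r = d r'\<close> and \<open>p\<close> does not divide \<open>r'\<close>, a Bezout relation between \<open>p\<close> and
  \<open>r'\<close> yields a point with \<open>p = 0\<close> and \<open>r' \<noteq> 0\<close>, and there \<open>d \<noteq> 0\<close> as well since \<open>G\<close> has no double
  zeros.\<close>

lemma vanishing_divisible:
 assumes van: "!!x. x \<in> K ==> peval c (coords x) = 0"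
 shows "to_poly G dvd to_poly c"
proof -
 let ?g = "to_poly G" and ?r = "to_poly c"
 have zero: "eval4 ?r u = 0" if "eval4 ?g u = 0" "u ~= 0" for u
  using van[of "shear u"] that by (simp add: eval4_to_poly K_def peval_G)
 have "d dvd ?g --> d dvd ?r" for d
 proof (induction d rule: prime_divisors_induct)
  case (factor p d)
  have pe: "prime_elem p" using factor(1) by (simp add: prime_def)
  show ?case
  proof
   assume pd: "p * d dvd ?g"
   then have "d dvd ?g" by (metis dvd_mult_right)
   then obtain r' where r': "?r = d * r'" using factor(2) by blast
   obtain w where w: "?g = p * d * w" using pd by blast
   have "lead_coeff p dvd lead_coeff ?g" by (simp add: w lead_coeff_mult)
   then have unit: "lead_coeff p dvd 1" using lead_coeff_G dvd_trans by blast
   then obtain v where v: "lead_coeff p * v = 1" by (metis dvdE)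
   have lead: "eval3 (lead_coeff p) x y z ~= 0" for x y z
    using arg_cong[OF v, of "%a. eval3 a x y z"] by auto
   have deg: "degree p > 0"
   proof (rule ccontr)
    assume "\<not> degree p > 0"
    then have "p = [:lead_coeff p:]" by (metis degree_eq_zeroE gr0I lead_coeff_pCons(2) pCons_0_0 coeff_pCons_0 degree_pCons_0)
    then have "p dvd 1" using unit by (metis is_unit_const_poly_iff)
    then show False using pe by (simp add: prime_elem_def)
   qed
   have "p dvd r'"
   proof (rule ccontr)
    assume "\<not> p dvd r'"
    then obtain U V a where a: "a ~= 0" and UV: "U * p + V * r' = [:a:]"
     using prime_bezout_poly[OF pe deg] by blast
    obtain x y z where xyz: "x ~= 0" "eval3 a x y z ~= 0" using eval3_nonzero[OF a] by blast
    define py where "py = (\<Sum>i\<le>degree p. Polynomial.monom (eval3 (coeff p i) x y z) i)"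
    have "coeff py (degree p) = eval3 (lead_coeff p) x y z"
     by (simp add: py_def coeff_sum)
    then have "degree py > 0" using lead deg by (metis le_degree less_le_trans)
    then obtain t where t: "poly py t = 0"
     using fundamental_theorem_of_algebra[of py] by (auto simp: constant_degree)
    define u :: "complex ^ 4" where "u = (\<chi> i. if i = 1 then x else if i = 2 then y else if i = 3 then z else t)"
    have u: "u $ 1 = x" "u $ 2 = y" "u $ 3 = z" "u $ 4 = t" by (simp_all add: u_def)
    have p0: "eval4 p u = 0" using t by (simp add: eval4_altdef py_def poly_sum poly_monom u)
    have "u ~= 0" using u(1) xyz(1) by auto
    then have "eval4 d u ~= 0" using no_double_zero[OF w _ p0] by blast
    moreover have "eval4 d u * eval4 r' u = 0"
     using zero[of u] \<open>u ~= 0\<close> p0 unfolding w r' by simp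
    ultimately have "eval4 r' u = 0" by simp
    then have "eval4 [:a:] u = 0" using p0 by (simp flip: UV)
    then show False using xyz by (simp add: eval4_const u)
   qed
   then show "p * d dvd ?r" unfolding r' by (metis dvd_refl mult.commute mult_dvd_mono)
  qed
 qed (use degree_to_poly_G in auto)
 then show ?thesis by simp
qed

text \<open>Hence a polynomial that vanishes on the cone is a multiple of \<open>F\<close>, and its gradient is
  proportional to that of \<open>F\<close>.\<close>

lemma vanishing_gradient:
 assumes "!!x. x \<in> K ==> peval f x = 0"
 obtains h where "!!x i. x \<in> K ==> peval (partial i f) x = peval h x * peval (partial i F) x"
proof -
 define c where "c = subst_form f shear_form"
 have c: "peval c (coords x) = peval f x" for x
 proof -
  have "peval c (coords x) = peval f (shear (coords x))" by (simp only: c_def peval_subst_form shear_def)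
  then show ?thesis by simp
 qed
 have "to_poly G dvd to_poly c" by (rule vanishing_divisible) (simp add: c assms)
 then obtain q where q: "to_poly c = to_poly G * q" by blast
 obtain h0 where h0: "!!u. peval h0 u = eval4 q u" using form_of_poly by blast
 define h where "h = subst_form h0 coord_form"
 have f: "peval f x = peval (F * h) x" for x
 proof -
  have "peval f x = eval4 (to_poly c) (coords x)" by (simp only: c eval4_to_poly)
  also have "\<dots> = eval4 (to_poly G * q) (coords x)" by (simp only: q)
  also have "\<dots> = peval F x * peval h x" by (simp add: eval4_to_poly peval_G h_def peval_subst_form h0 coords_def[symmetric])
  finally show ?thesis by simp
 qed
 have "peval (partial i f) x = peval h x * peval (partial i F) x" if "x \<in> K" for x i
  using that unfolding peval_partial_cong[OF f] peval_partial_mult by (simp add: K_def)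
 then show ?thesis using that by blast
qed

text \<open>Reduced polynomials are determined by their values on the cone, since \<open>G\<close> has degree four in
  the last variable.\<close>

theorem reduced_unique:
 assumes red: "reduced c" and van: "!!x. x \<in> K ==> peval c (coords x) = 0"
 shows "c = 0"
proof -
 let ?g = "to_poly G" and ?r = "to_poly c"
 have "?g dvd ?r" by (rule vanishing_divisible[OF van])
 moreover have "coeff ?r i = 0" if "i \<ge> 4" for i
 proof -
  have "{m\<in>pkeys c. plookup m 4 = i} = {}"
   using red that by (auto simp: reduced_def in_keys_iff)
  then show ?thesis unfolding coeff_to_poly by (simp only: sum.empty)
 qed
 then have "degree ?r < 4 \<or> ?r = 0" by (metis leading_coeff_0_iff not_less)
 ultimately have "?r = 0" using dvd_imp_degree_le[of ?g ?r] degree_to_poly_G by (metis not_less)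
 then have "peval c u = 0" for u using eval4_to_poly[of c u] by simp
 have "plookup c m = 0" for m
 proof (rule ccontr)
  assume nz: "plookup c m ~= 0"
  let ?l = plookup
  have "0 = coeff (coeff (coeff (coeff ?r (?l m 4)) (?l m 3)) (?l m 2)) (?l m 1)" using \<open>?r = 0\<close> by simp
  also have "\<dots> = (\<Sum>k\<in>{k\<in>pkeys c. ?l k 4 = ?l m 4}. if k = m then ?l c m else 0)"
   unfolding coeff_to_poly coeff_sum
  proof (intro sum.cong refl)
   fix k assume k: "k \<in> {k\<in>pkeys c. ?l k 4 = ?l m 4}"
   have "k = m \<longleftrightarrow> ?l k 1 = ?l m 1 & ?l k 2 = ?l m 2 & ?l k 3 = ?l m 3"
    using k forall_4[of "%i. ?l k i = ?l m i"] by (auto intro: poly_mapping_eqI)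
   then show "coeff (coeff (coeff (Polynomial.monom (Polynomial.monom (Polynomial.monom (?l c k) (?l k 1)) (?l k 2)) (?l k 3))
     (?l m 3)) (?l m 2)) (?l m 1) = (if k = m then ?l c m else 0)"
    by auto
  qed
  also have "\<dots> = ?l c m" using nz by (simp add: in_keys_iff)
  finally show False using nz by simp
 qed
 then show ?thesis by (intro poly_mapping_eqI) simp
qed

lemma reduced_0 [simp]: "reduced 0" by (simp add: reduced_def)

lemma reduced_add: "reduced a ==> reduced b ==> reduced (a + b)"
 unfolding reduced_def lookup_add by (metis add.right_neutral)

lemma reduced_uminus: "reduced a ==> reduced (- a)"
 by (simp add: reduced_def)

lemma reduced_diff: "reduced a ==> reduced b ==> reduced (a - b)"
 by (metis add_uminus_conv_diff reduced_add reduced_uminus)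

lemma reduced_sum: "(!!a. a \<in> A ==> reduced (f a)) ==> reduced (sum f A)"
 by (induction A rule: infinite_finite_induct) (auto intro: reduced_add)

lemma reduced_eqI:
 assumes "reduced a" "reduced b" "!!x. x \<in> K ==> peval a (coords x) = peval b (coords x)"
 shows "a = b"
 using reduced_unique[OF reduced_diff[OF assms(1,2)]] assms(3) by simp

text \<open>Existence of the reduced form: on the cone, the fourth power of the last coordinate is a
  combination of monomials of degree four with smaller exponent of that coordinate.\<close>

definition reducible_to :: "nat => form => bool" where
 "reducible_to n f \<longleftrightarrow> (\<exists>c. reduced c & homogeneous n c & (\<forall>x\<in>K. peval f (coords x) = peval c (coords x)))"

lemma reducible_to_sum: "finite A ==> (!!a. a \<in> A ==> reducible_to n (f a)) ==> reducible_to n (sum f A)"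
proof (induction A rule: finite_induct)
 case empty
 show ?case unfolding reducible_to_def by (rule exI[of _ 0]) simp
next
 case (insert a A)
 have "reducible_to n (f a)" "reducible_to n (sum f A)" using insert by auto
 then obtain c c' where "reduced c" "homogeneous n c" "\<forall>x\<in>K. peval (f a) (coords x) = peval c (coords x)"
  "reduced c'" "homogeneous n c'" "\<forall>x\<in>K. peval (sum f A) (coords x) = peval c' (coords x)"
  unfolding reducible_to_def by blast
 then show ?case using insert unfolding reducible_to_def
  by (intro exI[of _ "c + c'"]) (auto intro: reduced_add homogeneous_add)
qed

lemma reducible_single: "reducible_to (mon_degree m) (psingle m a)"
proof (induction "plookup m 4" arbitrary: m a rule: less_induct)
 case less
 show ?case
 proof (cases "plookup m 4 < 4")
  case True
  then show ?thesis unfolding reducible_to_def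
   by (intro exI[of _ "psingle m a"]) (auto simp: reduced_def lookup_single when_def homogeneous_single)
 next
  case False
  define m' where "m' = m - top_mon"
  have m: "m = m' + top_mon"
   by (rule poly_mapping_eqI) (use False in "auto simp: m'_def lookup_add lookup_minus lookup_single when_def")
  let ?g = "plookup G top_mon"
  let ?T = "pkeys G - {top_mon}"
  let ?f = "\<Sum>k\<in>?T. psingle (m' + k) (- a / ?g * plookup G k)"
  have deg: "mon_degree k = 4" if "k \<in> pkeys G" for k
   using homogeneous_G that by (auto simp: homogeneous_alt in_keys_iff)
  have top: "top_mon \<in> pkeys G" using G_top by (simp add: in_keys_iff)
  have "reducible_to (mon_degree m) ?f"
  proof (rule reducible_to_sum)
   fix k assume k: "k \<in> ?T"
   have "mon_degree (m' + k) = mon_degree m"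
    using deg[of k] deg[OF top] k unfolding m mon_degree_add by simp
   moreover have "plookup (m' + k) 4 < plookup m 4"
    using G_exponent[of k] k unfolding m by (auto simp: lookup_add)
   ultimately show "reducible_to (mon_degree m) (psingle (m' + k) (- a / ?g * plookup G k))"
    using less(1) by metis
  qed simp
  then obtain c where c: "reduced c" "homogeneous (mon_degree m) c" "!!x. x \<in> K ==> peval ?f (coords x) = peval c (coords x)"
   unfolding reducible_to_def by blast
  have "peval (psingle m a) (coords x) = peval ?f (coords x)" if "x \<in> K" for x
  proof -
   let ?u = "coords x"
   have "peval G ?u = ?g * mon_eval top_mon ?u + (\<Sum>k\<in>?T. plookup G k * mon_eval k ?u)"
    using sum.remove[OF _ top, of "%k. plookup G k * mon_eval k ?u"]
    by (simp add: peval_superset[of "pkeys G"])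
   moreover have "peval G ?u = 0" using that by (simp add: peval_G K_def)
   ultimately have "mon_eval top_mon ?u = - (\<Sum>k\<in>?T. plookup G k * mon_eval k ?u) / ?g"
    using G_top by (simp add: field_simps add_eq_0_iff)
   then show ?thesis
    by (simp add: m mon_eval_add sum_distrib_left sum_negf sum_divide_distrib mult_ac)
  qed
  then have "\<forall>x\<in>K. peval (psingle m a) (coords x) = peval c (coords x)"
   using c(3) by (metis (no_types))
  then show ?thesis using c(1,2) unfolding reducible_to_def by blast
 qed
qed

lemma reduced_exists:
 assumes "homogeneous n f"
 obtains c where "reduced c" "homogeneous n c" "!!x. x \<in> K ==> peval f x = peval c (coords x)"
proof -
 define f' where "f' = subst_form f shear_form"
 have hf': "homogeneous n f'" unfolding f'_def by (rule homogeneous_subst_form[OF assms homogeneous_shear_form])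
 have "reducible_to n (\<Sum>m\<in>pkeys f'. psingle m (plookup f' m))"
 proof (rule reducible_to_sum)
  fix m assume "m \<in> pkeys f'"
  then have "n = mon_degree m" using hf' by (auto simp: homogeneous_alt in_keys_iff)
  then show "reducible_to n (psingle m (plookup f' m))" using reducible_single by simp
 qed simp
 then have "reducible_to n f'" by (simp flip: form_sum_monomials)
 then obtain c where "reduced c" "homogeneous n c" "!!x. x \<in> K ==> peval f' (coords x) = peval c (coords x)"
  by (auto simp: reducible_to_def)
 moreover have "peval f' (coords x) = peval f x" for x
 proof -
  have "peval f' (coords x) = peval f (shear (coords x))" by (simp add: f'_def peval_subst_form shear_def)
  then show ?thesis by simp
 qed
 ultimately show ?thesis using that by metis
qed

lemma reduced_exists_any:
 obtains c where "reduced c" "!!x. x \<in> K ==> peval f x = peval c (coords x)"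
proof -
 obtain D where D: "f = (\<Sum>d\<le>D. hcomp d f)" using hcomp_decompose by blast
 have "\<exists>c. reduced c & (\<forall>x\<in>K. peval (hcomp d f) x = peval c (coords x))" for d
  using reduced_exists[OF homogeneous_hcomp] by metis
 then obtain c where c: "!!d. reduced (c d)" "!!d x. x \<in> K ==> peval (hcomp d f) x = peval (c d) (coords x)" by metis
 have "peval f x = peval (\<Sum>d\<le>D. c d) (coords x)" if "x \<in> K" for x
 proof -
  have "peval f x = peval (\<Sum>d\<le>D. hcomp d f) x" by (rule arg_cong[OF D, of "%g. peval g x"])
  also have "\<dots> = peval (\<Sum>d\<le>D. c d) (coords x)" by (simp only: peval_sum c(2)[OF that])
  finally show ?thesis .
 qed
 moreover have "reduced (\<Sum>d\<le>D. c d)" by (rule reduced_sum) (rule c(1))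
 ultimately show ?thesis using that by blast
qed

end

section \<open>Open sets of the quartic and sections of the twisted sheaves\<close>

definition line :: "complex ^ 4 => point" where
 "line x = {c *s x | c. c ~= 0}"

lemma in_line [simp]: "x \<in> line x"
 by (auto simp: line_def intro!: exI[of _ 1])

lemma line_eq: "x \<in> line y ==> line x = line y"
proof -
 assume "x \<in> line y"
 then obtain c where c: "c ~= 0" "x = c *s y" by (auto simp: line_def)
 have "\<exists>e. d *s y = e *s x & e ~= 0" if "d ~= 0" for d
  using c that by (intro exI[of _ "d / c"]) simp
 then show ?thesis using c by (auto simp: line_def)
qed

lemma point_eq_line: "p \<in> proj_space ==> x \<in> p ==> p = line x & x ~= 0"
proof -
 assume "p \<in> proj_space" "x \<in> p"
 then obtain y where y: "p = line y" "y ~= 0" by (auto simp: proj_space_def line_def)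
 with \<open>x \<in> p\<close> show ?thesis using line_eq[of x y] by (auto simp: line_def)
qed

lemma line_in_proj_space: "x ~= 0 ==> line x \<in> proj_space"
 by (auto simp: proj_space_def line_def)

lemma point_nonempty: "p \<in> proj_space ==> \<exists>x. x \<in> p"
 unfolding proj_space_def by (auto intro: exI[of _ "1::complex"])

text \<open>The punctured affine cone over a set of points.\<close>

definition over :: "point set => (complex ^ 4) set" where
 "over U = \<Union>U"

lemma over_mono: "A \<subseteq> B ==> over A \<subseteq> over B"
 unfolding over_def by blast

lemma in_cone_iff:
 assumes "U \<subseteq> proj_space" shows "x \<in> over U \<longleftrightarrow> x ~= 0 & line x \<in> U"
proof
 assume "x \<in> over U"
 then obtain p where "p \<in> U" "x \<in> p" unfolding over_def by blast
 then show "x ~= 0 & line x \<in> U" using point_eq_line[of p x] assms by auto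
qed (use in_line over_def in blast)

lemma zero_locus_cone: "homogeneous n f ==> over (zero_locus f) = {x. x ~= 0 & peval f x = 0}"
proof (intro equalityI subsetI)
 fix x assume "homogeneous n f" "x \<in> {x. x ~= 0 & peval f x = 0}"
 then have "line x \<in> zero_locus f"
  by (auto simp: zero_locus_def line_in_proj_space) (auto simp: line_def peval_scale)
 then show "x \<in> over (zero_locus f)" unfolding over_def by (rule UnionI) simp
qed (auto simp: over_def zero_locus_def dest: point_eq_line)

definition basic_open :: "form => point set" where
 "basic_open f = proj_space - zero_locus f"

lemma openin_basic_open: "homogeneous n f ==> openin zariski (basic_open f)"
 unfolding zariski_def basic_open_def openin_topology_generated_by_iff
 by (rule generate_topology_on.Basis) auto

lemma basic_open_line:
 assumes "homogeneous n f" "x ~= 0"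
 shows "line x \<in> basic_open f \<longleftrightarrow> peval f x ~= 0"
proof -
 have "peval f z = 0" if "peval f x = 0" "z \<in> line x" for z
  using that assms by (auto simp: line_def peval_scale)
 then show ?thesis using assms(2) by (auto simp: basic_open_def zero_locus_def line_in_proj_space intro: in_line)
qed

lemma openin_zariski_iff_nhd:
 assumes "openin zariski V"
 shows "V \<subseteq> proj_space & (\<forall>x. x ~= 0 --> line x \<in> V -->
  (\<exists>n f. homogeneous n f & peval f x ~= 0 & (\<forall>z. z ~= 0 --> peval f z ~= 0 --> line z \<in> V)))"
 using assms unfolding zariski_def openin_topology_generated_by_iff
proof (induction V rule: generate_topology_on.induct)
 case (Int A B)
 show ?case
 proof (intro conjI allI impI)
  show "A \<inter> B \<subseteq> proj_space" using Int by auto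
  fix x :: "complex ^ 4" assume "x ~= 0" "line x \<in> A \<inter> B"
  then obtain n f m g where f: "homogeneous n f" "peval f x ~= 0" "\<forall>z. z ~= 0 --> peval f z ~= 0 --> line z \<in> A"
   and g: "homogeneous m g" "peval g x ~= 0" "\<forall>z. z ~= 0 --> peval g z ~= 0 --> line z \<in> B"
   using Int.IH by (metis IntD1 IntD2)
  then show "\<exists>n f. homogeneous n f & peval f x ~= 0 & (\<forall>z. z ~= 0 --> peval f z ~= 0 --> line z \<in> A \<inter> B)"
   by (intro exI[of _ "n + m"] exI[of _ "f * g"]) (auto intro: homogeneous_mult)
 qed
next
 case (UN K)
 show ?case
 proof (intro conjI allI impI)
  show "\<Union>K \<subseteq> proj_space" using UN by auto
  fix x :: "complex ^ 4" assume "x ~= 0" "line x \<in> \<Union>K"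
  then obtain k where "k \<in> K" "line x \<in> k" by blast
  then obtain n f where "homogeneous n f" "peval f x ~= 0" "\<forall>z. z ~= 0 --> peval f z ~= 0 --> line z \<in> k"
   using UN.IH[OF \<open>k \<in> K\<close>] \<open>x ~= 0\<close> by metis
  then show "\<exists>n f. homogeneous n f & peval f x ~= 0 & (\<forall>z. z ~= 0 --> peval f z ~= 0 --> line z \<in> \<Union>K)"
   using \<open>k \<in> K\<close> by (intro exI[of _ n] exI[of _ f]) auto
 qed
next
 case (Basis s)
 then obtain f n where f: "s = basic_open f" "homogeneous n f" by (auto simp: basic_open_def)
 show ?case
 proof (intro conjI allI impI)
  show "s \<subseteq> proj_space" by (auto simp: f basic_open_def)
  fix x :: "complex ^ 4" assume "x ~= 0" "line x \<in> s"
  then show "\<exists>n f. homogeneous n f & peval f x ~= 0 & (\<forall>z. z ~= 0 --> peval f z ~= 0 --> line z \<in> s)"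
   using f basic_open_line[OF f(2)] by (intro exI[of _ n] exI[of _ f]) auto
 qed
qed auto

context smooth_quartic
begin

abbreviation X :: "(point, complex ^ 4 => complex) ringed_space" where
 "X \<equiv> hypersurface F"

abbreviation openX :: "point set => bool" where
 "openX U \<equiv> openin (pts X) U"

definition total :: "point set" where
 "total = zero_locus F"

definition open_locus :: "form => point set" where
 "open_locus f = zero_locus F \<inter> basic_open f"

lemma cone_total [simp]: "over total = K"
 unfolding total_def K_def by (rule zero_locus_cone[OF homogeneous_F])

lemma pts_X: "pts X = subtopology zariski (zero_locus F)"
 by (simp add: hypersurface_def)

lemma openX_subset: "openX U ==> U \<subseteq> total"
 by (simp add: pts_X openin_subtopology total_def) blast

lemma total_subset: "total \<subseteq> proj_space"
 by (auto simp: total_def zero_locus_def)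

lemma topspace_zariski: "topspace zariski = proj_space"
proof
 show "topspace zariski \<subseteq> proj_space"
  using openin_zariski_iff_nhd[of "topspace zariski"] by auto
 have "openin zariski (basic_open 1)" by (rule openin_basic_open[of 0]) simp
 moreover have "basic_open 1 = proj_space" using point_nonempty by (auto simp: basic_open_def zero_locus_def)
 ultimately show "proj_space \<subseteq> topspace zariski" using openin_subset by metis
qed

lemma topspace_X: "topspace (pts X) = total"
 using total_subset by (auto simp: pts_X topspace_zariski total_def)

lemma openX_total: "openX total"
 using openin_topspace[of "pts X"] by (simp add: topspace_X)

lemma openX_cone_subset: "openX U ==> x \<in> over U ==> x \<in> K"
 using openX_subset cone_total unfolding over_def by blast

lemma openX_proj: "openX U ==> U \<subseteq> proj_space"
 using openX_subset total_subset by blast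

lemma in_coneX_iff: "openX U ==> x \<in> over U \<longleftrightarrow> x ~= 0 & line x \<in> U"
 using in_cone_iff openX_proj by blast

lemma in_point_cone: "openX U ==> p \<in> U ==> x \<in> p ==> p = line x & x \<in> over U"
 unfolding over_def using point_eq_line openX_proj by blast

lemma pointX_nonempty: "openX U ==> p \<in> U ==> \<exists>x. x \<in> p"
 using point_nonempty openX_proj by blast

lemma cone_Int:
 assumes "openX U" "openX V" shows "over (U \<inter> V) = over U \<inter> over V"
proof -
 have "x \<in> over (U \<inter> V) \<longleftrightarrow> x \<in> over U & x \<in> over V" for x
  using assms by (simp only: in_coneX_iff openin_Int) blast
 then show ?thesis by blast
qed

lemma cone_mono:
 assumes "openX U" "openX V" "over U \<subseteq> over V" shows "U \<subseteq> V"
proof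
 fix p assume p: "p \<in> U"
 then obtain x where "x \<in> p" using pointX_nonempty[OF assms(1)] by blast
 then have "p = line x" "x \<in> over V" using in_point_cone[OF assms(1) p] assms(3) by blast+
 then show "p \<in> V" using in_coneX_iff[OF assms(2)] by blast
qed

lemma cone_scale: "openX U ==> x \<in> over U ==> c ~= 0 ==> c *s x \<in> over U"
proof -
 assume U: "openX U" and x: "x \<in> over U" and c: "c ~= 0"
 have "line (c *s x) = line x" using c by (intro line_eq) (auto simp: line_def)
 then show ?thesis using U x c by (simp add: in_coneX_iff)
qed

lemma openX_open_locus: "homogeneous n f ==> openX (open_locus f)"
 unfolding pts_X open_locus_def openin_subtopology using openin_basic_open by blast

lemma cone_open_locus:
 assumes "homogeneous n f" shows "over (open_locus f) = {x \<in> K. peval f x ~= 0}"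
proof -
 have "x \<in> over (open_locus f) \<longleftrightarrow> x \<in> K & peval f x ~= 0" for x
  using in_coneX_iff[OF openX_open_locus[OF assms], of x] in_coneX_iff[OF openX_total, of x] basic_open_line[OF assms, of x]
  by (auto simp: open_locus_def total_def[symmetric])
 then show ?thesis by blast
qed

lemma openX_nhd:
 assumes "openX U" "x \<in> over U"
 obtains n f where "homogeneous n f" "peval f x ~= 0" "!!z. z \<in> K ==> peval f z ~= 0 ==> z \<in> over U"
proof -
 obtain V where V: "openin zariski V" "U = V \<inter> total" using assms(1) by (auto simp: pts_X openin_subtopology total_def)
 have x: "x ~= 0" "line x \<in> V" using assms in_coneX_iff V(2) by blast+
 then obtain n f where f: "homogeneous n f" "peval f x ~= 0" "\<forall>z. z ~= 0 --> peval f z ~= 0 --> line z \<in> V"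
  using openin_zariski_iff_nhd[OF V(1)] by metis
 have "z \<in> over U" if "z \<in> K" "peval f z ~= 0" for z
  using that f(3) V(2) in_coneX_iff[OF assms(1), of z] in_coneX_iff[OF openX_total, of z] by auto
 then show ?thesis using that f by blast
qed

definition rst :: "point set => (complex ^ 4 => complex) => complex ^ 4 => complex" where
 "rst U s = (%x. if x \<in> over U then s x else 0)"

abbreviation Reg :: "int => point set => (complex ^ 4 => complex) => bool" where
 "Reg k U s \<equiv> s \<in> carrier (sec (twist F k) U)"

definition fraction_at :: "int => point set => (complex ^ 4 => complex) => complex ^ 4 => form => form => bool" where
 "fraction_at k U s x P Q \<longleftrightarrow> (\<exists>m n. homogeneous m P & homogeneous n Q & int m - int n = k) & peval Q x ~= 0 &
   (\<forall>z\<in>K. peval Q z ~= 0 --> z \<in> over U & s z = peval P z / peval Q z)"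

lemma fraction_atD:
 assumes "fraction_at k U s x P Q"
 shows "peval Q x ~= 0" "z \<in> K ==> peval Q z ~= 0 ==> z \<in> over U" "z \<in> K ==> peval Q z ~= 0 ==> s z = peval P z / peval Q z"
 using assms by (auto simp: fraction_at_def)

text \<open>Regular sections are described by fractions whose denominator also cuts out the neighbourhood
  on which the fraction represents the section.\<close>

lemma Reg_iff:
 assumes U: "openX U"
 shows "Reg k U s \<longleftrightarrow> (\<forall>x. x \<notin> over U --> s x = 0) & (\<forall>x\<in>over U. \<exists>P Q. fraction_at k U s x P Q)"
proof
 assume R: "Reg k U s"
 show "(\<forall>x. x \<notin> over U --> s x = 0) & (\<forall>x\<in>over U. \<exists>P Q. fraction_at k U s x P Q)"
 proof (intro conjI ballI)
  show "\<forall>x. x \<notin> over U --> s x = 0" using R by (auto simp: twist_def over_def)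
  fix x assume x: "x \<in> over U"
  then have lx: "x ~= 0" "line x \<in> U" using in_coneX_iff[OF U] by blast+
  then obtain V t where V: "openin zariski V" "line x \<in> V" "t \<in> proj_twist_sections k V" "\<forall>x\<in>over (U \<inter> V). s x = t x"
   using R by (auto simp: twist_def over_def)
  then obtain V' f g m n where V': "openin zariski V'" "line x \<in> V'" "V' \<subseteq> V" "homogeneous m f" "homogeneous n g"
    "int m - int n = k" "\<forall>x\<in>over V'. peval g x ~= 0 & t x = peval f x / peval g x"
   unfolding proj_twist_sections_def over_def by blast
  have UV: "openX (U \<inter> V')"
  proof -
   obtain T where "openin zariski T" "U = T \<inter> zero_locus F" using U unfolding pts_X openin_subtopology by blast
   then have "openin zariski (T \<inter> V')" "U \<inter> V' = (T \<inter> V') \<inter> zero_locus F" using V'(1) by auto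
   then show ?thesis unfolding pts_X openin_subtopology by blast
  qed
  have xUV: "x \<in> over (U \<inter> V')" using in_coneX_iff[OF UV] lx V'(2) by blast
  then obtain r q where q: "homogeneous r q" "peval q x ~= 0" "!!z. z \<in> K ==> peval q z ~= 0 ==> z \<in> over (U \<inter> V')"
   using openX_nhd[OF UV] by blast
  have "fraction_at k U s x (f * q) (g * q)"
   unfolding fraction_at_def
  proof (intro conjI ballI impI)
   show "\<exists>m n. homogeneous m (f * q) & homogeneous n (g * q) & int m - int n = k"
    using V' q by (intro exI[of _ "m + r"] exI[of _ "n + r"]) (auto intro: homogeneous_mult)
   show "peval (g * q) x ~= 0" using q(2) V'(7) xUV over_mono[of "U \<inter> V'" V'] by auto
   fix z assume z: "z \<in> K" "peval (g * q) z ~= 0"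
   then have "z \<in> over (U \<inter> V')" using q(3) by simp
   moreover have "over (U \<inter> V') \<subseteq> over V'" "over (U \<inter> V') \<subseteq> over U"
    "over (U \<inter> V') \<subseteq> over (U \<inter> V)" using V'(3) by (intro over_mono; blast)+
   moreover from calculation have "s z = t z" "t z = peval f z / peval g z" using V(4) V'(7) by blast+
   ultimately show "z \<in> over U" "s z = peval (f * q) z / peval (g * q) z" using z(2) by auto
  qed
  then show "\<exists>P Q. fraction_at k U s x P Q" by blast
 qed
next
 assume R: "(\<forall>x. x \<notin> over U --> s x = 0) & (\<forall>x\<in>over U. \<exists>P Q. fraction_at k U s x P Q)"
 have "\<exists>V t. openin zariski V & p \<in> V & t \<in> proj_twist_sections k V & (\<forall>x\<in>over (U \<inter> V). s x = t x)" if p: "p \<in> U" for p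
 proof -
  obtain x where x: "x \<in> p" using pointX_nonempty[OF U p] by blast
  then have px: "p = line x" "x \<in> over U" using in_point_cone[OF U p] by blast+
  then obtain P Q m n where PQ: "homogeneous m P" "homogeneous n Q" "int m - int n = k"
   and fr: "fraction_at k U s x P Q" using R unfolding fraction_at_def by blast
  let ?V = "basic_open Q"
  define t where "t z = (if z \<in> over ?V then peval P z / peval Q z else 0)" for z
  have V: "openin zariski ?V" by (rule openin_basic_open[OF PQ(2)])
  have VQ: "z ~= 0 & peval Q z ~= 0" if "z \<in> over ?V" for z
   using that in_cone_iff[of ?V z] basic_open_line[OF PQ(2), of z] by (auto simp: basic_open_def)
  have "p \<in> ?V" using px fr in_coneX_iff[OF U] basic_open_line[OF PQ(2), of x] by (auto dest: fraction_atD)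
  moreover have "t \<in> proj_twist_sections k ?V"
   unfolding proj_twist_sections_def over_def[symmetric]
  proof (intro CollectI conjI allI impI ballI)
   fix q assume "q \<in> ?V"
   moreover have "\<forall>x\<in>over ?V. peval Q x ~= 0 & t x = peval P x / peval Q x" using VQ unfolding t_def by simp
   ultimately show "\<exists>W f g m n. openin zariski W & q \<in> W & W \<subseteq> ?V & homogeneous m f & homogeneous n g &
     int m - int n = k & (\<forall>x\<in>over W. peval g x ~= 0 & t x = peval f x / peval g x)"
    using V PQ by (intro exI[of _ ?V] exI[of _ P] exI[of _ Q] exI[of _ m] exI[of _ n] conjI subset_refl)
  qed (simp add: t_def)
  moreover have "s z = t z" if "z \<in> over (U \<inter> ?V)" for z
  proof -
   have z: "z \<in> over U" "z \<in> over ?V" using that by (auto simp: over_def)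
   then show ?thesis using fraction_atD(3)[OF fr openX_cone_subset[OF U z(1)]] VQ[OF z(2)] by (simp add: t_def)
  qed
  ultimately show ?thesis using V by blast
 qed
 then show "Reg k U s" using R by (simp add: twist_def flip: over_def)
qed

lemma Reg_off: "openX U ==> Reg k U s ==> x \<notin> over U ==> s x = 0"
 using Reg_iff by blast

lemma Reg_fraction:
 assumes "openX U" "Reg k U s" "x \<in> over U"
 obtains P Q m n where "fraction_at k U s x P Q" "homogeneous m P" "homogeneous n Q" "int m - int n = k"
proof -
 obtain P Q where "fraction_at k U s x P Q" using assms Reg_iff by blast
 then show ?thesis using that unfolding fraction_at_def by blast
qed

lemma RegI:
 assumes "openX U" "!!x. x \<notin> over U ==> s x = 0" "!!x. x \<in> over U ==> \<exists>P Q. fraction_at k U s x P Q"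
 shows "Reg k U s"
 using assms Reg_iff by blast

lemma fraction_atI:
 assumes "homogeneous m P" "homogeneous n Q" "int m - int n = k" "peval Q x ~= 0"
  "!!z. z \<in> K ==> peval Q z ~= 0 ==> z \<in> over U & s z = peval P z / peval Q z"
 shows "fraction_at k U s x P Q"
 using assms unfolding fraction_at_def by blast

lemma Reg_zero: "openX U ==> Reg k U (%x. 0)"
proof (rule RegI)
 fix x assume U: "openX U" and "x \<in> over U"
 then obtain n f where f: "homogeneous n f" "peval f x ~= 0" "!!z. z \<in> K ==> peval f z ~= 0 ==> z \<in> over U"
  using openX_nhd by blast
  \<comment> \<open>\<open>0 / (f x\<^sub>1\<^sup>r)\<close> with degrees adjusted so that the difference is \<open>k\<close>\<close>
 have xn0: "x ~= 0" using \<open>x \<in> over U\<close> U in_coneX_iff by blast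
 then obtain i where "x $ i ~= 0" by (auto simp: vec_eq_iff)
 then have "fraction_at k U (%x. 0) x 0 (f * form_var i ^ nat (- k))"
  using f by (intro fraction_atI[of "nat (k + int (n + nat (- k)))" _ "n + nat (- k)"])
   (auto intro!: homogeneous_mult homogeneous_power[OF homogeneous_var, simplified])
 then show "\<exists>P Q. fraction_at k U (%x. 0) x P Q" by blast
qed auto

lemma Reg_add:
 assumes U: "openX U" and s: "Reg k U s" and t: "Reg k U t"
 shows "Reg k U (%x. s x + t x)"
proof (rule RegI[OF U])
 fix x assume "x \<in> over U"
 then obtain P Q m n P' Q' m' n' where 1: "fraction_at k U s x P Q" "homogeneous m P" "homogeneous n Q" "int m - int n = k"
  and 2: "fraction_at k U t x P' Q'" "homogeneous m' P'" "homogeneous n' Q'" "int m' - int n' = k"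
  using Reg_fraction[OF U s] Reg_fraction[OF U t] by metis
 have "homogeneous (m + n') (P * Q')" "homogeneous (m + n') (P' * Q)"
  using 1 2 by (auto intro: homogeneous_mult_eq)
 then have "fraction_at k U (%x. s x + t x) x (P * Q' + P' * Q) (Q * Q')"
  using 1 2 fraction_atD[OF 1(1)] fraction_atD[OF 2(1)] by (intro fraction_atI[of "m + n'" _ "n + n'"])
   (auto intro!: homogeneous_mult homogeneous_add simp: field_simps)
 then show "\<exists>P Q. fraction_at k U (%x. s x + t x) x P Q" by blast
qed (simp add: Reg_off[OF U s] Reg_off[OF U t])

lemma Reg_mult:
 assumes U: "openX U" and s: "Reg k U s" and t: "Reg l U t" and kl: "j = k + l"
 shows "Reg j U (%x. s x * t x)"
proof (rule RegI[OF U])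
 fix x assume "x \<in> over U"
 then obtain P Q m n P' Q' m' n' where 1: "fraction_at k U s x P Q" "homogeneous m P" "homogeneous n Q" "int m - int n = k"
  and 2: "fraction_at l U t x P' Q'" "homogeneous m' P'" "homogeneous n' Q'" "int m' - int n' = l"
  using Reg_fraction[OF U s] Reg_fraction[OF U t] by metis
 have "fraction_at j U (%x. s x * t x) x (P * P') (Q * Q')"
  using 1 2 fraction_atD[OF 1(1)] fraction_atD[OF 2(1)] kl by (intro fraction_atI[of "m + m'" _ "n + n'"])
   (auto intro!: homogeneous_mult)
 then show "\<exists>P Q. fraction_at j U (%x. s x * t x) x P Q" by blast
qed (simp add: Reg_off[OF U s])

lemma Reg_glue:
 assumes U: "openX U" and off: "!!x. x \<notin> over U ==> s x = 0"
  and loc: "!!x. x \<in> over U ==> \<exists>V t. openX V & x \<in> over V & over V \<subseteq> over U & Reg k V t & (\<forall>z\<in>over V. s z = t z)"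
 shows "Reg k U s"
proof (rule RegI[OF U off])
 fix x assume x: "x \<in> over U"
 obtain V t where V: "openX V" "x \<in> over V" "over V \<subseteq> over U" "Reg k V t" "\<forall>z\<in>over V. s z = t z"
  using loc[OF x] by (elim exE conjE)
 obtain P Q m n where PQ: "fraction_at k V t x P Q" "homogeneous m P" "homogeneous n Q" "int m - int n = k"
  using Reg_fraction[OF V(1,4,2)] by blast
 have "fraction_at k U s x P Q"
  using V(3,5) fraction_atD[OF PQ(1)] PQ by (intro fraction_atI[of m P n Q]) auto
 then show "\<exists>P Q. fraction_at k U s x P Q" by blast
qed

lemma Reg_rst:
 assumes U: "openX U" and V: "openX V" "over V \<subseteq> over U" and s: "Reg k U s"
 shows "Reg k V (rst V s)"
proof (rule RegI[OF V(1)])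
 fix x assume x: "x \<in> over V"
 then obtain r q where q: "homogeneous r q" "peval q x ~= 0" "!!z. z \<in> K ==> peval q z ~= 0 ==> z \<in> over V"
  using openX_nhd[OF V(1)] by blast
 have xU: "x \<in> over U" using x V by blast
 obtain P Q m n where PQ: "fraction_at k U s x P Q" "homogeneous m P" "homogeneous n Q" "int m - int n = k"
  using Reg_fraction[OF U s xU] by blast
 have "fraction_at k V (rst V s) x (P * q) (Q * q)"
  using q fraction_atD[OF PQ(1)] PQ by (intro fraction_atI[of "m + r" _ "n + r"]) (auto intro!: homogeneous_mult simp: rst_def)
 then show "\<exists>P Q. fraction_at k V (rst V s) x P Q" by blast
qed (auto simp: rst_def)

lemma Reg_form:
 assumes U: "openX U" and f: "homogeneous n f" and k: "k = int n"
 shows "Reg k U (rst U (peval f))"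
proof (rule RegI[OF U])
 fix x assume x: "x \<in> over U"
 then obtain r q where q: "homogeneous r q" "peval q x ~= 0" "!!z. z \<in> K ==> peval q z ~= 0 ==> z \<in> over U"
  using openX_nhd[OF U] by blast
 have "fraction_at k U (rst U (peval f)) x (f * q) q"
  using q f k by (intro fraction_atI[of "n + r" _ r]) (auto intro: homogeneous_mult simp: rst_def)
 then show "\<exists>P Q. fraction_at k U (rst U (peval f)) x P Q" by blast
qed (auto simp: rst_def)

lemma Reg_inverse:
 assumes U: "openX U" and s: "Reg k U s" and nz: "!!x. x \<in> over U ==> s x ~= 0" and l: "l = - k"
 shows "Reg l U (%x. inverse (s x))"
proof (rule RegI[OF U])
 fix x assume x: "x \<in> over U"
 obtain P Q m n where PQ: "fraction_at k U s x P Q" "homogeneous m P" "homogeneous n Q" "int m - int n = k"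
  using Reg_fraction[OF U s x] by blast
 have "peval P x ~= 0" using nz[OF x] fraction_atD[OF PQ(1)] openX_cone_subset[OF U x] by auto
 then have "fraction_at l U (%x. inverse (s x)) x (Q * Q) (P * Q)"
  using PQ l fraction_atD[OF PQ(1)] by (intro fraction_atI[of "n + n" _ "m + n"]) (auto intro!: homogeneous_mult)
 then show "\<exists>P Q. fraction_at l U (%x. inverse (s x)) x P Q" by blast
qed (simp add: Reg_off[OF U s])

lemma Reg_const: "openX U ==> Reg 0 U (rst U (%x. c))"
 using Reg_form[of U 0 "form_const c" 0] by (simp add: rst_def cong: if_cong)

lemma Reg_cmult:
 assumes U: "openX U" and s: "Reg k U s" shows "Reg k U (%x. c * s x)"
proof -
 have "Reg k U (%x. rst U (%x. c) x * s x)" by (rule Reg_mult[OF U Reg_const[OF U] s]) simp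
 moreover have "(%x. rst U (%x. c) x * s x) = (%x. c * s x)" using Reg_off[OF U s] by (auto simp: rst_def)
 ultimately show ?thesis by simp
qed

lemma Reg_uminus: "openX U ==> Reg k U s ==> Reg k U (%x. - s x)"
 using Reg_cmult[of U s k "-1"] by simp

lemma Reg_diff: "openX U ==> Reg k U s ==> Reg k U t ==> Reg k U (%x. s x - t x)"
 using Reg_add[of U s k "%x. - t x"] Reg_uminus by simp

lemma Reg_sum: "openX U ==> (!!a. a \<in> A ==> Reg k U (s a)) ==> Reg k U (%x. \<Sum>a\<in>A. s a x)"
 by (induction A rule: infinite_finite_induct) (auto intro: Reg_add Reg_zero)

lemma Reg_scale:
 assumes U: "openX U" and s: "Reg k U s" and c: "c ~= 0" shows "s (c *s x) = c powi k * s x"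
proof (cases "x \<in> over U")
 case True
 then obtain P Q m n where PQ: "fraction_at k U s x P Q" "homogeneous m P" "homogeneous n Q" "int m - int n = k"
  using Reg_fraction[OF U s] by metis
 have x: "x \<in> K" by (rule openX_cone_subset[OF U True])
 have "peval Q (c *s x) ~= 0" using c fraction_atD(1)[OF PQ(1)] by (simp add: peval_scale[OF PQ(3)])
 then have "s (c *s x) = (c ^ m * peval P x) / (c ^ n * peval Q x)"
  using fraction_atD(3)[OF PQ(1) K_scale[OF c x]] by (simp add: peval_scale[OF PQ(2)] peval_scale[OF PQ(3)])
 also have "\<dots> = c powi k * s x"
  using c fraction_atD(3)[OF PQ(1) x fraction_atD(1)[OF PQ(1)]] by (simp add: power_int_diff flip: PQ(4))
 finally show ?thesis .
next
 case False
 then have "c *s x \<notin> over U" using cone_scale[OF U, of "c *s x" "inverse c"] c by auto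
 then show ?thesis using False Reg_off[OF U s] by simp
qed

end

section \<open>Global sections and regular sequences\<close>

lemma form_var_power: "form_var i ^ N = psingle (psingle i N) 1"
 by (induction N) (simp_all add: form_var_def mult_single flip: single_add)

lemma exponent_shift: "psingle i N + k = m \<longleftrightarrow> N \<le> plookup m i & k = m - psingle i (N::nat)"
proof
 assume "psingle i N + k = m"
 then show "N \<le> plookup m i & k = m - psingle i N" by (auto simp: lookup_add)
next
 assume "N \<le> plookup m i & k = m - psingle i N"
 then show "psingle i N + k = m"
  by (intro poly_mapping_eqI) (auto simp: lookup_add lookup_minus lookup_single when_def)
qed

lemma lookup_var_power_mult:
 "plookup (form_var i ^ N * c) m = (if N \<le> plookup m i then plookup c (m - psingle i N) else 0)"
proof (induction c rule: form_induct)
 case (single k a)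
 then show ?case
  by (simp add: form_var_power mult_single lookup_single when_def exponent_shift)
qed (simp_all add: distrib_left lookup_add)

lemma split_by_power:
 obtains hi lo where "a = form_var i ^ N * hi + lo"
  "!!m. plookup lo m = (if N \<le> plookup m i then 0 else plookup a m)"
  "!!m. plookup hi m = plookup a (m + psingle i N)"
proof -
 let ?e = "psingle i N"
 let ?T = "{m \<in> pkeys a. N \<le> plookup m i}"
 define hi where "hi = (\<Sum>m\<in>?T. psingle (m - ?e) (plookup a m))"
 define lo where "lo = a - form_var i ^ N * hi"
 have hi: "plookup hi m = plookup a (m + ?e)" for m
 proof -
  have "plookup hi m = (\<Sum>k\<in>?T. if k = m + ?e then plookup a (m + ?e) else 0)"
   unfolding hi_def lookup_sum
  proof (intro sum.cong refl)
   fix k assume "k \<in> ?T"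
   then have "k - ?e = m \<longleftrightarrow> k = m + ?e" using exponent_shift[of i N m k] by (auto simp: add.commute)
   then show "plookup (psingle (k - ?e) (plookup a k)) m = (if k = m + ?e then plookup a (m + ?e) else 0)"
    by (auto simp: lookup_single when_def)
  qed
  also have "\<dots> = plookup a (m + ?e)" by (auto simp: in_keys_iff lookup_add)
  finally show ?thesis .
 qed
 have "plookup lo m = (if N \<le> plookup m i then 0 else plookup a m)" for m
 proof (cases "N \<le> plookup m i")
  case True
  then have "?e + (m - ?e) = m" by (simp add: exponent_shift)
  then have "m - ?e + ?e = m" by (simp add: add.commute)
  then show ?thesis using True by (simp add: lo_def lookup_minus lookup_var_power_mult hi)
 qed (simp add: lo_def lookup_minus lookup_var_power_mult)
 then show ?thesis using hi by (intro that[of hi lo]) (simp_all add: lo_def)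
qed

context smooth_quartic
begin

text \<open>The degree is an integer so that negative twists, which have no sections but \<open>0\<close>, need no
  special treatment.\<close>

definition graded :: "int => form => bool" where
 "graded k c \<longleftrightarrow> reduced c & (\<forall>m. plookup c m ~= 0 --> int (mon_degree m) = k)"

lemma reduced_var_power_mult: "i ~= 4 ==> reduced c ==> reduced (form_var i ^ N * c)"
 by (auto simp: reduced_def lookup_var_power_mult lookup_minus lookup_single when_def split: if_splits)

lemma graded_high:
 assumes "graded k a" "i ~= 4" "!!m. plookup hi m = plookup a (m + psingle i N)"
 shows "graded (k - int N) hi"
proof -
 have "mon_degree (psingle i N) = N" by (simp add: mon_degree_def lookup_single when_def)
 then show ?thesis using assms unfolding graded_def reduced_def
  by (auto simp: lookup_add lookup_single when_def mon_degree_add)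
qed

lemma graded_low:
 assumes "graded k a" "!!m. plookup lo m = (if N \<le> plookup m i then 0 else plookup a m)"
 shows "graded k lo"
 using assms by (auto simp: graded_def reduced_def split: if_splits)

definition section_of :: "form => complex ^ 4 => complex" where
 "section_of c = rst total (%x. peval c (coords x))"

lemma rst_total [simp]: "x \<in> K ==> rst total s x = s x"
 by (simp add: rst_def)

lemma section_of_on [simp]: "x \<in> K ==> section_of c x = peval c (coords x)"
 by (simp add: section_of_def)

lemma peval_coords: "peval c (coords x) = peval (subst_form c coord_form) x"
 by (simp add: peval_subst_form coords_def)

lemma Reg_section_of:
 assumes "graded k c" shows "Reg k total (section_of c)"
proof (cases "k \<ge> 0")
 case True
 then have "homogeneous (nat k) c" using assms by (auto simp: graded_def homogeneous_alt)
 then have "homogeneous (nat k) (subst_form c coord_form)" by (rule homogeneous_subst_form[OF _ homogeneous_coord_form])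
 from Reg_form[OF openX_total this, of k] True show ?thesis
  by (simp add: section_of_def rst_def peval_coords)
next
 case False
 then have "plookup c m = 0" for m using assms by (force simp: graded_def)
 then have "c = 0" by (intro poly_mapping_eqI) simp
 then have "section_of c = (%x. 0)" by (auto simp: section_of_def rst_def)
 then show ?thesis using Reg_zero[OF openX_total] by simp
qed

text \<open>A power of one of the first three coordinates times a reduced polynomial is again reduced, so its
  vanishing on the cone forces the reduced polynomial to vanish.\<close>

lemma cancel_power:
 assumes i: "i ~= 4" and z: "!!x. x \<in> K ==> (coords x $ i) ^ N * peval f x = 0"
 shows "x \<in> K ==> peval f x = 0"
proof -
 assume x: "x \<in> K"
 obtain c where c: "reduced c" "!!x. x \<in> K ==> peval f x = peval c (coords x)" using reduced_exists_any by blast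
 have 0: "form_var i ^ N * c = 0"
  by (rule reduced_unique[OF reduced_var_power_mult[OF i c(1)]]) (use z c(2) in auto)
 have "plookup c m = 0" for m
 proof -
  have "plookup (form_var i ^ N * c) (m + psingle i N) = 0" by (simp add: 0)
  then show ?thesis by (simp add: lookup_var_power_mult lookup_add)
 qed
 then have "c = 0" by (intro poly_mapping_eqI) simp
 then show ?thesis using c(2)[OF x] by simp
qed

text \<open>Coprimality of powers of two variables, read off from the coefficients.\<close>

lemma power_divides:
 assumes ij: "i ~= j" and eq: "form_var j ^ M * a = form_var i ^ N * b"
 obtains c where "a = form_var i ^ N * c" "!!m. plookup c m = plookup a (m + psingle i N)"
proof -
 obtain hi lo where h: "a = form_var i ^ N * hi + lo"
  "!!m. plookup lo m = (if N \<le> plookup m i then 0 else plookup a m)"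
  "!!m. plookup hi m = plookup a (m + psingle i N)" using split_by_power by blast
 have "plookup lo m = 0" for m
 proof (cases "N \<le> plookup m i")
  case False
  have "plookup a m = plookup (form_var j ^ M * a) (m + psingle j M)"
   by (simp add: lookup_var_power_mult lookup_add)
  also have "\<dots> = 0" unfolding eq lookup_var_power_mult using False ij by (simp add: lookup_add lookup_single)
  finally show ?thesis by (simp add: h(2))
 qed (simp add: h(2))
 then have "lo = 0" by (intro poly_mapping_eqI) simp
 then have "a = form_var i ^ N * hi" using h(1) by simp
 then show ?thesis using that h(3) by blast
qed

text \<open>Global sections are polynomials. The forms \<open>g\<close> such that \<open>g s\<close> is a polynomial on the cone
  generate an ideal without non-trivial zeros, hence powers of the first two coordinates are
  among them; since these form a regular sequence, \<open>s\<close> itself is a polynomial, and comparison of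
  \<open>s (2 x)\<close> with \<open>s x\<close> shows that it has the right degree.\<close>

theorem global_section_polynomial:
 assumes s: "Reg k total s"
 obtains c where "graded k c" "s = section_of c"
proof -
 define I where "I = {g. \<exists>f. \<forall>z\<in>K. peval g z * s z = peval f z}"
 have idl: "form_ideal I"
  unfolding form_ideal_def
 proof (intro conjI ballI allI)
  show "0 \<in> I" by (auto simp: I_def intro: exI[of _ 0])
 next
  fix f g assume "f \<in> I" "g \<in> I"
  then obtain f' g' where "\<forall>z\<in>K. peval f z * s z = peval f' z" "\<forall>z\<in>K. peval g z * s z = peval g' z" by (auto simp: I_def)
  then show "f + g \<in> I" unfolding I_def by (intro CollectI exI[of _ "f' + g'"]) (simp add: distrib_right)
 next
  fix f g assume "f \<in> I"
  then obtain f' where "\<forall>z\<in>K. peval f z * s z = peval f' z" by (auto simp: I_def)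
  then show "g * f \<in> I" unfolding I_def by (intro CollectI exI[of _ "g * f'"]) simp
 qed
 have zeros: "\<exists>f\<in>I. (\<exists>n. homogeneous n f) & peval f x ~= 0" if "x ~= 0" for x
 proof (cases "x \<in> K")
  case True
  obtain P Q m n where PQ: "fraction_at k total s x P Q" "homogeneous m P" "homogeneous n Q"
   using Reg_fraction[OF openX_total s] True by (metis cone_total)
  have "peval (Q * Q) z * s z = peval (P * Q) z" if "z \<in> K" for z
   using fraction_atD(3)[OF PQ(1) that] by (cases "peval Q z = 0") auto
  then have "Q * Q \<in> I" unfolding I_def by blast
  moreover have "peval (Q * Q) x ~= 0" using fraction_atD(1)[OF PQ(1)] by simp
  ultimately show ?thesis using homogeneous_mult[OF PQ(3,3)] by blast
 next
  case False
  have "F \<in> I" unfolding I_def by (intro CollectI exI[of _ 0]) (simp add: K_def)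
  then show ?thesis using False that homogeneous_F by (auto simp: K_def)
 qed
 have ex: "\<exists>N c. reduced c & (\<forall>x\<in>K. (coords x $ i) ^ N * s x = peval c (coords x))" for i
 proof -
  obtain N where "coord_form i ^ N \<in> I"
   using projective_nullstellensatz[OF idl zeros homogeneous_coord_form] by blast
  then obtain f where f: "\<forall>z\<in>K. peval (coord_form i ^ N) z * s z = peval f z" by (auto simp: I_def)
  obtain c where "reduced c" "!!x. x \<in> K ==> peval f x = peval c (coords x)" using reduced_exists_any by blast
  with f show ?thesis by (intro exI[of _ N] exI[of _ c]) (auto simp: coords_def)
 qed
 obtain N1 c1 where c1: "reduced c1" "!!x. x \<in> K ==> (coords x $ 1) ^ N1 * s x = peval c1 (coords x)" using ex[of 1] by blast
 obtain N2 c2 where c2: "reduced c2" "!!x. x \<in> K ==> (coords x $ 2) ^ N2 * s x = peval c2 (coords x)" using ex[of 2] by blast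
 have "form_var 2 ^ N2 * c1 = form_var 1 ^ N1 * c2"
  by (rule reduced_eqI) (auto intro: reduced_var_power_mult c1 c2 simp flip: c1(2) c2(2))
 then obtain c where c: "c1 = form_var 1 ^ N1 * c" "!!m. plookup c m = plookup c1 (m + psingle 1 N1)"
  using power_divides[of 1 2 N2 c1 N1 c2] by auto
 have redc: "reduced c" using c1(1) by (auto simp: reduced_def c(2)) (force simp: lookup_add lookup_single)
 let ?c = "subst_form c coord_form"
 have sc: "s x = peval c (coords x)" if x: "x \<in> K" for x
 proof -
  obtain P Q m n where PQ: "fraction_at k total s x P Q" "homogeneous m P" "homogeneous n Q"
   using Reg_fraction[OF openX_total s] x by (metis cone_total)
  have "(coords z $ 1) ^ N1 * peval (Q * (P - ?c * Q)) z = 0" if z: "z \<in> K" for z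
  proof (cases "peval Q z = 0")
   case False
   have "(coords z $ 1) ^ N1 * s z = (coords z $ 1) ^ N1 * peval c (coords z)"
    using c1(2)[OF z] by (simp add: c(1))
   then show ?thesis using fraction_atD(3)[OF PQ(1) z False] False
    by (simp add: peval_coords field_simps)
  qed simp
  then have "peval (Q * (P - ?c * Q)) x = 0" using cancel_power[of 1 N1 "Q * (P - ?c * Q)" x] x by simp
  then show ?thesis using fraction_atD(1,3)[OF PQ(1)] x by (simp add: peval_coords)
 qed
 define d where "d = (\<Sum>m\<in>pkeys c. psingle m (plookup c m * (2 ^ mon_degree m - 2 powi k)))"
 have lookd: "plookup d m = plookup c m * (2 ^ mon_degree m - 2 powi k)" for m
  by (auto simp: d_def lookup_sum lookup_single when_def in_keys_iff)
 have "d = 0"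
 proof (rule reduced_unique)
  show "reduced d" using redc by (auto simp: reduced_def lookd)
  fix x assume x: "x \<in> K"
  have me: "mon_eval m (2 *s y) = 2 ^ mon_degree m * mon_eval m y" for m y
   using peval_scale[OF homogeneous_single[OF refl], of m 1 2 y] by simp
  have "peval d (coords x) = peval c (2 *s coords x) - 2 powi k * peval c (coords x)"
   by (simp add: d_def peval_superset[of "pkeys c" c] me algebra_simps sum_subtractf sum_distrib_left)
  also have "\<dots> = s (2 *s x) - 2 powi k * s x"
   using sc[OF x] sc[OF K_scale[OF _ x], of 2] by (simp add: coords_scale)
  also have "\<dots> = 0" using Reg_scale[OF openX_total s, of 2 x] by simp
  finally show "peval d (coords x) = 0" .
 qed
 have "graded k c"
  unfolding graded_def
 proof (intro conjI allI impI redc)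
  fix m assume "plookup c m ~= 0"
  moreover have "plookup d m = 0" by (simp add: \<open>d = 0\<close>)
  ultimately have "(2::complex) ^ mon_degree m = 2 powi k" unfolding lookd by simp
  then have "norm ((2::complex) ^ mon_degree m) = norm ((2::complex) powi k)" by simp
  then have "(2::real) powi (int (mon_degree m)) = 2 powi k" by (simp add: norm_power norm_power_int)
  then show "int (mon_degree m) = k"
   using power_int_strict_increasing[of "int (mon_degree m)" k "2::real"] power_int_strict_increasing[of k "int (mon_degree m)" "2::real"]
   by (cases "int (mon_degree m)" k rule: linorder_cases) auto
 qed
 moreover have "s = section_of c"
  using sc Reg_off[OF openX_total s] by (auto simp: section_of_def rst_def)
 ultimately show ?thesis using that by blast
qed

lemma Reg_total_form: "homogeneous n f ==> k = int n ==> Reg k total (rst total (peval f))"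
 by (rule Reg_form[OF openX_total])

lemma Reg_total_negative: "Reg k total s ==> k < 0 ==> s = (%x. 0)"
proof -
 assume "Reg k total s" "k < 0"
 then obtain c where c: "graded k c" "s = section_of c" using global_section_polynomial by blast
 then have "plookup c m = 0" for m using \<open>k < 0\<close> by (force simp: graded_def)
 then have "c = 0" by (intro poly_mapping_eqI) simp
 then show ?thesis using c by (auto simp: section_of_def rst_def)
qed

text \<open>Powers of the first three coordinates form a regular sequence on the graded ring of global
  sections; on reduced polynomials this is read off from the exponents.\<close>

lemma regular_pair:
 assumes ij: "i ~= j" "i ~= 4" "j ~= 4" and a: "Reg k total a" and b: "Reg l total b"
  and eq: "!!x. x \<in> K ==> (coords x $ j) ^ M * a x = (coords x $ i) ^ N * b x"
 obtains c where "Reg (k - int N) total c" "!!x. x \<in> K ==> a x = (coords x $ i) ^ N * c x"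
proof -
 obtain \<alpha> \<beta> where \<alpha>: "graded k \<alpha>" "a = section_of \<alpha>" and \<beta>: "graded l \<beta>" "b = section_of \<beta>"
  using a b global_section_polynomial by metis
 have "form_var j ^ M * \<alpha> = form_var i ^ N * \<beta>"
  by (rule reduced_eqI) (use \<alpha> \<beta> ij eq in "auto simp: graded_def intro!: reduced_var_power_mult")
 then obtain \<gamma> where \<gamma>: "\<alpha> = form_var i ^ N * \<gamma>" "!!m. plookup \<gamma> m = plookup \<alpha> (m + psingle i N)"
  using power_divides[OF ij(1)] by blast
 show ?thesis
  by (rule that[OF Reg_section_of[OF graded_high[OF \<alpha>(1) ij(2) \<gamma>(2)]]]) (simp add: \<alpha>(2) \<gamma>(1))
qed

lemma regular_triple:
 assumes a: "Reg k total a" and b: "Reg l total b" and c: "Reg m total c"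
  and eq: "!!x. x \<in> K ==> (coords x $ 3) ^ L * a x = (coords x $ 1) ^ N * b x + (coords x $ 2) ^ M * c x"
 obtains p q where "Reg (k - int N) total p" "Reg (k - int M) total q"
  "!!x. x \<in> K ==> a x = (coords x $ 1) ^ N * p x + (coords x $ 2) ^ M * q x"
proof -
 obtain \<alpha> \<beta> \<gamma> where \<alpha>: "graded k \<alpha>" "a = section_of \<alpha>" and \<beta>: "graded l \<beta>" "b = section_of \<beta>"
  and \<gamma>: "graded m \<gamma>" "c = section_of \<gamma>" using a b c global_section_polynomial by metis
 have eq': "form_var 3 ^ L * \<alpha> = form_var 1 ^ N * \<beta> + form_var 2 ^ M * \<gamma>"
  by (rule reduced_eqI) (use \<alpha> \<beta> \<gamma> eq in "auto simp: graded_def intro!: reduced_var_power_mult reduced_add")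
 have key: "N \<le> plookup n 1 \<or> M \<le> plookup n 2" if "plookup \<alpha> n ~= 0" for n
 proof (rule ccontr)
  assume no: "\<not> ?thesis"
  have "plookup \<alpha> n = plookup (form_var 3 ^ L * \<alpha>) (n + psingle 3 L)"
   by (simp add: lookup_var_power_mult lookup_add)
  also have "\<dots> = 0" unfolding eq' lookup_add[of "form_var 1 ^ N * \<beta>"] lookup_var_power_mult
   using no by (simp add: lookup_add lookup_single)
  finally show False using that by simp
 qed
 obtain hi lo where h: "\<alpha> = form_var 1 ^ N * hi + lo"
  "!!m. plookup lo m = (if N \<le> plookup m 1 then 0 else plookup \<alpha> m)"
  "!!m. plookup hi m = plookup \<alpha> (m + psingle 1 N)" using split_by_power by blast
 obtain hi2 lo2 where h2: "lo = form_var 2 ^ M * hi2 + lo2"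
  "!!m. plookup lo2 m = (if M \<le> plookup m 2 then 0 else plookup lo m)"
  "!!m. plookup hi2 m = plookup lo (m + psingle 2 M)" using split_by_power by blast
 have "plookup lo2 m = 0" for m using key[of m] by (auto simp: h2(2) h(2))
 then have "lo2 = 0" by (intro poly_mapping_eqI) simp
 then have "\<alpha> = form_var 1 ^ N * hi + form_var 2 ^ M * hi2" using h(1) h2(1) by simp
 moreover have "graded (k - int N) hi" by (rule graded_high[OF \<alpha>(1) _ h(3)]) simp
 moreover have "graded (k - int M) hi2" by (rule graded_high[OF graded_low[OF \<alpha>(1) h(2)] _ h2(3)]) simp
 ultimately show ?thesis
  by (intro that[OF Reg_section_of Reg_section_of]) (simp_all add: \<alpha>(2))
qed

section \<open>Exactness of the Koszul complex of the gradient\<close>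

abbreviation dF :: "4 => complex ^ 4 => complex" where
 "dF i x \<equiv> peval (partial i F) x"

lemma homogeneous_dF: "homogeneous 3 (partial i F)"
 using homogeneous_partial[OF homogeneous_F, of i] by simp

lemma Reg_dF: "Reg 3 total (rst total (dF i))"
 by (rule Reg_total_form[OF homogeneous_dF]) simp

lemma euler_on_K: "x \<in> K ==> (\<Sum>i\<in>UNIV. x $ i * dF i x) = 0"
 using euler_identity[OF homogeneous_F, of x] by (simp add: K_def)

text \<open>The partial derivatives have no common zero besides the origin: at points off the cone, the relation of
  Euler and \<open>F \<noteq> 0\<close> provide a non-zero derivative.\<close>

lemma jacobian_power:
 obtains N g where "N \<ge> 3" "!!j. homogeneous (N - 3) (g j)"
  "!!x. (coords x $ i) ^ N = (\<Sum>j\<in>UNIV. peval (g j) x * dF j x)"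
proof -
 define I where "I = {f. \<exists>h. f = (\<Sum>j\<in>UNIV. h j * partial j F)}"
 have idl: "form_ideal I"
  unfolding form_ideal_def
 proof (intro conjI ballI allI)
  show "0 \<in> I" by (auto simp: I_def intro: exI[of _ "%_. 0"])
 next
  fix f g assume "f \<in> I" "g \<in> I"
  then obtain h h' where "f = (\<Sum>j\<in>UNIV. h j * partial j F)" "g = (\<Sum>j\<in>UNIV. h' j * partial j F)" by (auto simp: I_def)
  then show "f + g \<in> I" unfolding I_def by (intro CollectI exI[of _ "%j. h j + h' j"]) (simp add: distrib_right sum.distrib)
 next
  fix f g assume "f \<in> I"
  then obtain h where "f = (\<Sum>j\<in>UNIV. h j * partial j F)" by (auto simp: I_def)
  then show "g * f \<in> I" unfolding I_def by (intro CollectI exI[of _ "%j. g * h j"]) (simp add: sum_distrib_left mult.assoc)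
 qed
 have dI: "partial j F \<in> I" for j
  unfolding I_def by (intro CollectI exI[of _ "%i. if i = j then 1 else 0"]) (simp add: if_distrib[of "%a. a * _"] cong: if_cong)
 have zeros: "\<exists>f\<in>I. (\<exists>n. homogeneous n f) & peval f x ~= 0" if "x ~= 0" for x
 proof -
  have "\<exists>j. dF j x ~= 0"
  proof (rule ccontr)
   assume "\<nexists>j. dF j x ~= 0"
   then have "x \<in> K" using euler_identity[OF homogeneous_F, of x] that by (simp add: K_def)
   then show False using gradient_nonzero \<open>\<nexists>j. dF j x ~= 0\<close> by blast
  qed
  then show ?thesis using dI homogeneous_dF by blast
 qed
 obtain N0 where "coord_form i ^ N0 \<in> I"
  using projective_nullstellensatz[OF idl zeros homogeneous_coord_form] by blast
 then have "coord_form i ^ 3 * coord_form i ^ N0 \<in> I" by (rule form_idealD(3)[OF idl])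
 then obtain h where h: "coord_form i ^ (3 + N0) = (\<Sum>j\<in>UNIV. h j * partial j F)" by (auto simp: I_def power_add)
 have "homogeneous (3 + N0) (coord_form i ^ (3 + N0))"
  using homogeneous_power[OF homogeneous_coord_form, of "3 + N0" i] by simp
 then have "coord_form i ^ (3 + N0) = hcomp (3 + N0) (coord_form i ^ (3 + N0))" by (simp add: hcomp_homogeneous)
 also have "\<dots> = (\<Sum>j\<in>UNIV. hcomp N0 (h j) * partial j F)"
  unfolding h hcomp_sum hcomp_mult[OF homogeneous_dF] by simp
 finally have *: "coord_form i ^ (3 + N0) = (\<Sum>j\<in>UNIV. hcomp N0 (h j) * partial j F)" .
 show ?thesis
 proof (rule that[of "3 + N0" "%j. hcomp N0 (h j)"])
  fix x
  have "(coords x $ i) ^ (3 + N0) = peval (coord_form i ^ (3 + N0)) x" by (simp add: coords_def)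
  then show "(coords x $ i) ^ (3 + N0) = (\<Sum>j\<in>UNIV. peval (hcomp N0 (h j)) x * dF j x)"
   by (simp add: *)
 qed (simp_all add: homogeneous_hcomp)
qed

lemma Reg_mult_total: "Reg k total s ==> Reg l total t ==> j = k + l ==> Reg j total (%x. s x * t x)"
 by (rule Reg_mult[OF openX_total])

lemma Reg_cancel_power:
 assumes i: "i ~= 4" and s: "Reg k total s" and z: "!!x. x \<in> K ==> (coords x $ i) ^ N * s x = 0" and x: "x \<in> K"
 shows "s x = 0"
proof -
 obtain c where c: "s = section_of c" using s global_section_polynomial by blast
 have "peval (subst_form c coord_form) x = 0"
  by (rule cancel_power[OF i _ x]) (use z in "simp add: c peval_coords")
 then show ?thesis using x by (simp add: c peval_coords)
qed

text \<open>A power \<open>y\<close> of a coordinate lies in the Jacobian ideal, \<open>y = \<Sum> g\<^sub>j \<partial>\<^sub>j F\<close>; contraction with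
  \<open>g\<close> therefore solves \<open>y w = u dF\<close>. Doing this for two powers that form a regular sequence removes
  the factor.\<close>

lemma koszul_exact_1:
 assumes w: "!!i. Reg n total (w i)"
  and wF: "!!i j x. x \<in> K ==> w i x * dF j x = w j x * dF i x"
 obtains u where "Reg (n - 3) total u" "!!i x. x \<in> K ==> w i x = u x * dF i x"
proof -
 obtain N g where g: "N \<ge> 3" "!!j. homogeneous (N - 3) (g j)"
  "!!x. (coords x $ 1) ^ N = (\<Sum>j\<in>UNIV. peval (g j) x * dF j x)" using jacobian_power by blast
 obtain M h where h: "M \<ge> 3" "!!j. homogeneous (M - 3) (h j)"
  "!!x. (coords x $ 2) ^ M = (\<Sum>j\<in>UNIV. peval (h j) x * dF j x)" using jacobian_power by blast
 define a where "a = (%x. \<Sum>j\<in>UNIV. rst total (peval (g j)) x * w j x)"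
 define b where "b = (%x. \<Sum>j\<in>UNIV. rst total (peval (h j)) x * w j x)"
 have a: "Reg (int N - 3 + n) total a" unfolding a_def
  using g(1) by (intro Reg_sum[OF openX_total] Reg_mult_total[OF Reg_total_form[OF g(2)] w]) auto
 have b: "Reg (int M - 3 + n) total b" unfolding b_def
  using h(1) by (intro Reg_sum[OF openX_total] Reg_mult_total[OF Reg_total_form[OF h(2)] w]) auto
 have ya: "(coords x $ 1) ^ N * w i x = a x * dF i x" if "x \<in> K" for i x
  unfolding g(3) a_def sum_distrib_right using that wF[OF that, of i] by (intro sum.cong) (auto simp: mult_ac)
 have zb: "(coords x $ 2) ^ M * w i x = b x * dF i x" if "x \<in> K" for i x
  unfolding h(3) b_def sum_distrib_right using that wF[OF that, of i] by (intro sum.cong) (auto simp: mult_ac)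
 have "(coords x $ 2) ^ M * a x = (coords x $ 1) ^ N * b x" if x: "x \<in> K" for x
 proof -
  obtain i where i: "dF i x ~= 0" using gradient_nonzero[OF x] by blast
  have "(coords x $ 2) ^ M * a x * dF i x = (coords x $ 1) ^ N * b x * dF i x"
   unfolding mult.assoc ya[OF x, of i, symmetric] zb[OF x, of i, symmetric] by (rule mult.left_commute)
  then show ?thesis using i by simp
 qed
 from regular_pair[OF _ _ _ a b this] obtain u where
  u: "Reg (int N - 3 + n - int N) total u" "!!x. x \<in> K ==> a x = (coords x $ 1) ^ N * u x" by auto
 have "w i x = u x * dF i x" if x: "x \<in> K" for i x
 proof -
  have "Reg n total (%x. w i x - u x * rst total (dF i) x)"
   using u(1) by (intro Reg_diff[OF openX_total w] Reg_mult_total[OF _ Reg_dF]) auto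
  then have "w i x - u x * rst total (dF i) x = 0"
   by (rule Reg_cancel_power[where i = 1 and N = N, rotated]) (use x ya u(2) in "auto simp: algebra_simps")
  then show ?thesis using x by simp
 qed
 then show ?thesis using that u(1) by auto
qed

text \<open>The same idea in the next degree: three powers of coordinates give three contractions, whose
  differences are multiples of \<open>dF\<close>, and the relation between these multiples is resolved with the
  regular sequence of length three.\<close>

lemma koszul_exact_2:
 assumes \<eta>: "!!i j. Reg n total (\<eta> i j)"
  and anti: "!!i j x. x \<in> K ==> \<eta> i j x = - \<eta> j i x"
  and cyc: "!!i j l x. x \<in> K ==> dF i x * \<eta> j l x + dF j x * \<eta> l i x + dF l x * \<eta> i j x = 0"
 obtains w where "!!i. Reg (n - 3) total (w i)" "!!i j x. x \<in> K ==> \<eta> i j x = w i x * dF j x - w j x * dF i x"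
proof -
 have contract: "\<exists>N a. N \<ge> 3 & (\<forall>i. Reg (int N - 3 + n) total (a i)) &
   (\<forall>x\<in>K. \<forall>i j. (coords x $ q) ^ N * \<eta> i j x = a i x * dF j x - a j x * dF i x)" for q
 proof -
  obtain N g where g: "N \<ge> 3" "!!j. homogeneous (N - 3) (g j)"
   "!!x. (coords x $ q) ^ N = (\<Sum>j\<in>UNIV. peval (g j) x * dF j x)" using jacobian_power by blast
  define a where "a i = (%x. \<Sum>m\<in>UNIV. rst total (peval (g m)) x * \<eta> i m x)" for i
  have "Reg (int N - 3 + n) total (a i)" for i unfolding a_def
   using g(1) by (intro Reg_sum[OF openX_total] Reg_mult_total[OF Reg_total_form[OF g(2)] \<eta>]) auto
  moreover have "(coords x $ q) ^ N * \<eta> i j x = a i x * dF j x - a j x * dF i x" if x: "x \<in> K" for x i j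
  proof -
   have "peval (g m) x * dF m x * \<eta> i j x = peval (g m) x * \<eta> i m x * dF j x - peval (g m) x * \<eta> j m x * dF i x" for m
   proof -
    have "dF m x * \<eta> i j x = dF j x * \<eta> i m x - dF i x * \<eta> j m x"
     using cyc[OF x, of m i j] anti[OF x, of m i] by (simp add: algebra_simps eq_neg_iff_add_eq_0)
    then show ?thesis by (simp only: mult.assoc flip: right_diff_distrib) (simp add: mult.commute)
   qed
   then show ?thesis unfolding g(3) a_def using x
    by (simp add: sum_distrib_right flip: sum_subtractf)
  qed
  ultimately show ?thesis using g(1) by blast
 qed
 obtain N a where a: "N \<ge> 3" "!!i. Reg (int N - 3 + n) total (a i)"
   "!!x i j. x \<in> K ==> (coords x $ 1) ^ N * \<eta> i j x = a i x * dF j x - a j x * dF i x" using contract[of 1] by blast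
 obtain M b where b: "M \<ge> 3" "!!i. Reg (int M - 3 + n) total (b i)"
   "!!x i j. x \<in> K ==> (coords x $ 2) ^ M * \<eta> i j x = b i x * dF j x - b j x * dF i x" using contract[of 2] by blast
 obtain L c where c: "L \<ge> 3" "!!i. Reg (int L - 3 + n) total (c i)"
   "!!x i j. x \<in> K ==> (coords x $ 3) ^ L * \<eta> i j x = c i x * dF j x - c j x * dF i x" using contract[of 3] by blast
 have difference: "\<exists>u. Reg (int N1 + int N2 + n - 6) total u & (\<forall>x\<in>K. \<forall>i. (coords x $ q2) ^ N2 * a1 i x - (coords x $ q1) ^ N1 * a2 i x = u x * dF i x)"
  if a1: "!!i. Reg (int N1 - 3 + n) total (a1 i)" "!!x i j. x \<in> K ==> (coords x $ q1) ^ N1 * \<eta> i j x = a1 i x * dF j x - a1 j x * dF i x"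
  and a2: "!!i. Reg (int N2 - 3 + n) total (a2 i)" "!!x i j. x \<in> K ==> (coords x $ q2) ^ N2 * \<eta> i j x = a2 i x * dF j x - a2 j x * dF i x"
  for q1 q2 N1 N2 a1 a2
 proof -
  let ?p = "%q N. rst total (peval (coord_form q ^ N))"
  have hp: "Reg (int N) total (?p q N)" for q N
   using Reg_total_form[OF homogeneous_power[OF homogeneous_coord_form, of N q]] by simp
  have pe: "?p q N x = (coords x $ q) ^ N" if "x \<in> K" for q N x using that by (simp add: coords_def)
  define v where "v i = (%x. ?p q2 N2 x * a1 i x - ?p q1 N1 x * a2 i x)" for i
  have "Reg (int N1 + int N2 + n - 3) total (v i)" for i
   unfolding v_def by (intro Reg_diff[OF openX_total] Reg_mult_total[OF hp a1(1)] Reg_mult_total[OF hp a2(1)]) auto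
  moreover have "v i x * dF j x = v j x * dF i x" if x: "x \<in> K" for i j x
  proof -
   have "v i x * dF j x - v j x * dF i x = (coords x $ q2) ^ N2 * (a1 i x * dF j x - a1 j x * dF i x)
     - (coords x $ q1) ^ N1 * (a2 i x * dF j x - a2 j x * dF i x)"
    unfolding v_def pe[OF x] by (simp add: algebra_simps)
   also have "\<dots> = 0" unfolding a1(2)[OF x, symmetric] a2(2)[OF x, symmetric] by simp
   finally show ?thesis by simp
  qed
  ultimately obtain u where u: "Reg (int N1 + int N2 + n - 3 - 3) total u" "!!i x. x \<in> K ==> v i x = u x * dF i x"
   using koszul_exact_1 by blast
  have deg: "int N1 + int N2 + n - 3 - 3 = int N1 + int N2 + n - 6" by simp
  have "(coords x $ q2) ^ N2 * a1 i x - (coords x $ q1) ^ N1 * a2 i x = u x * dF i x" if "x \<in> K" for x i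
   using u(2)[OF that, of i] unfolding v_def pe[OF that] .
  then show ?thesis using u(1) unfolding deg by blast
 qed
 obtain u where u: "Reg (int N + int M + n - 6) total u" "!!x i. x \<in> K ==> (coords x $ 2) ^ M * a i x - (coords x $ 1) ^ N * b i x = u x * dF i x"
  using difference[OF a(2,3) b(2,3)] by blast
 obtain u' where u': "Reg (int N + int L + n - 6) total u'" "!!x i. x \<in> K ==> (coords x $ 3) ^ L * a i x - (coords x $ 1) ^ N * c i x = u' x * dF i x"
  using difference[OF a(2,3) c(2,3)] by blast
 obtain u'' where u'': "Reg (int M + int L + n - 6) total u''" "!!x i. x \<in> K ==> (coords x $ 3) ^ L * b i x - (coords x $ 2) ^ M * c i x = u'' x * dF i x"
  using difference[OF b(2,3) c(2,3)] by blast
 have rel: "(coords x $ 3) ^ L * u x = (coords x $ 1) ^ N * (- u'' x) + (coords x $ 2) ^ M * u' x" if x: "x \<in> K" for x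
 proof -
  obtain i where i: "dF i x ~= 0" using gradient_nonzero[OF x] by blast
  have "((coords x $ 3) ^ L * u x + (coords x $ 1) ^ N * u'' x - (coords x $ 2) ^ M * u' x) * dF i x
   = (coords x $ 3) ^ L * (u x * dF i x) + (coords x $ 1) ^ N * (u'' x * dF i x) - (coords x $ 2) ^ M * (u' x * dF i x)"
   by (simp add: algebra_simps)
  also have "\<dots> = 0" unfolding u(2)[OF x, symmetric] u'(2)[OF x, symmetric] u''(2)[OF x, symmetric]
   by (simp add: algebra_simps)
  finally have "(coords x $ 3) ^ L * u x + (coords x $ 1) ^ N * u'' x - (coords x $ 2) ^ M * u' x = 0"
   using i by (simp only: mult_eq_0_iff) simp
  then show ?thesis by (simp add: algebra_simps)
 qed
 obtain p q where pq: "Reg (int N + int M + n - 6 - int N) total p" "Reg (int N + int M + n - 6 - int M) total q"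
  "!!x. x \<in> K ==> u x = (coords x $ 1) ^ N * p x + (coords x $ 2) ^ M * q x"
  using regular_triple[OF u(1) Reg_uminus[OF openX_total u''(1)] u'(1) rel] by blast
 have "\<exists>w. Reg (n - 3) total w & (\<forall>x\<in>K. a i x - q x * dF i x = (coords x $ 1) ^ N * w x)" for i
 proof -
  have r1: "Reg (int N - 3 + n) total (%x. a i x - q x * rst total (dF i) x)"
   using pq(2) by (intro Reg_diff[OF openX_total a(2)] Reg_mult_total[OF _ Reg_dF]) auto
  have r2: "Reg (int M - 3 + n) total (%x. b i x + p x * rst total (dF i) x)"
   using pq(1) by (intro Reg_add[OF openX_total b(2)] Reg_mult_total[OF _ Reg_dF]) auto
  have "(coords x $ 2) ^ M * (a i x - q x * rst total (dF i) x) = (coords x $ 1) ^ N * (b i x + p x * rst total (dF i) x)" if x: "x \<in> K" for x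
   using u(2)[OF x, of i] x unfolding pq(3)[OF x] by (simp add: algebra_simps)
  from regular_pair[OF _ _ _ r1 r2 this] obtain w where
   "Reg (int N - 3 + n - int N) total w" "!!x. x \<in> K ==> a i x - q x * rst total (dF i) x = (coords x $ 1) ^ N * w x" by auto
  then show ?thesis by (intro exI[of _ w]) auto
 qed
 then obtain w where w: "!!i. Reg (n - 3) total (w i)" "!!i x. x \<in> K ==> a i x = (coords x $ 1) ^ N * w i x + q x * dF i x"
  by (metis add.commute diff_add_cancel)
 have "\<eta> i j x = w i x * dF j x - w j x * dF i x" if x: "x \<in> K" for i j x
 proof -
  have wd: "Reg n total (%x. w i x * rst total (dF j) x)" for i j by (rule Reg_mult_total[OF w(1) Reg_dF]) simp
  have "Reg n total (%x. \<eta> i j x - (w i x * rst total (dF j) x - w j x * rst total (dF i) x))"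
   by (intro Reg_diff[OF openX_total] \<eta> wd)
  then have "\<eta> i j x - (w i x * rst total (dF j) x - w j x * rst total (dF i) x) = 0"
  proof (rule Reg_cancel_power[where i = 1 and N = N, rotated])
   fix x assume x: "x \<in> K"
   show "(coords x $ 1) ^ N * (\<eta> i j x - (w i x * rst total (dF j) x - w j x * rst total (dF i) x)) = 0"
    using a(3)[OF x, of i j] x unfolding w(2)[OF x] by (simp add: algebra_simps)
  qed (use x in auto)
  then show ?thesis using x by simp
 qed
 then show ?thesis using that w(1) by blast
qed

end

section \<open>Dimensions of spaces of functions\<close>

lemma field_complex_field: "field complex_field"
proof -
 have "cring complex_field"
 proof (rule cringI)
  show "abelian_group complex_field"
  proof (rule abelian_groupI)
   fix x assume "x \<in> carrier complex_field"
   then show "\<exists>y\<in>carrier complex_field. y \<oplus>\<^bsub>complex_field\<^esub> x = \<zero>\<^bsub>complex_field\<^esub>"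
    by (intro bexI[of _ "- x"]) (auto simp: complex_field_def)
  qed (auto simp: complex_field_def)
  show "Group.comm_monoid complex_field"
   by (rule comm_monoidI) (auto simp: complex_field_def)
 qed (auto simp: complex_field_def algebra_simps)
 then show ?thesis
 proof (rule cring.cring_fieldI)
  show "Units complex_field = carrier complex_field - {\<zero>\<^bsub>complex_field\<^esub>}"
  proof (intro equalityI subsetI)
   fix x assume "x \<in> carrier complex_field - {\<zero>\<^bsub>complex_field\<^esub>}"
   then show "x \<in> Units complex_field"
    by (auto simp: Units_def complex_field_def intro!: exI[of _ "inverse x"])
  qed (auto simp: Units_def complex_field_def)
 qed
qed

lemma complex_field_simps [simp]:
 "carrier complex_field = UNIV" "a \<otimes>\<^bsub>complex_field\<^esub> b = a * b" "\<one>\<^bsub>complex_field\<^esub> = 1"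
 "\<zero>\<^bsub>complex_field\<^esub> = 0" "a \<oplus>\<^bsub>complex_field\<^esub> b = a + b"
 by (simp_all add: complex_field_def)

definition fspace :: "('j => complex) set => (complex, 'j => complex) module" where
 "fspace W = \<lparr>carrier = W, mult = (%f g j. f j * g j), one = (%j. 1), zero = (%j. 0),
   add = (%f g j. f j + g j), smult = (%c f j. c * f j)\<rparr>"

lemma fspace_simps [simp]:
 "carrier (fspace W) = W" "\<zero>\<^bsub>fspace W\<^esub> = (%j. 0)"
 "f \<oplus>\<^bsub>fspace W\<^esub> g = (%j. f j + g j)" "c \<odot>\<^bsub>fspace W\<^esub> f = (%j. c * f j)"
 "(fspace W)\<lparr>carrier := V\<rparr> = fspace V"
 by (simp_all add: fspace_def)

definition linear_subspace :: "('j => complex) set => bool" where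
 "linear_subspace W \<longleftrightarrow> (%j. 0) \<in> W & (\<forall>f\<in>W. \<forall>g\<in>W. (%j. f j + g j) \<in> W) & (\<forall>c. \<forall>f\<in>W. (%j. c * f j) \<in> W)"

lemma linear_subspaceD:
 assumes "linear_subspace W"
 shows "(%j. 0) \<in> W" "f \<in> W ==> g \<in> W ==> (%j. f j + g j) \<in> W" "f \<in> W ==> (%j. c * f j) \<in> W"
 using assms by (auto simp: linear_subspace_def)

lemma vectorspace_fspace:
 assumes "linear_subspace W" shows "vectorspace complex_field (fspace W)"
proof (rule vs_criteria[OF field_complex_field])
 show "\<forall>v\<in>carrier (fspace W). \<exists>w\<in>carrier (fspace W). v \<oplus>\<^bsub>fspace W\<^esub> w = \<zero>\<^bsub>fspace W\<^esub>"
 proof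
  fix v assume "v \<in> carrier (fspace W)"
  then have "(%j. - 1 * v j) \<in> W" using linear_subspaceD(3)[OF assms] by (simp only: fspace_simps)
  then show "\<exists>w\<in>carrier (fspace W). v \<oplus>\<^bsub>fspace W\<^esub> w = \<zero>\<^bsub>fspace W\<^esub>"
   by (intro bexI[of _ "%j. - 1 * v j"]) auto
 qed
qed (use linear_subspaceD[OF assms] in "auto simp: algebra_simps")

definition has_dim :: "('j => complex) set => nat => bool" where
 "has_dim W n \<longleftrightarrow> linear_subspace W & vectorspace.fin_dim complex_field (fspace W) &
   vectorspace.dim complex_field (fspace W) = n"

definition linear_on :: "('i => complex) set => (('i => complex) => 'j => complex) => bool" where
 "linear_on V T \<longleftrightarrow> (\<forall>f\<in>V. \<forall>g\<in>V. \<forall>j. T (%i. f i + g i) j = T f j + T g j) & (\<forall>c. \<forall>f\<in>V. \<forall>j. T (%i. c * f i) j = c * T f j)"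

lemma linear_onI:
 "(!!f g j. f \<in> V ==> g \<in> V ==> T (%i. f i + g i) j = T f j + T g j) ==>
  (!!c f j. f \<in> V ==> T (%i. c * f i) j = c * T f j) ==> linear_on V T"
 by (auto simp: linear_on_def)

lemma linear_on_zero:
 assumes V: "linear_subspace V" and T: "linear_on V T" shows "T (%i. 0) j = 0"
proof -
 have "T (%i. c * f i) j = c * T f j" if "f \<in> V" for c f using T that by (simp add: linear_on_def)
 from this[OF linear_subspaceD(1)[OF V], of 0] show ?thesis by simp
qed

lemma linear_subspace_image:
 assumes V: "linear_subspace V" and T: "linear_on V T" shows "linear_subspace (T ` V)"
 unfolding linear_subspace_def
proof (intro conjI ballI allI)
 have "T (%i. 0) = (%j. 0)" using linear_on_zero[OF V T] by (rule ext)
 then show "(%j. 0) \<in> T ` V" using linear_subspaceD(1)[OF V] by (rule image_eqI[OF sym])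
next
 fix f g assume "f \<in> T ` V" "g \<in> T ` V"
 then obtain a b where ab: "a \<in> V" "b \<in> V" "f = T a" "g = T b" by blast
 then have "(%j. f j + g j) = T (%i. a i + b i)" using T by (auto simp: linear_on_def)
 then show "(%j. f j + g j) \<in> T ` V" using linear_subspaceD(2)[OF V] ab by auto
next
 fix c f assume "f \<in> T ` V"
 then obtain a where a: "a \<in> V" "f = T a" by blast
 then have "(%j. c * f j) = T (%i. c * a i)" using T by (auto simp: linear_on_def)
 then show "(%j. c * f j) \<in> T ` V" using linear_subspaceD(3)[OF V] a by auto
qed

lemma linear_map_fspace:
 assumes V: "linear_subspace V" and W: "linear_subspace W" and T: "linear_on V T" "!!f. f \<in> V ==> T f \<in> W"
 shows "linear_map complex_field (fspace V) (fspace W) T"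
proof -
 interpret V: vectorspace complex_field "fspace V" by (rule vectorspace_fspace[OF V])
 interpret W: vectorspace complex_field "fspace W" by (rule vectorspace_fspace[OF W])
 have "T \<in> LinearCombinations.module_hom complex_field (fspace V) (fspace W)"
  using T by (auto simp: module_hom_def linear_on_def)
 then show ?thesis
  by (intro linear_map.intro mod_hom.intro mod_hom_axioms.intro V.vectorspace_axioms W.vectorspace_axioms V.module_axioms W.module_axioms)
qed

text \<open>A linearly independent subset of maximal size of a subspace spans it.\<close>

lemma has_dim_subspace:
 assumes V: "has_dim V n" and W: "linear_subspace W" "W \<subseteq> V"
 shows "\<exists>m. has_dim W m"
proof -
 have V': "linear_subspace V" "vectorspace.fin_dim complex_field (fspace V)" using V by (auto simp: has_dim_def)
 interpret V: vectorspace complex_field "fspace V" by (rule vectorspace_fspace[OF V'(1)])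
 interpret W: vectorspace complex_field "fspace W" by (rule vectorspace_fspace[OF W(1)])
 have sub: "submodule complex_field W (fspace V)"
  using V.module_axioms W linear_subspaceD[OF W(1)] by (auto simp: submodule_def)
 have bound: "finite A & card A \<le> V.dim" if "A \<subseteq> W" "W.lin_indpt A" for A
 proof -
  have "V.lin_indpt A" using V.span_li_not_depend(2)[OF that(1) sub] that(2) by simp
  then show ?thesis using V.li_le_dim[OF V'(2)] that(1) W(2) by auto
 qed
 have "W.lin_indpt {}" by (simp add: W.lin_dep_def)
 then have "\<exists>A. finite A & maximal A (%S. S \<subseteq> carrier (fspace W) & W.lin_indpt S)"
  by (intro maximal_exists[where B = "{}" and N = V.dim]) (use bound in auto)
 then obtain A where A: "finite A" "maximal A (%S. S \<subseteq> carrier (fspace W) & W.lin_indpt S)" by blast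
 then have "W.basis A" using W.max_li_is_basis by blast
 then have "W.fin_dim" using A(1) by (auto simp: W.fin_dim_def W.basis_def)
 then show ?thesis using W(1) by (auto simp: has_dim_def)
qed

lemma linear_subspace_kernel:
 assumes V: "linear_subspace V" and T: "linear_on V T" shows "linear_subspace {f \<in> V. \<forall>j. T f j = 0}"
 using T linear_subspaceD[OF V] linear_on_zero[OF V T] by (auto simp: linear_subspace_def linear_on_def)

lemma rank_nullity_spaces:
 assumes V: "has_dim V n" and T: "linear_on V T"
 shows "\<exists>a b. has_dim (T ` V) a & has_dim {f \<in> V. \<forall>j. T f j = 0} b & a + b = n"
proof -
 have V': "linear_subspace V" "vectorspace.fin_dim complex_field (fspace V)" using V by (auto simp: has_dim_def)
 note W = linear_subspace_image[OF V'(1) T]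
 interpret L: linear_map complex_field "fspace V" "fspace (T ` V)" T
  by (rule linear_map_fspace[OF V'(1) W T]) auto
 have im: "L.im = T ` V" by (simp add: L.im_def)
 have ker: "L.ker = {f \<in> V. \<forall>j. T f j = 0}" by (auto simp: L.ker_def)
 have "L.W.fin_dim" by (rule L.surj_fin_dim[OF V'(2)]) simp
 then have 1: "has_dim (T ` V) L.W.dim" using W by (simp add: has_dim_def)
 obtain b where b: "has_dim {f \<in> V. \<forall>j. T f j = 0} b"
  using has_dim_subspace[OF V linear_subspace_kernel[OF V'(1) T]] by auto
 have "L.W.dim + b = n"
  using L.rank_nullity[OF V'(2)] V b unfolding im ker by (simp add: has_dim_def)
 then show ?thesis using 1 b by blast
qed

lemma has_dim_unique: "has_dim W a ==> has_dim W b ==> a = b"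
 by (simp add: has_dim_def)

text \<open>Functions supported on a finite set, with the indicator functions as basis.\<close>

lemma has_dim_supported:
 assumes M: "finite M"
 shows "has_dim {f. \<forall>m. m \<notin> M --> f m = 0} (card M)"
proof -
 define W where "W = {f. \<forall>m. m \<notin> M --> f m = (0::complex)}"
 have W: "linear_subspace W" by (auto simp: W_def linear_subspace_def)
 interpret W: vectorspace complex_field "fspace W" by (rule vectorspace_fspace[OF W])
 define delta where "delta m = (%k. if k = m then 1 else (0::complex))" for m :: 'a
 have inj: "inj delta" by (auto simp: inj_def delta_def fun_eq_iff split: if_splits)
 define B where "B = delta ` M"
 have BW: "B \<subseteq> W" by (auto simp: B_def W_def delta_def)
 have sum: "W.lincomb a (delta ` T) = (%k. if k \<in> T then a (delta k) else 0)" if "finite T" "T \<subseteq> M" for a T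
  using that
 proof (induction T rule: finite_induct)
  case empty
  show ?case by (simp add: W.lincomb_def)
 next
  case (insert m T)
  have "W.lincomb a (insert (delta m) (delta ` T)) = (a (delta m) \<odot>\<^bsub>fspace W\<^esub> delta m) \<oplus>\<^bsub>fspace W\<^esub> W.lincomb a (delta ` T)"
   by (rule W.lincomb_insert2) (use insert BW inj in "auto simp: inj_eq B_def")
  then show ?case using insert by (auto simp: delta_def fun_eq_iff)
 qed
 have "W.basis B"
 proof (subst W.basis_criterion)
  show "\<forall>v. v \<in> carrier (fspace W) --> (\<exists>!a. a \<in> B \<rightarrow>\<^sub>E carrier complex_field & W.lincomb a B = v)"
  proof (intro allI impI)
   fix v assume v: "v \<in> carrier (fspace W)"
   let ?a = "restrict (%b. v (inv_into UNIV delta b)) B"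
   show "\<exists>!a. a \<in> B \<rightarrow>\<^sub>E carrier complex_field & W.lincomb a B = v"
   proof (rule ex1I[of _ ?a])
    show "?a \<in> B \<rightarrow>\<^sub>E carrier complex_field & W.lincomb ?a B = v"
    proof
     have "W.lincomb ?a B = (%k. if k \<in> M then ?a (delta k) else 0)" unfolding B_def by (rule sum[OF M subset_refl])
     also have "\<dots> = v" using v inj by (auto simp: B_def W_def fun_eq_iff)
     finally show "W.lincomb ?a B = v" .
    qed auto
    fix a assume a: "a \<in> B \<rightarrow>\<^sub>E carrier complex_field & W.lincomb a B = v"
    show "a = ?a"
    proof
     fix b
     show "a b = ?a b"
     proof (cases "b \<in> B")
      case True
      then obtain m where "m \<in> M" "b = delta m" unfolding B_def by blast
      moreover have "W.lincomb a (delta ` M) m = v m" using a by (simp add: B_def)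
      ultimately show ?thesis using inj by (simp add: sum[OF M subset_refl] B_def)
     next
      case False
      then show ?thesis using a by (auto simp: PiE_def extensional_def)
     qed
    qed
   qed
  qed
 qed (use M BW in "auto simp: B_def")
 then have "W.fin_dim" "W.dim = card B"
  using M W.dim_basis[of B] by (auto simp: W.fin_dim_def W.basis_def B_def)
 moreover have "card B = card M" unfolding B_def by (rule card_image) (use inj in "auto simp: inj_on_def inj_def")
 ultimately show ?thesis using W unfolding has_dim_def W_def by simp
qed

lemma has_dim_zero: "has_dim {(%j. 0) :: 'j => complex} 0"
proof -
 have "{f :: 'j => complex. \<forall>m. m \<notin> {} --> f m = 0} = {%j. 0}" by auto
 then show ?thesis using has_dim_supported[of "{} :: 'j set"] by simp
qed

lemma has_dim_iso:
 assumes V: "has_dim V n" and T: "linear_on V T" and inj: "!!f. f \<in> V ==> (\<forall>j. T f j = 0) ==> f = (%i. 0)"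
  and W: "T ` V = W"
 shows "has_dim W n"
proof -
 obtain a b where ab: "has_dim (T ` V) a" "has_dim {f \<in> V. \<forall>j. T f j = 0} b" "a + b = n"
  using rank_nullity_spaces[OF V T] by blast
 have "(%j. 0) \<in> {f \<in> V. \<forall>j. T f j = 0}" using ab(2) unfolding has_dim_def linear_subspace_def by blast
 then have "{f \<in> V. \<forall>j. T f j = 0} = {%j. 0}" using inj by blast
 then have "b = 0" using ab(2) has_dim_zero has_dim_unique by metis
 then show ?thesis using ab W by simp
qed

text \<open>Transport of structure: a module that a bijection identifies with a space of functions is a
  vector space of the same dimension.\<close>

lemma vectorspace_transport:
 fixes H :: "(complex, 'm) module"
 assumes W: "has_dim W n"
  and inj: "inj_on \<phi> (carrier H)" and im: "\<phi> ` carrier H = W"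
  and closed: "!!a b. a \<in> carrier H ==> b \<in> carrier H ==> a \<oplus>\<^bsub>H\<^esub> b \<in> carrier H" "\<zero>\<^bsub>H\<^esub> \<in> carrier H"
   "!!c a. a \<in> carrier H ==> c \<odot>\<^bsub>H\<^esub> a \<in> carrier H"
  and hom: "!!a b. a \<in> carrier H ==> b \<in> carrier H ==> \<phi> (a \<oplus>\<^bsub>H\<^esub> b) = (%j. \<phi> a j + \<phi> b j)" "\<phi> \<zero>\<^bsub>H\<^esub> = (%j. 0)"
   "!!c a. a \<in> carrier H ==> \<phi> (c \<odot>\<^bsub>H\<^esub> a) = (%j. c * \<phi> a j)"
 shows "fin_dim_space H" "vectorspace.dim complex_field H = n"
proof -
 have eqI: "a = b" if "a \<in> carrier H" "b \<in> carrier H" "\<phi> a = \<phi> b" for a b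
  using inj that by (auto simp: inj_on_def)
 have W': "linear_subspace W" "vectorspace.fin_dim complex_field (fspace W)" using W by (auto simp: has_dim_def)
 have H: "vectorspace complex_field H"
 proof (rule vs_criteria[OF field_complex_field])
  show "\<forall>v\<in>carrier H. \<exists>w\<in>carrier H. v \<oplus>\<^bsub>H\<^esub> w = \<zero>\<^bsub>H\<^esub>"
  proof
   fix v assume v: "v \<in> carrier H"
   then have "v \<oplus>\<^bsub>H\<^esub> (-1) \<odot>\<^bsub>H\<^esub> v = \<zero>\<^bsub>H\<^esub>" by (intro eqI) (auto simp: closed hom)
   then show "\<exists>w\<in>carrier H. v \<oplus>\<^bsub>H\<^esub> w = \<zero>\<^bsub>H\<^esub>" using closed(3)[OF v] by blast
  qed
 qed (auto intro!: eqI simp: closed hom algebra_simps)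
 interpret V: vectorspace complex_field "fspace W" by (rule vectorspace_fspace[OF W'(1)])
 interpret H: vectorspace complex_field H by (rule H)
 define \<psi> where "\<psi> = inv_into (carrier H) \<phi>"
 have \<psi>: "\<psi> f \<in> carrier H" "\<phi> (\<psi> f) = f" if "f \<in> W" for f
  using that im by (auto simp: \<psi>_def inv_into_into f_inv_into_f)
 have "\<psi> \<in> LinearCombinations.module_hom complex_field (fspace W) H"
  unfolding module_hom_def
  using \<psi> linear_subspaceD[OF W'(1)] by (auto intro!: eqI simp: closed hom)
 then interpret L: linear_map complex_field "fspace W" H \<psi>
  by (intro linear_map.intro mod_hom.intro mod_hom_axioms.intro V.vectorspace_axioms H.vectorspace_axioms V.module_axioms H.module_axioms)
 have surj: "\<psi> ` carrier (fspace W) = carrier H"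
  using \<psi> im inj by (auto simp: \<psi>_def inv_into_f_f image_iff intro!: bexI)
 have inj': "inj_on \<psi> (carrier (fspace W))" by (rule inj_onI) (metis \<psi>(2) fspace_simps(1))
 show "fin_dim_space H" using H L.surj_fin_dim[OF W'(2) surj] by (simp add: fin_dim_space_def)
 show "vectorspace.dim complex_field H = n" using L.dim_eq[OF W'(2) inj' surj] W by (simp add: has_dim_def)
qed

section \<open>The dimension of the space of twisted differentials\<close>

text \<open>The conditions on an alternating matrix to be of the form \<open>w \<and> v\<close> with \<open>w\<close> orthogonal to \<open>u\<close>.\<close>

definition wedge_cond :: "complex ^ 4 => complex ^ 4 => (4 => 4 => complex) => bool" where
 "wedge_cond u v M \<longleftrightarrow> (\<forall>i j. M i j = - M j i) & (\<forall>l. (\<Sum>i\<in>UNIV. u $ i * M i l) = 0) &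
   (\<forall>i j l. v $ i * M j l + v $ j * M l i + v $ l * M i j = 0)"

lemma wedge_condD:
 assumes "wedge_cond u v M"
 shows "M i j = - M j i" "(\<Sum>i\<in>UNIV. u $ i * M i l) = 0" "v $ i * M j l + v $ j * M l i + v $ l * M i j = 0"
 using assms unfolding wedge_cond_def by blast+

context smooth_quartic
begin

definition grad :: "complex ^ 4 => complex ^ 4" where
 "grad x = (\<chi> i. dF i x)"

text \<open>A differential \<open>\<omega>\<close> on the surface with values in \<open>\<O>(k)\<close> is encoded by \<open>\<omega> \<and> dF\<close> on the cone.\<close>

definition wedge_forms :: "int => point set => ((complex ^ 4) \<times> 4 \<times> 4 => complex) set" where
 "wedge_forms k U = {\<eta>. (\<forall>i j. Reg (k + 2) U (%x. \<eta> (x, i, j))) &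
   (\<forall>x\<in>over U. wedge_cond x (grad x) (%i j. \<eta> (x, i, j)))}"

definition exponents :: "int => (4 \<Rightarrow>\<^sub>0 nat) set" where
 "exponents k = {m. plookup m 4 < 4 & int (mon_degree m) = k}"

lemma finite_exponents: "finite (exponents k)"
 by (rule finite_subset[OF _ finite_mon_degree_le[of "nat k"]]) (auto simp: exponents_def)

definition form_of_coeffs :: "int => ((4 \<Rightarrow>\<^sub>0 nat) => complex) => form" where
 "form_of_coeffs k f = (\<Sum>m\<in>exponents k. psingle m (f m))"

lemma lookup_form_of_coeffs: "plookup (form_of_coeffs k f) m = (if m \<in> exponents k then f m else 0)"
 by (auto simp: form_of_coeffs_def lookup_sum lookup_single when_def finite_exponents)

lemma graded_form_of_coeffs: "graded k (form_of_coeffs k f)"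
 by (auto simp: graded_def reduced_def lookup_form_of_coeffs exponents_def split: if_splits)

lemma form_of_coeffs_lookup: "graded k c ==> form_of_coeffs k (plookup c) = c"
 by (rule poly_mapping_eqI) (auto simp: lookup_form_of_coeffs exponents_def graded_def reduced_def)

lemma section_of_coeffs: "section_of (form_of_coeffs k f) = rst total (%x. \<Sum>m\<in>exponents k. f m * mon_eval m (coords x))"
 by (simp add: section_of_def form_of_coeffs_def rst_def fun_eq_iff)

lemma has_dim_sections_power:
 fixes I :: "'i::finite itself"
 shows "has_dim {w :: 'i \<times> (complex ^ 4) => complex. \<forall>i. Reg k total (%x. w (i, x))} (CARD('i) * card (exponents k))"
proof -
 let ?M = "(UNIV :: 'i set) \<times> exponents k"
 let ?T = "%f (i, x). section_of (form_of_coeffs k (%m. f (i, m))) x"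
 have "has_dim {f. \<forall>m. m \<notin> ?M --> f m = 0} (card ?M)"
  by (rule has_dim_supported) (simp add: finite_exponents)
 then have "has_dim {w :: 'i \<times> (complex ^ 4) => complex. \<forall>i. Reg k total (%x. w (i, x))} (card ?M)"
 proof (rule has_dim_iso[where T = ?T])
  show "linear_on {f. \<forall>m. m \<notin> ?M --> f m = 0} ?T"
   by (rule linear_onI) (auto simp: section_of_coeffs rst_def sum.distrib algebra_simps sum_distrib_left split: prod.splits)
 next
  fix f assume f: "f \<in> {f. \<forall>m. m \<notin> ?M --> f m = 0}" and z: "\<forall>j. ?T f j = 0"
  have "form_of_coeffs k (%m. f (i, m)) = 0" for i
  proof (rule reduced_unique)
   show "reduced (form_of_coeffs k (%m. f (i, m)))" using graded_form_of_coeffs by (simp add: graded_def)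
   fix x assume "x \<in> K"
   then show "peval (form_of_coeffs k (%m. f (i, m))) (coords x) = 0" using z[rule_format, of "(i, x)"] by simp
  qed
  then have "f (i, m) = 0" if "m \<in> exponents k" for i m
   using lookup_form_of_coeffs[of k "%m. f (i, m)" m] that by simp
  then show "f = (%i. 0)" using f by (auto simp: fun_eq_iff)
 next
  show "?T ` {f. \<forall>m. m \<notin> ?M --> f m = 0} = {w. \<forall>i. Reg k total (%x. w (i, x))}"
  proof (intro equalityI subsetI)
   fix w assume "w \<in> ?T ` {f. \<forall>m. m \<notin> ?M --> f m = 0}"
   then obtain f where f: "w = ?T f" by blast
   have "(%x. w (i, x)) = section_of (form_of_coeffs k (%m. f (i, m)))" for i by (simp add: f)
   then show "w \<in> {w. \<forall>i. Reg k total (%x. w (i, x))}" using Reg_section_of[OF graded_form_of_coeffs] by simp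
  next
   fix w :: "'i \<times> (complex ^ 4) => complex" assume "w \<in> {w. \<forall>i. Reg k total (%x. w (i, x))}"
   then have "\<exists>c. graded k c & (%x. w (i, x)) = section_of c" for i using global_section_polynomial by blast
   then obtain c where c: "!!i. graded k (c i)" "!!i. (%x. w (i, x)) = section_of (c i)" by metis
   let ?f = "%(i, m). plookup (c i) m"
   have "w (i, x) = ?T ?f (i, x)" for i x
    using fun_cong[OF c(2)[of i], of x] by (simp add: form_of_coeffs_lookup[OF c(1)])
   then have "w = ?T ?f" by auto
   moreover have "?f \<in> {f. \<forall>m. m \<notin> ?M --> f m = 0}"
    using c(1) by (fastforce simp: graded_def reduced_def exponents_def)
   ultimately show "w \<in> ?T ` {f. \<forall>m. m \<notin> ?M --> f m = 0}" by blast
  qed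
 qed
 then show ?thesis by (simp add: card_cartesian_product)
qed

lemma has_dim_sections: "has_dim {s. Reg k total s} (card (exponents k))"
proof -
 have "has_dim {w :: 1 \<times> (complex ^ 4) => complex. \<forall>i. Reg k total (%x. w (i, x))} (card (exponents k))"
  using has_dim_sections_power[where 'i = 1] by simp
 then show ?thesis
 proof (rule has_dim_iso[where T = "%w x. w (1, x)"])
  show "(%w x. w (1 :: 1, x)) ` {w. \<forall>i. Reg k total (%x. w (i, x))} = {s. Reg k total s}"
  proof (intro equalityI subsetI)
   fix s assume "s \<in> {s. Reg k total s}"
   then show "s \<in> (%w x. w (1 :: 1, x)) ` {w. \<forall>i. Reg k total (%x. w (i, x))}"
    by (intro image_eqI[of _ _ "%(i, x). s x"]) auto
  qed auto
 next
  fix f :: "1 \<times> (complex ^ 4) => complex" assume "\<forall>x. f (1, x) = 0"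
  moreover have "i = 1" for i :: 1 by (rule num1_eq1)
  ultimately have "f (i, x) = 0" for i x by metis
  then show "f = (%i. 0)" by (simp add: fun_eq_iff)
 qed (auto intro: linear_onI)
qed

lemma wedge_cond_wedge:
 assumes "!!i j. M i j = w i * v $ j - w j * v $ i" "(\<Sum>i\<in>UNIV. u $ i * w i) = 0" "(\<Sum>i\<in>UNIV. u $ i * v $ i) = 0"
 shows "wedge_cond u v M"
 unfolding wedge_cond_def
proof (intro conjI allI)
 fix l
 have "(\<Sum>i\<in>UNIV. u $ i * M i l) = (\<Sum>i\<in>UNIV. u $ i * w i) * v $ l - w l * (\<Sum>i\<in>UNIV. u $ i * v $ i)"
  by (simp add: assms(1) sum_distrib_left sum_distrib_right right_diff_distrib sum_subtractf mult_ac)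
 then show "(\<Sum>i\<in>UNIV. u $ i * M i l) = 0" using assms by simp
qed (auto simp: assms(1) algebra_simps)

lemma wedge_forms_decompose:
 assumes \<eta>: "\<eta> \<in> wedge_forms k total"
 obtains w where "!!i. Reg (k - 1) total (w i)" "!!i j x. x \<in> K ==> \<eta> (x, i, j) = w i x * dF j x - w j x * dF i x"
proof -
 have R: "Reg (k + 2) total (%x. \<eta> (x, i, j))" for i j using \<eta> by (simp add: wedge_forms_def)
 have C: "wedge_cond x (grad x) (%i j. \<eta> (x, i, j))" if "x \<in> K" for x using \<eta> that by (simp add: wedge_forms_def)
 have cyc: "dF i x * \<eta> (x, j, l) + dF j x * \<eta> (x, l, i) + dF l x * \<eta> (x, i, j) = 0" if "x \<in> K" for i j l x
  using wedge_condD(3)[OF C[OF that], of i j l] by (simp add: grad_def)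
 obtain w where w: "!!i. Reg (k + 2 - 3) total (w i)" "!!i j x. x \<in> K ==> \<eta> (x, i, j) = w i x * dF j x - w j x * dF i x"
  using koszul_exact_2[of "%i j x. \<eta> (x, i, j)" "k + 2", OF R wedge_condD(1)[OF C] cyc] by blast
 have deg: "k + 2 - 3 = k - 1" by simp
 show ?thesis by (rule that[OF w[unfolded deg]])
qed

text \<open>Twisted differentials on the surface are computed from the restricted Euler sequence: by
  exactness of the Koszul complex every element of \<open>wedge_forms\<close> is \<open>w \<and> dF\<close> with \<open>\<Sum> x\<^sub>i w\<^sub>i = 0\<close>,
  where \<open>w\<close> is unique up to multiples of \<open>dF\<close>.\<close>

lemma wedge_forms_dim:
 assumes k: "k \<ge> 1"
 shows "\<exists>n. has_dim (wedge_forms k total) n &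
   n + card (exponents k) + card (exponents (k - 4)) = 4 * card (exponents (k - 1))"
proof -
 let ?A4 = "{w :: 4 \<times> (complex ^ 4) => complex. \<forall>i. Reg (k - 1) total (%x. w (i, x))}"
 have A4: "has_dim ?A4 (4 * card (exponents (k - 1)))" using has_dim_sections_power[where 'i = 4] by simp
 define T1 where "T1 w = (%x. \<Sum>i\<in>UNIV. x $ i * w (i, x))" for w :: "4 \<times> (complex ^ 4) => complex"
 have T1: "linear_on ?A4 T1" by (rule linear_onI) (simp_all add: T1_def algebra_simps sum.distrib sum_distrib_left)
 have off: "w (i, x) = 0" if "w \<in> ?A4" "x \<notin> K" for w i x
  using Reg_off[OF openX_total, of "%x. w (i, x)" "k - 1"] that by auto
 have im1: "T1 ` ?A4 = {s. Reg k total s}"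
 proof (intro equalityI subsetI)
  fix s assume "s \<in> T1 ` ?A4"
  then obtain w where w: "w \<in> ?A4" "s = T1 w" by blast
  have "Reg k total (%x. \<Sum>i\<in>UNIV. rst total (peval (form_var i)) x * w (i, x))"
   using w by (intro Reg_sum[OF openX_total] Reg_mult_total[OF Reg_total_form[OF homogeneous_var]]) auto
  moreover have "(%x. \<Sum>i\<in>UNIV. rst total (peval (form_var i)) x * w (i, x)) = s"
   using off[OF w(1)] by (force simp: w(2) T1_def rst_def intro!: sum.cong)
  ultimately show "s \<in> {s. Reg k total s}" by simp
 next
  fix s assume "s \<in> {s. Reg k total s}"
  then obtain c where c: "graded k c" "s = section_of c" using global_section_polynomial by blast
  let ?f = "subst_form c coord_form"
  have "homogeneous (nat k) c" using c(1) k by (auto simp: graded_def homogeneous_alt)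
  then have hf: "homogeneous (nat k) ?f" by (rule homogeneous_subst_form[OF _ homogeneous_coord_form])
  define w where "w = (%(i, x). rst total (peval (form_const (1 / of_int k) * partial i ?f)) x)"
  have "homogeneous (nat k - 1) (form_const (1 / of_int k) * partial i ?f)" for i
   by (rule homogeneous_const_mult[OF homogeneous_partial[OF hf]])
  then have "w \<in> ?A4" using k by (auto simp: w_def intro!: Reg_total_form)
  moreover have "T1 w = s"
  proof
   fix x
   show "T1 w x = s x"
   proof (cases "x \<in> K")
    case True
    have "T1 w x = (1 / of_int k) * (\<Sum>i\<in>UNIV. x $ i * peval (partial i ?f) x)"
     using True by (simp add: T1_def w_def sum_distrib_left mult_ac)
    also have "\<dots> = (1 / of_int k) * (of_nat (nat k) * peval ?f x)" by (simp only: euler_identity[OF hf])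
    also have "\<dots> = s x" using True k by (simp add: c(2) peval_coords)
    finally show ?thesis .
   next
    case False
    then show ?thesis by (simp add: T1_def w_def c(2) section_of_def rst_def)
   qed
  qed
  ultimately show "s \<in> T1 ` ?A4" by blast
 qed
 let ?Z = "{w \<in> ?A4. \<forall>x. T1 w x = 0}"
 obtain z where z: "has_dim ?Z z" "card (exponents k) + z = 4 * card (exponents (k - 1))"
  using rank_nullity_spaces[OF A4 T1] has_dim_sections[of k] has_dim_unique unfolding im1 by blast
 define T2 where "T2 w = (%(x, i, j). w (i, x) * dF j x - w (j, x) * dF i x)" for w :: "4 \<times> (complex ^ 4) => complex"
 have T2: "linear_on ?Z T2" by (rule linear_onI) (auto simp: T2_def algebra_simps)
 have euler: "(\<Sum>i\<in>UNIV. x $ i * grad x $ i) = 0" if "x \<in> K" for x using euler_on_K[OF that] by (simp add: grad_def)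
 have im2: "T2 ` ?Z = wedge_forms k total"
 proof (intro equalityI subsetI)
  fix \<eta> assume "\<eta> \<in> T2 ` ?Z"
  then obtain w where w: "w \<in> ?Z" "\<eta> = T2 w" by blast
  have wd: "Reg (k + 2) total (%x. w (i, x) * rst total (dF j) x)" for i j
   using w by (intro Reg_mult_total[OF _ Reg_dF]) auto
  have "Reg (k + 2) total (%x. \<eta> (x, i, j))" for i j
  proof -
   have "(%x. \<eta> (x, i, j)) = (%x. w (i, x) * rst total (dF j) x - w (j, x) * rst total (dF i) x)"
    using w off by (fastforce simp: T2_def rst_def)
   then show ?thesis using Reg_diff[OF openX_total wd wd] by simp
  qed
  moreover have "wedge_cond x (grad x) (%i j. \<eta> (x, i, j))" if "x \<in> K" for x
  proof (rule wedge_cond_wedge[where w = "%i. w (i, x)"])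
   have "T1 w x = 0" using w by blast
   then show "(\<Sum>i\<in>UNIV. x $ i * w (i, x)) = 0" by (simp add: T1_def)
  qed (use euler[OF that] w in "auto simp: T2_def grad_def")
  ultimately show "\<eta> \<in> wedge_forms k total" by (simp add: wedge_forms_def)
 next
  fix \<eta> assume \<eta>: "\<eta> \<in> wedge_forms k total"
  have R: "Reg (k + 2) total (%x. \<eta> (x, i, j))" for i j using \<eta> by (simp add: wedge_forms_def)
  have C: "wedge_cond x (grad x) (%i j. \<eta> (x, i, j))" if "x \<in> K" for x using \<eta> that by (simp add: wedge_forms_def)
  obtain w where w: "!!i. Reg (k - 1) total (w i)" "!!i j x. x \<in> K ==> \<eta> (x, i, j) = w i x * dF j x - w j x * dF i x"
   using wedge_forms_decompose[OF \<eta>] by blast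
  define w' where "w' = (%(i, x). w i x)"
  have w'A: "w' \<in> ?A4" using w(1) by (simp add: w'_def)
  have "T1 w' x = 0" for x
  proof (cases "x \<in> K")
   case True
   obtain l where l: "dF l x ~= 0" using gradient_nonzero[OF True] by blast
   have "0 = (\<Sum>i\<in>UNIV. x $ i * \<eta> (x, i, l))" using wedge_condD(2)[OF C[OF True]] by simp
   also have "\<dots> = (\<Sum>i\<in>UNIV. x $ i * w i x) * dF l x - w l x * (\<Sum>i\<in>UNIV. x $ i * dF i x)"
    by (simp add: w(2)[OF True] sum_distrib_left sum_distrib_right right_diff_distrib sum_subtractf mult_ac)
   finally show ?thesis using l euler_on_K[OF True] by (simp add: T1_def w'_def)
  next
   case False
   then show ?thesis using off[OF w'A] by (simp add: T1_def)
  qed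
  moreover have "T2 w' = \<eta>"
  proof
   fix y :: "(complex ^ 4) \<times> 4 \<times> 4"
   obtain x i j where y: "y = (x, i, j)" by (cases y)
   show "T2 w' y = \<eta> y"
   proof (cases "x \<in> K")
    case False
    then show ?thesis using off[OF w'A] Reg_off[OF openX_total R] by (simp add: y T2_def)
   qed (simp add: y T2_def w'_def w(2))
  qed
  ultimately show "\<eta> \<in> T2 ` ?Z" using w'A by blast
 qed
 let ?B = "{w \<in> ?Z. \<forall>j. T2 w j = 0}"
 have B: "has_dim ?B (card (exponents (k - 4)))"
 proof (rule has_dim_iso[OF has_dim_sections, where T = "%u (i, x). u x * dF i x"])
  fix u :: "complex ^ 4 => complex"
  assume u: "u \<in> {s. Reg (k - 4) total s}" "\<forall>j. (case j of (i, x) => u x * dF i x) = 0"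
  show "u = (%i. 0)"
  proof
   fix x
   show "u x = 0"
   proof (cases "x \<in> K")
    case True
    then obtain i where "dF i x ~= 0" using gradient_nonzero by blast
    then show ?thesis using u(2)[rule_format, of "(i, x)"] by simp
   next
    case False
    then show ?thesis using u(1) Reg_off[OF openX_total] by auto
   qed
  qed
 next
  show "(%u (i, x). u x * dF i x) ` {s. Reg (k - 4) total s} = ?B"
  proof (intro equalityI subsetI)
   fix w assume "w \<in> (%u (i, x). u x * dF i x) ` {s. Reg (k - 4) total s}"
   then obtain u where u: "Reg (k - 4) total u" "w = (%(i, x). u x * dF i x)" by blast
   have uoff: "u x = 0" if "x \<notin> K" for x using Reg_off[OF openX_total u(1)] that by simp
   have "(%x. w (i, x)) = (%x. u x * rst total (dF i) x)" for i using uoff by (auto simp: u(2) rst_def)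
   then have "w \<in> ?A4" using Reg_mult_total[OF u(1) Reg_dF] by simp
   moreover have "T1 w x = 0" for x
   proof (cases "x \<in> K")
    case True
    have "T1 w x = u x * (\<Sum>i\<in>UNIV. x $ i * dF i x)" by (simp add: T1_def u(2) sum_distrib_left mult_ac)
    then show ?thesis using euler_on_K[OF True] by simp
   qed (simp add: T1_def u(2) uoff)
   moreover have "T2 w j = 0" for j by (cases j) (simp add: T2_def u(2))
   ultimately show "w \<in> ?B" by simp
  next
   fix w assume w: "w \<in> ?B"
   obtain u where u: "Reg (k - 1 - 3) total u" "!!i x. x \<in> K ==> w (i, x) = u x * dF i x"
   proof (rule koszul_exact_1[of "%i x. w (i, x)" "k - 1"])
    fix i j x
    have "T2 w (x, i, j) = 0" using w by blast
    then show "w (i, x) * dF j x = w (j, x) * dF i x" by (simp add: T2_def)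
   qed (use w in auto)
   have "w (i, x) = u x * dF i x" for i x
    using u(2) off[of w x i] Reg_off[OF openX_total u(1), of x] w by (cases "x \<in> K") auto
   then have "w = (%(i, x). u x * dF i x)" by auto
   then show "w \<in> (%u (i, x). u x * dF i x) ` {s. Reg (k - 4) total s}" using u(1) by auto
  qed
 qed (auto intro!: linear_onI simp: algebra_simps)
 obtain n where n: "has_dim (wedge_forms k total) n" "n + card (exponents (k - 4)) = z"
  using rank_nullity_spaces[OF z(1) T2] B has_dim_unique unfolding im2 by blast
 then show ?thesis using z(2) by (intro exI[of _ n]) auto
qed

text \<open>A wedge form comes from a vector \<open>w\<close> of sections of \<open>\<O>(k - 1)\<close>, and these
  vanish for \<open>k \<le> 0\<close>.\<close>

lemma wedge_forms_nonpos:
 assumes k: "k \<le> 0"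
 shows "has_dim (wedge_forms k total) 0"
proof -
 have "\<eta> = (%j. 0)" if \<eta>: "\<eta> \<in> wedge_forms k total" for \<eta>
 proof -
  have R: "Reg (k + 2) total (%x. \<eta> (x, i, j))" for i j using \<eta> by (simp add: wedge_forms_def)
  obtain w where w: "!!i. Reg (k - 1) total (w i)" "!!i j x. x \<in> K ==> \<eta> (x, i, j) = w i x * dF j x - w j x * dF i x"
   using wedge_forms_decompose[OF \<eta>] by blast
  have "w i = (%x. 0)" for i using Reg_total_negative[OF w(1)] k by simp
  then have "\<eta> (x, i, j) = 0" for x i j using w(2) Reg_off[OF openX_total R, of x] by (cases "x \<in> K") auto
  then show ?thesis by auto
 qed
 moreover have "(%j. 0) \<in> wedge_forms k total"
  by (simp add: wedge_forms_def wedge_cond_def Reg_zero[OF openX_total])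
 ultimately have "wedge_forms k total = {%j. 0}" by blast
 then show ?thesis using has_dim_zero by simp
qed

text \<open>Reduced monomials have exponent at most \<open>3\<close> in the last variable, so the sum has four
  terms, each counting monomials in three variables.\<close>

lemma card_exponents:
 "int (card (exponents k)) = (if k < 0 then 0 else if k = 0 then 1 else 2 * k\<^sup>2 + 2)"
proof (cases "k < 0")
 case True
 then have "exponents k = {}" by (auto simp: exponents_def)
 then show ?thesis using True by simp
next
 case False
 define n where "n = nat k"
 let ?S = "Sigma {i. i < 4 & i \<le> n} (%i. Sigma {..n - i} (%a. {..n - i - a}))"
 let ?t = "%m. (plookup m (4::4), plookup m 1, plookup m 2)"
 have "bij_betw ?t (exponents k) ?S"
 proof (rule bij_betwI')
  fix m m' assume "m \<in> exponents k" "m' \<in> exponents k"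
  then show "(?t m = ?t m') = (m = m')"
   using forall_4[of "%i. plookup m i = plookup m' i"]
   by (auto simp: exponents_def mon_degree_4 intro!: poly_mapping_eqI)
 next
  fix m assume "m \<in> exponents k"
  then show "?t m \<in> ?S" by (auto simp: exponents_def mon_degree_4 n_def)
 next
  fix y assume "y \<in> ?S"
  then obtain i a b where y: "y = (i, a, b)" "i < 4" "i \<le> n" "a \<le> n - i" "b \<le> n - i - a" by auto
  define m :: "4 \<Rightarrow>\<^sub>0 nat" where "m = psingle 4 i + psingle 1 a + psingle 2 b + psingle 3 (n - i - a - b)"
  have "plookup m 1 = a" "plookup m 2 = b" "plookup m 3 = n - i - a - b" "plookup m 4 = i"
   by (simp_all add: m_def lookup_add lookup_single)
  then show "\<exists>m\<in>exponents k. y = ?t m" using y False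
   by (intro bexI[of _ m]) (auto simp: exponents_def mon_degree_4 n_def)
 qed
 then have "card (exponents k) = card ?S" by (rule bij_betw_same_card)
 also have "\<dots> = (\<Sum>i\<in>{i. i < 4 & i \<le> n}. \<Sum>a\<le>n - i. Suc (n - i - a))" by (simp add: card_SigmaI)
 also have "\<dots> = (\<Sum>i\<in>{i. i < 4 & i \<le> n}. (n - i + 1) * (n - i + 2) div 2)"
 proof (rule sum.cong[OF refl])
  fix i
  have "(\<Sum>a\<le>p. Suc (p - a)) = (p + 1) * (p + 2) div 2" for p :: nat
  proof -
   have "(\<Sum>a\<le>p. Suc (p - a)) = (\<Sum>a\<le>p. Suc a)" by (rule sum.reindex_bij_witness[of _ "%a. p - a" "%a. p - a"]) auto
   also have "2 * \<dots> = (p + 1) * (p + 2)" by (induction p) auto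
   finally show ?thesis by simp
  qed
  then show "(\<Sum>a\<le>n - i. Suc (n - i - a)) = (n - i + 1) * (n - i + 2) div 2" .
 qed
 finally have card: "card (exponents k) = (\<Sum>i\<in>{i. i < 4 & i \<le> n}. (n - i + 1) * (n - i + 2) div 2)" .
 have k: "k = int n" using False by (simp add: n_def)
 have "n = 0 \<or> n = 1 \<or> n = 2 \<or> n = (n - 3) + 3" by arith
 then consider "n = 0" | "n = 1" | "n = 2" | p where "n = p + 3" by blast
 then show ?thesis
 proof cases
  case 1
  then have set: "{i. i < 4 & i \<le> n} = {0}" by auto
  have "card (exponents k) = 1" unfolding card set using 1 by simp
  then show ?thesis using 1 k by simp
 next
  case 2
  then have set: "{i. i < 4 & i \<le> n} = {0, 1}" by auto
  have "card (exponents k) = 4" unfolding card set using 2 by simp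
  then show ?thesis using 2 k by simp
 next
  case 3
  then have set: "{i. i < 4 & i \<le> n} = {0, 1, 2}" by auto
  have "card (exponents k) = 10" unfolding card set using 3 by simp
  then show ?thesis using 3 k by simp
 next
  case (4 p)
  then have set: "{i. i < 4 & i \<le> n} = {0, 1, 2, 3}" by auto
  have c: "card (exponents k) = (n + 1) * (n + 2) div 2 + (n - 1 + 1) * (n - 1 + 2) div 2 + (n - 2 + 1) * (n - 2 + 2) div 2 + (n - 3 + 1) * (n - 3 + 2) div 2"
   unfolding card set by simp
  have half: "2 * ((q + 1) * (q + 2) div 2) = (q + 1) * (q + 2)" for q :: nat
   by (rule dvd_mult_div_cancel) simp
  have "2 * card (exponents k) = (n + 1) * (n + 2) + (n - 1 + 1) * (n - 1 + 2) + (n - 2 + 1) * (n - 2 + 2) + (n - 3 + 1) * (n - 3 + 2)"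
   unfolding c by (simp only: distrib_left[of 2] half)
  also have "\<dots> = 2 * (2 * (p + 3) ^ 2 + 2)" using 4 by (simp add: power2_eq_square algebra_simps)
  finally have "card (exponents k) = 2 * n ^ 2 + 2" using 4 by simp
  then show ?thesis using 4 k by simp
 qed
qed

end

section \<open>Presented modules over rings of regular functions\<close>

context smooth_quartic
begin

abbreviation OX :: "point set => (complex ^ 4 => complex, complex ^ 4 => complex) module" where
 "OX U \<equiv> sec (str X) U"

lemma str_X: "str X = twist F 0"
 by (simp add: hypersurface_def)

lemma carrier_OX: "carrier (OX U) = {a. Reg 0 U a}"
 by (simp add: str_X)

lemma twist_simps [simp]:
 "s \<oplus>\<^bsub>sec (twist F k) U\<^esub> t = (%x. s x + t x)" "a \<odot>\<^bsub>sec (twist F k) U\<^esub> s = (%x. a x * s x)"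
 "\<zero>\<^bsub>sec (twist F k) U\<^esub> = (%x. 0)" "a \<otimes>\<^bsub>sec (twist F k) U\<^esub> b = (%x. a x * b x)"
 "\<one>\<^bsub>sec (twist F k) U\<^esub> = rst U (%x. 1)" "res (twist F k) U V s = rst V s"
 by (simp_all add: twist_def rst_def over_def)

lemma OX_simps [simp]:
 "\<one>\<^bsub>OX U\<^esub> = rst U (%x. 1)" "a \<otimes>\<^bsub>OX U\<^esub> b = (%x. a x * b x)" "a \<oplus>\<^bsub>OX U\<^esub> b = (%x. a x + b x)"
 "\<zero>\<^bsub>OX U\<^esub> = (%x. 0)" "res (str X) U V a = rst V a"
 by (simp_all add: str_X)

lemma cring_OX:
 assumes U: "openX U" shows "cring (OX U)"
 unfolding str_X
proof (rule cringI)
 have one: "rst U (%x. 1) x * s x = s x" "s x * rst U (%x. 1) x = s x" if "Reg 0 U s" for s x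
  using Reg_off[OF U that] by (simp_all add: rst_def)
 show "abelian_group (sec (twist F 0) U)"
 proof (rule abelian_groupI)
  fix s assume s: "s \<in> carrier (sec (twist F 0) U)"
  show "\<exists>t\<in>carrier (sec (twist F 0) U). t \<oplus>\<^bsub>sec (twist F 0) U\<^esub> s = \<zero>\<^bsub>sec (twist F 0) U\<^esub>"
   by (rule bexI[OF _ Reg_uminus[OF U s]]) simp
 qed (auto intro: Reg_add Reg_zero U simp: add_ac)
 show "Group.comm_monoid (sec (twist F 0) U)"
  by (rule comm_monoidI) (auto intro!: Reg_mult[OF U] Reg_const U simp: one mult_ac)
qed (auto simp: algebra_simps)

definition frees :: "point set => 's set => ('s => complex ^ 4 => complex) set" where
 "frees U S = {f. finite {s. f s ~= (%x. 0)} & (\<forall>s. Reg 0 U (f s)) & (\<forall>s. s \<notin> S --> f s = (%x. 0))}"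

lemma carrier_free_module:
 assumes U: "openX U" shows "carrier (free_module (OX U) S) = frees U S"
proof -
 have "(\<forall>s. Reg 0 U (f s)) \<longleftrightarrow> (\<forall>s\<in>S. Reg 0 U (f s))" if "\<forall>s. s \<notin> S --> f s = (%x. 0)" for f
  using that Reg_zero[OF U] by metis
 then show ?thesis by (auto simp: free_module_def frees_def str_X)
qed

lemma free_module_simps [simp]:
 "f \<oplus>\<^bsub>free_module (OX U) S\<^esub> g = (%s x. f s x + g s x)"
 "a \<odot>\<^bsub>free_module (OX U) S\<^esub> f = (%s x. a x * f s x)"
 "\<zero>\<^bsub>free_module (OX U) S\<^esub> = (%s x. 0)"
 by (simp_all add: free_module_def str_X)

lemma frees_zero: "openX U ==> (%s x. 0) \<in> frees U S"
 by (simp add: frees_def Reg_zero)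

lemma frees_add:
 assumes U: "openX U" and f: "f \<in> frees U S" and g: "g \<in> frees U S"
 shows "(%s x. f s x + g s x) \<in> frees U S"
proof -
 have "{s. (%x. f s x + g s x) ~= (%x. 0)} \<subseteq> {s. f s ~= (%x. 0)} \<union> {s. g s ~= (%x. 0)}" by auto
 then have "finite {s. (%x. f s x + g s x) ~= (%x. 0)}"
  using f g finite_subset unfolding frees_def by blast
 then show ?thesis using f g Reg_add[OF U] unfolding frees_def by auto
qed

lemma frees_smult:
 assumes U: "openX U" and a: "Reg 0 U a" and f: "f \<in> frees U S"
 shows "(%s x. a x * f s x) \<in> frees U S"
proof -
 have "{s. (%x. a x * f s x) ~= (%x. 0)} \<subseteq> {s. f s ~= (%x. 0)}" by auto
 then have "finite {s. (%x. a x * f s x) ~= (%x. 0)}"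
  using f finite_subset unfolding frees_def by blast
 then show ?thesis using f Reg_mult[OF U a] unfolding frees_def by auto
qed

lemma rst_one_Reg: "Reg k U s ==> openX U ==> rst U (%x. 1) x * s x = s x" "Reg k U s ==> openX U ==> s x * rst U (%x. 1) x = s x"
 using Reg_off by (auto simp: rst_def)

lemma frees_uminus:
 assumes U: "openX U" and f: "f \<in> frees U S" shows "(%s x. - f s x) \<in> frees U S"
proof -
 have "(%s x. rst U (%x. -1) x * f s x) \<in> frees U S" by (rule frees_smult[OF U Reg_const[OF U] f])
 moreover have "rst U (%x. -1) x * f s x = - f s x" for s x
  using f Reg_off[OF U, of "f s" 0 x] by (auto simp: rst_def frees_def)
 ultimately show ?thesis by simp
qed

lemma frees_diff:
 assumes U: "openX U" and f: "f \<in> frees U S" and g: "g \<in> frees U S"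
 shows "(%s x. f s x - g s x) \<in> frees U S"
 using frees_add[OF U f frees_uminus[OF U g]] by simp

lemma module_free_module:
 assumes U: "openX U" shows "module (OX U) (free_module (OX U) S)"
proof (rule module_criteria[OF cring_OX[OF U]])
 show "\<forall>v\<in>carrier (free_module (OX U) S). \<exists>w\<in>carrier (free_module (OX U) S).
   v \<oplus>\<^bsub>free_module (OX U) S\<^esub> w = \<zero>\<^bsub>free_module (OX U) S\<^esub>"
 proof
  fix v assume "v \<in> carrier (free_module (OX U) S)"
  then show "\<exists>w\<in>carrier (free_module (OX U) S). v \<oplus>\<^bsub>free_module (OX U) S\<^esub> w = \<zero>\<^bsub>free_module (OX U) S\<^esub>"
   using frees_uminus[OF U, of v S] by (intro bexI[of _ "%s x. - v s x"]) (auto simp: carrier_free_module[OF U])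
 qed
 show "\<forall>v\<in>carrier (free_module (OX U) S). \<one>\<^bsub>OX U\<^esub> \<odot>\<^bsub>free_module (OX U) S\<^esub> v = v"
  using rst_one_Reg(1)[OF _ U] by (auto simp: carrier_free_module[OF U] frees_def fun_eq_iff simp del: mult_cancel_right2)
qed (auto simp: carrier_free_module[OF U] carrier_OX algebra_simps
  intro: frees_zero[OF U] frees_add[OF U] frees_smult[OF U])

lemma free_minus:
 assumes U: "openX U" and f: "f \<in> frees U S" and g: "g \<in> frees U S"
 shows "f \<ominus>\<^bsub>free_module (OX U) S\<^esub> g = (%s x. f s x - g s x)"
proof -
 interpret M: module "OX U" "free_module (OX U) S" by (rule module_free_module[OF U])
 have "\<ominus>\<^bsub>free_module (OX U) S\<^esub> g = (%s x. - g s x)"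
  by (rule M.minus_equality) (use g frees_uminus[OF U g] in "auto simp: carrier_free_module[OF U]")
 then show ?thesis by (simp add: a_minus_def)
qed

abbreviation gen :: "point set => 's => 's => complex ^ 4 => complex" where
 "gen U \<equiv> free_gen (OX U)"

lemma gen_apply: "gen U s t x = (if t = s then rst U (%x. 1) x else 0)"
 by (simp add: free_gen_def str_X)

lemma gen_in: "openX U ==> s \<in> S ==> gen U s \<in> frees U S"
 using Reg_const[of U 1] Reg_zero[of U 0] by (auto simp: frees_def free_gen_def str_X)

text \<open>Evaluation of a formal combination of generators at the points of the cone, for given values
  \<open>ev\<close> of the generators.\<close>

definition evaluate :: "('s => (complex ^ 4) \<times> 'i => complex) => ('s => complex ^ 4 => complex) => (complex ^ 4) \<times> 'i => complex" where
 "evaluate ev f = (%(x, i). \<Sum>s | f s ~= (%x. 0). f s x * ev s (x, i))"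

lemma evaluate_superset:
 "finite T ==> {s. f s ~= (%x. 0)} \<subseteq> T ==> evaluate ev f (x, i) = (\<Sum>s\<in>T. f s x * ev s (x, i))"
 unfolding evaluate_def prod.case by (rule sum.mono_neutral_left) auto

lemma evaluate_add:
 assumes "f \<in> frees U S" "g \<in> frees U S"
 shows "evaluate ev (%s x. f s x + g s x) (x, i) = evaluate ev f (x, i) + evaluate ev g (x, i)"
proof -
 let ?T = "{s. f s ~= (%x. 0)} \<union> {s. g s ~= (%x. 0)}"
 have T: "finite ?T" using assms by (auto simp: frees_def)
 have "{s. (%x. f s x + g s x) ~= (%x. 0)} \<subseteq> ?T" by auto
 then show ?thesis using T by (simp add: evaluate_superset[of ?T] distrib_right sum.distrib)
qed

lemma evaluate_smult:
 assumes "f \<in> frees U S"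
 shows "evaluate ev (%s x. a x * f s x) (x, i) = a x * evaluate ev f (x, i)"
proof -
 let ?T = "{s. f s ~= (%x. 0)}"
 have T: "finite ?T" using assms by (auto simp: frees_def)
 have "{s. (%x. a x * f s x) ~= (%x. 0)} \<subseteq> ?T" by auto
 then show ?thesis using T by (simp add: evaluate_superset[of ?T] sum_distrib_left mult.assoc)
qed

lemma evaluate_diff:
 assumes "openX U" "f \<in> frees U S" "g \<in> frees U S"
 shows "evaluate ev (%s x. f s x - g s x) (x, i) = evaluate ev f (x, i) - evaluate ev g (x, i)"
 using evaluate_add[OF assms(2) frees_uminus[OF assms(1,3)], of ev x i]
  evaluate_smult[OF assms(3), of ev "%x. -1" x i] by simp

lemma evaluate_gen: "evaluate ev (gen U s) (x, i) = rst U (%x. 1) x * ev s (x, i)"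
 by (subst evaluate_superset[of "{s}"]) (auto simp: free_gen_def str_X)

lemma evaluate_zero [simp]: "evaluate ev (%s x. 0) = (%j. 0)"
 by (auto simp: evaluate_def)

end

locale presentation = smooth_quartic +
 fixes U :: "point set" and S :: "'s set" and R :: "('s => complex ^ 4 => complex) set"
 assumes openU: "openX U" and R_sub: "R \<subseteq> frees U S"
begin

abbreviation "FM \<equiv> free_module (OX U) S"
abbreviation "N \<equiv> relation_module (OX U) S R"

interpretation FM: module "OX U" FM by (rule module_free_module[OF openU])

lemma sub_N: "submodule (OX U) N FM"
 unfolding relation_module_def by (rule FM.span_is_submodule) (use R_sub in "simp add: carrier_free_module[OF openU]")

lemma N_sub: "f \<in> N ==> f \<in> frees U S"
 using submodule.subset[OF sub_N] by (auto simp: carrier_free_module[OF openU])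

lemma N_zero: "(%s x. 0) \<in> N"
 using submodule.zero_closed[OF sub_N] by simp

lemma N_add: "f \<in> N ==> g \<in> N ==> (%s x. f s x + g s x) \<in> N"
 using submodule.m_closed[OF sub_N, of f g] by simp

lemma N_smult: "Reg 0 U a ==> f \<in> N ==> (%s x. a x * f s x) \<in> N"
 using submodule.smult_closed[OF sub_N, of a f] by (simp add: carrier_OX)

lemma N_rel: "f \<in> R ==> f \<in> N"
 unfolding relation_module_def using FM.in_own_span[of R] R_sub by (auto simp: carrier_free_module[OF openU])

lemma N_uminus: "f \<in> N ==> (%s x. - f s x) \<in> N"
proof -
 assume f: "f \<in> N"
 have "(%s x. rst U (%x. -1) x * f s x) \<in> N" by (rule N_smult[OF Reg_const[OF openU] f])
 moreover have "rst U (%x. -1) x * f s x = - f s x" for s x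
  using N_sub[OF f] Reg_off[OF openU, of "f s" 0 x] by (auto simp: rst_def frees_def)
 ultimately show ?thesis by simp
qed

lemma N_diff: "f \<in> N ==> g \<in> N ==> (%s x. f s x - g s x) \<in> N"
 using N_add[OF _ N_uminus, of f g] by simp

lemma N_induct [consumes 1, case_names zero add smult rel]:
 assumes "f \<in> N" and "P (%s x. 0)"
  and "!!f g. f \<in> frees U S ==> g \<in> frees U S ==> P f ==> P g ==> P (%s x. f s x + g s x)"
  and "!!a f. Reg 0 U a ==> f \<in> frees U S ==> P f ==> P (%s x. a x * f s x)"
  and "!!r. r \<in> R ==> P r"
 shows "P f"
proof -
 have "submodule (OX U) {f \<in> frees U S. P f} FM"
  by (rule submodule.intro[OF FM.module_axioms])
   (use assms frees_zero[OF openU] frees_add[OF openU] frees_smult[OF openU]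
    in "auto simp: carrier_free_module[OF openU] carrier_OX")
 then have "N \<subseteq> {f \<in> frees U S. P f}"
  unfolding relation_module_def by (rule FM.span_is_subset[rotated]) (use R_sub assms in auto)
 then show ?thesis using assms(1) by blast
qed

definition cls :: "('s => complex ^ 4 => complex) => ('s => complex ^ 4 => complex) set" where
 "cls f = N +>\<^bsub>FM\<^esub> f"

lemma cls_iff: "g \<in> cls f \<longleftrightarrow> (%s x. g s x - f s x) \<in> N"
proof
 assume "g \<in> cls f"
 then obtain n where "n \<in> N" "g = (%s x. n s x + f s x)" by (auto simp: cls_def a_r_coset_def')
 then show "(%s x. g s x - f s x) \<in> N" by simp
next
 assume n: "(%s x. g s x - f s x) \<in> N"
 have "g = (%s x. g s x - f s x) \<oplus>\<^bsub>FM\<^esub> f" by simp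
 then show "g \<in> cls f" using n unfolding cls_def a_r_coset_def' by blast
qed

lemma cls_self: "f \<in> cls f"
 by (simp add: cls_iff N_zero)

lemma cls_eq_iff: "cls f = cls g \<longleftrightarrow> (%s x. f s x - g s x) \<in> N"
proof
 assume "cls f = cls g"
 then have "f \<in> cls g" using cls_self by auto
 then show "(%s x. f s x - g s x) \<in> N" by (simp add: cls_iff)
next
 assume n: "(%s x. f s x - g s x) \<in> N"
 have "h \<in> cls f \<longleftrightarrow> h \<in> cls g" for h
  using N_add[OF _ n, of "%s x. h s x - f s x"] N_diff[OF _ n, of "%s x. h s x - g s x"] by (auto simp: cls_iff)
 then show "cls f = cls g" by blast
qed

lemma N_eq_cls: "N = cls (%s x. 0)"
proof -
 have "g \<in> N \<longleftrightarrow> g \<in> cls (%s x. 0)" for g by (simp add: cls_iff)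
 then show ?thesis by blast
qed

abbreviation "PM \<equiv> presented_module (OX U) S R"

lemma PM_carrier: "carrier PM = cls ` frees U S"
 by (auto simp: presented_module_def quotient_module_def A_RCOSETS_def' cls_def carrier_free_module[OF openU])

lemma PM_zero: "\<zero>\<^bsub>PM\<^esub> = cls (%s x. 0)"
 using N_eq_cls by (simp add: presented_module_def quotient_module_def)

lemma PM_add: "cls f \<oplus>\<^bsub>PM\<^esub> cls g = cls (%s x. f s x + g s x)"
proof -
 have "h \<in> cls f \<oplus>\<^bsub>PM\<^esub> cls g \<longleftrightarrow> h \<in> cls (%s x. f s x + g s x)" for h
 proof
  assume "h \<in> cls f \<oplus>\<^bsub>PM\<^esub> cls g"
  then obtain a b where "a \<in> cls f" "b \<in> cls g" "h = (%s x. a s x + b s x)"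
   by (auto simp: presented_module_def quotient_module_def set_add_def')
  then show "h \<in> cls (%s x. f s x + g s x)"
   using N_add[of "%s x. a s x - f s x" "%s x. b s x - g s x"] by (simp add: cls_iff algebra_simps)
 next
  assume "h \<in> cls (%s x. f s x + g s x)"
  then have "(%s x. h s x - g s x) \<in> cls f" by (simp add: cls_iff algebra_simps)
  moreover have "h = (%s x. h s x - g s x) \<oplus>\<^bsub>FM\<^esub> g" by simp
  ultimately have "\<exists>a\<in>cls f. \<exists>b\<in>cls g. h = a \<oplus>\<^bsub>FM\<^esub> b" using cls_self[of g] by blast
  then show "h \<in> cls f \<oplus>\<^bsub>PM\<^esub> cls g"
   unfolding presented_module_def quotient_module_def by (auto simp: set_add_def')
 qed
 then show ?thesis by blast
qed

lemma PM_smult: "Reg 0 U a ==> a \<odot>\<^bsub>PM\<^esub> cls f = cls (%s x. a x * f s x)"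
proof -
 assume a: "Reg 0 U a"
 have eq: "cls (%s x. a x * g s x) = cls (%s x. a x * f s x)" if "g \<in> cls f" for g
  using N_smult[OF a] that by (simp add: cls_iff cls_eq_iff flip: right_diff_distrib)
 have "(\<Union>m\<in>cls f. cls (a \<odot>\<^bsub>FM\<^esub> m)) = cls (%s x. a x * f s x)"
 proof (rule SUP_eq_const)
  show "cls f ~= {}" using cls_self by blast
  show "cls (a \<odot>\<^bsub>FM\<^esub> m) = cls (%s x. a x * f s x)" if "m \<in> cls f" for m
   unfolding free_module_simps by (rule eq[OF that])
 qed
 then show ?thesis unfolding presented_module_def quotient_module_def cls_def by simp
qed

definition cls_evaluate :: "('s => (complex ^ 4) \<times> 'i => complex) => ('s => complex ^ 4 => complex) set => (complex ^ 4) \<times> 'i => complex" where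
 "cls_evaluate ev C = evaluate ev (SOME f. f \<in> C)"

lemma cls_evaluate:
 assumes ev: "!!r j. r \<in> R ==> evaluate ev r j = 0" and f: "f \<in> frees U S"
 shows "cls_evaluate ev (cls f) = evaluate ev f"
proof -
 have N0: "evaluate ev n (x, i) = 0" if "n \<in> N" for n x i
  using that
 proof (induction n rule: N_induct)
  case (add f g)
  then show ?case by (simp add: evaluate_add)
 next
  case (smult a f)
  then show ?case by (simp add: evaluate_smult)
 qed (use ev in auto)
 have "(SOME g. g \<in> cls f) \<in> cls f" using someI[of "%g. g \<in> cls f" f] cls_self by blast
 then have n1: "(%s x. (SOME g. g \<in> cls f) s x - f s x) \<in> N" by (simp only: cls_iff)
 define n where "n = (%s x. (SOME g. g \<in> cls f) s x - f s x)"
 have n: "n \<in> N" "(SOME g. g \<in> cls f) = (%s x. n s x + f s x)" using n1 by (simp_all add: n_def)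
 have "evaluate ev (SOME g. g \<in> cls f) (x, i) = evaluate ev f (x, i)" for x i
  unfolding n(2) evaluate_add[OF N_sub[OF n(1)] f] N0[OF n(1)] by simp
 then show ?thesis unfolding cls_evaluate_def by auto
qed

end

context smooth_quartic
begin

lemma finsum_OX:
 assumes V: "openX V" and f: "!!s. s \<in> T ==> Reg 0 V (f s)" and T: "finite T"
 shows "(\<Oplus>\<^bsub>OX V\<^esub>s\<in>T. f s) = (%x. \<Sum>s\<in>T. f s x)"
proof -
 interpret R: cring "OX V" by (rule cring_OX[OF V])
 show ?thesis using T f
 proof (induction T rule: finite_induct)
  case empty
  show ?case using R.finsum_empty[of f] by (simp add: str_X)
 next
  case (insert s T)
  then have "(\<Oplus>\<^bsub>OX V\<^esub>s\<in>insert s T. f s) = f s \<oplus>\<^bsub>OX V\<^esub> (\<Oplus>\<^bsub>OX V\<^esub>s\<in>T. f s)"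
   by (intro R.finsum_insert) (auto simp: str_X)
  then show ?case using insert by (simp add: str_X)
 qed
qed

text \<open>Only finitely many generators contribute, so the ring-theoretic sum is a pointwise sum of functions.\<close>

lemma free_map_eq:
 assumes U: "openX U" and V: "openX V" "V \<subseteq> U" and f: "f \<in> frees U S"
  and T: "finite T" "{s. f s ~= (%x. 0)} \<subseteq> T"
 shows "free_map (OX U) (OX V) (rst V) \<sigma> f = (%t x. \<Sum>s\<in>T. if \<sigma> s = t then rst V (f s) x else 0)"
proof
 fix t
 let ?T = "{s. f s ~= (%x. 0) & \<sigma> s = t}"
 have fT: "finite ?T" using T by (auto intro: finite_subset)
 have "free_map (OX U) (OX V) (rst V) \<sigma> f t = (%x. \<Sum>s\<in>?T. rst V (f s) x)"
  unfolding free_map_def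
 proof (subst finsum_OX[OF V(1), symmetric, of _ "%s. rst V (f s)"])
  fix s show "Reg 0 V (rst V (f s))"
   using Reg_rst[OF U V(1) over_mono[OF V(2)], of "f s" 0] f by (simp add: frees_def)
 qed (use fT in "simp_all add: str_X")
 also have "\<dots> = (%x. \<Sum>s\<in>T. if \<sigma> s = t then rst V (f s) x else 0)"
 proof
  fix x
  have "(\<Sum>s\<in>T. if \<sigma> s = t then rst V (f s) x else 0) = (\<Sum>s\<in>?T. if \<sigma> s = t then rst V (f s) x else 0)"
   by (rule sum.mono_neutral_right) (use T in "auto simp: rst_def")
  then show "(\<Sum>s\<in>?T. rst V (f s) x) = (\<Sum>s\<in>T. if \<sigma> s = t then rst V (f s) x else 0)" by simp
 qed
 finally show "free_map (OX U) (OX V) (rst V) \<sigma> f t = (%x. \<Sum>s\<in>T. if \<sigma> s = t then rst V (f s) x else 0)" .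
qed

lemma free_map_in:
 assumes U: "openX U" and V: "openX V" "V \<subseteq> U" and f: "f \<in> frees U S" and \<sigma>: "!!s. s \<in> S ==> \<sigma> s \<in> S'"
 shows "free_map (OX U) (OX V) (rst V) \<sigma> f \<in> frees V S'"
proof -
 let ?T = "{s. f s ~= (%x. 0)}"
 have T: "finite ?T" "?T \<subseteq> S" using f by (auto simp: frees_def)
 have eq: "free_map (OX U) (OX V) (rst V) \<sigma> f = (%t x. \<Sum>s\<in>?T. if \<sigma> s = t then rst V (f s) x else 0)"
  by (rule free_map_eq[OF U V f T(1)]) simp
 have r: "Reg 0 V (rst V (f s))" for s
  using Reg_rst[OF U V(1) over_mono[OF V(2)], of "f s" 0] f by (simp add: frees_def)
 have "Reg 0 V (%x. if \<sigma> s = t then rst V (f s) x else 0)" for s t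
  using r[of s] Reg_zero[OF V(1), of 0] by (cases "\<sigma> s = t") auto
 then have "Reg 0 V (%x. \<Sum>s\<in>?T. if \<sigma> s = t then rst V (f s) x else 0)" for t
  by (intro Reg_sum[OF V(1)]) auto
 moreover have "finite {t. (%x. \<Sum>s\<in>?T. if \<sigma> s = t then rst V (f s) x else 0) ~= (%x. 0)}"
 proof (rule finite_subset)
  show "{t. (%x. \<Sum>s\<in>?T. if \<sigma> s = t then rst V (f s) x else 0) ~= (%x. 0)} \<subseteq> \<sigma> ` ?T"
  proof
   fix t assume "t \<in> {t. (%x. \<Sum>s\<in>?T. if \<sigma> s = t then rst V (f s) x else 0) ~= (%x. 0)}"
   then obtain x where "(\<Sum>s\<in>?T. if \<sigma> s = t then rst V (f s) x else 0) ~= 0" by auto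
   then obtain s where "s \<in> ?T" "(if \<sigma> s = t then rst V (f s) x else 0) ~= 0"
    by (rule sum.not_neutral_contains_not_neutral)
   then have "s \<in> ?T" "\<sigma> s = t" by (auto split: if_splits)
   then show "t \<in> \<sigma> ` ?T" by blast
  qed
 qed (use T in simp)
 moreover have "(\<Sum>s\<in>?T. if \<sigma> s = t then rst V (f s) x else 0) = 0" if "t \<notin> S'" for t x
  using that \<sigma> T(2) by (intro sum.neutral) auto
 ultimately show ?thesis unfolding eq frees_def by auto
qed

lemma free_map_add:
 assumes U: "openX U" and V: "openX V" "V \<subseteq> U" and f: "f \<in> frees U S" and g: "g \<in> frees U S"
 shows "free_map (OX U) (OX V) (rst V) \<sigma> (%s x. f s x + g s x)
  = (%t x. free_map (OX U) (OX V) (rst V) \<sigma> f t x + free_map (OX U) (OX V) (rst V) \<sigma> g t x)"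
proof -
 let ?T = "{s. f s ~= (%x. 0)} \<union> {s. g s ~= (%x. 0)}"
 have T: "finite ?T" using f g by (auto simp: frees_def)
 have 1: "{s. (%x. f s x + g s x) ~= (%x. 0)} \<subseteq> ?T" by auto
 show ?thesis
  unfolding free_map_eq[OF U V frees_add[OF U f g] T 1] free_map_eq[OF U V f T Un_upper1] free_map_eq[OF U V g T Un_upper2]
  by (auto simp: fun_eq_iff rst_def simp flip: sum.distrib intro!: sum.cong)
qed

lemma free_map_smult:
 assumes U: "openX U" and V: "openX V" "V \<subseteq> U" and a: "Reg 0 U a" and f: "f \<in> frees U S"
 shows "free_map (OX U) (OX V) (rst V) \<sigma> (%s x. a x * f s x) = (%t x. rst V a x * free_map (OX U) (OX V) (rst V) \<sigma> f t x)"
proof -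
 let ?T = "{s. f s ~= (%x. 0)}"
 have T: "finite ?T" using f by (auto simp: frees_def)
 have 1: "{s. (%x. a x * f s x) ~= (%x. 0)} \<subseteq> ?T" by auto
 show ?thesis
  unfolding free_map_eq[OF U V frees_smult[OF U a f] T 1] free_map_eq[OF U V f T subset_refl]
  by (auto simp: fun_eq_iff rst_def sum_distrib_left intro!: sum.cong cong: if_cong)
qed

lemma free_map_gen:
 assumes U: "openX U" and V: "openX V" "V \<subseteq> U"
 shows "free_map (OX U) (OX V) (rst V) \<sigma> (gen U s) = gen V (\<sigma> s)"
proof -
 have 1: "{t. gen U s t ~= (%x. 0)} \<subseteq> {s}" by (auto simp: free_gen_def str_X)
 have "over V \<subseteq> over U" by (rule over_mono[OF V(2)])
 then show ?thesis
  unfolding free_map_eq[OF U V gen_in[OF U UNIV_I] _ 1, simplified]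
  by (auto simp: fun_eq_iff gen_apply rst_def)
qed

lemma free_map_zero:
 assumes U: "openX U" and V: "openX V" "V \<subseteq> U"
 shows "free_map (OX U) (OX V) (rst V) \<sigma> (%s x. 0) = (%t x. 0)"
 by (subst free_map_eq[OF U V frees_zero[OF U], of "{}"]) auto

lemma free_map_diff:
 assumes U: "openX U" and V: "openX V" "V \<subseteq> U" and f: "f \<in> frees U S" and g: "g \<in> frees U S"
 shows "free_map (OX U) (OX V) (rst V) \<sigma> (%s x. f s x - g s x)
  = (%t x. free_map (OX U) (OX V) (rst V) \<sigma> f t x - free_map (OX U) (OX V) (rst V) \<sigma> g t x)"
proof -
 have "free_map (OX U) (OX V) (rst V) \<sigma> (%s x. (f s x - g s x) + g s x)
  = (%t x. free_map (OX U) (OX V) (rst V) \<sigma> (%s x. f s x - g s x) t x + free_map (OX U) (OX V) (rst V) \<sigma> g t x)"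
  by (rule free_map_add[OF U V frees_diff[OF U f g] g])
 then show ?thesis by (auto simp: fun_eq_iff)
qed

lemma evaluate_free_map:
 assumes U: "openX U" and V: "openX V" "V \<subseteq> U" and f: "f \<in> frees U S" and x: "x \<in> over V"
  and ev: "!!s. s \<in> S ==> ev (\<sigma> s) (x, i) = ev s (x, i)"
 shows "evaluate ev (free_map (OX U) (OX V) (rst V) \<sigma> f) (x, i) = evaluate ev f (x, i)"
proof -
 let ?T = "{s. f s ~= (%x. 0)}" and ?g = "free_map (OX U) (OX V) (rst V) \<sigma> f"
 have T: "finite ?T" "?T \<subseteq> S" using f by (auto simp: frees_def)
 have eq: "?g = (%t x. \<Sum>s\<in>?T. if \<sigma> s = t then rst V (f s) x else 0)"
  by (rule free_map_eq[OF U V f T(1)]) simp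
 have "{t. ?g t ~= (%x. 0)} \<subseteq> \<sigma> ` ?T"
 proof
  fix t assume "t \<in> {t. ?g t ~= (%x. 0)}"
  then obtain x where "(\<Sum>s\<in>?T. if \<sigma> s = t then rst V (f s) x else 0) ~= 0" unfolding eq by auto
  then obtain s where "s \<in> ?T" "(if \<sigma> s = t then rst V (f s) x else 0) ~= 0"
    by (rule sum.not_neutral_contains_not_neutral)
   then have "s \<in> ?T" "\<sigma> s = t" by (auto split: if_splits)
  then show "t \<in> \<sigma> ` ?T" by blast
 qed
 then have "evaluate ev ?g (x, i) = (\<Sum>t\<in>\<sigma> ` ?T. ?g t x * ev t (x, i))"
  using T by (intro evaluate_superset) auto
 also have "\<dots> = (\<Sum>t\<in>\<sigma> ` ?T. \<Sum>s\<in>{s \<in> ?T. \<sigma> s = t}. f s x * ev s (x, i))"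
 proof (rule sum.cong[OF refl])
  fix t
  have "?g t x = (\<Sum>s\<in>{s \<in> ?T. \<sigma> s = t}. f s x)"
   unfolding eq using T(1) x by (simp only: sum.inter_filter) (simp add: rst_def cong: if_cong)
  then have "?g t x * ev t (x, i) = (\<Sum>s\<in>{s \<in> ?T. \<sigma> s = t}. f s x * ev t (x, i))" by (simp add: sum_distrib_right)
  also have "\<dots> = (\<Sum>s\<in>{s \<in> ?T. \<sigma> s = t}. f s x * ev s (x, i))"
   by (rule sum.cong[OF refl]) (use ev T(2) in auto)
  finally show "?g t x * ev t (x, i) = (\<Sum>s\<in>{s \<in> ?T. \<sigma> s = t}. f s x * ev s (x, i))" .
 qed
 also have "\<dots> = (\<Sum>s\<in>?T. f s x * ev s (x, i))"
  by (rule sum.image_gen[symmetric]) (rule T)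
 also have "\<dots> = evaluate ev f (x, i)" by (simp add: evaluate_def)
 finally show ?thesis .
qed

end

section \<open>Sheafification of presheaves with pointwise values\<close>

text \<open>A presheaf of modules whose sections take values at the points of the cone, such that two
  sections have the same germ as soon as their values agree near the point. Its associated
  sheaf consists of the functions that locally are values of sections.\<close>

locale valued_presheaf = smooth_quartic +
 fixes P :: "(point, complex ^ 4 => complex, 'm) presheaf"
  and val :: "point set => 'm => (complex ^ 4) \<times> 'i => complex"
 assumes add_in: "openX U ==> m \<in> carrier (sec P U) ==> n \<in> carrier (sec P U) ==> m \<oplus>\<^bsub>sec P U\<^esub> n \<in> carrier (sec P U)"
  and zero_in: "openX U ==> \<zero>\<^bsub>sec P U\<^esub> \<in> carrier (sec P U)"
  and smult_in: "openX U ==> Reg 0 U a ==> m \<in> carrier (sec P U) ==> a \<odot>\<^bsub>sec P U\<^esub> m \<in> carrier (sec P U)"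
  and res_in: "openX U ==> openX V ==> V \<subseteq> U ==> m \<in> carrier (sec P U) ==> res P U V m \<in> carrier (sec P V)"
  and val_add: "openX U ==> m \<in> carrier (sec P U) ==> n \<in> carrier (sec P U) ==> val U (m \<oplus>\<^bsub>sec P U\<^esub> n) (x, i) = val U m (x, i) + val U n (x, i)"
  and val_zero: "openX U ==> val U \<zero>\<^bsub>sec P U\<^esub> (x, i) = 0"
  and val_smult: "openX U ==> Reg 0 U a ==> m \<in> carrier (sec P U) ==> val U (a \<odot>\<^bsub>sec P U\<^esub> m) (x, i) = a x * val U m (x, i)"
  and val_res: "openX U ==> openX V ==> V \<subseteq> U ==> m \<in> carrier (sec P U) ==> x \<in> over V ==> val V (res P U V m) (x, i) = val U m (x, i)"
  and separated: "openX U ==> openX V ==> openX W ==> p \<in> W ==> W \<subseteq> U \<inter> V ==> m \<in> carrier (sec P U) ==> n \<in> carrier (sec P V) ==>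
   (!!x i. x \<in> over W ==> val U m (x, i) = val V n (x, i)) ==>
   \<exists>W'. openX W' & p \<in> W' & W' \<subseteq> U \<inter> V & res P U W' m = res P V W' n"
begin

lemma in_germ_iff:
 assumes U: "openX U" and m: "m \<in> carrier (sec P U)"
 shows "(V, n) \<in> germ X P p U m \<longleftrightarrow> openX V & p \<in> V & n \<in> carrier (sec P V) &
  (\<exists>W. openX W & p \<in> W & W \<subseteq> U \<inter> V & (\<forall>x\<in>over W. \<forall>i. val U m (x, i) = val V n (x, i)))"
proof
 assume "(V, n) \<in> germ X P p U m"
 then obtain W where V: "openX V" "p \<in> V" "n \<in> carrier (sec P V)" and W: "openX W" "p \<in> W" "W \<subseteq> U \<inter> V" "res P U W m = res P V W n"
  by (auto simp: germ_def)
 have "val U m (x, i) = val V n (x, i)" if "x \<in> over W" for x i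
  using val_res[OF U W(1) _ m that, of i] val_res[OF V(1) W(1) _ V(3) that, of i] W(3,4) by auto
 then show "openX V & p \<in> V & n \<in> carrier (sec P V) &
  (\<exists>W. openX W & p \<in> W & W \<subseteq> U \<inter> V & (\<forall>x\<in>over W. \<forall>i. val U m (x, i) = val V n (x, i)))" using V W by blast
next
 assume R: "openX V & p \<in> V & n \<in> carrier (sec P V) &
  (\<exists>W. openX W & p \<in> W & W \<subseteq> U \<inter> V & (\<forall>x\<in>over W. \<forall>i. val U m (x, i) = val V n (x, i)))"
 then obtain W where W: "openX W" "p \<in> W" "W \<subseteq> U \<inter> V" "\<forall>x\<in>over W. \<forall>i. val U m (x, i) = val V n (x, i)" by blast
 then have "\<exists>W'. openX W' & p \<in> W' & W' \<subseteq> U \<inter> V & res P U W' m = res P V W' n"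
  using R m by (intro separated[OF U _ W(1,2,3)]) auto
 then show "(V, n) \<in> germ X P p U m" using R by (auto simp: germ_def)
qed

lemma germ_self: "openX U ==> m \<in> carrier (sec P U) ==> p \<in> U ==> (U, m) \<in> germ X P p U m"
 by (subst in_germ_iff) auto

lemma germ_eqI:
 assumes U: "openX U" "m \<in> carrier (sec P U)" and V: "openX V" "n \<in> carrier (sec P V)"
  and W: "openX W" "p \<in> W" "W \<subseteq> U \<inter> V" "!!x i. x \<in> over W ==> val U m (x, i) = val V n (x, i)"
 shows "germ X P p U m = germ X P p V n"
proof -
 have sub: "y \<in> germ X P p V n" if U: "openX U" "m \<in> carrier (sec P U)" and V: "openX V" "n \<in> carrier (sec P V)"
  and W: "openX W" "p \<in> W" "W \<subseteq> U \<inter> V" "!!x i. x \<in> over W ==> val U m (x, i) = val V n (x, i)"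
  and y: "y \<in> germ X P p U m" for U m V n y
 proof -
  obtain V' n' where y': "y = (V', n')" by (cases y)
  obtain W' where W': "openX V'" "p \<in> V'" "n' \<in> carrier (sec P V')" "openX W'" "p \<in> W'" "W' \<subseteq> U \<inter> V'"
    "\<forall>x\<in>over W'. \<forall>i. val U m (x, i) = val V' n' (x, i)"
   using y unfolding y' in_germ_iff[OF U] by blast
  have "\<forall>x\<in>over (W \<inter> W'). \<forall>i. val V n (x, i) = val V' n' (x, i)"
   using W(4) W'(7) over_mono[of "W \<inter> W'" W] over_mono[of "W \<inter> W'" W'] by (metis Int_lower1 Int_lower2 subsetD)
  moreover have "openX (W \<inter> W')" "p \<in> W \<inter> W'" "W \<inter> W' \<subseteq> V \<inter> V'" using W W' by auto
  ultimately show ?thesis unfolding y' in_germ_iff[OF V] using W' by blast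
 qed
 show ?thesis
  using sub[OF U V W] sub[OF V U W(1,2) _ W(4)[symmetric]] W(3) by blast
qed

abbreviation "SP \<equiv> sheafify X P"

lemma SP_local:
 assumes "s \<in> carrier (sec SP U)" "p \<in> U"
 obtains V m where "openX V" "p \<in> V" "V \<subseteq> U" "m \<in> carrier (sec P V)" "!!q. q \<in> V ==> s q = germ X P q V m"
 using assms unfolding sheafify_def by auto

lemma SP_off: "s \<in> carrier (sec SP U) ==> p \<notin> U ==> s p = {}"
 by (simp add: sheafify_def)

lemma SP_I:
 assumes "!!p. p \<notin> U ==> s p = {}"
  "!!p. p \<in> U ==> \<exists>V m. openX V & p \<in> V & V \<subseteq> U & m \<in> carrier (sec P V) & (\<forall>q\<in>V. s q = germ X P q V m)"
 shows "s \<in> carrier (sec SP U)"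
 using assms by (simp add: sheafify_def)

text \<open>The value of a germ is computed from any of its representatives; the point determines the germ, the
  vector on its line the value.\<close>

definition Val :: "(point => (point set \<times> 'm) set) => (complex ^ 4) \<times> 'i => complex" where
 "Val s = (%(x, i). if s (line x) = {} \<or> x = 0 then 0 else let y = (SOME y. y \<in> s (line x)) in val (fst y) (snd y) (x, i))"

lemma Val_germ:
 assumes V: "openX V" and m: "m \<in> carrier (sec P V)" and s: "s (line x) = germ X P (line x) V m" and x: "x \<in> over V"
 shows "Val s (x, i) = val V m (x, i)"
proof -
 have lx: "x ~= 0" "line x \<in> V" using x in_coneX_iff[OF V] by blast+
 then have ne: "s (line x) ~= {}" using germ_self[OF V m] s by blast
 define y where "y = (SOME y. y \<in> s (line x))"
 have "y \<in> germ X P (line x) V m" using ne some_in_eq[of "s (line x)"] by (simp add: y_def s)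
 then have "(fst y, snd y) \<in> germ X P (line x) V m" by simp
 then obtain W where W: "openX W" "line x \<in> W" "\<forall>z\<in>over W. \<forall>i. val V m (z, i) = val (fst y) (snd y) (z, i)"
  unfolding in_germ_iff[OF V m] by blast
 have "x \<in> over W" using in_coneX_iff[OF W(1)] W(2) lx by blast
 then show ?thesis using ne lx W(3) by (simp add: Val_def Let_def flip: y_def)
qed

lemma Val_off: "s \<in> carrier (sec SP U) ==> openX U ==> x \<notin> over U ==> Val s (x, i) = 0"
 using SP_off[of s U "line x"] in_coneX_iff[of U x] by (auto simp: Val_def)

lemma Val_local:
 assumes "s \<in> carrier (sec SP U)" "p \<in> U"
 obtains V m where "openX V" "p \<in> V" "V \<subseteq> U" "m \<in> carrier (sec P V)" "!!x i. x \<in> over V ==> Val s (x, i) = val V m (x, i)"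
proof -
 obtain V m where V: "openX V" "p \<in> V" "V \<subseteq> U" "m \<in> carrier (sec P V)" "!!q. q \<in> V ==> s q = germ X P q V m"
  using SP_local[OF assms] by blast
 have "Val s (x, i) = val V m (x, i)" if "x \<in> over V" for x i
  using that in_coneX_iff[OF V(1)] V by (intro Val_germ[OF V(1,4)]) auto
 then show ?thesis using V that by blast
qed

text \<open>Separatedness: equal values near a point give equal germs, and a section is the family of its germs.\<close>

lemma Val_inject:
 assumes U: "openX U" and s: "s \<in> carrier (sec SP U)" and t: "t \<in> carrier (sec SP U)"
  and eq: "!!x i. x \<in> over U ==> Val s (x, i) = Val t (x, i)"
 shows "s = t"
proof
 fix p
 show "s p = t p"
 proof (cases "p \<in> U")
  case True
  obtain V m where V: "openX V" "p \<in> V" "V \<subseteq> U" "m \<in> carrier (sec P V)" "!!q. q \<in> V ==> s q = germ X P q V m"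
   using SP_local[OF s True] by blast
  obtain V' m' where V': "openX V'" "p \<in> V'" "V' \<subseteq> U" "m' \<in> carrier (sec P V')" "!!q. q \<in> V' ==> t q = germ X P q V' m'"
   using SP_local[OF t True] by blast
  have "germ X P p V m = germ X P p V' m'"
  proof (rule germ_eqI[OF V(1,4) V'(1,4), of "V \<inter> V'"])
   fix x i assume x: "x \<in> over (V \<inter> V')"
   then have xV: "x \<in> over V" "x \<in> over V'" using cone_Int[OF V(1) V'(1)] by auto
   then have "line x \<in> V" "line x \<in> V'" using in_coneX_iff V(1) V'(1) by blast+
   then have "Val s (x, i) = val V m (x, i)" "Val t (x, i) = val V' m' (x, i)"
    using xV V V' by (auto intro: Val_germ)
   then show "val V m (x, i) = val V' m' (x, i)" using eq[of x i] over_mono[OF V(3)] xV by auto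
  qed (use V V' in auto)
  then show ?thesis using V V' by simp
 qed (use SP_off s t in auto)
qed

text \<open>Representatives that agree in value on overlaps define the same germs, so their germs fit together.\<close>

lemma Val_surject:
 assumes U: "openX U" and off: "!!x i. x \<notin> over U ==> \<eta> (x, i) = 0"
  and loc: "!!p. p \<in> U ==> \<exists>V m. openX V & p \<in> V & V \<subseteq> U & m \<in> carrier (sec P V) & (\<forall>x\<in>over V. \<forall>i. \<eta> (x, i) = val V m (x, i))"
 obtains s where "s \<in> carrier (sec SP U)" "Val s = \<eta>"
proof -
 obtain V m where V: "!!p. p \<in> U ==> openX (V p) & p \<in> V p & V p \<subseteq> U & m p \<in> carrier (sec P (V p)) & (\<forall>x\<in>over (V p). \<forall>i. \<eta> (x, i) = val (V p) (m p) (x, i))"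
  using loc by metis
 define s where "s p = (if p \<in> U then germ X P p (V p) (m p) else {})" for p
 have eq: "s q = germ X P q (V p) (m p)" if p: "p \<in> U" and q: "q \<in> V p" for p q
 proof -
  have qU: "q \<in> U" using V[OF p] q by blast
  have "germ X P q (V q) (m q) = germ X P q (V p) (m p)"
  proof (rule germ_eqI[of _ _ _ _ "V q \<inter> V p"])
   fix x i assume "x \<in> over (V q \<inter> V p)"
   then show "val (V q) (m q) (x, i) = val (V p) (m p) (x, i)"
    using V[OF p] V[OF qU] cone_Int by force
  qed (use V[OF p] V[OF qU] q in auto)
  then show ?thesis using qU by (simp add: s_def)
 qed
 have sin: "s \<in> carrier (sec SP U)"
 proof (rule SP_I)
  fix p assume p: "p \<in> U"
  show "\<exists>V m. openX V & p \<in> V & V \<subseteq> U & m \<in> carrier (sec P V) & (\<forall>q\<in>V. s q = germ X P q V m)"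
   using V[OF p] eq[OF p] by (intro exI[of _ "V p"] exI[of _ "m p"]) blast
 qed (simp add: s_def)
 have "Val s (x, i) = \<eta> (x, i)" for x i
 proof (cases "x \<in> over U")
  case True
  then have p: "line x \<in> U" "x ~= 0" using in_coneX_iff[OF U] by blast+
  then have "x \<in> over (V (line x))" using in_coneX_iff V[OF p(1)] by blast
  then show ?thesis using Val_germ[of "V (line x)" "m (line x)" s x i] V[OF p(1)] eq[OF p(1)] by auto
 qed (use off Val_off[OF sin U] in auto)
 then have "Val s = \<eta>" by auto
 then show ?thesis by (rule that[OF sin])
qed

lemma SP_zero_in: "openX U ==> \<zero>\<^bsub>sec SP U\<^esub> \<in> carrier (sec SP U)"
 by (rule SP_I) (auto simp: sheafify_def intro!: exI[of _ U] exI[of _ "\<zero>\<^bsub>sec P U\<^esub>"] zero_in)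

lemma Val_zero:
 assumes U: "openX U" shows "Val \<zero>\<^bsub>sec SP U\<^esub> (x, i) = 0"
proof (cases "x \<in> over U")
 case True
 then have "line x \<in> U" using in_coneX_iff[OF U] by blast
 then have "Val \<zero>\<^bsub>sec SP U\<^esub> (x, i) = val U \<zero>\<^bsub>sec P U\<^esub> (x, i)"
  by (intro Val_germ[OF U zero_in[OF U] _ True]) (simp add: sheafify_def)
 then show ?thesis using val_zero[OF U] by simp
qed (use Val_off[OF SP_zero_in[OF U] U] in simp)

text \<open>Pointwise operations on families of germs: all representatives give the same germ.\<close>

lemma germ_add:
 assumes V: "openX V" "m \<in> carrier (sec P V)" and W: "openX W" "n \<in> carrier (sec P W)" and q: "q \<in> V" "q \<in> W"
 shows "(\<Union>(V', m')\<in>germ X P q V m. \<Union>(W', n')\<in>germ X P q W n. germ X P q (V' \<inter> W') (res P V' (V' \<inter> W') m' \<oplus>\<^bsub>sec P (V' \<inter> W')\<^esub> res P W' (V' \<inter> W') n'))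
  = germ X P q (V \<inter> W) (res P V (V \<inter> W) m \<oplus>\<^bsub>sec P (V \<inter> W)\<^esub> res P W (V \<inter> W) n)" (is "?L = ?R")
proof -
 have "germ X P q (V' \<inter> W') (res P V' (V' \<inter> W') m' \<oplus>\<^bsub>sec P (V' \<inter> W')\<^esub> res P W' (V' \<inter> W') n') = ?R"
  if a: "(V', m') \<in> germ X P q V m" and b: "(W', n') \<in> germ X P q W n" for V' m' W' n'
 proof -
  obtain A where A: "openX V'" "q \<in> V'" "m' \<in> carrier (sec P V')" "openX A" "q \<in> A" "A \<subseteq> V \<inter> V'"
   "\<forall>x\<in>over A. \<forall>i. val V m (x, i) = val V' m' (x, i)" using a unfolding in_germ_iff[OF V] by blast
  obtain B where B: "openX W'" "q \<in> W'" "n' \<in> carrier (sec P W')" "openX B" "q \<in> B" "B \<subseteq> W \<inter> W'"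
   "\<forall>x\<in>over B. \<forall>i. val W n (x, i) = val W' n' (x, i)" using b unfolding in_germ_iff[OF W] by blast
  have o: "openX (V \<inter> W)" "openX (V' \<inter> W')" "openX (A \<inter> B)" using V W A B by auto
  have r: "res P V (V \<inter> W) m \<in> carrier (sec P (V \<inter> W))" "res P W (V \<inter> W) n \<in> carrier (sec P (V \<inter> W))"
   "res P V' (V' \<inter> W') m' \<in> carrier (sec P (V' \<inter> W'))" "res P W' (V' \<inter> W') n' \<in> carrier (sec P (V' \<inter> W'))"
   using res_in[OF V(1) o(1) _ V(2)] res_in[OF W(1) o(1) _ W(2)] res_in[OF A(1) o(2) _ A(3)] res_in[OF B(1) o(2) _ B(3)] by auto
  show ?thesis
  proof (rule germ_eqI[OF o(2) _ o(1) _ o(3)])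
   fix x i assume "x \<in> over (A \<inter> B)"
   then have x: "x \<in> over A" "x \<in> over B" using cone_Int[OF A(4) B(4)] by auto
   moreover have "over A \<subseteq> over V" "over A \<subseteq> over V'" "over B \<subseteq> over W" "over B \<subseteq> over W'"
    using A(6) B(6) by (auto intro!: over_mono)
   ultimately have "x \<in> over (V \<inter> W)" "x \<in> over (V' \<inter> W')"
    using cone_Int[OF V(1) W(1)] cone_Int[OF A(1) B(1)] by auto
   then have "val (V' \<inter> W') (res P V' (V' \<inter> W') m') (x, i) = val V m (x, i)"
     "val (V' \<inter> W') (res P W' (V' \<inter> W') n') (x, i) = val W n (x, i)"
     "val (V \<inter> W) (res P V (V \<inter> W) m) (x, i) = val V m (x, i)"
     "val (V \<inter> W) (res P W (V \<inter> W) n) (x, i) = val W n (x, i)"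
    using val_res[OF V(1) o(1) _ V(2), of x i] val_res[OF W(1) o(1) _ W(2), of x i] val_res[OF A(1) o(2) _ A(3), of x i] val_res[OF B(1) o(2) _ B(3), of x i]
     A(7) B(7) x by auto
   then show "val (V' \<inter> W') (res P V' (V' \<inter> W') m' \<oplus>\<^bsub>sec P (V' \<inter> W')\<^esub> res P W' (V' \<inter> W') n') (x, i)
     = val (V \<inter> W) (res P V (V \<inter> W) m \<oplus>\<^bsub>sec P (V \<inter> W)\<^esub> res P W (V \<inter> W) n) (x, i)"
    by (simp only: val_add[OF o(2) r(3,4)] val_add[OF o(1) r(1,2)])
  qed (use A B r o add_in in auto)
 qed
 then have inner: "(\<Union>(W', n')\<in>germ X P q W n. germ X P q (V' \<inter> W') (res P V' (V' \<inter> W') m' \<oplus>\<^bsub>sec P (V' \<inter> W')\<^esub> res P W' (V' \<inter> W') n')) = ?R"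
  if "(V', m') \<in> germ X P q V m" for V' m'
  using that germ_self[OF W q(2)] by (intro SUP_eq_const) blast+
 show ?thesis
 proof (rule SUP_eq_const)
  show "germ X P q V m ~= {}" using germ_self[OF V q(1)] by blast
 next
  fix y assume "y \<in> germ X P q V m"
  then show "(case y of (V', m') => \<Union>(W', n')\<in>germ X P q W n. germ X P q (V' \<inter> W') (res P V' (V' \<inter> W') m' \<oplus>\<^bsub>sec P (V' \<inter> W')\<^esub> res P W' (V' \<inter> W') n')) = ?R"
   by (cases y) (simp only: prod.case inner)
 qed
qed

lemma germ_smult:
 assumes U: "openX U" and a: "Reg 0 U a" and V: "openX V" "m \<in> carrier (sec P V)" "V \<subseteq> U" and q: "q \<in> V"
 shows "(\<Union>(V', m')\<in>germ X P q V m. germ X P q (U \<inter> V') (rst (U \<inter> V') a \<odot>\<^bsub>sec P (U \<inter> V')\<^esub> res P V' (U \<inter> V') m'))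
  = germ X P q V (rst V a \<odot>\<^bsub>sec P V\<^esub> m)" (is "?L = ?R")
proof -
 have aV: "Reg 0 W (rst W a)" if "openX W" "W \<subseteq> U" for W by (rule Reg_rst[OF U that(1) over_mono[OF that(2)] a])
 have "germ X P q (U \<inter> V') (rst (U \<inter> V') a \<odot>\<^bsub>sec P (U \<inter> V')\<^esub> res P V' (U \<inter> V') m') = ?R"
  if b: "(V', m') \<in> germ X P q V m" for V' m'
 proof -
  obtain A where A: "openX V'" "q \<in> V'" "m' \<in> carrier (sec P V')" "openX A" "q \<in> A" "A \<subseteq> V \<inter> V'"
   "\<forall>x\<in>over A. \<forall>i. val V m (x, i) = val V' m' (x, i)" using b unfolding in_germ_iff[OF V(1,2)] by blast
  have o: "openX (U \<inter> V')" using U A by auto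
  have r: "res P V' (U \<inter> V') m' \<in> carrier (sec P (U \<inter> V'))" using res_in[OF A(1) o _ A(3)] by auto
  have aUV: "Reg 0 (U \<inter> V') (rst (U \<inter> V') a)" using aV[OF o] by simp
  show ?thesis
  proof (rule germ_eqI[OF o _ V(1) _ A(4)])
   fix x i assume x: "x \<in> over A"
   have "over A \<subseteq> over V" "over A \<subseteq> over V'" "over V \<subseteq> over U"
    using A(6) V(3) by (auto intro!: over_mono)
   then have xx: "x \<in> over V" "x \<in> over (U \<inter> V')" using x cone_Int[OF U A(1)] by auto
   show "val (U \<inter> V') (rst (U \<inter> V') a \<odot>\<^bsub>sec P (U \<inter> V')\<^esub> res P V' (U \<inter> V') m') (x, i) = val V (rst V a \<odot>\<^bsub>sec P V\<^esub> m) (x, i)"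
    unfolding val_smult[OF o aUV r] val_smult[OF V(1) aV[OF V(1,3)] V(2)]
    using val_res[OF A(1) o _ A(3) xx(2), of i] A(7) x xx by (simp add: rst_def)
  qed (use A V r o smult_in aUV aV[OF V(1,3)] in auto)
 qed
 then show ?thesis
  using germ_self[OF V(1,2) q] by (intro SUP_eq_const) blast+
qed

lemma SP_add:
 assumes U: "openX U" and s: "s \<in> carrier (sec SP U)" and t: "t \<in> carrier (sec SP U)"
 shows "s \<oplus>\<^bsub>sec SP U\<^esub> t \<in> carrier (sec SP U)" "Val (s \<oplus>\<^bsub>sec SP U\<^esub> t) (x, i) = Val s (x, i) + Val t (x, i)"
proof -
 let ?st = "s \<oplus>\<^bsub>sec SP U\<^esub> t"
 have loc: "\<exists>V m. openX V & p \<in> V & V \<subseteq> U & m \<in> carrier (sec P V) & (\<forall>q\<in>V. ?st q = germ X P q V m) &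
   (\<forall>x\<in>over V. \<forall>i. val V m (x, i) = Val s (x, i) + Val t (x, i))" if p: "p \<in> U" for p
 proof -
  obtain V m where V: "openX V" "p \<in> V" "V \<subseteq> U" "m \<in> carrier (sec P V)" "!!q. q \<in> V ==> s q = germ X P q V m"
   using SP_local[OF s p] by blast
  obtain W n where W: "openX W" "p \<in> W" "W \<subseteq> U" "n \<in> carrier (sec P W)" "!!q. q \<in> W ==> t q = germ X P q W n"
   using SP_local[OF t p] by blast
  let ?m = "res P V (V \<inter> W) m \<oplus>\<^bsub>sec P (V \<inter> W)\<^esub> res P W (V \<inter> W) n"
  have o: "openX (V \<inter> W)" using V W by auto
  have r: "res P V (V \<inter> W) m \<in> carrier (sec P (V \<inter> W))" "res P W (V \<inter> W) n \<in> carrier (sec P (V \<inter> W))"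
   using res_in[OF V(1) o _ V(4)] res_in[OF W(1) o _ W(4)] by auto
  have g: "?st q = germ X P q (V \<inter> W) ?m" if q: "q \<in> V \<inter> W" for q
  proof -
   have "?st q = (\<Union>(V', m')\<in>s q. \<Union>(W', n')\<in>t q. germ X P q (V' \<inter> W') (res P V' (V' \<inter> W') m' \<oplus>\<^bsub>sec P (V' \<inter> W')\<^esub> res P W' (V' \<inter> W') n'))"
    by (simp add: sheafify_def)
   then show ?thesis using germ_add[OF V(1,4) W(1,4)] q V(5) W(5) by auto
  qed
  have v: "val (V \<inter> W) ?m (x, i) = Val s (x, i) + Val t (x, i)" if x: "x \<in> over (V \<inter> W)" for x i
  proof -
   have xx: "x \<in> over V" "x \<in> over W" using x cone_Int[OF V(1) W(1)] by auto
   then have lx: "line x \<in> V" "line x \<in> W" using in_coneX_iff V(1) W(1) by blast+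
   have "Val s (x, i) = val V m (x, i)" "Val t (x, i) = val W n (x, i)"
    using Val_germ[of V m s x i, OF V(1,4) V(5)[OF lx(1)] xx(1)] Val_germ[of W n t x i, OF W(1,4) W(5)[OF lx(2)] xx(2)] by auto
   then show ?thesis using val_res[OF V(1) o _ V(4) x, of i] val_res[OF W(1) o _ W(4) x, of i] by (simp add: val_add[OF o r])
  qed
  have "p \<in> V \<inter> W" "V \<inter> W \<subseteq> U" using V W by auto
  then show ?thesis using o g v add_in[OF o r] by (intro exI[of _ "V \<inter> W"] exI[of _ ?m]) blast
 qed
 have off: "?st p = {}" if "p \<notin> U" for p using SP_off[OF s that] by (simp add: sheafify_def)
 show sin: "?st \<in> carrier (sec SP U)"
 proof (rule SP_I)
  show "\<exists>V m. openX V & p \<in> V & V \<subseteq> U & m \<in> carrier (sec P V) & (\<forall>q\<in>V. ?st q = germ X P q V m)"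
   if p: "p \<in> U" for p
   using loc[OF p] by (elim exE conjE) (intro exI conjI; assumption)
 qed (rule off)
 show "Val ?st (x, i) = Val s (x, i) + Val t (x, i)"
 proof (cases "x \<in> over U")
  case True
  then have lx: "line x \<in> U" "x ~= 0" using in_coneX_iff[OF U] by blast+
  obtain V m where V: "openX V" "line x \<in> V" "m \<in> carrier (sec P V)" "\<forall>q\<in>V. ?st q = germ X P q V m"
   "\<forall>x\<in>over V. \<forall>i. val V m (x, i) = Val s (x, i) + Val t (x, i)" using loc[OF lx(1)] by (elim exE conjE)
  have "x \<in> over V" using in_coneX_iff[OF V(1)] V(2) lx by blast
  then show ?thesis using Val_germ[OF V(1,3), of ?st x i] V by simp
 qed (use Val_off[OF sin U] Val_off[OF s U] Val_off[OF t U] in simp)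
qed

lemma SP_smult:
 assumes U: "openX U" and a: "Reg 0 U a" and s: "s \<in> carrier (sec SP U)"
 shows "a \<odot>\<^bsub>sec SP U\<^esub> s \<in> carrier (sec SP U)" "Val (a \<odot>\<^bsub>sec SP U\<^esub> s) (x, i) = a x * Val s (x, i)"
proof -
 let ?as = "a \<odot>\<^bsub>sec SP U\<^esub> s"
 have loc: "\<exists>V m. openX V & p \<in> V & V \<subseteq> U & m \<in> carrier (sec P V) & (\<forall>q\<in>V. ?as q = germ X P q V m) &
   (\<forall>x\<in>over V. \<forall>i. val V m (x, i) = a x * Val s (x, i))" if p: "p \<in> U" for p
 proof -
  obtain V m where V: "openX V" "p \<in> V" "V \<subseteq> U" "m \<in> carrier (sec P V)" "!!q. q \<in> V ==> s q = germ X P q V m"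
   using SP_local[OF s p] by blast
  let ?m = "rst V a \<odot>\<^bsub>sec P V\<^esub> m"
  have aV: "Reg 0 V (rst V a)" by (rule Reg_rst[OF U V(1) over_mono[OF V(3)] a])
  have g: "?as q = germ X P q V ?m" if q: "q \<in> V" for q
  proof -
   have "?as q = (\<Union>(V', m')\<in>s q. germ X P q (U \<inter> V') (rst (U \<inter> V') a \<odot>\<^bsub>sec P (U \<inter> V')\<^esub> res P V' (U \<inter> V') m'))"
    by (simp add: sheafify_def str_X)
   then show ?thesis using germ_smult[OF U a V(1,4,3) q] q V(5) by auto
  qed
  have v: "val V ?m (x, i) = a x * Val s (x, i)" if x: "x \<in> over V" for x i
  proof -
   have lx: "line x \<in> V" using in_coneX_iff V(1) x by blast
   have "Val s (x, i) = val V m (x, i)" using Val_germ[of V m s x i, OF V(1,4) V(5)[OF lx] x] by auto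
   then show ?thesis using x unfolding val_smult[OF V(1) aV V(4)] by (simp add: rst_def)
  qed
  show ?thesis using V g v smult_in[OF V(1) aV V(4)] by (intro exI[of _ V] exI[of _ ?m]) blast
 qed
 have off: "?as p = {}" if "p \<notin> U" for p using SP_off[OF s that] by (simp add: sheafify_def)
 show sin: "?as \<in> carrier (sec SP U)"
 proof (rule SP_I)
  show "\<exists>V m. openX V & p \<in> V & V \<subseteq> U & m \<in> carrier (sec P V) & (\<forall>q\<in>V. ?as q = germ X P q V m)"
   if p: "p \<in> U" for p
   using loc[OF p] by (elim exE conjE) (intro exI conjI; assumption)
 qed (rule off)
 show "Val ?as (x, i) = a x * Val s (x, i)"
 proof (cases "x \<in> over U")
  case True
  then have lx: "line x \<in> U" "x ~= 0" using in_coneX_iff[OF U] by blast+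
  obtain V m where V: "openX V" "line x \<in> V" "m \<in> carrier (sec P V)" "\<forall>q\<in>V. ?as q = germ X P q V m"
   "\<forall>x\<in>over V. \<forall>i. val V m (x, i) = a x * Val s (x, i)" using loc[OF lx(1)] by (elim exE conjE)
  have "x \<in> over V" using in_coneX_iff[OF V(1)] V(2) lx by blast
  then show ?thesis using Val_germ[OF V(1,3), of ?as x i] V by simp
 qed (use Val_off[OF sin U] Val_off[OF s U] in simp)
qed

lemma SP_res:
 assumes U: "openX U" and V: "openX V" "V \<subseteq> U" and s: "s \<in> carrier (sec SP U)"
 shows "res SP U V s \<in> carrier (sec SP V)" "x \<in> over V ==> Val (res SP U V s) (x, i) = Val s (x, i)"
proof -
 have eq: "res SP U V s = (%p. if p \<in> V then s p else {})" by (simp add: sheafify_def)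
 show "res SP U V s \<in> carrier (sec SP V)"
 proof (rule SP_I)
  fix p assume p: "p \<in> V"
  then obtain W m where W: "openX W" "p \<in> W" "W \<subseteq> U" "m \<in> carrier (sec P W)" "!!q. q \<in> W ==> s q = germ X P q W m"
   using SP_local[OF s, of p] V by blast
  let ?m = "res P W (W \<inter> V) m"
  have o: "openX (W \<inter> V)" using W V by auto
  have r: "?m \<in> carrier (sec P (W \<inter> V))" using res_in[OF W(1) o _ W(4)] by auto
  have "germ X P q W m = germ X P q (W \<inter> V) ?m" if "q \<in> W \<inter> V" for q
   by (rule germ_eqI[OF W(1,4) o r o]) (use that val_res[OF W(1) o _ W(4)] in auto)
  then show "\<exists>W m. openX W & p \<in> W & W \<subseteq> V & m \<in> carrier (sec P W) & (\<forall>q\<in>W. res SP U V s q = germ X P q W m)"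
   using o r p W by (intro exI[of _ "W \<inter> V"] exI[of _ ?m]) (auto simp: eq)
 qed (simp add: eq)
 assume "x \<in> over V"
 then have "line x \<in> V" using in_coneX_iff[OF V(1)] by blast
 then show "Val (res SP U V s) (x, i) = Val s (x, i)" by (simp add: Val_def eq)
qed

end

section \<open>Presented presheaves with two local generators\<close>

context presentation
begin

text \<open>A representation by two generators modulo the relations. Together with the independence of the values
  of the generators it shows that equal values imply equal classes.\<close>

definition spanned :: "'s => 's => ('s => complex ^ 4 => complex) => bool" where
 "spanned g h f \<longleftrightarrow> (\<exists>c d. Reg 0 U c & Reg 0 U d & (%s x. f s x - (c x * gen U g s x + d x * gen U h s x)) \<in> N)"

lemma spanned_N:
 assumes "spanned g h f" "(%s x. f' s x - f s x) \<in> N" shows "spanned g h f'"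
proof -
 obtain c d where cd: "Reg 0 U c" "Reg 0 U d" "(%s x. f s x - (c x * gen U g s x + d x * gen U h s x)) \<in> N"
  using assms(1) by (auto simp: spanned_def)
 have "(%s x. (f' s x - f s x) + (f s x - (c x * gen U g s x + d x * gen U h s x)))
   = (%s x. f' s x - (c x * gen U g s x + d x * gen U h s x))" by (intro ext) (simp add: algebra_simps)
 with N_add[OF assms(2) cd(3)] show ?thesis unfolding spanned_def using cd(1,2) by (auto intro: exI[of _ c] exI[of _ d])
qed

lemma spanned_zero: "spanned g h (%s x. 0)"
 unfolding spanned_def
 by (intro exI[of _ "%x. 0"]) (simp add: N_zero Reg_zero[OF openU])

lemma spanned_add:
 assumes "spanned g h f" "spanned g h f'" shows "spanned g h (%s x. f s x + f' s x)"
proof -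
 obtain c d where cd: "Reg 0 U c" "Reg 0 U d" "(%s x. f s x - (c x * gen U g s x + d x * gen U h s x)) \<in> N"
  using assms(1) by (auto simp: spanned_def)
 obtain c' d' where cd': "Reg 0 U c'" "Reg 0 U d'" "(%s x. f' s x - (c' x * gen U g s x + d' x * gen U h s x)) \<in> N"
  using assms(2) by (auto simp: spanned_def)
 have "(%s x. (f s x - (c x * gen U g s x + d x * gen U h s x)) + (f' s x - (c' x * gen U g s x + d' x * gen U h s x)))
   = (%s x. f s x + f' s x - ((c x + c' x) * gen U g s x + (d x + d' x) * gen U h s x))"
  by (intro ext) (simp add: algebra_simps)
 with N_add[OF cd(3) cd'(3)] show ?thesis unfolding spanned_def using cd cd' Reg_add[OF openU]
  by (intro exI[of _ "%x. c x + c' x"] exI[of _ "%x. d x + d' x"]) simp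
qed

lemma spanned_smult:
 assumes "spanned g h f" "Reg 0 U a" shows "spanned g h (%s x. a x * f s x)"
proof -
 obtain c d where cd: "Reg 0 U c" "Reg 0 U d" "(%s x. f s x - (c x * gen U g s x + d x * gen U h s x)) \<in> N"
  using assms(1) by (auto simp: spanned_def)
 have "(%s x. a x * (f s x - (c x * gen U g s x + d x * gen U h s x)))
   = (%s x. a x * f s x - ((a x * c x) * gen U g s x + (a x * d x) * gen U h s x))"
  by (intro ext) (simp add: algebra_simps)
 with N_smult[OF assms(2) cd(3)] show ?thesis unfolding spanned_def using Reg_mult[OF openU assms(2)] cd
  by (intro exI[of _ "%x. a x * c x"] exI[of _ "%x. a x * d x"]) simp
qed

lemma spanned_sum:
 "finite T ==> (!!i. i \<in> T ==> spanned g h (f i)) ==> spanned g h (%s x. \<Sum>i\<in>T. f i s x)"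
 by (induction T rule: finite_induct) (auto intro: spanned_zero spanned_add)

lemma one_gen: "rst U (%x. 1) x * gen U g s x = gen U g s x"
 by (simp add: gen_apply rst_def)

lemma spanned_gen: "spanned g h (gen U g)" "spanned g h (gen U h)"
proof -
 have 1: "(%s x. gen U g s x - (rst U (%x. 1) x * gen U g s x + 0 * gen U h s x)) \<in> N"
  "(%s x. gen U h s x - (0 * gen U g s x + rst U (%x. 1) x * gen U h s x)) \<in> N"
  by (simp_all add: one_gen N_zero)
 show "spanned g h (gen U g)" unfolding spanned_def
  by (intro exI[of _ "rst U (%x. 1)"] exI[of _ "%x. 0"]) (use 1 Reg_const[OF openU] Reg_zero[OF openU] in simp)
 show "spanned g h (gen U h)" unfolding spanned_def
  by (intro exI[of _ "%x. 0"] exI[of _ "rst U (%x. 1)"]) (use 1 Reg_const[OF openU] Reg_zero[OF openU] in simp)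
qed

end

lemma (in smooth_quartic) frees_induct [consumes 2, case_names zero gen add]:
 assumes U: "openX U" and f: "f \<in> frees U S" and zero: "P (%s x. 0)"
  and gen: "!!a s. Reg 0 U a ==> s \<in> S ==> P (%t x. a x * gen U s t x)"
  and add: "!!f g. f \<in> frees U S ==> g \<in> frees U S ==> P f ==> P g ==> P (%s x. f s x + g s x)"
 shows "P f"
proof -
 have "finite T ==> f \<in> frees U S ==> {s. f s ~= (%x. 0)} \<subseteq> T ==> P f" for T f
 proof (induction T arbitrary: f rule: finite_induct)
  case empty
  then have "f = (%s x. 0)" by auto
  then show ?case using zero by simp
 next
  case (insert t T)
  define g where "g = f(t := (%x. 0))"
  have g: "g \<in> frees U S"
   using insert.prems(1) Reg_zero[OF U] by (auto simp: frees_def g_def elim: rev_finite_subset)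
  have Pg: "P g" by (rule insert.IH[OF g]) (use insert.prems in "auto simp: g_def")
  show ?case
  proof (cases "t \<in> S")
   case True
   have ft: "Reg 0 U (f t)" using insert.prems by (simp add: frees_def)
   have "(%s x. f t x * gen U t s x) \<in> frees U S"
    by (rule frees_smult[OF U ft gen_in[OF U True]])
   moreover have "f = (%s x. g s x + f t x * gen U t s x)"
    using rst_one_Reg(2)[OF ft U] by (auto simp: g_def gen_apply fun_eq_iff)
   ultimately show ?thesis using add[OF g _ Pg gen[OF ft True]] by simp
  next
   case False
   then have "f = g" using insert.prems by (auto simp: g_def frees_def)
   then show ?thesis using Pg by simp
  qed
 qed
 then show ?thesis using f unfolding frees_def by blast
qed

text \<open>Locally all generators are combinations of two of them, whose values are linearly independent
  at every point. Then the coefficients, and hence the germs of sections, are determined by the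
  values.\<close>

locale presented_presheaf = smooth_quartic +
 fixes P :: "(point, complex ^ 4 => complex, ('s => complex ^ 4 => complex) set) presheaf"
  and S :: "point set => 's set" and R :: "point set => ('s => complex ^ 4 => complex) set"
  and \<sigma> :: "point set => point set => 's => 's"
  and ev :: "'s => (complex ^ 4) \<times> 'i => complex"
 assumes sec_P: "openX U ==> sec P U = presented_module (OX U) (S U) (R U)"
  and res_P: "openX U ==> openX V ==> V \<subseteq> U ==>
   res P U V = presented_map (OX U) (OX V) (rst V) (\<sigma> U V) (S V) (relation_module (OX V) (S V) (R V))"
  and R_in: "openX U ==> R U \<subseteq> frees U (S U)"
  and \<sigma>_in: "openX U ==> openX V ==> V \<subseteq> U ==> s \<in> S U ==> \<sigma> U V s \<in> S V"
  and ev_rel: "openX U ==> r \<in> R U ==> evaluate ev r j = 0"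
  and ev_\<sigma>: "openX U ==> openX V ==> V \<subseteq> U ==> s \<in> S U ==> x \<in> over V ==> ev (\<sigma> U V s) (x, i) = ev s (x, i)"
  and rel_res: "openX U ==> openX V ==> V \<subseteq> U ==> r \<in> R U ==>
   free_map (OX U) (OX V) (rst V) (\<sigma> U V) r \<in> relation_module (OX V) (S V) (R V)"
  and local_generators: "p \<in> total ==> \<exists>W0 g h. openX W0 & p \<in> W0 &
   (\<forall>W. openX W & W \<subseteq> W0 --> g W \<in> S W & h W \<in> S W &
    (\<forall>z\<in>over W. \<forall>c d. (\<forall>i. c * ev (g W) (z, i) + d * ev (h W) (z, i) = 0) --> c = 0 & d = 0)) &
   (\<forall>U s. openX U & p \<in> U & s \<in> S U --> (\<exists>W1. openX W1 & p \<in> W1 & W1 \<subseteq> U \<inter> W0 &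
    (\<forall>W. openX W & p \<in> W & W \<subseteq> W1 --> presentation.spanned F W (S W) (R W) (g W) (h W) (gen W (\<sigma> U W s)))))"
begin

lemma presentation: "openX U ==> presentation F U (S U) (R U)"
 by (intro presentation.intro presentation_axioms.intro smooth_quartic_axioms R_in)

lemma res_cls:
 assumes U: "openX U" and V: "openX V" "V \<subseteq> U" and f: "f \<in> frees U (S U)"
 shows "res P U V (presentation.cls F U (S U) (R U) f) = presentation.cls F V (S V) (R V) (free_map (OX U) (OX V) (rst V) (\<sigma> U V) f)"
proof -
 interpret PU: presentation F U "S U" "R U" by (rule presentation[OF U])
 interpret PV: presentation F V "S V" "R V" by (rule presentation[OF V(1)])
 let ?m = "free_map (OX U) (OX V) (rst V) (\<sigma> U V)"
 have N: "?m n \<in> PV.N" if "n \<in> PU.N" for n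
  using that
 proof (induction n rule: PU.N_induct)
  case zero
  then show ?case by (simp add: PV.N_zero free_map_zero[OF U V])
 next
  case (add f g)
  then show ?case by (simp add: PV.N_add free_map_add[OF U V])
 next
  case (smult a f)
  then show ?case by (simp add: PV.N_smult[OF Reg_rst[OF U V(1) over_mono[OF V(2)]]] free_map_smult[OF U V])
 next
  case (rel r)
  then show ?case using rel_res[OF U V] by simp
 qed
 have "PV.cls (?m g) = PV.cls (?m f)" if g: "g \<in> PU.cls f" for g
 proof -
  have n: "(%s x. g s x - f s x) \<in> PU.N" using g by (simp only: PU.cls_iff)
  have "(%s x. (g s x - f s x) + f s x) \<in> frees U (S U)" by (rule frees_add[OF U PU.N_sub[OF n] f])
  then have g': "g \<in> frees U (S U)" by simp
  show ?thesis unfolding PV.cls_eq_iff using N[OF n] by (simp add: free_map_diff[OF U V g' f])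
 qed
 then have "(\<Union>g\<in>PU.cls f. PV.cls (?m g)) = PV.cls (?m f)"
  using PU.cls_self by (intro SUP_eq_const) blast+
 then show ?thesis unfolding res_P[OF U V] presented_map_def PV.cls_def by simp
qed

lemma cls_value:
 assumes U: "openX U" and f: "f \<in> frees U (S U)"
 shows "presentation.cls_evaluate ev (presentation.cls F U (S U) (R U) f) = evaluate ev f"
 by (rule presentation.cls_evaluate[OF presentation[OF U] _ f]) (rule ev_rel[OF U])

lemma free_map_\<sigma>_in: "openX U ==> openX V ==> V \<subseteq> U ==> f \<in> frees U (S U) ==>
  free_map (OX U) (OX V) (rst V) (\<sigma> U V) f \<in> frees V (S V)"
 by (rule free_map_in) (auto intro: \<sigma>_in)

text \<open>The neighbourhood depends on the generator, but an element involves only finitely many generators.\<close>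

lemma all_spanned:
 assumes W0: "openX W0" "p \<in> W0"
  and gens: "\<forall>U s. openX U & p \<in> U & s \<in> S U --> (\<exists>W1. openX W1 & p \<in> W1 & W1 \<subseteq> U \<inter> W0 &
    (\<forall>W. openX W & p \<in> W & W \<subseteq> W1 --> presentation.spanned F W (S W) (R W) (g W) (h W) (gen W (\<sigma> U W s))))"
  and U: "openX U" "p \<in> U" and f: "f \<in> frees U (S U)"
 shows "\<exists>W1. openX W1 & p \<in> W1 & W1 \<subseteq> U \<inter> W0 &
    (\<forall>W. openX W & p \<in> W & W \<subseteq> W1 --> presentation.spanned F W (S W) (R W) (g W) (h W) (free_map (OX U) (OX W) (rst W) (\<sigma> U W) f))"
 using U(1) f
proof (induction rule: frees_induct)
 case zero
 show ?case
 proof (intro exI[of _ "U \<inter> W0"] conjI allI impI)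
  fix W assume W: "openX W & p \<in> W & W \<subseteq> U \<inter> W0"
  then have "openX W" "W \<subseteq> U" by auto
  then show "presentation.spanned F W (S W) (R W) (g W) (h W) (free_map (OX U) (OX W) (rst W) (\<sigma> U W) (%s x. 0))"
   by (simp add: free_map_zero[OF U(1)] presentation.spanned_zero[OF presentation])
 qed (use U W0 in auto)
next
 case (gen a s)
 obtain W1 where W1': "openX W1" "p \<in> W1" "W1 \<subseteq> U \<inter> W0"
  "\<forall>W. openX W & p \<in> W & W \<subseteq> W1 --> presentation.spanned F W (S W) (R W) (g W) (h W) (gen W (\<sigma> U W s))"
  using gens[THEN spec, THEN spec, THEN mp, OF conjI[OF U(1) conjI[OF U(2) gen(2)]]] by (elim exE conjE)
 note W1 = W1'(1,2,3) W1'(4)[THEN spec, THEN mp, OF conjI, OF _ conjI]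
 show ?case
 proof (intro exI[of _ W1] conjI allI impI)
  fix W assume W: "openX W & p \<in> W & W \<subseteq> W1"
  then have WU: "W \<subseteq> U" using W1(3) by auto
  have "free_map (OX U) (OX W) (rst W) (\<sigma> U W) (%t x. a x * gen U s t x) = (%t x. rst W a x * gen W (\<sigma> U W s) t x)"
   using W by (simp add: free_map_smult[OF U(1) _ WU gen(1) gen_in[OF U(1) gen(2)]] free_map_gen[OF U(1) _ WU])
  then show "presentation.spanned F W (S W) (R W) (g W) (h W) (free_map (OX U) (OX W) (rst W) (\<sigma> U W) (%t x. a x * gen U s t x))"
   using presentation.spanned_smult[OF presentation W1(4)] W Reg_rst[OF U(1) _ over_mono[OF WU] gen(1)] by simp
 qed (use W1 in auto)
next
 case (add f f')
 obtain W1 where W1': "openX W1" "p \<in> W1" "W1 \<subseteq> U \<inter> W0"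
  "\<forall>W. openX W & p \<in> W & W \<subseteq> W1 --> presentation.spanned F W (S W) (R W) (g W) (h W) (free_map (OX U) (OX W) (rst W) (\<sigma> U W) f)"
  using add.IH(1) by (elim exE conjE)
 note W1 = W1'(1,2,3) W1'(4)[THEN spec, THEN mp, OF conjI, OF _ conjI]
 obtain W2 where W2': "openX W2" "p \<in> W2" "W2 \<subseteq> U \<inter> W0"
  "\<forall>W. openX W & p \<in> W & W \<subseteq> W2 --> presentation.spanned F W (S W) (R W) (g W) (h W) (free_map (OX U) (OX W) (rst W) (\<sigma> U W) f')"
  using add.IH(2) by (elim exE conjE)
 note W2 = W2'(1,2,3) W2'(4)[THEN spec, THEN mp, OF conjI, OF _ conjI]
 show ?case
 proof (intro exI[of _ "W1 \<inter> W2"] conjI allI impI)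
  fix W assume W: "openX W & p \<in> W & W \<subseteq> W1 \<inter> W2"
  then have WU: "W \<subseteq> U" using W1(3) by auto
  show "presentation.spanned F W (S W) (R W) (g W) (h W) (free_map (OX U) (OX W) (rst W) (\<sigma> U W) (%s x. f s x + f' s x))"
   using presentation.spanned_add[OF presentation W1(4) W2(4), of W] W by (simp add: free_map_add[OF U(1) _ WU add.hyps])
 qed (use W1 W2 in auto)
qed

text \<open>The two local generators have independent values, so the coefficients of a local section are determined
  by its values; this is the separatedness required for sheafification.\<close>

lemma valued_presheaf: "valued_presheaf F P (%U. presentation.cls_evaluate ev)"
proof (intro valued_presheaf.intro valued_presheaf_axioms.intro smooth_quartic_axioms)
 fix U m n assume U: "openX U" and m: "m \<in> carrier (sec P U)" and n: "n \<in> carrier (sec P U)"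
 interpret PU: presentation F U "S U" "R U" by (rule presentation[OF U])
 obtain f g where f: "m = PU.cls f" "f \<in> frees U (S U)" and g: "n = PU.cls g" "g \<in> frees U (S U)"
  using m n by (auto simp: sec_P[OF U] PU.PM_carrier)
 note fg = frees_add[OF U f(2) g(2)]
 show "m \<oplus>\<^bsub>sec P U\<^esub> n \<in> carrier (sec P U)"
  using fg by (simp add: sec_P[OF U] PU.PM_carrier f g PU.PM_add)
 show "presentation.cls_evaluate ev (m \<oplus>\<^bsub>sec P U\<^esub> n) (x, i) = presentation.cls_evaluate ev m (x, i) + presentation.cls_evaluate ev n (x, i)" for x i
  by (simp add: sec_P[OF U] f(1) g(1) PU.PM_add cls_value[OF U f(2)] cls_value[OF U g(2)] cls_value[OF U fg] evaluate_add[OF f(2) g(2)])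
next
 fix U assume U: "openX U"
 interpret PU: presentation F U "S U" "R U" by (rule presentation[OF U])
 show "\<zero>\<^bsub>sec P U\<^esub> \<in> carrier (sec P U)"
  by (simp add: sec_P[OF U] PU.PM_carrier PU.PM_zero frees_zero[OF U])
 show "presentation.cls_evaluate ev \<zero>\<^bsub>sec P U\<^esub> (x, i) = 0" for x i
  by (simp add: sec_P[OF U] PU.PM_zero cls_value[OF U frees_zero[OF U]])
next
 fix U a m assume U: "openX U" and a: "Reg 0 U a" and m: "m \<in> carrier (sec P U)"
 interpret PU: presentation F U "S U" "R U" by (rule presentation[OF U])
 obtain f where f: "m = PU.cls f" "f \<in> frees U (S U)" using m by (auto simp: sec_P[OF U] PU.PM_carrier)
 note af = frees_smult[OF U a f(2)]
 show "a \<odot>\<^bsub>sec P U\<^esub> m \<in> carrier (sec P U)"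
  using af by (simp add: sec_P[OF U] PU.PM_carrier f PU.PM_smult[OF a])
 show "presentation.cls_evaluate ev (a \<odot>\<^bsub>sec P U\<^esub> m) (x, i) = a x * presentation.cls_evaluate ev m (x, i)" for x i
  by (simp add: sec_P[OF U] f(1) PU.PM_smult[OF a] cls_value[OF U f(2)] cls_value[OF U af] evaluate_smult[OF f(2)])
next
 fix U V m assume U: "openX U" and V: "openX V" "V \<subseteq> U" and m: "m \<in> carrier (sec P U)"
 interpret PU: presentation F U "S U" "R U" by (rule presentation[OF U])
 interpret PV: presentation F V "S V" "R V" by (rule presentation[OF V(1)])
 obtain f where f: "m = PU.cls f" "f \<in> frees U (S U)" using m by (auto simp: sec_P[OF U] PU.PM_carrier)
 note ff = free_map_\<sigma>_in[OF U V f(2)]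
 show "res P U V m \<in> carrier (sec P V)"
  using ff by (simp add: sec_P[OF V(1)] PV.PM_carrier f res_cls[OF U V f(2)])
 show "presentation.cls_evaluate ev (res P U V m) (x, i) = presentation.cls_evaluate ev m (x, i)" if "x \<in> over V" for x i
  using evaluate_free_map[OF U V f(2) that, of ev "\<sigma> U V" i] ev_\<sigma>[OF U V _ that]
  by (simp add: f(1) res_cls[OF U V f(2)] cls_value[OF U f(2)] cls_value[OF V(1) ff])
next
 fix U V W p m n assume U: "openX U" and V: "openX V" and W: "openX W" "p \<in> W" "W \<subseteq> U \<inter> V"
  and m: "m \<in> carrier (sec P U)" and n: "n \<in> carrier (sec P V)"
  and eq: "!!x i. x \<in> over W ==> presentation.cls_evaluate ev m (x, i) = presentation.cls_evaluate ev n (x, i)"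
 interpret PU: presentation F U "S U" "R U" by (rule presentation[OF U])
 interpret PV: presentation F V "S V" "R V" by (rule presentation[OF V])
 obtain f where f: "m = PU.cls f" "f \<in> frees U (S U)" using m by (auto simp: sec_P[OF U] PU.PM_carrier)
 obtain g where g: "n = PV.cls g" "g \<in> frees V (S V)" using n by (auto simp: sec_P[OF V] PV.PM_carrier)
 have p: "p \<in> total" "p \<in> U" "p \<in> V" using W openX_subset by auto
 obtain W0 g1 g2 where W0: "openX W0" "p \<in> W0"
  and ind': "\<forall>W. openX W & W \<subseteq> W0 --> g1 W \<in> S W & g2 W \<in> S W &
    (\<forall>z\<in>over W. \<forall>c d. (\<forall>i. c * ev (g1 W) (z, i) + d * ev (g2 W) (z, i) = 0) --> c = 0 & d = 0)"
  and gens': "\<forall>U s. openX U & p \<in> U & s \<in> S U --> (\<exists>W1. openX W1 & p \<in> W1 & W1 \<subseteq> U \<inter> W0 &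
    (\<forall>W. openX W & p \<in> W & W \<subseteq> W1 --> presentation.spanned F W (S W) (R W) (g1 W) (g2 W) (gen W (\<sigma> U W s))))"
  using local_generators[OF p(1)] by (elim exE conjE)
 note ind = ind'[THEN spec, THEN mp, OF conjI]
 obtain W1 where W1': "openX W1" "p \<in> W1" "W1 \<subseteq> U \<inter> W0"
  "\<forall>W. openX W & p \<in> W & W \<subseteq> W1 --> presentation.spanned F W (S W) (R W) (g1 W) (g2 W) (free_map (OX U) (OX W) (rst W) (\<sigma> U W) f)"
  using all_spanned[OF W0 gens' U p(2) f(2)] by (elim exE conjE)
 note W1 = W1'(1,2,3) W1'(4)[THEN spec, THEN mp, OF conjI, OF _ conjI]
 obtain W2 where W2': "openX W2" "p \<in> W2" "W2 \<subseteq> V \<inter> W0"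
  "\<forall>W. openX W & p \<in> W & W \<subseteq> W2 --> presentation.spanned F W (S W) (R W) (g1 W) (g2 W) (free_map (OX V) (OX W) (rst W) (\<sigma> V W) g)"
  using all_spanned[OF W0 gens' V p(3) g(2)] by (elim exE conjE)
 note W2 = W2'(1,2,3) W2'(4)[THEN spec, THEN mp, OF conjI, OF _ conjI]
 define W' where "W' = W \<inter> (W1 \<inter> W2)"
 have W': "openX W'" "p \<in> W'" "W' \<subseteq> U" "W' \<subseteq> V" "W' \<subseteq> W" "W' \<subseteq> W1" "W' \<subseteq> W2" "W' \<subseteq> W0"
  using W W1 W2 by (auto simp: W'_def)
 interpret PW: presentation F W' "S W'" "R W'" by (rule presentation[OF W'(1)])
 let ?f = "free_map (OX U) (OX W') (rst W') (\<sigma> U W') f" and ?g = "free_map (OX V) (OX W') (rst W') (\<sigma> V W') g"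
 have f': "?f \<in> frees W' (S W')" and g': "?g \<in> frees W' (S W')"
  using free_map_\<sigma>_in[OF U W'(1,3) f(2)] free_map_\<sigma>_in[OF V W'(1,4) g(2)] by auto
 have gs: "g1 W' \<in> S W'" "g2 W' \<in> S W'" using ind[OF W'(1,8)] by auto
 obtain c d where cd: "Reg 0 W' c" "Reg 0 W' d" "(%s x. ?f s x - (c x * gen W' (g1 W') s x + d x * gen W' (g2 W') s x)) \<in> PW.N"
  using W1(4)[OF W'(1,2,6)] unfolding PW.spanned_def by blast
 obtain c' d' where cd': "Reg 0 W' c'" "Reg 0 W' d'" "(%s x. ?g s x - (c' x * gen W' (g1 W') s x + d' x * gen W' (g2 W') s x)) \<in> PW.N"
  using W2(4)[OF W'(1,2,7)] unfolding PW.spanned_def by blast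
 have value_of: "evaluate ev f0 (x, i) = a x * ev (g1 W') (x, i) + b x * ev (g2 W') (x, i)"
  if a: "Reg 0 W' a" and b: "Reg 0 W' b" and f0: "f0 \<in> frees W' (S W')"
   and N: "(%s x. f0 s x - (a x * gen W' (g1 W') s x + b x * gen W' (g2 W') s x)) \<in> PW.N" and x: "x \<in> over W'" for a b f0 x i
 proof -
  note ga = frees_smult[OF W'(1) a gen_in[OF W'(1) gs(1)]] and gb = frees_smult[OF W'(1) b gen_in[OF W'(1) gs(2)]]
  have "PW.cls f0 = PW.cls (%s x. a x * gen W' (g1 W') s x + b x * gen W' (g2 W') s x)" using N by (simp add: PW.cls_eq_iff)
  then have "evaluate ev f0 = evaluate ev (%s x. a x * gen W' (g1 W') s x + b x * gen W' (g2 W') s x)"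
   by (simp only: cls_value[OF W'(1) f0, symmetric] cls_value[OF W'(1) frees_add[OF W'(1) ga gb], symmetric])
  then show ?thesis
   using x by (simp add: evaluate_add[OF ga gb] evaluate_smult[OF gen_in[OF W'(1) gs(1)]] evaluate_smult[OF gen_in[OF W'(1) gs(2)]] evaluate_gen rst_def)
 qed
 have cc: "c x = c' x & d x = d' x" for x
 proof (cases "x \<in> over W'")
  case True
  then have xW: "x \<in> over W" using over_mono[OF W'(5)] by blast
  have "(c x - c' x) * ev (g1 W') (x, i) + (d x - d' x) * ev (g2 W') (x, i) = 0" for i
  proof -
   have "evaluate ev ?f (x, i) = evaluate ev f (x, i)" by (rule evaluate_free_map[OF U W'(1,3) f(2) True]) (rule ev_\<sigma>[OF U W'(1,3) _ True])
   moreover have "evaluate ev ?g (x, i) = evaluate ev g (x, i)" by (rule evaluate_free_map[OF V W'(1,4) g(2) True]) (rule ev_\<sigma>[OF V W'(1,4) _ True])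
   moreover have "evaluate ev f (x, i) = evaluate ev g (x, i)"
    using eq[OF xW, of i] by (simp add: f(1) g(1) cls_value[OF U f(2)] cls_value[OF V g(2)])
   ultimately show ?thesis
    using value_of[OF cd(1,2) f' cd(3) True, of i] value_of[OF cd'(1,2) g' cd'(3) True, of i] by (simp add: algebra_simps)
  qed
  then have "c x - c' x = 0 & d x - d' x = 0" using ind[OF W'(1,8)] True by blast
  then show ?thesis by simp
 next
  case False
  then show ?thesis using Reg_off[OF W'(1)] cd(1,2) cd'(1,2) by metis
 qed
 have "(%s x. (?f s x - (c x * gen W' (g1 W') s x + d x * gen W' (g2 W') s x)) - (?g s x - (c' x * gen W' (g1 W') s x + d' x * gen W' (g2 W') s x))) \<in> PW.N"
  by (rule PW.N_diff[OF cd(3) cd'(3)])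
 then have "PW.cls ?f = PW.cls ?g" using cc by (simp add: PW.cls_eq_iff)
 then show "\<exists>W'. openX W' & p \<in> W' & W' \<subseteq> U \<inter> V & res P U W' m = res P V W' n"
  using W' by (intro exI[of _ W']) (simp add: f(1) g(1) res_cls[OF U W'(1,3) f(2)] res_cls[OF V W'(1,4) g(2)])
qed

end

section \<open>Differentials of regular functions\<close>

context smooth_quartic
begin

definition local_fraction :: "(complex ^ 4 => complex) => complex ^ 4 => form => form => bool" where
 "local_fraction f x P Q \<longleftrightarrow> (\<exists>n. homogeneous n P & homogeneous n Q) & peval Q x ~= 0 &
   (\<forall>z\<in>K. peval Q z ~= 0 --> f z = peval P z / peval Q z)"

definition fraction_diff :: "form => form => complex ^ 4 => 4 => complex" where
 "fraction_diff P Q x i = (peval (partial i P) x - peval P x / peval Q x * peval (partial i Q) x) / peval Q x"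

lemma fraction_difference:
 fixes q q' :: complex
 assumes "q ~= 0" "q' ~= 0"
 shows "(p - f * e) / q - (p' - f * e') / q' = (f * q * e' + q' * p - (f * q' * e + q * p')) / (q * q')"
 using assms by (simp add: field_simps)

text \<open>The value at \<open>x\<close> of \<open>df \<and> dF\<close>, which does not depend on the fraction that represents \<open>f\<close>.\<close>

definition dwedge :: "(complex ^ 4 => complex) => (complex ^ 4) \<times> 4 \<times> 4 => complex" where
 "dwedge f = (%(x, i, j). let PQ = SOME PQ. local_fraction f x (fst PQ) (snd PQ) in
   fraction_diff (fst PQ) (snd PQ) x i * dF j x - fraction_diff (fst PQ) (snd PQ) x j * dF i x)"

lemma local_fractionD:
 assumes "local_fraction f x P Q"
 shows "peval Q x ~= 0" "z \<in> K ==> peval Q z ~= 0 ==> f z = peval P z / peval Q z"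
 using assms by (auto simp: local_fraction_def)

lemma local_fractionI:
 assumes "homogeneous n P" "homogeneous n Q" "peval Q x ~= 0" "!!z. z \<in> K ==> peval Q z ~= 0 ==> f z = peval P z / peval Q z"
 shows "local_fraction f x P Q"
 using assms by (auto simp: local_fraction_def)

text \<open>Two fractions for \<open>f\<close> differ by a form that vanishes on the cone. The gradient of such a
  form is a multiple of \<open>dF\<close>, which disappears after wedging with \<open>dF\<close>.\<close>

lemma dwedge_unique:
 assumes x: "x \<in> K" and PQ: "local_fraction f x P Q"
 shows "dwedge f (x, i, j) = fraction_diff P Q x i * dF j x - fraction_diff P Q x j * dF i x"
proof -
 define PQ' where "PQ' = (SOME PQ. local_fraction f x (fst PQ) (snd PQ))"
 define P' where "P' = fst PQ'"
 define Q' where "Q' = snd PQ'"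
 have PQ': "local_fraction f x P' Q'"
  unfolding P'_def Q'_def PQ'_def by (rule someI[of "%PQ. local_fraction f x (fst PQ) (snd PQ)" "(P, Q)"]) (simp add: PQ)
 define A where "A = P * Q' - P' * Q"
 have "peval (A * (Q * Q')) z = 0" if z: "z \<in> K" for z
 proof (cases "peval Q z = 0 \<or> peval Q' z = 0")
  case False
  then have "peval P z / peval Q z = peval P' z / peval Q' z"
   using local_fractionD(2)[OF PQ z] local_fractionD(2)[OF PQ' z] by simp
  then show ?thesis using False by (simp add: A_def field_simps)
 qed auto
 then obtain h where h: "!!i. peval (partial i (A * (Q * Q'))) x = peval h x * dF i x"
  using vanishing_gradient[of "A * (Q * Q')"] x by metis
 have nz: "peval Q x ~= 0" "peval Q' x ~= 0" using local_fractionD(1) PQ PQ' by auto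
 have fx: "peval P x / peval Q x = peval P' x / peval Q' x"
  using local_fractionD(2)[OF PQ x] local_fractionD(2)[OF PQ' x] nz by simp
 then have A0: "peval A x = 0" using nz by (simp add: A_def field_simps)
 have dA: "peval (partial i A) x * (peval Q x * peval Q' x) = peval h x * dF i x" for i
  using h[of i] A0 by (simp add: peval_partial_mult mult_ac)
 have pA: "peval (partial i A) x = peval P x * peval (partial i Q') x + peval Q' x * peval (partial i P) x
   - (peval P' x * peval (partial i Q) x + peval Q x * peval (partial i P') x)" for i
 proof -
  have m1: "partial i (- f) = - partial i f" for f
   using partial_add[of i f "- f"] by (simp add: partial_def eq_neg_iff_add_eq_0 add.commute)
  have "A = P * Q' + - (P' * Q)" by (simp add: A_def)
  then have "partial i A = partial i (P * Q') + - partial i (P' * Q)" by (simp only: partial_add m1)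
  then show ?thesis by (simp add: peval_partial_mult)
 qed
 define c where "c = peval h x / (peval Q x * peval Q' x) ^ 2"
 have "fraction_diff P Q x i - fraction_diff P' Q' x i = c * dF i x" for i
 proof -
  have P: "peval P x = peval P' x / peval Q' x * peval Q x" using fx nz by (simp add: field_simps)
  have P': "peval P' x = peval P' x / peval Q' x * peval Q' x" using nz by simp
  have "fraction_diff P Q x i - fraction_diff P' Q' x i = peval (partial i A) x / (peval Q x * peval Q' x)"
   using fraction_difference[OF nz, of "peval (partial i P) x" "peval P' x / peval Q' x" "peval (partial i Q) x" "peval (partial i P') x" "peval (partial i Q') x"]
   unfolding fraction_diff_def fx pA P[symmetric] P'[symmetric] .
  also have "\<dots> = c * dF i x" using dA[of i] nz by (simp add: c_def field_simps power2_eq_square)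
  finally show ?thesis .
 qed
 then have e: "fraction_diff P Q x i = fraction_diff P' Q' x i + c * dF i x" for i by (simp add: algebra_simps)
 have "dwedge f (x, i, j) = fraction_diff P' Q' x i * dF j x - fraction_diff P' Q' x j * dF i x"
  by (simp add: dwedge_def Let_def P'_def Q'_def PQ'_def)
 then show ?thesis by (simp add: e algebra_simps)
qed

lemma Reg_local_fraction:
 assumes U: "openX U" and f: "Reg 0 U f" and x: "x \<in> over U"
 obtains P Q n where "local_fraction f x P Q" "homogeneous n P" "homogeneous n Q" "!!z. z \<in> K ==> peval Q z ~= 0 ==> z \<in> over U"
proof -
 obtain P Q m n where PQ: "fraction_at 0 U f x P Q" "homogeneous m P" "homogeneous n Q" "int m - int n = 0"
  using Reg_fraction[OF U f x] by blast
 then have "m = n" by simp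
 then have "local_fraction f x P Q"
  using fraction_atD[OF PQ(1)] PQ(2,3) by (intro local_fractionI) auto
 then show ?thesis using that PQ fraction_atD(2)[OF PQ(1)] \<open>m = n\<close> by blast
qed

lemma dwedge_rst:
 assumes U: "openX U" and V: "openX V" "V \<subseteq> U" and f: "Reg 0 U f" and x: "x \<in> over V"
 shows "dwedge (rst V f) (x, i) = dwedge f (x, i)"
proof -
 obtain a b where i: "i = (a, b)" by (cases i)
 have xK: "x \<in> K" by (rule openX_cone_subset[OF V(1) x])
 obtain P Q n where PQ: "local_fraction (rst V f) x P Q" "homogeneous n P" "homogeneous n Q" "!!z. z \<in> K ==> peval Q z ~= 0 ==> z \<in> over V"
  using Reg_local_fraction[OF V(1) Reg_rst[OF U V(1) over_mono[OF V(2)] f] x] by blast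
 have "local_fraction f x P Q"
  using local_fractionD[OF PQ(1)] PQ by (intro local_fractionI) (auto simp: rst_def)
 then show ?thesis unfolding i by (simp only: dwedge_unique[OF xK PQ(1)] dwedge_unique[OF xK])
qed

lemma dwedge_add:
 assumes U: "openX U" and f: "Reg 0 U f" and g: "Reg 0 U g" and x: "x \<in> over U"
 shows "dwedge (%z. f z + g z) (x, i) = dwedge f (x, i) + dwedge g (x, i)"
proof -
 obtain a b where i: "i = (a, b)" by (cases i)
 have xK: "x \<in> K" by (rule openX_cone_subset[OF U x])
 obtain P Q n where PQ: "local_fraction f x P Q" "homogeneous n P" "homogeneous n Q" using Reg_local_fraction[OF U f x] by metis
 obtain P' Q' n' where PQ': "local_fraction g x P' Q'" "homogeneous n' P'" "homogeneous n' Q'" using Reg_local_fraction[OF U g x] by metis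
 have nz: "peval Q x ~= 0" "peval Q' x ~= 0" using local_fractionD(1) PQ PQ' by auto
 have "local_fraction (%z. f z + g z) x (P * Q' + P' * Q) (Q * Q')"
 proof (rule local_fractionI)
  show "homogeneous (n + n') (P * Q' + P' * Q)"
   by (rule homogeneous_add[OF homogeneous_mult[OF PQ(2) PQ'(3)] homogeneous_mult_eq[OF PQ'(2) PQ(3)]]) simp
  show "homogeneous (n + n') (Q * Q')" by (rule homogeneous_mult[OF PQ(3) PQ'(3)])
  show "f z + g z = peval (P * Q' + P' * Q) z / peval (Q * Q') z" if "z \<in> K" "peval (Q * Q') z ~= 0" for z
   using that local_fractionD(2)[OF PQ(1), of z] local_fractionD(2)[OF PQ'(1), of z] by (simp add: field_simps)
 qed (use nz in simp)
 moreover have "fraction_diff (P * Q' + P' * Q) (Q * Q') x a = fraction_diff P Q x a + fraction_diff P' Q' x a" for a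
  using nz by (simp add: fraction_diff_def partial_add peval_partial_mult field_simps)
 ultimately show ?thesis
  unfolding i by (simp add: dwedge_unique[OF xK] dwedge_unique[OF xK PQ(1)] dwedge_unique[OF xK PQ'(1)] algebra_simps)
qed

lemma dwedge_mult:
 assumes U: "openX U" and f: "Reg 0 U f" and g: "Reg 0 U g" and x: "x \<in> over U"
 shows "dwedge (%z. f z * g z) (x, i) = f x * dwedge g (x, i) + g x * dwedge f (x, i)"
proof -
 obtain a b where i: "i = (a, b)" by (cases i)
 have xK: "x \<in> K" by (rule openX_cone_subset[OF U x])
 obtain P Q n where PQ: "local_fraction f x P Q" "homogeneous n P" "homogeneous n Q" using Reg_local_fraction[OF U f x] by metis
 obtain P' Q' n' where PQ': "local_fraction g x P' Q'" "homogeneous n' P'" "homogeneous n' Q'" using Reg_local_fraction[OF U g x] by metis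
 have nz: "peval Q x ~= 0" "peval Q' x ~= 0" using local_fractionD(1) PQ PQ' by auto
 have v: "f x = peval P x / peval Q x" "g x = peval P' x / peval Q' x"
  using local_fractionD(2)[OF PQ(1) xK] local_fractionD(2)[OF PQ'(1) xK] nz by auto
 have "local_fraction (%z. f z * g z) x (P * P') (Q * Q')"
  using local_fractionD[OF PQ(1)] local_fractionD[OF PQ'(1)] PQ PQ'
  by (intro local_fractionI[of "n + n'"]) (auto intro!: homogeneous_mult)
 moreover have "fraction_diff (P * P') (Q * Q') x a = f x * fraction_diff P' Q' x a + g x * fraction_diff P Q x a" for a
  using nz by (simp add: fraction_diff_def v peval_partial_mult field_simps)
 ultimately show ?thesis
  unfolding i by (simp add: dwedge_unique[OF xK] dwedge_unique[OF xK PQ(1)] dwedge_unique[OF xK PQ'(1)] algebra_simps)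
qed

lemma dwedge_const:
 assumes U: "openX U" and x: "x \<in> over U"
 shows "dwedge (rst U (%z. c)) (x, i) = 0"
proof -
 obtain a b where i: "i = (a, b)" by (cases i)
 have xK: "x \<in> K" by (rule openX_cone_subset[OF U x])
 have "local_fraction (%z. c) x (form_const c) (form_const 1)"
  by (rule local_fractionI[of 0]) auto
 then have "dwedge (%z. c) (x, a, b) = 0"
  by (subst dwedge_unique[OF xK, of _ "form_const c" "form_const 1"]) (simp_all add: fraction_diff_def del: form_const_1)
 moreover have "dwedge (rst U (%z. c)) (x, i) = dwedge (rst total (%z. c)) (x, i)"
 proof -
  have "rst U (%z. c) = rst U (rst total (%z. c))" using openX_cone_subset[OF U] by (auto simp: rst_def)
  then show ?thesis using dwedge_rst[OF openX_total U openX_subset[OF U] Reg_const[OF openX_total] x] by simp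
 qed
 moreover have "local_fraction (rst total (%z. c)) x (form_const c) (form_const 1)"
  by (rule local_fractionI[of 0]) auto
 then have "dwedge (rst total (%z. c)) (x, a, b) = 0"
  by (subst dwedge_unique[OF xK, of _ "form_const c" "form_const 1"]) (simp_all add: fraction_diff_def del: form_const_1)
 ultimately show ?thesis by (simp add: i)
qed

lemma fraction_diff_euler:
 assumes "homogeneous n P" "homogeneous n Q" "peval Q x ~= 0"
 shows "(\<Sum>i\<in>UNIV. x $ i * fraction_diff P Q x i) = 0"
proof -
 have "(\<Sum>i\<in>UNIV. x $ i * fraction_diff P Q x i)
   = ((\<Sum>i\<in>UNIV. x $ i * peval (partial i P) x) - peval P x / peval Q x * (\<Sum>i\<in>UNIV. x $ i * peval (partial i Q) x)) / peval Q x"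
  by (simp add: fraction_diff_def right_diff_distrib sum_subtractf sum_distrib_left sum_divide_distrib diff_divide_distrib mult_ac)
 also have "\<dots> = 0" using assms by (simp add: euler_identity)
 finally show ?thesis .
qed

lemma dwedge_cond:
 assumes U: "openX U" and f: "Reg 0 U f" and x: "x \<in> over U"
 shows "wedge_cond x (grad x) (%i j. dwedge f (x, i, j))"
proof -
 have xK: "x \<in> K" by (rule openX_cone_subset[OF U x])
 obtain P Q n where PQ: "local_fraction f x P Q" "homogeneous n P" "homogeneous n Q" using Reg_local_fraction[OF U f x] by metis
 show ?thesis
  by (rule wedge_cond_wedge[of _ "fraction_diff P Q x"])
   (use dwedge_unique[OF xK PQ(1)] fraction_diff_euler[OF PQ(2,3) local_fractionD(1)[OF PQ(1)]] euler_on_K[OF xK] in "auto simp: grad_def")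
qed

lemma homogeneous_partial_0: "homogeneous 0 P ==> partial i P = 0"
proof -
 assume P: "homogeneous 0 P"
 have "plookup m i = 0" if "m \<in> pkeys P" for m
 proof -
  have "(\<Sum>i\<in>UNIV. plookup m i) = 0" using P that by (simp add: homogeneous_def)
  then show ?thesis by simp
 qed
 then show ?thesis by (simp add: partial_def)
qed

lemma Reg_dwedge:
 assumes U: "openX U" and f: "Reg 0 U f"
 shows "Reg 2 U (rst U (%x. dwedge f (x, i, j)))"
proof (rule RegI[OF U])
 fix x assume x: "x \<in> over U"
 obtain P Q n where PQ: "local_fraction f x P Q" "homogeneous n P" "homogeneous n Q" "!!z. z \<in> K ==> peval Q z ~= 0 ==> z \<in> over U"
  using Reg_local_fraction[OF U f x] by blast
 define A where "A i = Q * partial i P - P * partial i Q" for i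
 have A: "homogeneous (2 * n + 2) (A i * partial j F)" for i j
 proof (cases n)
  case 0
  then show ?thesis using PQ(2,3) homogeneous_partial_0 by (simp add: A_def)
 next
  case (Suc k)
  then have "homogeneous (n + k) (A i)" unfolding A_def
   using homogeneous_partial[OF PQ(2)] homogeneous_partial[OF PQ(3)] PQ(2,3) by (intro homogeneous_diff homogeneous_mult) auto
  then show ?thesis using homogeneous_mult_eq[OF _ homogeneous_dF, of "n + k" "A i" "2 * n + 2" j] Suc by simp
 qed
 have "fraction_at 2 U (rst U (%x. dwedge f (x, i, j))) x (A i * partial j F - A j * partial i F) (Q * Q)"
 proof (rule fraction_atI[of "2 * n + 2" _ "2 * n"])
  show "homogeneous (2 * n) (Q * Q)" by (rule homogeneous_mult_eq[OF PQ(3,3)]) simp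
  show "homogeneous (2 * n + 2) (A i * partial j F - A j * partial i F)" by (intro homogeneous_diff A)
  show "peval (Q * Q) x ~= 0" using local_fractionD(1)[OF PQ(1)] by simp
  fix z assume z: "z \<in> K" "peval (Q * Q) z ~= 0"
  then have Qz: "peval Q z ~= 0" by simp
  have zf: "local_fraction f z P Q" using PQ Qz local_fractionD(2)[OF PQ(1)] by (intro local_fractionI) auto
  have "fraction_diff P Q z i = peval (A i) z / (peval Q z * peval Q z)" for i
   using Qz by (simp add: fraction_diff_def A_def field_simps)
  then show "z \<in> over U & rst U (%x. dwedge f (x, i, j)) z = peval (A i * partial j F - A j * partial i F) z / peval (Q * Q) z"
   using PQ(4)[OF z(1) Qz] by (simp add: rst_def dwedge_unique[OF z(1) zf] diff_divide_distrib)
 qed simp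
 then show "\<exists>P Q. fraction_at 2 U (rst U (%x. dwedge f (x, i, j))) x P Q" by blast
qed (simp add: rst_def)

end

context presentation
begin

lemma spanned_uminus: assumes "spanned g h f" shows "spanned g h (%s x. - f s x)"
proof -
 obtain c d where cd: "Reg 0 U c" "Reg 0 U d" "(%s x. f s x - (c x * gen U g s x + d x * gen U h s x)) \<in> N"
  using assms(1) by (auto simp: spanned_def)
 have "(%s x. - (f s x - (c x * gen U g s x + d x * gen U h s x)))
   = (%s x. - f s x - (- c x * gen U g s x + - d x * gen U h s x))" by (intro ext) (simp add: algebra_simps)
 with N_uminus[OF cd(3)] show ?thesis unfolding spanned_def using Reg_uminus[OF openU cd(1)] Reg_uminus[OF openU cd(2)]
  by (intro exI[of _ "%x. - c x"] exI[of _ "%x. - d x"]) simp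
qed

lemma spanned_diff: "spanned g h f ==> spanned g h f' ==> spanned g h (%s x. f s x - f' s x)"
 using spanned_add[OF _ spanned_uminus, of g h f f'] by simp

lemma spanned_of_N: "f \<in> N ==> spanned g h f"
 by (rule spanned_N[OF spanned_zero]) simp

end

section \<open>Local coordinates\<close>

context smooth_quartic
begin

text \<open>Pivots for the chart: a coordinate to divide by and a derivative to solve for.\<close>

lemma good_indices:
 assumes x: "x \<in> K"
 obtains j l a b :: 4 where "x $ j ~= 0" "dF l x ~= 0" "j ~= l" "a ~= j" "a ~= l" "b ~= j" "b ~= l" "a ~= b" "UNIV = {j, l, a, b}"
proof -
 have "x ~= 0" using x by (simp add: K_def)
 then obtain j0 where j0: "x $ j0 ~= 0" by (auto simp: vec_eq_iff)
 obtain l where l: "dF l x ~= 0" using gradient_nonzero[OF x] by blast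
  \<comment> \<open>if the two indices agree, Euler's relation provides another non-zero derivative\<close>
 have "\<exists>l. dF l x ~= 0 & l ~= j0"
 proof (rule ccontr)
  assume no: "\<not> ?thesis"
  then have "(\<Sum>i\<in>UNIV. x $ i * dF i x) = x $ j0 * dF j0 x"
   by (subst sum.remove[of _ j0]) (auto intro!: sum.neutral)
  then show False using euler_on_K[OF x] j0 l no by auto
 qed
 then obtain l where l: "dF l x ~= 0" "l ~= j0" by blast
 have "card (UNIV - {j0, l}) = 2" using l(2) by (subst card_Diff_subset) auto
 then obtain a b where ab: "UNIV - {j0, l} = {a, b}" "a ~= b" by (auto simp: card_2_iff)
 then have "UNIV = {j0, l, a, b}" by blast
 moreover have "a ~= j0" "a ~= l" "b ~= j0" "b ~= l" using ab by blast+
 ultimately show ?thesis using that[of j0 l a b] j0 l ab(2) by blast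
qed

text \<open>Here \<open>x\<^sub>i / x\<^sub>j\<close> for the two indices \<open>i\<close> other than
  \<open>j\<close> and \<open>l\<close> are local coordinates.\<close>

definition chart :: "4 => 4 => point set" where
 "chart j l = open_locus (form_var j * partial l F)"

lemma homogeneous_chart: "homogeneous 4 (form_var j * partial l F)"
 by (rule homogeneous_mult_eq[OF homogeneous_var homogeneous_dF]) simp

lemma open_chart: "openX (chart j l)"
 unfolding chart_def by (rule openX_open_locus[OF homogeneous_chart])

lemma cone_chart: "z \<in> over (chart j l) \<longleftrightarrow> z \<in> K & z $ j ~= 0 & dF l z ~= 0"
 unfolding chart_def by (auto simp: cone_open_locus[OF homogeneous_chart])

abbreviation axis :: "4 => point set" where
 "axis j \<equiv> open_locus (form_var j)"

lemma open_axis: "openX (axis j)"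
 by (rule openX_open_locus[OF homogeneous_var])

lemma cone_axis: "z \<in> over (axis j) \<longleftrightarrow> z \<in> K & z $ j ~= 0"
 by (auto simp: cone_open_locus[OF homogeneous_var])

lemma chart_axis: "chart j l \<subseteq> axis j"
 by (rule cone_mono[OF open_chart open_axis]) (auto simp: cone_chart cone_axis)

definition coordinate :: "4 => 4 => complex ^ 4 => complex" where
 "coordinate j i = rst (axis j) (%z. z $ i / z $ j)"

lemma Reg_var_power:
 assumes W: "openX W" "W \<subseteq> axis j" shows "Reg n W (rst W (%z. z $ j powi n))"
proof -
 have nz: "z $ j ~= 0" if "z \<in> over W" for z
  using over_mono[OF W(2)] that by (auto simp: cone_axis)
 have pos: "Reg (int m) W (rst W (%z. z $ j ^ m))" for m
  using Reg_form[OF W(1) homogeneous_power[OF homogeneous_var, of m j], of "int m"] by (simp add: rst_def cong: if_cong)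
 show ?thesis
 proof (cases "n \<ge> 0")
  case True
  then show ?thesis using pos[of "nat n"] by (simp add: power_int_def)
 next
  case False
  have "Reg n W (%x. inverse (rst W (%z. z $ j ^ nat (- n)) x))"
   by (rule Reg_inverse[OF W(1) pos]) (use nz False in "auto simp: rst_def")
  moreover have "(%x. inverse (rst W (%z. z $ j ^ nat (- n)) x)) = rst W (%z. z $ j powi n)"
   using False by (auto simp: rst_def power_int_def power_inverse)
  ultimately show ?thesis by simp
 qed
qed

lemma Reg_coordinate: "Reg 0 (axis j) (coordinate j i)"
proof -
 let ?W = "axis j"
 have "Reg 0 ?W (%x. rst ?W (peval (form_var i)) x * rst ?W (%z. z $ j powi (-1)) x)"
  by (rule Reg_mult[OF open_axis Reg_form[OF open_axis homogeneous_var] Reg_var_power[OF open_axis subset_refl]]) auto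
 moreover have "(%x. rst ?W (peval (form_var i)) x * rst ?W (%z. z $ j powi (-1)) x) = coordinate j i"
  by (auto simp: coordinate_def rst_def power_int_minus divide_inverse)
 ultimately show ?thesis by simp
qed

text \<open>The partial derivatives of \<open>z\<^sub>i / z\<^sub>j\<close>.\<close>

definition cdiff :: "4 => 4 => complex ^ 4 => 4 => complex" where
 "cdiff j i z m = ((if m = i then 1 else 0) - z $ i / z $ j * (if m = j then 1 else 0)) / z $ j"

lemma dwedge_coordinate:
 assumes W: "openX W" "W \<subseteq> axis j" and z: "z \<in> over W"
 shows "dwedge (rst W (coordinate j i)) (z, m, n) = cdiff j i z m * dF n z - cdiff j i z n * dF m z"
proof -
 have zz: "z \<in> K" "z $ j ~= 0" using over_mono[OF W(2)] z by (auto simp: cone_axis)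
 have fd: "fraction_diff (form_var i) (form_var j) z m = cdiff j i z m" for m
  using zz(2) by (simp add: fraction_diff_def cdiff_def)
 have "local_fraction (coordinate j i) z (form_var i) (form_var j)"
  by (rule local_fractionI[OF homogeneous_var homogeneous_var]) (auto simp: zz coordinate_def rst_def cone_axis)
 then have "dwedge (coordinate j i) (z, m, n) = cdiff j i z m * dF n z - cdiff j i z n * dF m z"
  by (simp only: dwedge_unique[OF zz(1)] fd)
 then show ?thesis using dwedge_rst[OF open_axis W Reg_coordinate z] by simp
qed

text \<open>In a chart, \<open>du\<^sub>a \<and> dF\<close> and \<open>du\<^sub>b \<and> dF\<close> form a basis of the matrices that satisfy the
  wedge conditions.\<close>

lemma wedge_cond_basis:
 assumes M: "wedge_cond z (grad z) M" and j: "z $ j ~= 0" and l: "dF l z ~= 0"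
  and ind: "j ~= l" "a ~= j" "a ~= l" "b ~= j" "b ~= l" "a ~= b" "UNIV = {j, l, a, b}"
 shows "M m n = z $ j * M a l / dF l z * (cdiff j a z m * dF n z - cdiff j a z n * dF m z)
  + z $ j * M b l / dF l z * (cdiff j b z m * dF n z - cdiff j b z n * dF m z)"
proof -
 define w where "w i = M i l / dF l z" for i
 have Mll: "M l l = 0" using wedge_condD(1)[OF M, of l l] by simp
 have Mw: "M m n = w m * dF n z - w n * dF m z" for m n
 proof -
  have "dF m z * M n l + dF n z * M l m + dF l z * M m n = 0" using wedge_condD(3)[OF M, of m n l] by (simp add: grad_def)
  moreover have "M l m = - M m l" by (rule wedge_condD(1)[OF M])
  ultimately have "dF l z * M m n = dF n z * M m l - dF m z * M n l" by (simp add: algebra_simps eq_neg_iff_add_eq_0)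
  then have "M m n = (dF n z * M m l - dF m z * M n l) / dF l z" using l by (simp add: field_simps)
  then show ?thesis by (simp add: w_def diff_divide_distrib mult_ac)
 qed
 have "(\<Sum>i\<in>{j, l, a, b}. z $ i * M i l) = 0" using wedge_condD(2)[OF M, of l] unfolding ind(7) .
 then have "z $ j * M j l + z $ a * M a l + z $ b * M b l = 0" using ind(1-6) by (simp add: Mll add.assoc)
 then have "z $ j * w j + z $ a * w a + z $ b * w b = 0" using l by (simp add: w_def field_simps)
 then have wj: "w j = - (z $ a * w a + z $ b * w b) / z $ j" using j by (simp add: field_simps eq_neg_iff_add_eq_0)
 have "w i = z $ j * w a * cdiff j a z i + z $ j * w b * cdiff j b z i" for i
 proof -
  have wl: "w l = 0" by (simp add: w_def Mll)
  have "i \<in> {j, l, a, b}" using UNIV_I[of i] unfolding ind(7) .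
  then consider "i = j" | "i = l" | "i = a" | "i = b" by auto
  then show ?thesis
  proof cases
   case 1
   show ?thesis unfolding 1 wj using ind(2,4) j by (simp add: cdiff_def field_simps)
  next
   case 2
   show ?thesis unfolding 2 wl using ind(1-5) by (simp add: cdiff_def)
  next
   case 3
   show ?thesis unfolding 3 using ind(1-6) j by (simp add: cdiff_def)
  next
   case 4
   show ?thesis unfolding 4 using ind(1-6) j by (simp add: cdiff_def)
  qed
 qed
 then have wi: "w i = z $ j * M a l / dF l z * cdiff j a z i + z $ j * M b l / dF l z * cdiff j b z i" for i
  unfolding w_def[of a] w_def[of b] times_divide_eq_right .
 show ?thesis unfolding Mw[of m n] wi[of m] wi[of n] by (simp only: algebra_simps)
qed

lemma coordinates_independent:
 assumes W: "openX W" "W \<subseteq> chart j l" and z: "z \<in> over W"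
  and ind: "a ~= j" "a ~= l" "b ~= j" "b ~= l" "a ~= b" "j ~= l"
  and zero: "!!i. c * dwedge (rst W (coordinate j a)) (z, i) + d * dwedge (rst W (coordinate j b)) (z, i) = 0"
 shows "c = 0 & d = 0"
proof -
 have zz: "z \<in> K" "z $ j ~= 0" "dF l z ~= 0" using over_mono[OF W(2)] z by (auto simp: cone_chart)
 have WA: "W \<subseteq> axis j" using W(2) chart_axis by blast
 have "c * (dF l z / z $ j) = 0" "d * (dF l z / z $ j) = 0"
  using zero[of "(a, l)"] zero[of "(b, l)"] ind
  by (simp_all add: dwedge_coordinate[OF W(1) WA z] cdiff_def)
 then show ?thesis using zz by simp
qed

section \<open>Kaehler differentials and the cotangent sheaf\<close>

abbreviation KR :: "point set => ((complex ^ 4 => complex) => complex ^ 4 => complex) set" where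
 "KR U \<equiv> kaehler_relations (OX U) (cst X U)"

definition sum_relation :: "point set => (complex ^ 4 => complex) => (complex ^ 4 => complex) => (complex ^ 4 => complex) => complex ^ 4 => complex" where
 "sum_relation U a b = (%s x. gen U (%x. a x + b x) s x - (gen U a s x + gen U b s x))"

definition product_relation :: "point set => (complex ^ 4 => complex) => (complex ^ 4 => complex) => (complex ^ 4 => complex) => complex ^ 4 => complex" where
 "product_relation U a b = (%s x. gen U (%x. a x * b x) s x - (a x * gen U b s x + b x * gen U a s x))"

lemma cst_X: "cst X U c = rst U (%x. c)"
 by (simp add: hypersurface_def rst_def over_def)

lemma gen_Reg: "openX U ==> Reg 0 U a ==> gen U a \<in> frees U (carrier (OX U))"
 by (rule gen_in) (simp_all add: carrier_OX)

lemma KR_iff: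
 assumes U: "openX U"
 shows "r \<in> KR U \<longleftrightarrow> (\<exists>a b. Reg 0 U a & Reg 0 U b & r = sum_relation U a b) \<or>
  (\<exists>a b. Reg 0 U a & Reg 0 U b & r = product_relation U a b) \<or> (\<exists>c. r = gen U (rst U (%x. c)))"
proof -
 let ?F = "free_module (OX U) (carrier (OX U))"
 have e1: "gen U (a \<oplus>\<^bsub>OX U\<^esub> b) \<ominus>\<^bsub>?F\<^esub> (gen U a \<oplus>\<^bsub>?F\<^esub> gen U b) = sum_relation U a b" if ab: "Reg 0 U a" "Reg 0 U b" for a b
  unfolding sum_relation_def OX_simps free_module_simps
  by (rule free_minus[OF U gen_Reg[OF U Reg_add[OF U ab]] frees_add[OF U gen_Reg[OF U ab(1)] gen_Reg[OF U ab(2)]]])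
 have e2: "gen U (a \<otimes>\<^bsub>OX U\<^esub> b) \<ominus>\<^bsub>?F\<^esub> (a \<odot>\<^bsub>?F\<^esub> gen U b \<oplus>\<^bsub>?F\<^esub> b \<odot>\<^bsub>?F\<^esub> gen U a) = product_relation U a b" if ab: "Reg 0 U a" "Reg 0 U b" for a b
  unfolding product_relation_def OX_simps free_module_simps
  by (rule free_minus[OF U gen_Reg[OF U Reg_mult[OF U ab]] frees_add[OF U frees_smult[OF U ab(1) gen_Reg[OF U ab(2)]] frees_smult[OF U ab(2) gen_Reg[OF U ab(1)]]]]) simp
 have "r \<in> KR U \<longleftrightarrow> (\<exists>a b. r = gen U (a \<oplus>\<^bsub>OX U\<^esub> b) \<ominus>\<^bsub>?F\<^esub> (gen U a \<oplus>\<^bsub>?F\<^esub> gen U b) & a \<in> carrier (OX U) & b \<in> carrier (OX U)) \<or>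
  (\<exists>a b. r = gen U (a \<otimes>\<^bsub>OX U\<^esub> b) \<ominus>\<^bsub>?F\<^esub> (a \<odot>\<^bsub>?F\<^esub> gen U b \<oplus>\<^bsub>?F\<^esub> b \<odot>\<^bsub>?F\<^esub> gen U a) & a \<in> carrier (OX U) & b \<in> carrier (OX U)) \<or>
  (\<exists>c. r = gen U (cst X U c))"
  unfolding kaehler_relations_def Let_def by blast
 moreover have "(\<exists>a b. r = gen U (a \<oplus>\<^bsub>OX U\<^esub> b) \<ominus>\<^bsub>?F\<^esub> (gen U a \<oplus>\<^bsub>?F\<^esub> gen U b) & a \<in> carrier (OX U) & b \<in> carrier (OX U))
   \<longleftrightarrow> (\<exists>a b. Reg 0 U a & Reg 0 U b & r = sum_relation U a b)"
  using e1 unfolding str_X by metis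
 moreover have "(\<exists>a b. r = gen U (a \<otimes>\<^bsub>OX U\<^esub> b) \<ominus>\<^bsub>?F\<^esub> (a \<odot>\<^bsub>?F\<^esub> gen U b \<oplus>\<^bsub>?F\<^esub> b \<odot>\<^bsub>?F\<^esub> gen U a) & a \<in> carrier (OX U) & b \<in> carrier (OX U))
   \<longleftrightarrow> (\<exists>a b. Reg 0 U a & Reg 0 U b & r = product_relation U a b)"
  using e2 unfolding str_X by metis
 ultimately show ?thesis by (simp only: cst_X)
qed

lemma KR_in: assumes U: "openX U" shows "KR U \<subseteq> frees U (carrier (OX U))"
proof
 fix r assume "r \<in> KR U"
 then consider (s) a b where "Reg 0 U a" "Reg 0 U b" "r = sum_relation U a b"
  | (p) a b where "Reg 0 U a" "Reg 0 U b" "r = product_relation U a b" | (c) c where "r = gen U (rst U (%x. c))"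
  unfolding KR_iff[OF U] by blast
 then show "r \<in> frees U (carrier (OX U))"
 proof cases
  case s
  then show ?thesis unfolding sum_relation_def
   by (simp only:) (intro frees_diff[OF U] frees_add[OF U] gen_Reg[OF U] Reg_add[OF U])
 next
  case p
  then show ?thesis unfolding product_relation_def
   by (simp only:) (intro frees_diff[OF U] frees_add[OF U] frees_smult[OF U] gen_Reg[OF U] Reg_mult[OF U, of _ 0 _ 0]; simp)
 next
  case c
  then show ?thesis using gen_Reg[OF U Reg_const[OF U]] by simp
 qed
qed

lemma kaehler_presentation: "openX U ==> presentation F U (carrier (OX U)) (KR U)"
 by (intro presentation.intro presentation_axioms.intro smooth_quartic_axioms KR_in)

text \<open>Chain rule: the differential of a polynomial in the local coordinates.\<close>

definition dehom :: "point set => 4 => form => complex ^ 4 => complex" where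
 "dehom W j f = rst W (%z. peval f ((1 / z $ j) *s z))"

lemma dehom_homogeneous:
 assumes "homogeneous n f" "z \<in> over W" shows "dehom W j f z = peval f z / (z $ j) ^ n"
 using assms by (simp add: dehom_def rst_def peval_scale power_divide)

lemma dehom_simps:
 "dehom W j (f + g) = (%x. dehom W j f x + dehom W j g x)"
 "dehom W j (f * g) = (%x. dehom W j f x * dehom W j g x)"
 "dehom W j (form_const c) = rst W (%x. c)"
 by (auto simp: dehom_def rst_def)

lemma dehom_var:
 assumes W: "openX W" "W \<subseteq> axis j"
 shows "dehom W j (form_var i) = rst W (coordinate j i)"
 using over_mono[OF W(2)] by (auto simp: dehom_def rst_def coordinate_def fun_eq_iff)

lemma Reg_dehom:
 assumes W: "openX W" "W \<subseteq> axis j"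
 shows "Reg 0 W (dehom W j f)"
proof (induction f rule: form_ring_induct)
 case (const c)
 then show ?case by (simp only: dehom_simps Reg_const[OF W(1)])
next
 case (var i)
 then show ?case
  unfolding dehom_var[OF W] by (rule Reg_rst[OF open_axis W(1) over_mono[OF W(2)] Reg_coordinate])
next
 case (add f g)
 then show ?case by (simp only: dehom_simps) (rule Reg_add[OF W(1)])
next
 case (mult f g)
 then show ?case by (simp only: dehom_simps) (rule Reg_mult[OF W(1) mult(1) mult(2)], simp)
qed

lemma chain_rule:
 assumes W: "openX W" "W \<subseteq> axis j"
 shows "(%s x. gen W (dehom W j f) s x - (\<Sum>i\<in>UNIV. dehom W j (partial i f) x * gen W (rst W (coordinate j i)) s x))
  \<in> relation_module (OX W) (carrier (OX W)) (KR W)"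
proof -
 interpret PW: presentation F W "carrier (OX W)" "KR W" by (rule kaehler_presentation[OF W(1)])
 note RD = Reg_dehom[OF W]
 let ?D = "%f s x. \<Sum>i\<in>UNIV. dehom W j (partial i f) x * gen W (rst W (coordinate j i)) s x"
 show ?thesis
 proof (induction f rule: form_ring_induct)
  case (const c)
  have "dehom W j (partial i (form_const c)) x = 0" for i x by (simp add: dehom_def rst_def)
  moreover have "gen W (dehom W j (form_const c)) \<in> PW.N"
   unfolding dehom_simps by (rule PW.N_rel) (use KR_iff[OF W(1)] in blast)
  ultimately show ?case by simp
 next
  case (var i)
  have "dehom W j (partial k (form_var i)) x = (if k = i then rst W (%x. 1) x else 0)" for k x
   by (simp add: dehom_def rst_def)
  then have "?D (form_var i) s x = rst W (%x. 1) x * gen W (rst W (coordinate j i)) s x" for s x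
   by (simp add: if_distrib[of "%a. a * _"] cong: if_cong)
  then show ?case by (simp add: dehom_var[OF W] PW.one_gen PW.N_zero)
 next
  case (add f g)
  have r: "sum_relation W (dehom W j f) (dehom W j g) \<in> PW.N"
   by (rule PW.N_rel) (use KR_iff[OF W(1)] RD in blast)
  have D: "?D (f + g) s x = ?D f s x + ?D g s x" for s x
   by (simp add: partial_add dehom_simps distrib_right sum.distrib)
  have "(%s x. sum_relation W (dehom W j f) (dehom W j g) s x
    + ((gen W (dehom W j f) s x - ?D f s x) + (gen W (dehom W j g) s x - ?D g s x))) \<in> PW.N"
   by (rule PW.N_add[OF r PW.N_add[OF add]])
  then show ?case unfolding D dehom_simps sum_relation_def by (simp add: algebra_simps)
 next
  case (mult f g)
  let ?f = "dehom W j f" and ?g = "dehom W j g"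
  have r: "product_relation W ?f ?g \<in> PW.N"
   by (rule PW.N_rel) (use KR_iff[OF W(1)] RD in blast)
  have "dehom W j (partial i (f * g)) x = ?f x * dehom W j (partial i g) x + ?g x * dehom W j (partial i f) x" for i x
   by (simp add: dehom_def rst_def peval_partial_mult)
  then have D: "?D (f * g) s x = ?f x * ?D g s x + ?g x * ?D f s x" for s x
   by (simp add: distrib_right sum.distrib sum_distrib_left mult.assoc)
  have "(%s x. product_relation W ?f ?g s x + (?f x * (gen W ?g s x - ?D g s x) + ?g x * (gen W ?f s x - ?D f s x))) \<in> PW.N"
   by (rule PW.N_add[OF r PW.N_add[OF PW.N_smult[OF RD mult(2)] PW.N_smult[OF RD mult(1)]]])
  moreover have "product_relation W ?f ?g s x + (?f x * (gen W ?g s x - ?D g s x) + ?g x * (gen W ?f s x - ?D f s x))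
    = gen W (dehom W j (f * g)) s x - ?D (f * g) s x" for s x
   unfolding D dehom_simps product_relation_def by (simp add: algebra_simps)
  ultimately show ?case by simp
 qed
qed

text \<open>By the chain rule every differential is a combination of the \<open>du\<^sub>i\<close>. Here
  \<open>du\<^sub>j = 0\<close> since \<open>u\<^sub>j = 1\<close>, and the relation \<open>dF = 0\<close> can be
  solved for \<open>du\<^sub>l\<close> because \<open>\<partial>\<^sub>lF\<close> is invertible.\<close>

lemma coordinates_generate:
 assumes W: "openX W" "W \<subseteq> chart j l" and ind: "UNIV = {j, l, a, b}" "j ~= l" "a ~= j" "a ~= l" "b ~= j" "b ~= l" "a ~= b"
 shows "presentation.spanned F W (carrier (OX W)) (KR W) (rst W (coordinate j a)) (rst W (coordinate j b)) (gen W (dehom W j f))"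
proof -
 interpret PW: presentation F W "carrier (OX W)" "KR W" by (rule kaehler_presentation[OF W(1)])
 have WA: "W \<subseteq> axis j" using W(2) chart_axis by blast
 note RD = Reg_dehom[OF W(1) WA]
 let ?u = "%i. gen W (rst W (coordinate j i))"
 let ?sp = "PW.spanned (rst W (coordinate j a)) (rst W (coordinate j b))"
 have zz: "z \<in> K" "z $ j ~= 0" "dF l z ~= 0" if "z \<in> over W" for z
  using over_mono[OF W(2)] that by (auto simp: cone_chart)
 have ua: "?sp (?u a)" and ub: "?sp (?u b)" by (rule PW.spanned_gen)+
 have "rst W (coordinate j j) = rst W (%x. 1)"
  using zz by (auto simp: rst_def coordinate_def cone_axis)
 then have "?u j \<in> PW.N" using PW.N_rel[of "gen W (rst W (%x. 1))"] KR_iff[OF W(1)] by auto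
 then have uj: "?sp (?u j)" by (rule PW.spanned_of_N)
 have ul: "?sp (?u l)"
 proof -
  have "dehom W j F = rst W (%x. 0)"
  proof
   fix z show "dehom W j F z = rst W (%x. 0) z"
   proof (cases "z \<in> over W")
    case True
    then show ?thesis using zz(1)[OF True] by (simp add: dehom_homogeneous[OF homogeneous_F True] K_def rst_def)
   qed (simp add: dehom_def rst_def)
  qed
  then have "gen W (dehom W j F) \<in> PW.N" using PW.N_rel[of "gen W (rst W (%x. 0))"] KR_iff[OF W(1)] by auto
  then have "(%s x. gen W (dehom W j F) s x - (gen W (dehom W j F) s x - (\<Sum>i\<in>UNIV. dehom W j (partial i F) x * ?u i s x))) \<in> PW.N"
   by (rule PW.N_diff[OF _ chain_rule[OF W(1) WA]])
  then have 1: "?sp (%s x. \<Sum>i\<in>UNIV. dehom W j (partial i F) x * ?u i s x)" by (intro PW.spanned_of_N) simp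
  have 2: "?sp (%s x. dehom W j (partial j F) x * ?u j s x + (dehom W j (partial a F) x * ?u a s x + dehom W j (partial b F) x * ?u b s x))"
   by (intro PW.spanned_add PW.spanned_smult RD uj ua ub)
  have "(\<Sum>i\<in>UNIV. dehom W j (partial i F) x * ?u i s x) - (dehom W j (partial j F) x * ?u j s x + (dehom W j (partial a F) x * ?u a s x + dehom W j (partial b F) x * ?u b s x))
    = dehom W j (partial l F) x * ?u l s x" for s x
  proof -
   have "(\<Sum>i\<in>{j, l, a, b}. dehom W j (partial i F) x * ?u i s x) = dehom W j (partial j F) x * ?u j s x + (dehom W j (partial l F) x * ?u l s x + (dehom W j (partial a F) x * ?u a s x + dehom W j (partial b F) x * ?u b s x))"
    using ind(2-) by simp
   then show ?thesis unfolding ind(1) by simp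
  qed
  then have 3: "?sp (%s x. dehom W j (partial l F) x * ?u l s x)" using PW.spanned_diff[OF 1 2] by simp
  have nz: "dehom W j (partial l F) x ~= 0" if "x \<in> over W" for x
   using zz[OF that] by (simp add: dehom_homogeneous[OF homogeneous_dF that])
  have "?sp (%s x. inverse (dehom W j (partial l F) x) * (dehom W j (partial l F) x * ?u l s x))"
   by (rule PW.spanned_smult[OF 3 Reg_inverse[OF W(1) RD]]) (use nz in auto)
  moreover have "inverse (dehom W j (partial l F) x) * (dehom W j (partial l F) x * ?u l s x) = ?u l s x" for s x
   using nz[of x] by (cases "x \<in> over W") (auto simp: gen_apply rst_def)
  ultimately show ?thesis by simp
 qed
 have "i \<in> {j, l, a, b}" for i using UNIV_I[of i] unfolding ind(1) .
 then have ui: "?sp (?u i)" for i using ua ub uj ul by fast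
 have "?sp (%s x. \<Sum>i\<in>UNIV. dehom W j (partial i f) x * ?u i s x)"
  by (intro PW.spanned_sum PW.spanned_smult ui RD) simp
 then show ?thesis by (rule PW.spanned_N) (rule chain_rule[OF W(1) WA])
qed

text \<open>A regular function is locally a fraction \<open>P / Q\<close> of polynomials in the affine coordinates;
  the product rule for \<open>Q s = P\<close> expresses its differential by those of \<open>P\<close> and
  \<open>Q\<close>.\<close>

lemma kaehler_presented_presheaf:
 "presented_presheaf F (kaehler_presheaf X) (%U. carrier (OX U)) KR (%U V. rst V) dwedge"
proof (intro presented_presheaf.intro presented_presheaf_axioms.intro smooth_quartic_axioms)
 fix U assume U: "openX U"
 show "sec (kaehler_presheaf X) U = presented_module (OX U) (carrier (OX U)) (KR U)"
  by (simp add: kaehler_presheaf_def Let_def kaehler_module_def)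
 show "KR U \<subseteq> frees U (carrier (OX U))" by (rule KR_in[OF U])
next
 fix U V :: "point set"
 have "res (str X) U V = rst V" by (intro ext) (simp add: OX_simps)
 then show "res (kaehler_presheaf X) U V = presented_map (OX U) (OX V) (rst V) (rst V) (carrier (OX V)) (relation_module (OX V) (carrier (OX V)) (KR V))"
  by (simp add: kaehler_presheaf_def Let_def)
next
 fix U V s assume "openX U" "openX V" "V \<subseteq> U" "s \<in> carrier (OX U)"
 then show "rst V s \<in> carrier (OX V)" using Reg_rst[OF _ _ over_mono] by (simp add: carrier_OX)
next
 fix U r and y :: "(complex ^ 4) \<times> 4 \<times> 4" assume U: "openX U" and r: "r \<in> KR U"
 obtain x i where y: "y = (x, i)" by (cases y)
 from r consider (s) a b where "Reg 0 U a" "Reg 0 U b" "r = sum_relation U a b"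
  | (p) a b where "Reg 0 U a" "Reg 0 U b" "r = product_relation U a b" | (c) c where "r = gen U (rst U (%x. c))"
  unfolding KR_iff[OF U] by blast
 then show "evaluate dwedge r y = 0"
 proof cases
  case s
  note g = gen_Reg[OF U Reg_add[OF U s(1,2)]] gen_Reg[OF U s(1)] gen_Reg[OF U s(2)]
  have "evaluate dwedge r y = rst U (%x. 1) x * (dwedge (%x. a x + b x) (x, i) - (dwedge a (x, i) + dwedge b (x, i)))"
   unfolding y s(3) sum_relation_def
   by (simp add: evaluate_diff[OF U g(1) frees_add[OF U g(2,3)]] evaluate_add[OF g(2,3)] evaluate_gen algebra_simps)
  then show ?thesis using dwedge_add[OF U s(1,2), of x i] by (cases "x \<in> over U") (auto simp: rst_def)
 next
  case p
  have pr: "Reg 0 U (%x. a x * b x)" by (rule Reg_mult[OF U p(1,2)]) simp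
  note g = gen_Reg[OF U pr] gen_Reg[OF U p(1)] gen_Reg[OF U p(2)]
  note ag = frees_smult[OF U p(1) g(3)] and bg = frees_smult[OF U p(2) g(2)]
  have "evaluate dwedge r y = rst U (%x. 1) x * (dwedge (%x. a x * b x) (x, i) - (a x * dwedge b (x, i) + b x * dwedge a (x, i)))"
   unfolding y p(3) product_relation_def
   by (simp add: evaluate_diff[OF U g(1) frees_add[OF U ag bg]] evaluate_add[OF ag bg] evaluate_smult[OF g(2)] evaluate_smult[OF g(3)] evaluate_gen algebra_simps)
  then show ?thesis using dwedge_mult[OF U p(1,2), of x i] by (cases "x \<in> over U") (auto simp: rst_def)
 next
  case c
  then show ?thesis using dwedge_const[OF U, of x _ i] unfolding y by (cases "x \<in> over U") (auto simp: evaluate_gen rst_def)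
 qed
next
 fix U V s x and i :: "4 \<times> 4" assume "openX U" "openX V" "V \<subseteq> U" "s \<in> carrier (OX U)" "x \<in> over V"
 then show "dwedge (rst V s) (x, i) = dwedge s (x, i)" by (intro dwedge_rst) (auto simp: carrier_OX)
next
 fix U V r assume U: "openX U" and V: "openX V" "V \<subseteq> U" and r: "r \<in> KR U"
 interpret PV: presentation F V "carrier (OX V)" "KR V" by (rule kaehler_presentation[OF V(1)])
 have RV: "Reg 0 V (rst V a)" if "Reg 0 U a" for a by (rule Reg_rst[OF U V(1) over_mono[OF V(2)] that])
 let ?m = "free_map (OX U) (OX V) (rst V) (rst V)"
 from r consider (s) a b where "Reg 0 U a" "Reg 0 U b" "r = sum_relation U a b"
  | (p) a b where "Reg 0 U a" "Reg 0 U b" "r = product_relation U a b" | (c) c where "r = gen U (rst U (%x. c))"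
  unfolding KR_iff[OF U] by blast
 then have "?m r \<in> KR V"
 proof cases
  case s
  note g = gen_Reg[OF U Reg_add[OF U s(1,2)]] gen_Reg[OF U s(1)] gen_Reg[OF U s(2)]
  have "rst V (%x. a x + b x) = (%x. rst V a x + rst V b x)" by (auto simp: rst_def)
  then have "?m r = sum_relation V (rst V a) (rst V b)"
   unfolding s(3) sum_relation_def free_map_diff[OF U V g(1) frees_add[OF U g(2,3)]] free_map_add[OF U V g(2,3)] free_map_gen[OF U V] by simp
  then show ?thesis unfolding KR_iff[OF V(1)] using RV s by blast
 next
  case p
  have pr: "Reg 0 U (%x. a x * b x)" by (rule Reg_mult[OF U p(1,2)]) simp
  note g = gen_Reg[OF U pr] gen_Reg[OF U p(1)] gen_Reg[OF U p(2)]
  note ag = frees_smult[OF U p(1) g(3)] and bg = frees_smult[OF U p(2) g(2)]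
  have "rst V (%x. a x * b x) = (%x. rst V a x * rst V b x)" by (auto simp: rst_def)
  then have "?m r = product_relation V (rst V a) (rst V b)"
   unfolding p(3) product_relation_def free_map_diff[OF U V g(1) frees_add[OF U ag bg]] free_map_add[OF U V ag bg]
    free_map_smult[OF U V p(1) g(3)] free_map_smult[OF U V p(2) g(2)] free_map_gen[OF U V] by simp
  then show ?thesis unfolding KR_iff[OF V(1)] using RV p by blast
 next
  case (c c)
  have "rst V (rst U (%x. c)) = rst V (%x. c)" using over_mono[OF V(2)] by (force simp: rst_def fun_eq_iff)
  then have "?m r = gen V (rst V (%x. c))" unfolding c free_map_gen[OF U V] by simp
  then show ?thesis unfolding KR_iff[OF V(1)] by blast
 qed
 then show "?m r \<in> relation_module (OX V) (carrier (OX V)) (KR V)" by (rule PV.N_rel)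
next
 fix p assume p: "p \<in> total"
 obtain x where x: "x \<in> p" using pointX_nonempty[OF openX_total p] by blast
 then have px: "p = line x" "x \<in> K" using in_point_cone[OF openX_total p] by auto
 obtain j l a b where jl: "x $ j ~= 0" "dF l x ~= 0" and ind: "j ~= l" "a ~= j" "a ~= l" "b ~= j" "b ~= l" "a ~= b" "UNIV = {j, l, a, b}"
  using good_indices[OF px(2)] by metis
 let ?W0 = "chart j l"
 have xW0: "x \<in> over ?W0" using jl px by (simp add: cone_chart)
 then have pW0: "p \<in> ?W0" using in_coneX_iff[OF open_chart] px by blast
 have gen: "\<exists>W1. openX W1 & p \<in> W1 & W1 \<subseteq> U \<inter> ?W0 & (\<forall>W. openX W & p \<in> W & W \<subseteq> W1 -->
   presentation.spanned F W (carrier (OX W)) (KR W) (rst W (coordinate j a)) (rst W (coordinate j b)) (gen W (rst W s)))"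
  if U: "openX U" "p \<in> U" and s': "s \<in> carrier (OX U)" for U s
 proof -
  have s: "Reg 0 U s" using s' by (simp add: carrier_OX)
  have xU: "x \<in> over U" using in_point_cone[OF U x] by blast
  obtain P Q n where PQ: "local_fraction s x P Q" "homogeneous n P" "homogeneous n Q" "!!z. z \<in> K ==> peval Q z ~= 0 ==> z \<in> over U"
   using Reg_local_fraction[OF U(1) s xU] by blast
  let ?W1 = "U \<inter> (?W0 \<inter> open_locus Q)"
  have "x \<in> over (open_locus Q)" using local_fractionD(1)[OF PQ(1)] px(2) by (simp add: cone_open_locus[OF PQ(3)])
  then have pQ: "p \<in> open_locus Q" using in_coneX_iff[OF openX_open_locus[OF PQ(3)]] px by blast
  show ?thesis
  proof (intro exI[of _ ?W1] conjI allI impI)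
   show "openX ?W1" using U open_chart openX_open_locus[OF PQ(3)] by blast
   show "p \<in> ?W1" using U pW0 pQ by blast
   fix W assume W': "openX W & p \<in> W & W \<subseteq> ?W1"
   then have W: "openX W" "W \<subseteq> U" "W \<subseteq> ?W0" "W \<subseteq> open_locus Q" by auto
   have WA: "W \<subseteq> axis j" using W(3) chart_axis by blast
   interpret PW: presentation F W "carrier (OX W)" "KR W" by (rule kaehler_presentation[OF W(1)])
   let ?sp = "PW.spanned (rst W (coordinate j a)) (rst W (coordinate j b))"
   let ?P = "dehom W j P" and ?Q = "dehom W j Q" and ?s = "rst W s"
   note RD = Reg_dehom[OF W(1) WA]
   have Rs: "Reg 0 W ?s" by (rule Reg_rst[OF U(1) W(1) over_mono[OF W(2)] s])
   note cg = coordinates_generate[OF W(1,3) ind(7,1,2,3,4,5,6)]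
   have zz: "z \<in> K" "peval Q z ~= 0" "z $ j ~= 0" if "z \<in> over W" for z
    using over_mono[OF W(4)] over_mono[OF W(3)] that by (auto simp: cone_open_locus[OF PQ(3)] cone_chart)
   have QsP: "(%x. ?Q x * ?s x) = ?P"
   proof
    fix z
    show "?Q z * ?s z = ?P z"
    proof (cases "z \<in> over W")
     case True
     then show ?thesis using local_fractionD(2)[OF PQ(1) zz(1,2)[OF True]] zz[OF True]
      by (simp add: dehom_homogeneous[OF PQ(2)] dehom_homogeneous[OF PQ(3)] rst_def)
    qed (simp add: rst_def dehom_def)
   qed
   have "product_relation W ?Q ?s \<in> PW.N" by (rule PW.N_rel) (use KR_iff[OF W(1)] RD Rs in blast)
   then have rel: "(%t x. - product_relation W ?Q ?s t x) \<in> PW.N" by (rule PW.N_uminus)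
   have 1: "?sp (%t x. gen W ?P t x - ?s x * gen W ?Q t x)"
    by (intro PW.spanned_diff PW.spanned_smult cg Rs)
   have Qsp: "?sp (%t x. ?Q x * gen W ?s t x)"
   proof (rule PW.spanned_N[OF 1])
    have "(%t x. ?Q x * gen W ?s t x - (gen W ?P t x - ?s x * gen W ?Q t x)) = (%t x. - product_relation W ?Q ?s t x)"
     unfolding product_relation_def QsP by (intro ext) (simp add: algebra_simps)
    then show "(%t x. ?Q x * gen W ?s t x - (gen W ?P t x - ?s x * gen W ?Q t x)) \<in> PW.N" using rel by simp
   qed
   have nz: "?Q x ~= 0" if "x \<in> over W" for x using zz[OF that] by (simp add: dehom_homogeneous[OF PQ(3) that])
   have "?sp (%t x. inverse (?Q x) * (?Q x * gen W ?s t x))"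
    by (rule PW.spanned_smult[OF Qsp Reg_inverse[OF W(1) RD]]) (use nz in auto)
   moreover have "inverse (?Q x) * (?Q x * gen W ?s t x) = gen W ?s t x" for t x
    using nz[of x] by (cases "x \<in> over W") (auto simp: gen_apply rst_def)
   ultimately show "?sp (gen W ?s)" by simp
  qed auto
 qed
 show "\<exists>W0 g h. openX W0 & p \<in> W0 &
   (\<forall>W. openX W & W \<subseteq> W0 --> g W \<in> carrier (OX W) & h W \<in> carrier (OX W) &
    (\<forall>z\<in>over W. \<forall>c d. (\<forall>i. c * dwedge (g W) (z, i) + d * dwedge (h W) (z, i) = 0) --> c = 0 & d = 0)) &
   (\<forall>U s. openX U & p \<in> U & s \<in> carrier (OX U) --> (\<exists>W1. openX W1 & p \<in> W1 & W1 \<subseteq> U \<inter> W0 &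
    (\<forall>W. openX W & p \<in> W & W \<subseteq> W1 --> presentation.spanned F W (carrier (OX W)) (KR W) (g W) (h W) (gen W (rst W s)))))"
 proof (rule exI[of _ ?W0], rule exI[of _ "%W. rst W (coordinate j a)"], rule exI[of _ "%W. rst W (coordinate j b)"], intro conjI allI impI ballI)
  fix W assume W: "openX W & W \<subseteq> ?W0"
  then have WA: "W \<subseteq> axis j" using chart_axis by blast
  have "Reg 0 W (rst W (coordinate j i))" for i
   using Reg_rst[OF open_axis _ over_mono[OF WA] Reg_coordinate] W by blast
  then show "rst W (coordinate j a) \<in> carrier (OX W)" "rst W (coordinate j b) \<in> carrier (OX W)" by (simp_all add: carrier_OX)
  fix z c d assume "z \<in> over W" "\<forall>i. c * dwedge (rst W (coordinate j a)) (z, i) + d * dwedge (rst W (coordinate j b)) (z, i) = 0"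
  then have "c = 0 & d = 0" using W coordinates_independent[of W j l z a b c d] ind by blast
  then show "c = 0" "d = 0" by auto
 qed (use open_chart pW0 gen in auto)
qed

end

section \<open>The cotangent sheaf and its twists\<close>

lemma wedge_cond_zero: "wedge_cond u v (%i j. 0)"
 by (simp add: wedge_cond_def)

lemma wedge_cond_add:
 assumes M: "wedge_cond u v M" and N: "wedge_cond u v N" shows "wedge_cond u v (%i j. M i j + c * N i j)"
 unfolding wedge_cond_def
proof (intro conjI allI)
 fix i j l
 have "M i j = - M j i" "N i j = - N j i" by (rule wedge_condD(1)[OF M], rule wedge_condD(1)[OF N])
 then show "M i j + c * N i j = - (M j i + c * N j i)" by (simp only:) (simp add: algebra_simps)
 have "(\<Sum>i\<in>UNIV. u $ i * (M i l + c * N i l)) = (\<Sum>i\<in>UNIV. u $ i * M i l) + c * (\<Sum>i\<in>UNIV. u $ i * N i l)"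
  by (simp add: sum.distrib sum_distrib_left algebra_simps)
 then show "(\<Sum>i\<in>UNIV. u $ i * (M i l + c * N i l)) = 0" by (simp add: wedge_condD(2)[OF M] wedge_condD(2)[OF N])
 have "v $ i * (M j l + c * N j l) + v $ j * (M l i + c * N l i) + v $ l * (M i j + c * N i j)
   = (v $ i * M j l + v $ j * M l i + v $ l * M i j) + c * (v $ i * N j l + v $ j * N l i + v $ l * N i j)"
  by (simp add: algebra_simps)
 then show "v $ i * (M j l + c * N j l) + v $ j * (M l i + c * N l i) + v $ l * (M i j + c * N i j) = 0"
  by (simp add: wedge_condD(3)[OF M] wedge_condD(3)[OF N])
qed

lemma wedge_cond_smult: "wedge_cond u v M ==> wedge_cond u v (%i j. c * M i j)"
 using wedge_cond_add[OF wedge_cond_zero, of u v M c] by simp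

lemma wedge_cond_sum:
 "finite A ==> (!!a. a \<in> A ==> wedge_cond u v (M a)) ==> wedge_cond u v (%i j. \<Sum>a\<in>A. c a * M a i j)"
proof (induction A rule: finite_induct)
 case (insert a A)
 have "wedge_cond u v (%i j. (\<Sum>a\<in>A. c a * M a i j) + c a * M a i j)"
  by (rule wedge_cond_add) (use insert in auto)
 then show ?case using insert(1,2) by (simp add: add.commute)
qed (simp add: wedge_cond_zero)

context smooth_quartic
begin

definition on_cone :: "point set => ((complex ^ 4) \<times> 'i => complex) => (complex ^ 4) \<times> 'i => complex" where
 "on_cone U \<eta> = (%(x, i). if x \<in> over U then \<eta> (x, i) else 0)"

lemma on_cone_apply: "on_cone U \<eta> (x, i) = (if x \<in> over U then \<eta> (x, i) else 0)"
 by (simp add: on_cone_def)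

lemma wedge_formsD:
 assumes "\<eta> \<in> wedge_forms k U"
 shows "Reg (k + 2) U (%x. \<eta> (x, i, j))" "x \<in> over U ==> wedge_cond x (grad x) (%i j. \<eta> (x, i, j))"
 using assms by (auto simp: wedge_forms_def)

lemma wedge_forms_off: "openX U ==> \<eta> \<in> wedge_forms k U ==> x \<notin> over U ==> \<eta> (x, i) = 0"
 by (cases i) (simp add: Reg_off[OF _ wedge_formsD(1)])

lemma wedge_forms_glue:
 assumes U: "openX U" and off: "!!x i. x \<notin> over U ==> \<eta> (x, i) = 0"
  and loc: "!!p. p \<in> U ==> \<exists>V \<eta>'. openX V & p \<in> V & V \<subseteq> U & \<eta>' \<in> wedge_forms k V & (\<forall>x\<in>over V. \<forall>i. \<eta> (x, i) = \<eta>' (x, i))"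
 shows "\<eta> \<in> wedge_forms k U"
proof -
 have loc': "\<exists>V \<eta>'. openX V & x \<in> over V & over V \<subseteq> over U & \<eta>' \<in> wedge_forms k V & (\<forall>x\<in>over V. \<forall>i. \<eta> (x, i) = \<eta>' (x, i))"
  if x: "x \<in> over U" for x
 proof -
  have xU: "line x \<in> U" "x ~= 0" using x in_coneX_iff[OF U] by auto
  obtain V \<eta>' where V: "openX V" "line x \<in> V" "V \<subseteq> U" "\<eta>' \<in> wedge_forms k V" "\<forall>x\<in>over V. \<forall>i. \<eta> (x, i) = \<eta>' (x, i)"
   using loc[OF xU(1)] by (elim exE conjE)
  have "x \<in> over V" using in_coneX_iff[OF V(1)] V(2) xU(2) by simp
  then show ?thesis using V over_mono[OF V(3)] by (intro exI[of _ V] exI[of _ \<eta>'] conjI)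
 qed
 have "Reg (k + 2) U (%x. \<eta> (x, i, j))" for i j
 proof (rule Reg_glue[OF U off])
  fix x assume "x \<in> over U"
  obtain V \<eta>' where V: "openX V" "x \<in> over V" "over V \<subseteq> over U" "\<eta>' \<in> wedge_forms k V" "\<forall>x\<in>over V. \<forall>i. \<eta> (x, i) = \<eta>' (x, i)"
   using loc'[OF \<open>x \<in> over U\<close>] by (elim exE conjE)
  show "\<exists>V t. openX V & x \<in> over V & over V \<subseteq> over U & Reg (k + 2) V t & (\<forall>z\<in>over V. \<eta> (z, i, j) = t z)"
   by (intro exI[of _ V] exI[of _ "%x. \<eta>' (x, i, j)"] conjI V(1-3) wedge_formsD(1)[OF V(4)]) (use V(5) in blast)
 qed
 moreover have "wedge_cond x (grad x) (%i j. \<eta> (x, i, j))" if xU: "x \<in> over U" for x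
 proof -
  obtain V \<eta>' where V: "openX V" "x \<in> over V" "over V \<subseteq> over U" "\<eta>' \<in> wedge_forms k V" "\<forall>x\<in>over V. \<forall>i. \<eta> (x, i) = \<eta>' (x, i)"
   using loc'[OF xU] by (elim exE conjE)
  have "(%i j. \<eta> (x, i, j)) = (%i j. \<eta>' (x, i, j))" using V(2,5) by auto
  then show ?thesis using wedge_formsD(2)[OF V(4,2)] by (simp only:)
 qed
 ultimately show ?thesis by (simp add: wedge_forms_def)
qed

lemma wedge_forms_restrict:
 assumes U: "openX U" and V: "openX V" "V \<subseteq> U" and \<eta>: "\<eta> \<in> wedge_forms k U"
 shows "on_cone V \<eta> \<in> wedge_forms k V"
proof -
 have "(%x. on_cone V \<eta> (x, i, j)) = rst V (%x. \<eta> (x, i, j))" for i j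
  by (simp add: on_cone_def rst_def)
 then have "Reg (k + 2) V (%x. on_cone V \<eta> (x, i, j))" for i j
  using Reg_rst[OF U V(1) over_mono[OF V(2)] wedge_formsD(1)[OF \<eta>]] by simp
 moreover have "wedge_cond x (grad x) (%i j. on_cone V \<eta> (x, i, j))" if "x \<in> over V" for x
  using wedge_formsD(2)[OF \<eta>, of x] over_mono[OF V(2)] that by (auto simp: on_cone_def)
 ultimately show ?thesis by (simp add: wedge_forms_def)
qed

lemma evaluate_wedge:
 fixes ev :: "'s => (complex ^ 4) \<times> 4 \<times> 4 => complex"
 assumes V: "openX V" and f: "f \<in> frees V S" and ev: "!!s. s \<in> S ==> on_cone V (ev s) \<in> wedge_forms k V"
 shows "evaluate ev f \<in> wedge_forms k V"
proof -
 let ?T = "{s. f s ~= (%x. 0)}"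
 have T: "finite ?T" "!!s. s \<in> ?T ==> s \<in> S" and R: "!!s. Reg 0 V (f s)" using f by (auto simp: frees_def)
 have e: "evaluate ev f (x, i) = (\<Sum>s\<in>?T. f s x * on_cone V (ev s) (x, i))" for x i
  unfolding evaluate_def prod.case
  by (rule sum.cong[OF refl]) (simp add: on_cone_apply Reg_off[OF V R])
 have "Reg (k + 2) V (%x. evaluate ev f (x, i, j))" for i j
  unfolding e
 proof (rule Reg_sum[OF V])
  fix s assume "s \<in> ?T"
  then show "Reg (k + 2) V (%x. f s x * on_cone V (ev s) (x, i, j))"
   by (intro Reg_mult[OF V R wedge_formsD(1)[OF ev[OF T(2)]]]) simp_all
 qed
 moreover have "wedge_cond x (grad x) (%i j. evaluate ev f (x, i, j))" if "x \<in> over V" for x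
  unfolding e by (intro wedge_cond_sum T(1) wedge_formsD(2)[OF ev[OF T(2)] that])
 ultimately show ?thesis by (simp add: wedge_forms_def)
qed

text \<open>The degree of \<open>\<eta>\<close> is \<open>k + 2\<close>; the power of \<open>z\<^sub>j\<close>
  makes the coefficient a function.\<close>

definition chart_coeff :: "4 => 4 => int => point set => ((complex ^ 4) \<times> 4 \<times> 4 => complex) => 4 => complex ^ 4 => complex" where
 "chart_coeff j l k W \<eta> a = rst W (%z. \<eta> (z, a, l) / dF l z * z $ j powi (1 - k))"

lemma Reg_chart_coeff:
 assumes W: "openX W" "W \<subseteq> chart j l" and \<eta>: "\<eta> \<in> wedge_forms k W"
 shows "Reg 0 W (chart_coeff j l k W \<eta> a)"
proof -
 have WA: "W \<subseteq> axis j" using W(2) chart_axis by blast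
 have nz: "z \<in> over W ==> dF l z ~= 0" for z using over_mono[OF W(2)] by (auto simp: cone_chart)
 have R1: "Reg 3 W (rst W (dF l))" by (rule Reg_form[OF W(1) homogeneous_dF]) simp
 have R2: "Reg (-3) W (%z. inverse (rst W (dF l) z))"
  by (rule Reg_inverse[OF W(1) R1]) (use nz in "auto simp: rst_def")
 have R3: "Reg (k - 1) W (%z. \<eta> (z, a, l) * inverse (rst W (dF l) z))"
  by (rule Reg_mult[OF W(1) wedge_formsD(1)[OF \<eta>] R2]) simp
 have "Reg 0 W (%z. \<eta> (z, a, l) * inverse (rst W (dF l) z) * rst W (%z. z $ j powi (1 - k)) z)"
  by (rule Reg_mult[OF W(1) R3 Reg_var_power[OF W(1) WA]]) simp
 moreover have "(%z. \<eta> (z, a, l) * inverse (rst W (dF l) z) * rst W (%z. z $ j powi (1 - k)) z) = chart_coeff j l k W \<eta> a"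
  by (auto simp: chart_coeff_def rst_def divide_inverse)
 ultimately show ?thesis by simp
qed

lemma chart_expansion:
 assumes W: "openX W" "W \<subseteq> chart j l" and \<eta>: "\<eta> \<in> wedge_forms k W" and z: "z \<in> over W"
  and ind: "j ~= l" "a ~= j" "a ~= l" "b ~= j" "b ~= l" "a ~= b" "UNIV = {j, l, a, b}"
 shows "\<eta> (z, i) = chart_coeff j l k W \<eta> a z * (dwedge (rst W (coordinate j a)) (z, i) * z $ j powi k)
  + chart_coeff j l k W \<eta> b z * (dwedge (rst W (coordinate j b)) (z, i) * z $ j powi k)"
proof -
 obtain m n where i: "i = (m, n)" by (cases i)
 have zz: "z $ j ~= 0" "dF l z ~= 0" using over_mono[OF W(2)] z by (auto simp: cone_chart)
 have WA: "W \<subseteq> axis j" using W(2) chart_axis by blast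
 have p: "z $ j powi (1 - k) * z $ j powi k = z $ j" using power_int_add[of "z $ j" "1 - k" k] zz(1) by simp
 have c: "chart_coeff j l k W \<eta> c z * (D * z $ j powi k) = z $ j * \<eta> (z, c, l) / dF l z * D" for c D
 proof -
  have "chart_coeff j l k W \<eta> c z * (D * z $ j powi k) = \<eta> (z, c, l) / dF l z * D * (z $ j powi (1 - k) * z $ j powi k)"
   using z by (simp add: chart_coeff_def rst_def)
  then show ?thesis unfolding p by simp
 qed
 show ?thesis
  unfolding i c dwedge_coordinate[OF W(1) WA z] by (rule wedge_cond_basis[OF wedge_formsD(2)[OF \<eta> z] zz ind])
qed

lemma chart_at:
 assumes p: "p \<in> total"
 obtains j l a b where "p \<in> chart j l" "j ~= l" "a ~= j" "a ~= l" "b ~= j" "b ~= l" "a ~= b" "UNIV = {j, l, a, b :: 4}"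
proof -
 obtain x where x: "x \<in> p" using pointX_nonempty[OF openX_total p] by blast
 then have px: "p = line x" "x \<in> K" using in_point_cone[OF openX_total p] by auto
 obtain j l a b where jl: "x $ j ~= 0" "dF l x ~= 0" and ind: "j ~= l" "a ~= j" "a ~= l" "b ~= j" "b ~= l" "a ~= b" "UNIV = {j, l, a, b}"
  using good_indices[OF px(2)] by metis
 have "x \<in> over (chart j l)" using jl px by (simp add: cone_chart)
 then have "p \<in> chart j l" using in_coneX_iff[OF open_chart] px by blast
 then show ?thesis using ind by (rule that)
qed

end

text \<open>Presented presheaves whose sections have the wedge forms of degree \<open>k\<close> as local values.\<close>

locale wedge_presheaf = presented_presheaf F P S R \<sigma> ev
 for F :: form and P :: "(point, complex ^ 4 => complex, ('s => complex ^ 4 => complex) set) presheaf"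
  and S :: "point set => 's set" and R :: "point set => ('s => complex ^ 4 => complex) set"
  and \<sigma> :: "point set => point set => 's => 's"
  and ev :: "'s => (complex ^ 4) \<times> 4 \<times> 4 => complex" +
 fixes k :: int
 assumes ev_wedge: "openX U ==> s \<in> S U ==> on_cone U (ev s) \<in> wedge_forms k U"
  and wedge_span: "p \<in> total ==> \<exists>W0. openX W0 & p \<in> W0 & (\<forall>W. openX W & W \<subseteq> W0 --> (\<exists>g\<in>S W. \<exists>h\<in>S W. \<forall>\<eta>\<in>wedge_forms k W.
   \<exists>c d. Reg 0 W c & Reg 0 W d & (\<forall>x\<in>over W. \<forall>i. \<eta> (x, i) = c x * ev g (x, i) + d x * ev h (x, i))))"
begin

sublocale valued_presheaf F P "%U. presentation.cls_evaluate ev"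
 by (rule valued_presheaf)

lemma Val_wedge:
 assumes U: "openX U" and s: "s \<in> carrier (sec SP U)" shows "Val s \<in> wedge_forms k U"
proof (rule wedge_forms_glue[OF U])
 fix p assume "p \<in> U"
 then obtain V m where V: "openX V" "p \<in> V" "V \<subseteq> U" "m \<in> carrier (sec P V)"
   "!!x i. x \<in> over V ==> Val s (x, i) = presentation.cls_evaluate ev m (x, i)"
  using Val_local[OF s] by metis
 interpret PV: presentation F V "S V" "R V" by (rule presentation[OF V(1)])
 obtain f where f: "m = PV.cls f" "f \<in> frees V (S V)" using V(4) by (auto simp: sec_P[OF V(1)] PV.PM_carrier)
 have "presentation.cls_evaluate ev m = evaluate ev f" unfolding f(1) by (rule cls_value[OF V(1) f(2)])
 moreover have "evaluate ev f \<in> wedge_forms k V" by (rule evaluate_wedge[OF V(1) f(2) ev_wedge[OF V(1)]])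
 ultimately show "\<exists>V \<eta>'. openX V & p \<in> V & V \<subseteq> U & \<eta>' \<in> wedge_forms k V & (\<forall>x\<in>over V. \<forall>i. Val s (x, i) = \<eta>' (x, i))"
  using V by (intro exI[of _ V] exI[of _ "evaluate ev f"]) auto
qed (rule Val_off[OF s U])

lemma Val_range:
 assumes U: "openX U" shows "Val ` carrier (sec SP U) = wedge_forms k U"
proof
 show "Val ` carrier (sec SP U) \<subseteq> wedge_forms k U" using Val_wedge[OF U] by blast
 show "wedge_forms k U \<subseteq> Val ` carrier (sec SP U)"
 proof
  fix \<eta> assume \<eta>: "\<eta> \<in> wedge_forms k U"
  have "\<exists>s. s \<in> carrier (sec SP U) & Val s = \<eta>"
  proof (rule Val_surject[OF U, of \<eta>])
   fix x and i :: "4 \<times> 4" assume "x \<notin> over U"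
   then show "\<eta> (x, i) = 0" by (rule wedge_forms_off[OF U \<eta>])
  next
   fix p assume p: "p \<in> U"
   obtain W0 where W0: "openX W0" "p \<in> W0" and span: "\<forall>W. openX W & W \<subseteq> W0 --> (\<exists>g\<in>S W. \<exists>h\<in>S W. \<forall>\<eta>\<in>wedge_forms k W.
     \<exists>c d. Reg 0 W c & Reg 0 W d & (\<forall>x\<in>over W. \<forall>i. \<eta> (x, i) = c x * ev g (x, i) + d x * ev h (x, i)))"
    using wedge_span[OF subsetD[OF openX_subset[OF U] p]] by (elim exE conjE)
   let ?W = "U \<inter> W0"
   have W: "openX ?W" using U W0 by blast
   have "\<exists>g\<in>S ?W. \<exists>h\<in>S ?W. \<forall>\<eta>\<in>wedge_forms k ?W.
     \<exists>c d. Reg 0 ?W c & Reg 0 ?W d & (\<forall>x\<in>over ?W. \<forall>i. \<eta> (x, i) = c x * ev g (x, i) + d x * ev h (x, i))"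
    by (rule mp[OF spec[OF span]]) (rule conjI[OF W Int_lower2])
   then obtain g h where gh: "g \<in> S ?W" "h \<in> S ?W" and span': "\<forall>\<eta>\<in>wedge_forms k ?W.
     \<exists>c d. Reg 0 ?W c & Reg 0 ?W d & (\<forall>x\<in>over ?W. \<forall>i. \<eta> (x, i) = c x * ev g (x, i) + d x * ev h (x, i))"
    by (elim bexE)
   obtain c d where cd: "Reg 0 ?W c" "Reg 0 ?W d"
     "\<forall>x\<in>over ?W. \<forall>i. on_cone ?W \<eta> (x, i) = c x * ev g (x, i) + d x * ev h (x, i)"
    using bspec[OF span' wedge_forms_restrict[OF U W Int_lower1 \<eta>]] by (elim exE conjE)
   interpret PW: presentation F ?W "S ?W" "R ?W" by (rule presentation[OF W])
   let ?f = "%s x. c x * gen ?W g s x + d x * gen ?W h s x"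
   note gg = gen_in[OF W gh(1)] gen_in[OF W gh(2)]
   note sg = frees_smult[OF W cd(1) gg(1)] frees_smult[OF W cd(2) gg(2)]
   have f: "?f \<in> frees ?W (S ?W)" by (rule frees_add[OF W sg])
   have "\<eta> (x, i) = presentation.cls_evaluate ev (PW.cls ?f) (x, i)" if "x \<in> over ?W" for x i
    using cd(3)[rule_format, OF that, of i] that
    by (simp add: cls_value[OF W f] evaluate_add[OF sg] evaluate_smult[OF gg(1)] evaluate_smult[OF gg(2)] evaluate_gen on_cone_apply rst_def)
   moreover have "PW.cls ?f \<in> carrier (sec P ?W)" using f by (simp add: sec_P[OF W] PW.PM_carrier)
   ultimately show "\<exists>V m. openX V & p \<in> V & V \<subseteq> U & m \<in> carrier (sec P V) &
     (\<forall>x\<in>over V. \<forall>i. \<eta> (x, i) = presentation.cls_evaluate ev m (x, i))"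
    using W p W0 by (intro exI[of _ ?W] exI[of _ "PW.cls ?f"]) auto
  next
   fix s assume "s \<in> carrier (sec SP U)" "Val s = \<eta>"
   then show ?thesis by blast
  qed
  then show "\<eta> \<in> Val ` carrier (sec SP U)" by blast
 qed
qed

lemma H0_dim:
 assumes "has_dim (wedge_forms k total) n"
 shows "fin_dim_space (H0 X SP)" "h0 X SP = n"
proof -
 let ?M = "sec SP total"
 have H: "carrier (H0 X SP) = carrier ?M" "a \<oplus>\<^bsub>H0 X SP\<^esub> b = a \<oplus>\<^bsub>?M\<^esub> b" "\<zero>\<^bsub>H0 X SP\<^esub> = \<zero>\<^bsub>?M\<^esub>"
   "c \<odot>\<^bsub>H0 X SP\<^esub> a = rst total (%x. c) \<odot>\<^bsub>?M\<^esub> a" for a b c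
  by (simp_all add: H0_def Let_def topspace_X cst_X)
 note add = SP_add[OF openX_total] and sm = SP_smult[OF openX_total Reg_const[OF openX_total]]
 have inj: "inj_on Val (carrier (H0 X SP))"
  unfolding H by (rule inj_onI) (rule Val_inject[OF openX_total], auto)
 have im: "Val ` carrier (H0 X SP) = wedge_forms k total"
  unfolding H by (rule Val_range[OF openX_total])
 have sm0: "rst total (%x. c) x * Val a (x, i) = c * Val a (x, i)" if "a \<in> carrier ?M" for a x i c
  using Val_off[OF that openX_total, of x i] by (cases "x \<in> K") (auto simp: rst_def)
 have hom: "Val (a \<oplus>\<^bsub>H0 X SP\<^esub> b) = (%j. Val a j + Val b j)" if "a \<in> carrier (H0 X SP)" "b \<in> carrier (H0 X SP)" for a b
  using add(2)[of a b] that unfolding H by (intro ext) (metis surj_pair)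
 have hom0: "Val \<zero>\<^bsub>H0 X SP\<^esub> = (%j. 0)"
  unfolding H by (intro ext) (metis surj_pair Val_zero[OF openX_total])
 have hom1: "Val (c \<odot>\<^bsub>H0 X SP\<^esub> a) = (%j. c * Val a j)" if "a \<in> carrier (H0 X SP)" for a c
 proof
  fix j :: "(complex ^ 4) \<times> 4 \<times> 4"
  show "Val (c \<odot>\<^bsub>H0 X SP\<^esub> a) j = c * Val a j"
   using that sm(2)[of a c] sm0[of a c] unfolding H by (cases j) simp
 qed
 note c1 = add(1)[folded H] and c0 = SP_zero_in[OF openX_total, folded H] and c2 = sm(1)[folded H]
 show "fin_dim_space (H0 X SP)" "h0 X SP = n" unfolding h0_def
  by (rule vectorspace_transport[OF assms inj im], (fact c1 c0 c2 hom hom0 hom1)+)+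
qed

end

context smooth_quartic
begin

lemma kaehler_wedge_presheaf:
 "wedge_presheaf F (kaehler_presheaf X) (%U. carrier (OX U)) KR (%U V. rst V) dwedge 0"
proof (intro wedge_presheaf.intro wedge_presheaf_axioms.intro kaehler_presented_presheaf)
 fix U s assume U: "openX U" and "s \<in> carrier (OX U)"
 then have s: "Reg 0 U s" by (simp add: carrier_OX)
 have "(%x. on_cone U (dwedge s) (x, i, j)) = rst U (%x. dwedge s (x, i, j))" for i j
  by (simp add: on_cone_def rst_def)
 then show "on_cone U (dwedge s) \<in> wedge_forms 0 U"
  unfolding wedge_forms_def using Reg_dwedge[OF U s] dwedge_cond[OF U s] by (auto simp: on_cone_apply)
next
 fix p assume "p \<in> total"
 then obtain j l a b where p: "p \<in> chart j l" and ind: "j ~= l" "a ~= j" "a ~= l" "b ~= j" "b ~= l" "a ~= b" "UNIV = {j, l, a, b}"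
  by (rule chart_at)
 show "\<exists>W0. openX W0 & p \<in> W0 & (\<forall>W. openX W & W \<subseteq> W0 --> (\<exists>g\<in>carrier (OX W). \<exists>h\<in>carrier (OX W). \<forall>\<eta>\<in>wedge_forms 0 W.
   \<exists>c d. Reg 0 W c & Reg 0 W d & (\<forall>x\<in>over W. \<forall>i. \<eta> (x, i) = c x * dwedge g (x, i) + d x * dwedge h (x, i))))"
 proof (intro exI[of _ "chart j l"] conjI allI impI open_chart p)
  fix W assume "openX W & W \<subseteq> chart j l"
  then have W: "openX W" "W \<subseteq> chart j l" by auto
  have WA: "W \<subseteq> axis j" using W(2) chart_axis by blast
  have R: "rst W (coordinate j i) \<in> carrier (OX W)" for i
   using Reg_rst[OF open_axis W(1) over_mono[OF WA] Reg_coordinate] by (simp add: carrier_OX)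
  show "\<exists>g\<in>carrier (OX W). \<exists>h\<in>carrier (OX W). \<forall>\<eta>\<in>wedge_forms 0 W.
   \<exists>c d. Reg 0 W c & Reg 0 W d & (\<forall>x\<in>over W. \<forall>i. \<eta> (x, i) = c x * dwedge g (x, i) + d x * dwedge h (x, i))"
  proof (rule bexI[OF _ R[of a]], rule bexI[OF _ R[of b]], rule ballI)
   fix \<eta> assume \<eta>: "\<eta> \<in> wedge_forms 0 W"
   show "\<exists>c d. Reg 0 W c & Reg 0 W d & (\<forall>x\<in>over W. \<forall>i. \<eta> (x, i) = c x * dwedge (rst W (coordinate j a)) (x, i) + d x * dwedge (rst W (coordinate j b)) (x, i))"
    by (rule exI[of _ "chart_coeff j l 0 W \<eta> a"], rule exI[of _ "chart_coeff j l 0 W \<eta> b"], intro conjI Reg_chart_coeff[OF W \<eta>])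
     (use chart_expansion[OF W \<eta> _ ind] in simp)
  qed
 qed
qed

end

context smooth_quartic
begin

interpretation cot: wedge_presheaf F "kaehler_presheaf X" "%U. carrier (OX U)" KR "%U V. rst V" dwedge 0
 by (rule kaehler_wedge_presheaf)

abbreviation Om :: "(point, complex ^ 4 => complex, point => (point set \<times> ((complex ^ 4 => complex) => complex ^ 4 => complex) set) set) presheaf" where
 "Om \<equiv> sheafify X (kaehler_presheaf X)"

text \<open>Restriction of sections of the sheafification is compared through values.\<close>

lemma Om_res_add:
 assumes U: "openX U" and V: "openX V" "V \<subseteq> U" and s: "s \<in> carrier (sec Om U)" and t: "t \<in> carrier (sec Om U)"
 shows "res Om U V (s \<oplus>\<^bsub>sec Om U\<^esub> t) = res Om U V s \<oplus>\<^bsub>sec Om V\<^esub> res Om U V t"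
proof -
 note r = cot.SP_res[OF U V]
 note st = cot.SP_add[OF U s t] and rst = cot.SP_add[OF V(1) r(1)[OF s] r(1)[OF t]]
 show ?thesis
  by (rule cot.Val_inject[OF V(1) r(1)[OF st(1)] rst(1)])
   (simp only: r(2)[OF st(1)] r(2)[OF s] r(2)[OF t] st(2) rst(2))
qed

lemma Om_res_smult:
 assumes U: "openX U" and V: "openX V" "V \<subseteq> U" and a: "Reg 0 U a" and s: "s \<in> carrier (sec Om U)"
 shows "res Om U V (a \<odot>\<^bsub>sec Om U\<^esub> s) = rst V a \<odot>\<^bsub>sec Om V\<^esub> res Om U V s"
proof -
 note r = cot.SP_res[OF U V]
 note as = cot.SP_smult[OF U a s] and ras = cot.SP_smult[OF V(1) Reg_rst[OF U V(1) over_mono[OF V(2)] a] r(1)[OF s]]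
 show ?thesis
  by (rule cot.Val_inject[OF V(1) r(1)[OF as(1)] ras(1)])
   (simp only: r(2)[OF as(1)] r(2)[OF s] as(2) ras(2), simp add: rst_def)
qed

text \<open>A differential form on \<open>U\<close> is the same as its wedge with \<open>dF\<close>.\<close>

definition section_with :: "point set => ((complex ^ 4) \<times> 4 \<times> 4 => complex) => point => (point set \<times> ((complex ^ 4 => complex) => complex ^ 4 => complex) set) set" where
 "section_with U = inv_into (carrier (sec Om U)) cot.Val"

lemma section_with:
 assumes U: "openX U" and \<eta>: "\<eta> \<in> wedge_forms 0 U"
 shows "section_with U \<eta> \<in> carrier (sec Om U)" "cot.Val (section_with U \<eta>) = \<eta>"
proof -
 have \<eta>': "\<eta> \<in> cot.Val ` carrier (sec Om U)" using \<eta> by (simp only: cot.Val_range[OF U])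
 show "section_with U \<eta> \<in> carrier (sec Om U)" unfolding section_with_def by (rule inv_into_into[OF \<eta>'])
 show "cot.Val (section_with U \<eta>) = \<eta>" unfolding section_with_def by (rule f_inv_into_f[OF \<eta>'])
qed

lemma wedge_forms_mult:
 assumes U: "openX U" and \<eta>: "\<eta> \<in> wedge_forms m U" and e: "Reg k U e"
 shows "(%(x, i). \<eta> (x, i) * e x) \<in> wedge_forms (m + k) U"
proof -
 have "Reg (m + k + 2) U (%x. \<eta> (x, i, j) * e x)" for i j
  by (rule Reg_mult[OF U wedge_formsD(1)[OF \<eta>] e]) simp
 moreover have "wedge_cond x (grad x) (%i j. \<eta> (x, i, j) * e x)" if "x \<in> over U" for x
  using wedge_cond_smult[OF wedge_formsD(2)[OF \<eta> that], of "e x"] by (simp add: mult.commute)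
 ultimately show ?thesis by (simp add: wedge_forms_def)
qed

abbreviation TS where "TS k U \<equiv> carrier (sec Om U) \<times> carrier (sec (twist F k) U)"
abbreviation TR where "TR k U \<equiv> tensor_relations (OX U) (sec Om U) (sec (twist F k) U)"
abbreviation T\<sigma> where "T\<sigma> k U V \<equiv> map_prod (res Om U V) (res (twist F k) U V)"

definition tensor_value where
 "tensor_value = (%(\<omega>, e) (x, i). cot.Val \<omega> (x, i) * e x)"

lemma tensor_value_apply: "tensor_value (\<omega>, e) (x, i) = cot.Val \<omega> (x, i) * e x"
 by (simp add: tensor_value_def)

text \<open>The additivity relations and the scaling relations of the tensor product each come in two kinds, one
  for either factor, which are treated together.\<close>

definition sum_triple where
 "sum_triple k U p q r \<longleftrightarrow>
  (\<exists>m m' n. m \<in> carrier (sec Om U) & m' \<in> carrier (sec Om U) & Reg k U n & p = (m \<oplus>\<^bsub>sec Om U\<^esub> m', n) & q = (m, n) & r = (m', n)) \<or>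
  (\<exists>m n n'. m \<in> carrier (sec Om U) & Reg k U n & Reg k U n' & p = (m, %x. n x + n' x) & q = (m, n) & r = (m, n'))"

definition scale_pair where
 "scale_pair k U a p q \<longleftrightarrow> (\<exists>m n. m \<in> carrier (sec Om U) & Reg k U n & q = (m, n) &
  (p = (a \<odot>\<^bsub>sec Om U\<^esub> m, n) \<or> p = (m, %x. a x * n x)))"

definition tensor_sum_relation where
 "tensor_sum_relation U p q r = (%s x. gen U p s x - (gen U q s x + gen U r s x))"

definition tensor_scale_relation where
 "tensor_scale_relation U a p q = (%s x. gen U p s x - a x * gen U q s x)"

lemma sum_triple_in:
 assumes U: "openX U" and t: "sum_triple k U p q r" shows "p \<in> TS k U" "q \<in> TS k U" "r \<in> TS k U"
 using t unfolding sum_triple_def by (auto simp: cot.SP_add(1)[OF U] Reg_add[OF U])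

lemma scale_pair_in:
 assumes U: "openX U" and a: "Reg 0 U a" and t: "scale_pair k U a p q" shows "p \<in> TS k U" "q \<in> TS k U"
 using t unfolding scale_pair_def by (auto simp: cot.SP_smult(1)[OF U a] Reg_mult[OF U a])

lemma sum_triple_value:
 assumes U: "openX U" and t: "sum_triple k U p q r"
 shows "tensor_value p (x, i) = tensor_value q (x, i) + tensor_value r (x, i)"
 using t unfolding sum_triple_def by (auto simp: tensor_value_apply cot.SP_add(2)[OF U] algebra_simps)

lemma scale_pair_value:
 assumes U: "openX U" and a: "Reg 0 U a" and t: "scale_pair k U a p q"
 shows "tensor_value p (x, i) = a x * tensor_value q (x, i)"
 using t unfolding scale_pair_def by (auto simp: tensor_value_apply cot.SP_smult(2)[OF U a] algebra_simps)

lemma sum_triple_res: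
 assumes U: "openX U" and V: "openX V" "V \<subseteq> U" and t: "sum_triple k U p q r"
 shows "sum_triple k V (T\<sigma> k U V p) (T\<sigma> k U V q) (T\<sigma> k U V r)"
proof -
 note r = cot.SP_res(1)[OF U V] and R = Reg_rst[OF U V(1) over_mono[OF V(2)]]
 have rs: "rst V (%x. n x + n' x) = (%x. rst V n x + rst V n' x)" for n n' by (auto simp: rst_def)
 from t[unfolded sum_triple_def] show ?thesis
 proof (elim disjE exE conjE)
  fix m m' n assume m: "m \<in> carrier (sec Om U)" "m' \<in> carrier (sec Om U)" "Reg k U n"
   and p: "p = (m \<oplus>\<^bsub>sec Om U\<^esub> m', n)" "q = (m, n)" "r = (m', n)"
  show ?thesis unfolding sum_triple_def
   by (rule disjI1, intro exI[of _ "res Om U V m"] exI[of _ "res Om U V m'"] exI[of _ "rst V n"] conjI r R m)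
    (simp_all only: p map_prod_simp twist_simps Om_res_add[OF U V m(1,2)])
 next
  fix m n n' assume m: "m \<in> carrier (sec Om U)" "Reg k U n" "Reg k U n'"
   and p: "p = (m, %x. n x + n' x)" "q = (m, n)" "r = (m, n')"
  show ?thesis unfolding sum_triple_def
   by (rule disjI2, intro exI[of _ "res Om U V m"] exI[of _ "rst V n"] exI[of _ "rst V n'"] conjI r R m)
    (simp_all only: p map_prod_simp twist_simps rs)
 qed
qed

lemma scale_pair_res:
 assumes U: "openX U" and V: "openX V" "V \<subseteq> U" and a: "Reg 0 U a" and t: "scale_pair k U a p q"
 shows "scale_pair k V (rst V a) (T\<sigma> k U V p) (T\<sigma> k U V q)"
proof -
 note r = cot.SP_res(1)[OF U V] and R = Reg_rst[OF U V(1) over_mono[OF V(2)]]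
 obtain m n where m: "m \<in> carrier (sec Om U)" "Reg k U n" "q = (m, n)" "p = (a \<odot>\<^bsub>sec Om U\<^esub> m, n) \<or> p = (m, %x. a x * n x)"
  using t unfolding scale_pair_def by (elim exE conjE)
 have rs: "rst V (%x. a x * n x) = (%x. rst V a x * rst V n x)" by (auto simp: rst_def)
 from m(4) have "T\<sigma> k U V p = (rst V a \<odot>\<^bsub>sec Om V\<^esub> res Om U V m, rst V n) \<or> T\<sigma> k U V p = (res Om U V m, %x. rst V a x * rst V n x)"
  by (elim disjE) (simp_all only: map_prod_simp twist_simps Om_res_smult[OF U V a m(1)] rs simp_thms)
 then show ?thesis unfolding scale_pair_def
  by (intro exI[of _ "res Om U V m"] exI[of _ "rst V n"] conjI r R m) (simp_all only: m(3) map_prod_simp twist_simps)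
qed

lemma TR_iff:
 assumes U: "openX U"
 shows "\<rho> \<in> TR k U \<longleftrightarrow> (\<exists>p q r. sum_triple k U p q r & \<rho> = tensor_sum_relation U p q r) \<or>
  (\<exists>a p q. Reg 0 U a & scale_pair k U a p q & \<rho> = tensor_scale_relation U a p q)"
proof -
 let ?F = "free_module (OX U) (TS k U)"
 have g: "p \<in> TS k U ==> gen U p \<in> frees U (TS k U)" for p by (rule gen_in[OF U])
 have e1: "gen U p \<ominus>\<^bsub>?F\<^esub> (gen U q \<oplus>\<^bsub>?F\<^esub> gen U r) = tensor_sum_relation U p q r" if "sum_triple k U p q r" for p q r
  unfolding tensor_sum_relation_def free_module_simps
  by (intro free_minus[OF U] frees_add[OF U] g sum_triple_in[OF U that])
 have e2: "gen U p \<ominus>\<^bsub>?F\<^esub> a \<odot>\<^bsub>?F\<^esub> gen U q = tensor_scale_relation U a p q" if "Reg 0 U a" "scale_pair k U a p q" for a p q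
  unfolding tensor_scale_relation_def free_module_simps
  by (intro free_minus[OF U] frees_smult[OF U] g scale_pair_in[OF U that] that(1))
 have t1: "sum_triple k U (m \<oplus>\<^bsub>sec Om U\<^esub> m', n) (m, n) (m', n)"
  if "m \<in> carrier (sec Om U)" "m' \<in> carrier (sec Om U)" "n \<in> carrier (sec (twist F k) U)" for m m' n
  using that unfolding sum_triple_def by blast
 have t2: "sum_triple k U (m, n \<oplus>\<^bsub>sec (twist F k) U\<^esub> n') (m, n) (m, n')"
  if "m \<in> carrier (sec Om U)" "n \<in> carrier (sec (twist F k) U)" "n' \<in> carrier (sec (twist F k) U)" for m n n'
  using that unfolding sum_triple_def twist_simps by blast
 have t3: "scale_pair k U a (a \<odot>\<^bsub>sec Om U\<^esub> m, n) (m, n)" "scale_pair k U a (m, a \<odot>\<^bsub>sec (twist F k) U\<^esub> n) (m, n)"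
  if "m \<in> carrier (sec Om U)" "n \<in> carrier (sec (twist F k) U)" for a m n
  using that unfolding scale_pair_def twist_simps by blast+
 have A: "a \<in> carrier (OX U) \<longleftrightarrow> Reg 0 U a" for a by (simp add: carrier_OX)
 show ?thesis
 proof
  assume "\<rho> \<in> TR k U"
  then show "(\<exists>p q r. sum_triple k U p q r & \<rho> = tensor_sum_relation U p q r) \<or>
    (\<exists>a p q. Reg 0 U a & scale_pair k U a p q & \<rho> = tensor_scale_relation U a p q)"
   unfolding tensor_relations_def Let_def
  proof (elim UnE CollectE exE conjE, goal_cases)
   case (1 m m' n)
   show ?case by (rule disjI1, intro exI conjI, rule t1[OF 1(2,3,4)]) (simp only: 1(1) e1[OF t1[OF 1(2,3,4)]])
  next
   case (2 m n n')
   show ?case by (rule disjI1, intro exI conjI, rule t2[OF 2(2,3,4)]) (simp only: 2(1) e1[OF t2[OF 2(2,3,4)]])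
  next
   case (3 a m n)
   note a = 3(2)[unfolded A]
   show ?case by (rule disjI2, intro exI conjI, rule a, rule t3(1)[OF 3(3,4)]) (simp only: 3(1) e2[OF a t3(1)[OF 3(3,4)]])
  next
   case (4 a m n)
   note a = 4(2)[unfolded A]
   show ?case by (rule disjI2, intro exI conjI, rule a, rule t3(2)[OF 4(3,4)]) (simp only: 4(1) e2[OF a t3(2)[OF 4(3,4)]])
  qed
 next
  assume "(\<exists>p q r. sum_triple k U p q r & \<rho> = tensor_sum_relation U p q r) \<or>
    (\<exists>a p q. Reg 0 U a & scale_pair k U a p q & \<rho> = tensor_scale_relation U a p q)"
  then show "\<rho> \<in> TR k U"
  proof (elim disjE exE conjE)
   fix p q r assume t: "sum_triple k U p q r" and \<rho>: "\<rho> = tensor_sum_relation U p q r"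
   have \<rho>': "\<rho> = gen U p \<ominus>\<^bsub>?F\<^esub> (gen U q \<oplus>\<^bsub>?F\<^esub> gen U r)" by (simp only: \<rho> e1[OF t])
   show ?thesis using t unfolding sum_triple_def tensor_relations_def Let_def \<rho>'
    by (elim disjE exE conjE) (simp only: Un_iff mem_Collect_eq twist_simps, blast)+
  next
   fix a p q assume a: "Reg 0 U a" and t: "scale_pair k U a p q" and \<rho>: "\<rho> = tensor_scale_relation U a p q"
   have \<rho>': "\<rho> = gen U p \<ominus>\<^bsub>?F\<^esub> a \<odot>\<^bsub>?F\<^esub> gen U q" by (simp only: \<rho> e2[OF a t])
   show ?thesis using t a[folded A] unfolding scale_pair_def tensor_relations_def Let_def \<rho>'
    by (elim disjE exE conjE) (simp only: Un_iff mem_Collect_eq twist_simps, blast)+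
  qed
 qed
qed

lemma TR_in: assumes U: "openX U" shows "TR k U \<subseteq> frees U (TS k U)"
proof
 fix \<rho> assume "\<rho> \<in> TR k U"
 then show "\<rho> \<in> frees U (TS k U)" unfolding TR_iff[OF U]
 proof (elim disjE exE conjE)
  fix p q r assume t: "sum_triple k U p q r" and \<rho>: "\<rho> = tensor_sum_relation U p q r"
  show ?thesis unfolding \<rho> tensor_sum_relation_def
   by (intro frees_diff[OF U] frees_add[OF U] gen_in[OF U] sum_triple_in[OF U t])
 next
  fix a p q assume a: "Reg 0 U a" and t: "scale_pair k U a p q" and \<rho>: "\<rho> = tensor_scale_relation U a p q"
  show ?thesis unfolding \<rho> tensor_scale_relation_def
   by (intro frees_diff[OF U] frees_smult[OF U] gen_in[OF U] scale_pair_in[OF U a t] a)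
 qed
qed

lemma tensor_presentation: "openX U ==> presentation F U (TS k U) (TR k U)"
 by (intro presentation.intro presentation_axioms.intro smooth_quartic_axioms TR_in)

definition chart_form where
 "chart_form j a W = section_with W (on_cone W (dwedge (rst W (coordinate j a))))"

lemma chart_form:
 assumes W: "openX W" "W \<subseteq> axis j"
 shows "chart_form j a W \<in> carrier (sec Om W)" "z \<in> over W ==> cot.Val (chart_form j a W) (z, i) = dwedge (rst W (coordinate j a)) (z, i)"
proof -
 have "rst W (coordinate j a) \<in> carrier (OX W)"
  using Reg_rst[OF open_axis W(1) over_mono[OF W(2)] Reg_coordinate] by (simp add: carrier_OX)
 note s = section_with[OF W(1) cot.ev_wedge[OF W(1) this], folded chart_form_def]
 show "chart_form j a W \<in> carrier (sec Om W)" by (rule s(1))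
 show "z \<in> over W ==> cot.Val (chart_form j a W) (z, i) = dwedge (rst W (coordinate j a)) (z, i)"
  by (simp add: s(2) on_cone_apply)
qed

text \<open>A form is \<open>A du\<^sub>a + B du\<^sub>b\<close> and a section of \<open>\<O>(k)\<close> is
  \<open>c z\<^sub>j\<^sup>k\<close> on the chart; bilinearity moves the coefficients in front of the tensors.\<close>

lemma chart_forms_generate:
 assumes U: "openX U" and W: "openX W" "W \<subseteq> U" "W \<subseteq> chart j l" and s: "s \<in> TS k U"
  and ind: "j ~= l" "a ~= j" "a ~= l" "b ~= j" "b ~= l" "a ~= b" "UNIV = {j, l, a, b}"
 shows "presentation.spanned F W (TS k W) (TR k W) (chart_form j a W, rst W (%z. z $ j powi k))
  (chart_form j b W, rst W (%z. z $ j powi k)) (gen W (T\<sigma> k U W s))"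
proof -
 interpret PW: presentation F W "TS k W" "TR k W" by (rule tensor_presentation[OF W(1)])
 obtain \<omega>0 e0 where s': "s = (\<omega>0, e0)" "\<omega>0 \<in> carrier (sec Om U)" "Reg k U e0" using s by auto
 have WA: "W \<subseteq> axis j" using W(3) chart_axis by blast
 define \<omega> e u where "\<omega> = res Om U W \<omega>0" and "e = rst W e0" and "u = rst W (%z. z $ j powi k)"
 define c where "c = (%x. e x * rst W (%z. z $ j powi (- k)) x)"
 define A where "A = chart_coeff j l 0 W (cot.Val \<omega>)"
 have \<omega>: "\<omega> \<in> carrier (sec Om W)" unfolding \<omega>_def by (rule cot.SP_res(1)[OF U W(1,2) s'(2)])
 have e: "Reg k W e" unfolding e_def by (rule Reg_rst[OF U W(1) over_mono[OF W(2)] s'(3)])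
 have u: "Reg k W u" unfolding u_def by (rule Reg_var_power[OF W(1) WA])
 have c: "Reg 0 W c" unfolding c_def by (rule Reg_mult[OF W(1) e Reg_var_power[OF W(1) WA]]) simp
 have A: "Reg 0 W (A i)" for i unfolding A_def by (rule Reg_chart_coeff[OF W(1,3) cot.Val_wedge[OF W(1) \<omega>]])
 note D = chart_form[OF W(1) WA]
 have nz: "z $ j ~= 0" if "z \<in> over W" for z using over_mono[OF WA] that by (auto simp: cone_axis)
 have cu: "(%x. c x * u x) = e"
 proof
  fix x show "c x * u x = e x"
  proof (cases "x \<in> over W")
   case True
   then show ?thesis using nz[OF True] by (simp add: c_def u_def rst_def power_int_minus)
  qed (simp add: c_def e_def rst_def)
 qed
 let ?sp = "PW.spanned (chart_form j a W, u) (chart_form j b W, u)"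
 have scale: "?sp (gen W p)" if "scale_pair k W f p q" "?sp (gen W q)" "Reg 0 W f" for f p q
 proof (rule PW.spanned_N[OF PW.spanned_smult[OF that(2,3)]])
  show "(%s x. gen W p s x - f x * gen W q s x) \<in> PW.N"
   by (rule PW.N_rel) (unfold TR_iff[OF W(1)] tensor_scale_relation_def, rule disjI2, rule exI[of _ f], rule exI[of _ p], rule exI[of _ q], intro conjI that(3) that(1) refl)
 qed
 have 1: "?sp (gen W (A i \<odot>\<^bsub>sec Om W\<^esub> chart_form j i W, e))" if "?sp (gen W (chart_form j i W, u))" for i
 proof (rule scale[OF _ _ A])
  show "?sp (gen W (chart_form j i W, e))"
  proof (rule scale[OF _ that c])
   show "scale_pair k W c (chart_form j i W, e) (chart_form j i W, u)"
    unfolding scale_pair_def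
    by (rule exI[of _ "chart_form j i W"], rule exI[of _ u]) (simp add: D(1) u cu)
  qed
  show "scale_pair k W (A i) (A i \<odot>\<^bsub>sec Om W\<^esub> chart_form j i W, e) (chart_form j i W, e)"
   unfolding scale_pair_def
   by (rule exI[of _ "chart_form j i W"], rule exI[of _ e]) (simp add: D(1) e)
 qed
 note sm = cot.SP_smult[OF W(1) A D(1)]
 have \<omega>eq: "\<omega> = A a \<odot>\<^bsub>sec Om W\<^esub> chart_form j a W \<oplus>\<^bsub>sec Om W\<^esub> A b \<odot>\<^bsub>sec Om W\<^esub> chart_form j b W"
 proof (rule cot.Val_inject[OF W(1) \<omega> cot.SP_add(1)[OF W(1) sm(1) sm(1)]])
  fix x i assume x: "x \<in> over W"
  show "cot.Val \<omega> (x, i) = cot.Val (A a \<odot>\<^bsub>sec Om W\<^esub> chart_form j a W \<oplus>\<^bsub>sec Om W\<^esub> A b \<odot>\<^bsub>sec Om W\<^esub> chart_form j b W) (x, i)"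
   using chart_expansion[OF W(1,3) cot.Val_wedge[OF W(1) \<omega>] x ind, of i, folded A_def]
   unfolding cot.SP_add(2)[OF W(1) sm(1) sm(1)] sm(2) D(2)[OF x] by simp
 qed
 have sma: "A a \<odot>\<^bsub>sec Om W\<^esub> chart_form j a W \<in> carrier (sec Om W)" "A b \<odot>\<^bsub>sec Om W\<^esub> chart_form j b W \<in> carrier (sec Om W)"
  by (rule sm(1))+
 have st: "sum_triple k W (\<omega>, e) (A a \<odot>\<^bsub>sec Om W\<^esub> chart_form j a W, e) (A b \<odot>\<^bsub>sec Om W\<^esub> chart_form j b W, e)"
  unfolding sum_triple_def \<omega>eq using sma e by blast
 have "?sp (%s x. gen W (A a \<odot>\<^bsub>sec Om W\<^esub> chart_form j a W, e) s x + gen W (A b \<odot>\<^bsub>sec Om W\<^esub> chart_form j b W, e) s x)"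
  by (intro PW.spanned_add 1 PW.spanned_gen)
 then have "?sp (gen W (\<omega>, e))"
 proof (rule PW.spanned_N)
  show "(%s x. gen W (\<omega>, e) s x - (gen W (A a \<odot>\<^bsub>sec Om W\<^esub> chart_form j a W, e) s x + gen W (A b \<odot>\<^bsub>sec Om W\<^esub> chart_form j b W, e) s x)) \<in> PW.N"
   by (rule PW.N_rel) (unfold TR_iff[OF W(1)] tensor_sum_relation_def, rule disjI1, rule exI, rule exI, rule exI, rule conjI[OF st refl])
 qed
 then show ?thesis by (simp only: s'(1) map_prod_simp twist_simps \<omega>_def e_def u_def)
qed

lemma tensor_presented_presheaf:
 "presented_presheaf F (tensor_presheaf X Om (twist F k)) (TS k) (TR k) (T\<sigma> k) tensor_value"
proof (intro presented_presheaf.intro presented_presheaf_axioms.intro smooth_quartic_axioms)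
 fix U assume U: "openX U"
 show "sec (tensor_presheaf X Om (twist F k)) U = presented_module (OX U) (TS k U) (TR k U)"
  by (simp add: tensor_presheaf_def Let_def tensor_module_def)
 show "TR k U \<subseteq> frees U (TS k U)" by (rule TR_in[OF U])
next
 fix U V :: "point set"
 have "res (str X) U V = rst V" by (intro ext) (simp add: OX_simps)
 then show "res (tensor_presheaf X Om (twist F k)) U V = presented_map (OX U) (OX V) (rst V) (T\<sigma> k U V) (TS k V) (relation_module (OX V) (TS k V) (TR k V))"
  by (simp add: tensor_presheaf_def Let_def)
next
 fix U V s assume U: "openX U" and V: "openX V" "V \<subseteq> U" and s: "s \<in> TS k U"
 show "T\<sigma> k U V s \<in> TS k V"
  using s by (auto simp: cot.SP_res(1)[OF U V] Reg_rst[OF U V(1) over_mono[OF V(2)]])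
 fix x i assume x: "x \<in> over V"
 show "tensor_value (T\<sigma> k U V s) (x, i) = tensor_value s (x, i)"
  using s x by (auto simp: tensor_value_apply cot.SP_res(2)[OF U V _ x] rst_def)
next
 fix U \<rho> and y :: "(complex ^ 4) \<times> 4 \<times> 4" assume U: "openX U" and "\<rho> \<in> TR k U"
 then have r: "(\<exists>p q r. sum_triple k U p q r & \<rho> = tensor_sum_relation U p q r) \<or>
  (\<exists>a p q. Reg 0 U a & scale_pair k U a p q & \<rho> = tensor_scale_relation U a p q)" by (simp only: TR_iff[OF U])
 obtain x i where y: "y = (x, i)" by (cases y)
 from r show "evaluate tensor_value \<rho> y = 0"
 proof (elim disjE exE conjE)
  fix p q r assume t: "sum_triple k U p q r" and \<rho>: "\<rho> = tensor_sum_relation U p q r"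
  note g = sum_triple_in[OF U t, THEN gen_in[OF U]]
  show ?thesis unfolding y \<rho> tensor_sum_relation_def
   by (simp add: evaluate_diff[OF U g(1) frees_add[OF U g(2,3)]] evaluate_add[OF g(2,3)] evaluate_gen sum_triple_value[OF U t] algebra_simps)
 next
  fix a p q assume a: "Reg 0 U a" and t: "scale_pair k U a p q" and \<rho>: "\<rho> = tensor_scale_relation U a p q"
  note g = scale_pair_in[OF U a t, THEN gen_in[OF U]]
  show ?thesis unfolding y \<rho> tensor_scale_relation_def
   by (simp add: evaluate_diff[OF U g(1) frees_smult[OF U a g(2)]] evaluate_smult[OF g(2)] evaluate_gen scale_pair_value[OF U a t] algebra_simps)
 qed
next
 fix U V \<rho> assume U: "openX U" and V: "openX V" "V \<subseteq> U" and r: "\<rho> \<in> TR k U"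
 interpret PV: presentation F V "TS k V" "TR k V" by (rule tensor_presentation[OF V(1)])
 let ?m = "free_map (OX U) (OX V) (rst V) (T\<sigma> k U V)"
 from r have "?m \<rho> \<in> TR k V" unfolding TR_iff[OF U]
 proof (elim disjE exE conjE)
  fix p q r assume t: "sum_triple k U p q r" and \<rho>: "\<rho> = tensor_sum_relation U p q r"
  note g = sum_triple_in[OF U t, THEN gen_in[OF U]]
  have "?m \<rho> = tensor_sum_relation V (T\<sigma> k U V p) (T\<sigma> k U V q) (T\<sigma> k U V r)"
   unfolding \<rho> tensor_sum_relation_def free_map_diff[OF U V g(1) frees_add[OF U g(2,3)]] free_map_add[OF U V g(2,3)] free_map_gen[OF U V] ..
  then show ?thesis unfolding TR_iff[OF V(1)] using sum_triple_res[OF U V t] by blast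
 next
  fix a p q assume a: "Reg 0 U a" and t: "scale_pair k U a p q" and \<rho>: "\<rho> = tensor_scale_relation U a p q"
  note g = scale_pair_in[OF U a t, THEN gen_in[OF U]]
  have "?m \<rho> = tensor_scale_relation V (rst V a) (T\<sigma> k U V p) (T\<sigma> k U V q)"
   unfolding \<rho> tensor_scale_relation_def free_map_diff[OF U V g(1) frees_smult[OF U a g(2)]] free_map_smult[OF U V a g(2)] free_map_gen[OF U V] ..
  then show ?thesis unfolding TR_iff[OF V(1)]
   using scale_pair_res[OF U V a t] Reg_rst[OF U V(1) over_mono[OF V(2)] a] by blast
 qed
 then show "?m \<rho> \<in> relation_module (OX V) (TS k V) (TR k V)" by (rule PV.N_rel)
next
 fix p assume "p \<in> total"
 then obtain j l a b where p: "p \<in> chart j l" and ind: "j ~= l" "a ~= j" "a ~= l" "b ~= j" "b ~= l" "a ~= b" "UNIV = {j, l, a, b}"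
  by (rule chart_at)
 let ?W0 = "chart j l" and ?u = "%W. rst W (%z. z $ j powi k)"
 show "\<exists>W0 g h. openX W0 & p \<in> W0 &
   (\<forall>W. openX W & W \<subseteq> W0 --> g W \<in> TS k W & h W \<in> TS k W &
    (\<forall>z\<in>over W. \<forall>c d. (\<forall>i. c * tensor_value (g W) (z, i) + d * tensor_value (h W) (z, i) = 0) --> c = 0 & d = 0)) &
   (\<forall>U s. openX U & p \<in> U & s \<in> TS k U --> (\<exists>W1. openX W1 & p \<in> W1 & W1 \<subseteq> U \<inter> W0 &
    (\<forall>W. openX W & p \<in> W & W \<subseteq> W1 --> presentation.spanned F W (TS k W) (TR k W) (g W) (h W) (gen W (T\<sigma> k U W s)))))"
 proof (rule exI[of _ ?W0], rule exI[of _ "%W. (chart_form j a W, ?u W)"], rule exI[of _ "%W. (chart_form j b W, ?u W)"], intro conjI allI impI ballI)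
  fix W assume "openX W & W \<subseteq> ?W0"
  then have W: "openX W" "W \<subseteq> ?W0" by auto
  have WA: "W \<subseteq> axis j" using W(2) chart_axis by blast
  show "(chart_form j a W, ?u W) \<in> TS k W" "(chart_form j b W, ?u W) \<in> TS k W"
   using chart_form(1)[OF W(1) WA] Reg_var_power[OF W(1) WA] by auto
  fix z c d assume z: "z \<in> over W" and zero: "\<forall>i. c * tensor_value (chart_form j a W, ?u W) (z, i) + d * tensor_value (chart_form j b W, ?u W) (z, i) = 0"
  have "z $ j ~= 0" using over_mono[OF W(2)] z by (auto simp: cone_chart)
  then have nz: "?u W z ~= 0" using z by (simp add: rst_def)
  have "?u W z * (c * dwedge (rst W (coordinate j a)) (z, i) + d * dwedge (rst W (coordinate j b)) (z, i)) = 0" for i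
   using zero[rule_format, of i] by (simp add: tensor_value_apply chart_form(2)[OF W(1) WA z] algebra_simps)
  then have "c * dwedge (rst W (coordinate j a)) (z, i) + d * dwedge (rst W (coordinate j b)) (z, i) = 0" for i
   using nz by simp
  then have "c = 0 & d = 0" by (rule coordinates_independent[OF W z ind(2-6,1)])
  then show "c = 0" "d = 0" by auto
 next
  fix U s assume "openX U & p \<in> U & s \<in> TS k U"
  then have U: "openX U" "p \<in> U" "s \<in> TS k U" by auto
  show "\<exists>W1. openX W1 & p \<in> W1 & W1 \<subseteq> U \<inter> ?W0 & (\<forall>W. openX W & p \<in> W & W \<subseteq> W1 -->
    presentation.spanned F W (TS k W) (TR k W) (chart_form j a W, ?u W) (chart_form j b W, ?u W) (gen W (T\<sigma> k U W s)))"
  proof (intro exI[of _ "U \<inter> ?W0"] conjI allI impI)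
   show "openX (U \<inter> ?W0)" using U open_chart by blast
   fix W assume "openX W & p \<in> W & W \<subseteq> U \<inter> ?W0"
   then have W: "openX W" "W \<subseteq> U" "W \<subseteq> ?W0" by auto
   show "presentation.spanned F W (TS k W) (TR k W) (chart_form j a W, ?u W) (chart_form j b W, ?u W) (gen W (T\<sigma> k U W s))"
    by (rule chart_forms_generate[OF U(1) W U(3) ind])
  qed (use U p in auto)
 qed (use open_chart p in auto)
qed

lemma tensor_wedge_presheaf:
 "wedge_presheaf F (tensor_presheaf X Om (twist F k)) (TS k) (TR k) (T\<sigma> k) tensor_value k"
proof (intro wedge_presheaf.intro wedge_presheaf_axioms.intro tensor_presented_presheaf)
 fix U s assume U: "openX U" and "s \<in> TS k U"
 then obtain \<omega> e where s: "s = (\<omega>, e)" "\<omega> \<in> carrier (sec Om U)" "Reg k U e" by auto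
 have "on_cone U (tensor_value s) = (%(x, i). cot.Val \<omega> (x, i) * e x)"
  using Reg_off[OF U s(3)] by (auto simp: s(1) on_cone_apply tensor_value_apply fun_eq_iff)
 then show "on_cone U (tensor_value s) \<in> wedge_forms k U"
  using wedge_forms_mult[OF U cot.Val_wedge[OF U s(2)] s(3)] by simp
next
 fix p assume "p \<in> total"
 then obtain j l a b where p: "p \<in> chart j l" and ind: "j ~= l" "a ~= j" "a ~= l" "b ~= j" "b ~= l" "a ~= b" "UNIV = {j, l, a, b}"
  by (rule chart_at)
 let ?u = "%W. rst W (%z. z $ j powi k)"
 show "\<exists>W0. openX W0 & p \<in> W0 & (\<forall>W. openX W & W \<subseteq> W0 --> (\<exists>g\<in>TS k W. \<exists>h\<in>TS k W. \<forall>\<eta>\<in>wedge_forms k W.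
   \<exists>c d. Reg 0 W c & Reg 0 W d & (\<forall>x\<in>over W. \<forall>i. \<eta> (x, i) = c x * tensor_value g (x, i) + d x * tensor_value h (x, i))))"
 proof (intro exI[of _ "chart j l"] conjI allI impI open_chart p)
  fix W assume "openX W & W \<subseteq> chart j l"
  then have W: "openX W" "W \<subseteq> chart j l" by auto
  have WA: "W \<subseteq> axis j" using W(2) chart_axis by blast
  have T: "(chart_form j i W, ?u W) \<in> TS k W" for i
   using chart_form(1)[OF W(1) WA] Reg_var_power[OF W(1) WA] by auto
  show "\<exists>g\<in>TS k W. \<exists>h\<in>TS k W. \<forall>\<eta>\<in>wedge_forms k W.
   \<exists>c d. Reg 0 W c & Reg 0 W d & (\<forall>x\<in>over W. \<forall>i. \<eta> (x, i) = c x * tensor_value g (x, i) + d x * tensor_value h (x, i))"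
  proof (rule bexI[OF _ T[of a]], rule bexI[OF _ T[of b]], rule ballI)
   fix \<eta> assume \<eta>: "\<eta> \<in> wedge_forms k W"
   have "\<eta> (x, i) = chart_coeff j l k W \<eta> a x * tensor_value (chart_form j a W, ?u W) (x, i) + chart_coeff j l k W \<eta> b x * tensor_value (chart_form j b W, ?u W) (x, i)"
    if x: "x \<in> over W" for x i
    using chart_expansion[OF W \<eta> x ind, of i] x by (simp add: tensor_value_apply chart_form(2)[OF W(1) WA x] rst_def)
   then show "\<exists>c d. Reg 0 W c & Reg 0 W d & (\<forall>x\<in>over W. \<forall>i. \<eta> (x, i) = c x * tensor_value (chart_form j a W, ?u W) (x, i) + d x * tensor_value (chart_form j b W, ?u W) (x, i))"
    by (intro exI[of _ "chart_coeff j l k W \<eta> a"] exI[of _ "chart_coeff j l k W \<eta> b"] conjI Reg_chart_coeff[OF W \<eta>] ballI allI)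
  qed
 qed
qed

lemma tensor_dim:
 assumes "has_dim (wedge_forms k total) n"
 shows "fin_dim_space (H0 X (tensor_sheaf X (cotangent_sheaf X) (twist F k)))" "h0 X (tensor_sheaf X (cotangent_sheaf X) (twist F k)) = n"
 unfolding tensor_sheaf_def cotangent_sheaf_def by (rule wedge_presheaf.H0_dim[OF tensor_wedge_presheaf assms])+

end

section \<open>Foliations as wedge forms\<close>

text \<open>The Hodge star of a bivector in dimension four; each entry is the complementary entry with the sign of
  the permutation.\<close>

definition star :: "(4 => 4 => complex) => 4 => 4 => complex" where
 "star M i j =
  (if i = 1 then (if j = 2 then M 3 4 else if j = 3 then M 4 2 else if j = 4 then M 2 3 else 0)
   else if i = 2 then (if j = 1 then M 4 3 else if j = 3 then M 1 4 else if j = 4 then M 3 1 else 0)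
   else if i = 3 then (if j = 1 then M 2 4 else if j = 2 then M 4 1 else if j = 4 then M 1 2 else 0)
   else (if j = 1 then M 3 2 else if j = 2 then M 1 3 else if j = 3 then M 2 1 else 0))"

lemma star_linear: "star (%i j. M i j + N i j) i j = star M i j + star N i j" "star (%i j. c * M i j) i j = c * star M i j"
 by (simp_all add: star_def)

lemma star_star:
 assumes M: "!!i j. M i j = - M j i" shows "star (star M) i j = M i j"
proof -
 have d: "M i i = 0" for i using M[of i i] by simp
 have "\<forall>i j. star (star M) i j = M i j"
  unfolding forall_4 by (simp add: star_def d)
 then show ?thesis by blast
qed

text \<open>The star exchanges contraction and wedge product: the contraction with \<open>v\<close> of \<open>star
  M\<close> is the cyclic product of \<open>v\<close> and \<open>M\<close>, and conversely.\<close>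

lemma wedge_cond_star:
 assumes M: "wedge_cond u v M" shows "wedge_cond v u (star M)"
proof -
 have s: "M 2 1 = - M 1 2" "M 3 1 = - M 1 3" "M 4 1 = - M 1 4" "M 3 2 = - M 2 3" "M 4 2 = - M 2 4" "M 4 3 = - M 3 4"
  by (rule wedge_condD(1)[OF M])+
 have d: "M i i = 0" for i using wedge_condD(1)[OF M, of i i] by simp
 note c = wedge_condD(2)[OF M, unfolded sum_4]
 note r = wedge_condD(3)[OF M, of 2 3 4] wedge_condD(3)[OF M, of 1 3 4] wedge_condD(3)[OF M, of 1 2 4] wedge_condD(3)[OF M, of 1 2 3]
 show ?thesis unfolding wedge_cond_def
 proof (intro conjI)
  show "\<forall>i j. star M i j = - star M j i" unfolding forall_4 by (simp add: star_def s)
  show "\<forall>l. (\<Sum>i\<in>UNIV. v $ i * star M i l) = 0"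
   unfolding forall_4 sum_4 using r by (simp add: star_def s algebra_simps) 
  show "\<forall>i j l. u $ i * star M j l + u $ j * star M l i + u $ l * star M i j = 0"
   unfolding forall_4 using c[of 1] c[of 2] c[of 3] c[of 4] by (simp add: star_def s d algebra_simps) (intro conjI, (rule minus_unique, assumption), (simp only: neg_eq_iff_add_eq_0))
 qed
qed

context smooth_quartic
begin

text \<open>The encoding \<open>v \<and> x\<close> of a vector field \<open>v\<close> tangent to the quartic: the
  Euler field becomes zero and tangency means contraction to zero with \<open>dF\<close>.\<close>

definition vector_forms :: "int => ((complex ^ 4) \<times> 4 \<times> 4 => complex) set" where
 "vector_forms k = {P. (\<forall>i j. Reg (k + 2) total (%x. P (x, i, j))) & (\<forall>x\<in>K. wedge_cond (grad x) x (%i j. P (x, i, j)))}"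

definition star_form :: "((complex ^ 4) \<times> 4 \<times> 4 => complex) => (complex ^ 4) \<times> 4 \<times> 4 => complex" where
 "star_form \<eta> = (%(x, i, j). star (%i j. \<eta> (x, i, j)) i j)"

lemma Reg_star:
 assumes "!!i j. Reg n U (%x. \<eta> (x, i, j))" and U: "openX U"
 shows "Reg n U (%x. star_form \<eta> (x, i, j))"
proof -
 have "\<forall>i j. Reg n U (%x. star_form \<eta> (x, i, j))"
  unfolding forall_4 by (simp add: star_form_def star_def assms(1) Reg_zero[OF U])
 then show ?thesis by blast
qed

lemma vector_forms_dim:
 assumes "has_dim (wedge_forms k total) n" shows "has_dim (vector_forms k) n"
proof (rule has_dim_iso[OF assms, of star_form])
 show "linear_on (wedge_forms k total) star_form"
  by (rule linear_onI) (auto simp: star_form_def star_linear)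
 have inv: "star_form (star_form \<eta>) = \<eta>"
  if "!!x. x \<in> K ==> wedge_cond (u x) (v x) (%i j. \<eta> (x, i, j))" "!!i j. Reg m total (%x. \<eta> (x, i, j))" for \<eta> u v m
 proof
  fix y :: "(complex ^ 4) \<times> 4 \<times> 4"
  obtain x i j where y: "y = (x, i, j)" by (cases y)
  have "\<eta> (x, i, j) = - \<eta> (x, j, i)" for i j
  proof (cases "x \<in> K")
   case True
   show ?thesis by (rule wedge_condD(1)[OF that(1)[OF True]])
  next
   case False
   then show ?thesis using Reg_off[OF openX_total that(2), of x] by simp
  qed
  then show "star_form (star_form \<eta>) y = \<eta> y" unfolding y star_form_def prod.case by (rule star_star)
 qed
 have W: "star_form (star_form \<eta>) = \<eta>" "star_form \<eta> \<in> vector_forms k" if "\<eta> \<in> wedge_forms k total" for \<eta>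
 proof -
  have w: "x \<in> K ==> wedge_cond x (grad x) (%i j. \<eta> (x, i, j))" for x using wedge_formsD(2)[OF that, of x] by simp
  show "star_form (star_form \<eta>) = \<eta>" by (rule inv[OF w wedge_formsD(1)[OF that]])
  show "star_form \<eta> \<in> vector_forms k" unfolding vector_forms_def
   using Reg_star[OF wedge_formsD(1)[OF that] openX_total] wedge_cond_star[OF w] by (simp add: star_form_def)
 qed
 have V: "star_form (star_form \<eta>) = \<eta>" "star_form \<eta> \<in> wedge_forms k total" if "\<eta> \<in> vector_forms k" for \<eta>
 proof -
  have w: "x \<in> K ==> wedge_cond (grad x) x (%i j. \<eta> (x, i, j))" and R: "Reg (k + 2) total (%x. \<eta> (x, i, j))" for x i j
   using that by (auto simp: vector_forms_def)
  show "star_form (star_form \<eta>) = \<eta>" by (rule inv[OF w R])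
  show "star_form \<eta> \<in> wedge_forms k total" unfolding wedge_forms_def
   using Reg_star[OF R openX_total] wedge_cond_star[OF w] by (simp add: star_form_def)
 qed
 show "star_form ` wedge_forms k total = vector_forms k"
 proof
  show "star_form ` wedge_forms k total \<subseteq> vector_forms k" using W(2) by blast
  show "vector_forms k \<subseteq> star_form ` wedge_forms k total" using V by (metis image_eqI subsetI)
 qed
 fix \<eta> assume \<eta>: "\<eta> \<in> wedge_forms k total" and z: "\<forall>j. star_form \<eta> j = 0"
 have "star_form \<eta> = (%j. 0)" using z by auto
 then have "\<eta> = star_form (%j. 0)" using W(1)[OF \<eta>] by simp
 also have "\<dots> = (%j. 0)" by (auto simp: star_form_def star_def fun_eq_iff)
 finally show "\<eta> = (%i. 0)" .
qed

text \<open>The pairing of a vector field with a differential, in the two matrix encodings: if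
  \<open>P = v \<and> x\<close> and \<open>M = w \<and> dF\<close>, it is \<open>\<Sum> v\<^sub>i w\<^sub>i\<close>.\<close>

definition pairing :: "complex ^ 4 => (4 => 4 => complex) => (4 => 4 => complex) => complex" where
 "pairing x P M = (let (j, l) = SOME (j, l). x $ j ~= 0 & dF l x ~= 0 in (\<Sum>c\<in>UNIV. P c j * M c l) / (x $ j * dF l x))"

lemma pairing_linear: "pairing x P (%i j. M i j + N i j) = pairing x P M + pairing x P N" "pairing x P (%i j. a * M i j) = a * pairing x P M"
 by (simp_all add: pairing_def split_beta Let_def distrib_left sum.distrib add_divide_distrib sum_distrib_left mult_ac)

text \<open>For \<open>P = v \<and> x\<close> and \<open>M = w \<and> dF\<close>, the sum over \<open>c\<close> is
  \<open>x\<^sub>j \<partial>\<^sub>lF \<Sum> v\<^sub>c w\<^sub>c\<close>: the other terms contain one of the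
  vanishing products of \<open>v\<close> with \<open>dF\<close>, \<open>w\<close> with \<open>x\<close> and
  \<open>x\<close> with \<open>dF\<close>.\<close>

lemma pairing_cross:
 assumes x: "x \<in> K" and P: "wedge_cond (grad x) x P" and M: "wedge_cond x (grad x) M"
 shows "(x $ j * dF l x) * (\<Sum>c\<in>UNIV. P c j' * M c l') = (x $ j' * dF l' x) * (\<Sum>c\<in>UNIV. P c j * M c l)"
proof -
 have g: "grad x $ i = dF i x" for i by (simp add: grad_def)
 have p: "x $ j * P c j' = x $ j' * P c j - x $ c * P j' j" for c
 proof -
  have "x $ c * P j' j + x $ j' * (- P c j) + x $ j * P c j' = 0"
   using wedge_condD(3)[OF P, of c j' j] by (simp only: wedge_condD(1)[OF P, of j c])
  then show ?thesis by (simp add: algebra_simps)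
 qed
 have m: "dF l x * M c l' = dF l' x * M c l - dF c x * M l' l" for c
 proof -
  have "dF c x * M l' l + dF l' x * (- M c l) + dF l x * M c l' = 0"
   using wedge_condD(3)[OF M, of c l' l] by (simp only: wedge_condD(1)[OF M, of l c] g)
  then show ?thesis by (simp add: algebra_simps)
 qed
 have "(x $ j * dF l x) * (\<Sum>c\<in>UNIV. P c j' * M c l') = (\<Sum>c\<in>UNIV. (x $ j * P c j') * (dF l x * M c l'))"
  by (simp add: sum_distrib_left mult_ac)
 also have "\<dots> = (\<Sum>c\<in>UNIV. (x $ j' * dF l' x) * (P c j * M c l) - (x $ j' * M l' l) * (dF c x * P c j)
    - (P j' j * dF l' x) * (x $ c * M c l) + (P j' j * M l' l) * (x $ c * dF c x))"
  unfolding p m by (rule sum.cong[OF refl]) (simp add: algebra_simps)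
 also have "\<dots> = (x $ j' * dF l' x) * (\<Sum>c\<in>UNIV. P c j * M c l) - (x $ j' * M l' l) * (\<Sum>c\<in>UNIV. dF c x * P c j)
    - (P j' j * dF l' x) * (\<Sum>c\<in>UNIV. x $ c * M c l) + (P j' j * M l' l) * (\<Sum>c\<in>UNIV. x $ c * dF c x)"
  by (simp add: sum.distrib sum_subtractf sum_distrib_left)
 finally show ?thesis
  using wedge_condD(2)[OF P, of j] by (simp add: g wedge_condD(2)[OF M] euler_on_K[OF x])
qed

lemma pairing_eq:
 assumes x: "x \<in> K" and P: "wedge_cond (grad x) x P" and M: "wedge_cond x (grad x) M" and jl: "x $ j ~= 0" "dF l x ~= 0"
 shows "pairing x P M = (\<Sum>c\<in>UNIV. P c j * M c l) / (x $ j * dF l x)"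
proof -
 obtain j' l' where s: "(SOME (j, l). x $ j ~= 0 & dF l x ~= 0) = (j', l')" by (cases "SOME (j, l). x $ j ~= 0 & dF l x ~= 0")
 have "case (SOME (j, l). x $ j ~= 0 & dF l x ~= 0) of (j, l) => x $ j ~= 0 & dF l x ~= 0"
  by (rule someI[where P = "%(j, l). x $ j ~= 0 & dF l x ~= 0" and x = "(j, l)"]) (simp add: jl)
 then have "x $ j' ~= 0" "dF l' x ~= 0" unfolding s by auto
 then show ?thesis unfolding pairing_def s using pairing_cross[OF x P M, of j l j' l'] jl by (simp add: field_simps)
qed

lemma hom_sheaf_carrier:
 "h \<in> carrier (sec (hom_sheaf X M N) U) \<longleftrightarrow>
  (\<forall>V m. \<not> (openX V & V \<subseteq> U & m \<in> carrier (sec M V)) --> h V m = undefined) &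
  (\<forall>V. openX V & V \<subseteq> U --> h V \<in> module_hom (OX V) (sec M V) (sec N V)) &
  (\<forall>V W m. (openX V & V \<subseteq> U & m \<in> carrier (sec M V)) & openX W & W \<subseteq> V --> h W (res M V W m) = res N V W (h V m))"
proof -
 have "h = (%V m. if openX V & V \<subseteq> U & m \<in> carrier (sec M V) then h V m else undefined) \<longleftrightarrow>
  (\<forall>V m. \<not> (openX V & V \<subseteq> U & m \<in> carrier (sec M V)) --> h V m = undefined)"
  by (auto simp: fun_eq_iff)
 then show ?thesis unfolding hom_sheaf_def Let_def by simp
qed

lemma hom_sheaf_carrierD:
 assumes h: "h \<in> carrier (sec (hom_sheaf X M N) U)"
 shows "\<not> (openX V & V \<subseteq> U & m \<in> carrier (sec M V)) ==> h V m = undefined"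
  "openX V ==> V \<subseteq> U ==> h V \<in> module_hom (OX V) (sec M V) (sec N V)"
  "openX V ==> V \<subseteq> U ==> m \<in> carrier (sec M V) ==> openX W ==> W \<subseteq> V ==> h W (res M V W m) = res N V W (h V m)"
proof -
 note c = h[unfolded hom_sheaf_carrier]
 show "\<not> (openX V & V \<subseteq> U & m \<in> carrier (sec M V)) ==> h V m = undefined"
  by (rule c[THEN conjunct1, THEN spec, THEN spec, THEN mp])
 show "openX V ==> V \<subseteq> U ==> h V \<in> module_hom (OX V) (sec M V) (sec N V)"
  by (rule c[THEN conjunct2, THEN conjunct1, THEN spec, THEN mp]) (rule conjI)
 show "openX V ==> V \<subseteq> U ==> m \<in> carrier (sec M V) ==> openX W ==> W \<subseteq> V ==> h W (res M V W m) = res N V W (h V m)"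
  by (rule c[THEN conjunct2, THEN conjunct2, THEN spec, THEN spec, THEN spec, THEN mp]) (intro conjI)
qed

lemma module_homD:
 assumes "f \<in> module_hom R M N"
 shows "m \<in> carrier M ==> f m \<in> carrier N" "m \<in> carrier M ==> m' \<in> carrier M ==> f (m \<oplus>\<^bsub>M\<^esub> m') = f m \<oplus>\<^bsub>N\<^esub> f m'"
  "r \<in> carrier R ==> m \<in> carrier M ==> f (r \<odot>\<^bsub>M\<^esub> m) = r \<odot>\<^bsub>N\<^esub> f m"
 using assms by (auto simp: module_hom_def)

lemma hom_sheaf_simps:
 "\<zero>\<^bsub>sec (hom_sheaf X M N) U\<^esub> = (%V m. if openX V & V \<subseteq> U & m \<in> carrier (sec M V) then \<zero>\<^bsub>sec N V\<^esub> else undefined)"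
 "h \<oplus>\<^bsub>sec (hom_sheaf X M N) U\<^esub> h' = (%V m. if openX V & V \<subseteq> U & m \<in> carrier (sec M V) then h V m \<oplus>\<^bsub>sec N V\<^esub> h' V m else undefined)"
 "a \<odot>\<^bsub>sec (hom_sheaf X M N) U\<^esub> h = (%V m. if openX V & V \<subseteq> U & m \<in> carrier (sec M V) then rst V a \<odot>\<^bsub>sec N V\<^esub> h V m else undefined)"
 "res (hom_sheaf X M N) U U' h = (%V m. if openX V & V \<subseteq> U' & m \<in> carrier (sec M V) then h V m else undefined)"
 by (simp_all add: hom_sheaf_def Let_def)

lemma OX_smult: "a \<odot>\<^bsub>OX U\<^esub> s = (%x. a x * s x)"
 by (simp add: str_X)

abbreviation Th where "Th \<equiv> hom_sheaf X Om (str X)"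
abbreviation Fol where "Fol k \<equiv> hom_sheaf X (twist F (- k)) Th"

text \<open>The arguments at which a section of the foliation sheaf is not \<open>undefined\<close>.\<close>

definition hom_dom where
 "hom_dom k V e W \<omega> \<longleftrightarrow> openX V & Reg (- k) V e & openX W & W \<subseteq> V & \<omega> \<in> carrier (sec Om W)"

lemma Fol_undefined:
 assumes h: "h \<in> carrier (sec (Fol k) total)" and n: "\<not> (openX V & Reg (- k) V e)" shows "h V e = undefined"
 by (rule hom_sheaf_carrierD(1)[OF h]) (use n in blast)

lemma Fol_component:
 assumes h: "h \<in> carrier (sec (Fol k) total)" and V: "openX V" "Reg (- k) V e"
 shows "h V e \<in> carrier (sec Th V)"
 by (rule module_homD(1)[OF hom_sheaf_carrierD(2)[OF h V(1) openX_subset[OF V(1)]] V(2)])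

lemma Fol_ext:
 assumes h: "h \<in> carrier (sec (Fol k) total)" and h': "h' \<in> carrier (sec (Fol k) total)"
  and eq: "!!V e W \<omega>. hom_dom k V e W \<omega> ==> h V e W \<omega> = h' V e W \<omega>"
 shows "h = h'"
proof -
 have "h V e W \<omega> = h' V e W \<omega>" for V e W \<omega>
 proof (cases "openX V & Reg (- k) V e")
  case True
  then have V: "openX V" "Reg (- k) V e" by auto
  show ?thesis
  proof (cases "openX W & W \<subseteq> V & \<omega> \<in> carrier (sec Om W)")
   case True
   then show ?thesis using V by (intro eq) (simp add: hom_dom_def)
  next
   case False
   then show ?thesis using hom_sheaf_carrierD(1)[OF Fol_component[OF h V] False] hom_sheaf_carrierD(1)[OF Fol_component[OF h' V] False] by simp
  qed
 next
  case False
  then show ?thesis using Fol_undefined[OF h False] Fol_undefined[OF h' False] by simp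
 qed
 then show ?thesis by (intro ext) (rule fun_cong)
qed

lemma Fol_rules:
 assumes h: "h \<in> carrier (sec (Fol k) total)" and d: "hom_dom k V e W \<omega>"
 shows "Reg 0 W (h V e W \<omega>)"
  "\<omega>' \<in> carrier (sec Om W) ==> h V e W (\<omega> \<oplus>\<^bsub>sec Om W\<^esub> \<omega>') = (%x. h V e W \<omega> x + h V e W \<omega>' x)"
  "Reg 0 W a ==> h V e W (a \<odot>\<^bsub>sec Om W\<^esub> \<omega>) = (%x. a x * h V e W \<omega> x)"
  "openX W' ==> W' \<subseteq> W ==> h V e W' (res Om W W' \<omega>) = rst W' (h V e W \<omega>)"
  "Reg 0 V b ==> h V (%x. b x * e x) W \<omega> = (%x. rst W b x * h V e W \<omega> x)"
  "openX V' ==> W \<subseteq> V' ==> V' \<subseteq> V ==> h V' (rst V' e) W \<omega> = h V e W \<omega>"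
proof -
 have V: "openX V" "Reg (- k) V e" and W: "openX W" "W \<subseteq> V" "\<omega> \<in> carrier (sec Om W)" using d by (auto simp: hom_dom_def)
 have g: "h V e \<in> carrier (sec Th V)" by (rule Fol_component[OF h V])
 note gW = module_homD[OF hom_sheaf_carrierD(2)[OF g W(1,2)]]
 note hV = module_homD[OF hom_sheaf_carrierD(2)[OF h V(1) openX_subset[OF V(1)]]]
 show "Reg 0 W (h V e W \<omega>)" using gW(1)[OF W(3)] by (simp add: carrier_OX)
 show "\<omega>' \<in> carrier (sec Om W) ==> h V e W (\<omega> \<oplus>\<^bsub>sec Om W\<^esub> \<omega>') = (%x. h V e W \<omega> x + h V e W \<omega>' x)"
  using gW(2)[OF W(3), of \<omega>'] by simp
 show "Reg 0 W a ==> h V e W (a \<odot>\<^bsub>sec Om W\<^esub> \<omega>) = (%x. a x * h V e W \<omega> x)"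
  using gW(3)[OF _ W(3), of a] by (simp add: carrier_OX OX_smult)
 show "openX W' ==> W' \<subseteq> W ==> h V e W' (res Om W W' \<omega>) = rst W' (h V e W \<omega>)"
  using hom_sheaf_carrierD(3)[OF g W, of W'] by simp
 show "h V (%x. b x * e x) W \<omega> = (%x. rst W b x * h V e W \<omega> x)" if b: "Reg 0 V b"
 proof -
  have "h V (b \<odot>\<^bsub>sec (twist F (- k)) V\<^esub> e) = b \<odot>\<^bsub>sec Th V\<^esub> h V e"
   by (rule hV(3)[OF _ V(2)]) (simp add: carrier_OX b)
  then show ?thesis using W by (simp add: hom_sheaf_simps OX_smult)
 qed
 show "h V' (rst V' e) W \<omega> = h V e W \<omega>" if "openX V'" "W \<subseteq> V'" "V' \<subseteq> V"
 proof -
  have "h V' (res (twist F (- k)) V V' e) = res Th V V' (h V e)"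
   by (rule hom_sheaf_carrierD(3)[OF h V(1) openX_subset[OF V(1)] V(2) that(1,3)])
  then show ?thesis using W that by (simp add: hom_sheaf_simps)
 qed
qed

end

context smooth_quartic
begin

interpretation cot: wedge_presheaf F "kaehler_presheaf X" "%U. carrier (OX U)" KR "%U V. rst V" dwedge 0
 by (rule kaehler_wedge_presheaf)

text \<open>Linearity over the regular functions, in the form in which it is applied: a linear relation between
  values of differential forms holds for the forms.\<close>

lemma Fol_combination:
 assumes h: "h \<in> carrier (sec (Fol k) total)" and V: "openX V" "Reg (- k) V e" and W: "openX W" "W \<subseteq> V"
  and I: "finite I" and \<theta>: "!!i. i \<in> I ==> \<theta> i \<in> carrier (sec Om W)" and c: "!!i. i \<in> I ==> Reg 0 W (c i)"
  and \<omega>: "\<omega> \<in> carrier (sec Om W)"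
  and eq: "!!x y. x \<in> over W ==> cot.Val \<omega> (x, y) = (\<Sum>i\<in>I. c i x * cot.Val (\<theta> i) (x, y))"
 shows "h V e W \<omega> x = (\<Sum>i\<in>I. c i x * h V e W (\<theta> i) x)"
 using I \<theta> c \<omega> eq
proof (induction I arbitrary: \<omega> rule: finite_induct)
 case empty
 have d: "hom_dom k V e W \<omega>" using V W empty by (simp add: hom_dom_def)
 note z = cot.SP_smult[OF W(1) Reg_zero[OF W(1)] empty(3)]
 have "\<omega> = (%x. 0) \<odot>\<^bsub>sec Om W\<^esub> \<omega>"
  by (rule cot.Val_inject[OF W(1) empty(3) z(1)]) (simp only: z(2) empty(4) sum.empty mult_zero_left)
 then have "h V e W \<omega> x = h V e W ((%x. 0) \<odot>\<^bsub>sec Om W\<^esub> \<omega>) x" by (rule arg_cong[where f = "%\<omega>. h V e W \<omega> x"])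
 also have "\<dots> = 0" unfolding Fol_rules(3)[OF h d Reg_zero[OF W(1)]] by simp
 finally show ?case by simp
next
 case (insert i I)
 have \<theta>i: "\<theta> i \<in> carrier (sec Om W)" and c': "Reg 0 W (%x. - c i x)"
  using insert.prems(1,2)[of i] by (simp_all add: Reg_uminus[OF W(1)])
 note s = cot.SP_smult[OF W(1) c' \<theta>i]
 note a = cot.SP_add[OF W(1) insert.prems(3) s(1)]
 let ?\<omega>' = "\<omega> \<oplus>\<^bsub>sec Om W\<^esub> ((%x. - c i x) \<odot>\<^bsub>sec Om W\<^esub> \<theta> i)"
 have d: "hom_dom k V e W \<omega>" and di: "hom_dom k V e W (\<theta> i)" using V W insert.prems(3) \<theta>i by (simp_all add: hom_dom_def)
 have IH: "h V e W ?\<omega>' x = (\<Sum>i\<in>I. c i x * h V e W (\<theta> i) x)"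
 proof (rule insert.IH[OF _ _ a(1)])
  fix x y assume x: "x \<in> over W"
  show "cot.Val ?\<omega>' (x, y) = (\<Sum>i\<in>I. c i x * cot.Val (\<theta> i) (x, y))"
   using insert.prems(4)[OF x, of y] insert.hyps by (simp add: a(2) s(2))
 qed (use insert.prems in auto)
 have "h V e W ?\<omega>' x = h V e W \<omega> x + - c i x * h V e W (\<theta> i) x"
  by (simp add: Fol_rules(2)[OF h d s(1)] Fol_rules(3)[OF h di c'])
 then show ?case using IH insert.hyps by simp
qed

text \<open>The values of a section of the foliation sheaf on the frame of a chart.\<close>

definition frame_value where
 "frame_value h k j i = h (axis j) (rst (axis j) (%z. z $ j powi (- k))) (axis j) (chart_form j i (axis j))"

lemma chart_form_value:
 assumes z: "z \<in> over (axis j)"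
 shows "cot.Val (chart_form j i (axis j)) (z, y) = dwedge (coordinate j i) (z, y)"
 using chart_form(2)[OF open_axis subset_refl z, of i y]
  dwedge_rst[OF open_axis open_axis subset_refl Reg_coordinate z, of i y] by simp

text \<open>On the chart \<open>e\<close> is a multiple of \<open>z\<^sub>j\<^sup>-\<^sup>k\<close>, so the section
  is determined by its values on \<open>du\<^sub>i\<close> and this one local generator.\<close>

lemma Fol_local:
 assumes h: "h \<in> carrier (sec (Fol k) total)" and V: "openX V" "Reg (- k) V e" and W: "openX W" "W \<subseteq> V" "W \<subseteq> axis j"
  and c: "!!i. Reg 0 W (c i)" and \<omega>: "\<omega> \<in> carrier (sec Om W)"
  and eq: "!!z y. z \<in> over W ==> cot.Val \<omega> (z, y) = (\<Sum>i\<in>UNIV. c i z * dwedge (coordinate j i) (z, y))"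
  and x: "x \<in> over W"
 shows "h V e W \<omega> x = e x * x $ j powi k * (\<Sum>i\<in>UNIV. c i x * frame_value h k j i x)"
proof -
 let ?D = "axis j"
 define E where "E = rst ?D (%z. z $ j powi (- k))"
 define a where "a = (%x. rst W e x * rst W (%z. z $ j powi k) x)"
 have E: "Reg (- k) ?D E" unfolding E_def by (rule Reg_var_power[OF open_axis subset_refl])
 have EW: "Reg (- k) W (rst W E)" by (rule Reg_rst[OF open_axis W(1) over_mono[OF W(3)] E])
 have eW: "Reg (- k) W (rst W e)" by (rule Reg_rst[OF V(1) W(1) over_mono[OF W(2)] V(2)])
 have a: "Reg 0 W a" unfolding a_def by (rule Reg_mult[OF W(1) eW Reg_var_power[OF W(1,3)]]) simp
 have nz: "z $ j ~= 0" "z \<in> over ?D" if "z \<in> over W" for z using over_mono[OF W(3)] that by (auto simp: cone_axis)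
 have aE: "rst W e = (%x. a x * rst W E x)"
 proof
  fix z show "rst W e z = a z * rst W E z"
  proof (cases "z \<in> over W")
   case True
   then show ?thesis using nz[OF True] by (simp add: a_def E_def rst_def power_int_minus)
  qed (simp add: rst_def)
 qed
 have d1: "hom_dom k V e W \<omega>" and d2: "hom_dom k W (rst W E) W \<omega>" and d3: "hom_dom k ?D E W \<omega>"
  using V W \<omega> EW E open_axis by (simp_all add: hom_dom_def)
 have "h V e W \<omega> = h W (rst W e) W \<omega>" by (rule Fol_rules(6)[OF h d1 W(1) subset_refl W(2), symmetric])
 also have "\<dots> = (%x. rst W a x * h W (rst W E) W \<omega> x)" unfolding aE by (rule Fol_rules(5)[OF h d2 a])
 also have "h W (rst W E) W \<omega> = h ?D E W \<omega>" by (rule Fol_rules(6)[OF h d3 W(1) subset_refl W(3)])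
 finally have 1: "h V e W \<omega> x = a x * h ?D E W \<omega> x" using x by (simp add: rst_def)
 let ?\<theta> = "%i. res Om ?D W (chart_form j i ?D)"
 note cf = chart_form(1)[OF open_axis subset_refl]
 note r = cot.SP_res[OF open_axis W(1,3) cf]
 have 2: "h ?D E W \<omega> x = (\<Sum>i\<in>UNIV. c i x * h ?D E W (?\<theta> i) x)"
 proof (rule Fol_combination[OF h open_axis E W(1,3) finite[of UNIV] r(1) c \<omega>])
  fix z y assume z: "z \<in> over W"
  show "cot.Val \<omega> (z, y) = (\<Sum>i\<in>UNIV. c i z * cot.Val (?\<theta> i) (z, y))"
   using eq[OF z, of y] by (simp only: r(2)[OF z] chart_form_value[OF nz(2)[OF z]])
 qed
 have 3: "h ?D E W (?\<theta> i) x = frame_value h k j i x" for i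
 proof -
  have "hom_dom k ?D E ?D (chart_form j i ?D)" using E open_axis cf by (simp add: hom_dom_def)
  from Fol_rules(4)[OF h this W(1,3)] show ?thesis using x by (simp add: frame_value_def E_def rst_def)
 qed
 show ?thesis unfolding 1 2 3 using x by (simp add: a_def rst_def)
qed

lemma dwedge_coordinate_axis:
 assumes z: "z \<in> over (axis j)"
 shows "dwedge (coordinate j i) (z, m, n) = cdiff j i z m * dF n z - cdiff j i z n * dF m z"
 using dwedge_coordinate[OF open_axis subset_refl z, of i m n]
  dwedge_rst[OF open_axis open_axis subset_refl Reg_coordinate z, of i "(m, n)"] by simp

text \<open>Relations between the \<open>du\<^sub>i\<close> are respected by every section of the foliation sheaf.\<close>

lemma frame_value_relation:
 assumes h: "h \<in> carrier (sec (Fol k) total)" and c: "!!i. Reg 0 (axis j) (c i)"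
  and zero: "!!z m n. z \<in> over (axis j) ==> (\<Sum>i\<in>UNIV. c i z * dwedge (coordinate j i) (z, m, n)) = 0"
  and x: "x \<in> over (axis j)"
 shows "(\<Sum>i\<in>UNIV. c i x * frame_value h k j i x) = 0"
proof -
 let ?D = "axis j" and ?E = "rst (axis j) (%z. z $ j powi (- k))"
 have E: "Reg (- k) ?D ?E" by (rule Reg_var_power[OF open_axis subset_refl])
 note z = cot.SP_zero_in[OF open_axis, of j]
 note L = Fol_local[OF h open_axis E open_axis subset_refl subset_refl _ z _ x]
 have "h ?D ?E ?D \<zero>\<^bsub>sec Om ?D\<^esub> x = ?E x * x $ j powi k * (\<Sum>i\<in>UNIV. c i x * frame_value h k j i x)"
  by (rule L[OF c]) (use zero in "auto simp: cot.Val_zero[OF open_axis]")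
 moreover have "h ?D ?E ?D \<zero>\<^bsub>sec Om ?D\<^esub> x = ?E x * x $ j powi k * (\<Sum>i\<in>UNIV. 0 * frame_value h k j i x)"
  by (rule L[of "%i x. 0"]) (simp_all add: Reg_zero[OF open_axis] cot.Val_zero[OF open_axis])
 moreover have "x $ j ~= 0" using x by (simp add: cone_axis)
 ultimately show ?thesis using x by (simp add: rst_def)
qed

lemma frame_value_self:
 assumes h: "h \<in> carrier (sec (Fol k) total)" and x: "x \<in> over (axis j)"
 shows "frame_value h k j j x = 0"
proof -
 let ?c = "%i. if i = j then rst (axis j) (%x. 1) else (%x. 0)"
 have "(\<Sum>i\<in>UNIV. ?c i x * frame_value h k j i x) = 0"
 proof (rule frame_value_relation[OF h _ _ x])
  show "Reg 0 (axis j) (?c i)" for i using Reg_const[OF open_axis] Reg_zero[OF open_axis] by simp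
  fix z m n assume z: "z \<in> over (axis j)"
  then have "dwedge (coordinate j j) (z, m, n) = 0"
   unfolding dwedge_coordinate_axis[OF z] by (simp add: cdiff_def cone_axis)
  then show "(\<Sum>i\<in>UNIV. ?c i z * dwedge (coordinate j i) (z, m, n)) = 0" by (intro sum.neutral) auto
 qed
 moreover have "(\<Sum>i\<in>UNIV. ?c i x * frame_value h k j i x) = (\<Sum>i\<in>UNIV. if i = j then frame_value h k j i x else 0)"
  by (rule sum.cong[OF refl]) (use x in "simp add: rst_def")
 ultimately show ?thesis by simp
qed

text \<open>The relation \<open>\<Sum> \<partial>\<^sub>iF du\<^sub>i = 0\<close> on the quartic.\<close>

lemma frame_value_gradient:
 assumes h: "h \<in> carrier (sec (Fol k) total)" and x: "x \<in> over (axis j)"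
 shows "(\<Sum>i\<in>UNIV. dF i x * frame_value h k j i x) = 0"
proof -
 let ?D = "axis j"
 let ?c = "%i z. rst ?D (dF i) z * rst ?D (%z. z $ j powi (-3)) z"
 have "(\<Sum>i\<in>UNIV. ?c i x * frame_value h k j i x) = 0"
 proof (rule frame_value_relation[OF h _ _ x])
  show "Reg 0 ?D (?c i)" for i
   by (rule Reg_mult[OF open_axis Reg_form[OF open_axis homogeneous_dF] Reg_var_power[OF open_axis subset_refl]]) simp_all
  fix z m n assume z: "z \<in> over ?D"
  then have zK: "z \<in> K" "z $ j ~= 0" by (auto simp: cone_axis)
  have s: "(\<Sum>i\<in>UNIV. dF i z * cdiff j i z m) = dF m z / z $ j" for m
  proof -
   have "(\<Sum>i\<in>UNIV. dF i z * cdiff j i z m)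
     = (\<Sum>i\<in>UNIV. (if m = i then dF i z / z $ j else 0) - (if m = j then 1 else 0) / (z $ j)\<^sup>2 * (z $ i * dF i z))"
    by (rule sum.cong[OF refl]) (simp add: cdiff_def power2_eq_square diff_divide_distrib algebra_simps)
   also have "\<dots> = dF m z / z $ j - (if m = j then 1 else 0) / (z $ j)\<^sup>2 * (\<Sum>i\<in>UNIV. z $ i * dF i z)"
    by (simp add: sum_subtractf sum_distrib_left)
   finally show ?thesis by (simp add: euler_on_K[OF zK(1)])
  qed
  have "(\<Sum>i\<in>UNIV. ?c i z * dwedge (coordinate j i) (z, m, n))
    = z $ j powi (-3) * ((\<Sum>i\<in>UNIV. dF i z * cdiff j i z m) * dF n z - (\<Sum>i\<in>UNIV. dF i z * cdiff j i z n) * dF m z)"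
   unfolding dwedge_coordinate_axis[OF z] sum_distrib_right sum_subtractf[symmetric] sum_distrib_left
   by (rule sum.cong[OF refl]) (use z in "simp add: rst_def algebra_simps")
  then show "(\<Sum>i\<in>UNIV. ?c i z * dwedge (coordinate j i) (z, m, n)) = 0" unfolding s by simp
 qed
 then have "x $ j powi (-3) * (\<Sum>i\<in>UNIV. dF i x * frame_value h k j i x) = 0"
  using x by (simp add: rst_def sum_distrib_left mult_ac)
 then show ?thesis using x by (simp add: cone_axis)
qed

text \<open>The matrix \<open>v \<and> x\<close> for the vector \<open>v\<close> with components
  \<open>x\<^sub>j\<^sup>k\<^sup>+\<^sup>1 h(du\<^sub>i)\<close>; wedging with \<open>x\<close> makes it
  independent of the chart.\<close>

definition frame_matrix where
 "frame_matrix h k j x i i' = x $ j powi (k + 1) * (x $ i' * frame_value h k j i x - x $ i * frame_value h k j i' x)"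

text \<open>The quotient rule for \<open>x\<^sub>i / x\<^sub>j' = (x\<^sub>i / x\<^sub>j) / (x\<^sub>j' /
  x\<^sub>j)\<close>.\<close>

lemma frame_change:
 assumes h: "h \<in> carrier (sec (Fol k) total)" and x: "x \<in> K" "x $ j ~= 0" "x $ j' ~= 0"
 shows "frame_value h k j' i x = x $ j' powi (- k) * x $ j powi k * (x $ j / x $ j') *
  (frame_value h k j i x - x $ i / x $ j' * frame_value h k j j' x)"
proof -
 let ?D = "axis j'"
 let ?E = "rst ?D (%z. z $ j' powi (- k))"
 let ?W = "axis j \<inter> ?D"
 have W: "openX ?W" "?W \<subseteq> ?D" "?W \<subseteq> axis j" using open_axis[of j] open_axis[of j'] by auto
 define u v where "u = rst ?W (coordinate j' j)" and "v = rst ?W (coordinate j' i)"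
 define c where "c m = (%z. (if m = i then 1 else 0) * u z - (if m = j' then 1 else 0) * (v z * u z))" for m
 have E: "Reg (- k) ?D ?E" by (rule Reg_var_power[OF open_axis subset_refl])
 have uv: "Reg 0 ?W u" "Reg 0 ?W v"
  unfolding u_def v_def by (rule Reg_rst[OF open_axis W(1) over_mono[OF W(2)] Reg_coordinate])+
 have c: "Reg 0 ?W (c m)" for m
  unfolding c_def by (intro Reg_diff[OF W(1)] Reg_cmult[OF W(1)] uv(1) Reg_mult[OF W(1) uv(2,1)]) simp
 have cs: "(\<Sum>m\<in>UNIV. c m z * Y m) = u z * Y i - v z * u z * Y j'" for z and Y :: "4 => complex"
 proof -
  have "(\<Sum>m\<in>UNIV. c m z * Y m) = (\<Sum>m\<in>UNIV. (if m = i then u z * Y m else 0) - (if m = j' then v z * u z * Y m else 0))"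
   by (rule sum.cong[OF refl]) (simp add: c_def algebra_simps)
  then show ?thesis by (simp add: sum_subtractf)
 qed
 have nz: "z $ j ~= 0" "z $ j' ~= 0" "z \<in> over (axis j)" "z \<in> over ?D" if "z \<in> over ?W" for z
  using over_mono[OF W(2)] over_mono[OF W(3)] that by (auto simp: cone_axis)
 have uvz: "u z = z $ j / z $ j'" "v z = z $ i / z $ j'" if "z \<in> over ?W" for z
  using that nz(4)[OF that] by (simp_all add: u_def v_def coordinate_def rst_def)
 have xW: "x \<in> over ?W" using cone_Int[OF open_axis open_axis, of j j'] x by (simp add: cone_axis)
 note cf = chart_form(1)[OF open_axis subset_refl, of j' i]
 note r = cot.SP_res[OF open_axis W(1,2) cf]
 have "h ?D ?E ?W (res Om ?D ?W (chart_form j' i ?D)) x = ?E x * x $ j powi k * (\<Sum>m\<in>UNIV. c m x * frame_value h k j m x)"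
 proof (rule Fol_local[OF h open_axis E W c r(1) _ xW])
  fix z and y :: "4 \<times> 4" assume z: "z \<in> over ?W"
  obtain m n where y: "y = (m, n)" by (cases y)
  have cd: "cdiff j' i z m = u z * cdiff j i z m - v z * u z * cdiff j j' z m" for m
  proof -
   have "(a - zi / zj' * b) / zj' = zj / zj' * ((a - zi / zj * d) / zj) - zi / zj' * (zj / zj') * ((b - zj' / zj * d) / zj)"
    if "zj ~= 0" "zj' ~= 0" for a b d zi zj zj' :: complex
    using that by (simp add: field_simps)
   from this[OF nz(1)[OF z] nz(2)[OF z]] show ?thesis unfolding cdiff_def uvz[OF z] .
  qed
  show "cot.Val (res Om ?D ?W (chart_form j' i ?D)) (z, y) = (\<Sum>m\<in>UNIV. c m z * dwedge (coordinate j m) (z, y))"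
   unfolding cs r(2)[OF z] chart_form_value[OF nz(4)[OF z]] y dwedge_coordinate_axis[OF nz(3)[OF z]] dwedge_coordinate_axis[OF nz(4)[OF z]] cd
   by (simp add: algebra_simps)
 qed
 moreover have "h ?D ?E ?W (res Om ?D ?W (chart_form j' i ?D)) x = frame_value h k j' i x"
 proof -
  have "hom_dom k ?D ?E ?D (chart_form j' i ?D)" using E open_axis cf by (simp add: hom_dom_def)
  from Fol_rules(4)[OF h this W(1,2)] show ?thesis using xW by (simp add: frame_value_def rst_def)
 qed
 ultimately show ?thesis using nz(4)[OF xW] unfolding cs uvz[OF xW] by (simp add: rst_def algebra_simps)
qed

lemma frame_matrix_independent:
 assumes h: "h \<in> carrier (sec (Fol k) total)" and x: "x \<in> K" "x $ j ~= 0" "x $ j' ~= 0"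
 shows "frame_matrix h k j' x i i' = frame_matrix h k j x i i'"
proof -
 have p: "x $ j' powi (k + 1) * (x $ j' powi (- k) * x $ j powi k * (x $ j / x $ j')) = x $ j powi (k + 1)"
  using x by (simp add: power_int_add_1 power_int_minus)
 have fac: "x $ i' * (p * (a - x $ i / q * c)) - x $ i * (p * (b - x $ i' / q * c)) = p * (x $ i' * a - x $ i * b)" for p q a b c
  by (simp add: algebra_simps)
 have "frame_matrix h k j' x i i' = x $ j' powi (k + 1) * (x $ j' powi (- k) * x $ j powi k * (x $ j / x $ j'))
   * (x $ i' * frame_value h k j i x - x $ i * frame_value h k j i' x)"
  unfolding frame_matrix_def frame_change[OF h x] fac by (simp only: mult.assoc)
 then show ?thesis unfolding p by (simp add: frame_matrix_def)
qed

definition vector_form_of where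
 "vector_form_of k h = (%(x, i, i'). if x \<in> K then frame_matrix h k (SOME j. x $ j ~= 0) x i i' else 0)"

lemma vector_form_of_eq:
 assumes h: "h \<in> carrier (sec (Fol k) total)" and x: "x \<in> K" "x $ j ~= 0"
 shows "vector_form_of k h (x, i, i') = frame_matrix h k j x i i'"
proof -
 have s: "x $ (SOME j. x $ j ~= 0) ~= 0" using x(2) by (rule someI)
 have "vector_form_of k h (x, i, i') = frame_matrix h k (SOME j. x $ j ~= 0) x i i'" using x(1) by (simp add: vector_form_of_def)
 then show ?thesis unfolding frame_matrix_independent[OF h x s] .
qed

lemma vector_form_of_in:
 assumes h: "h \<in> carrier (sec (Fol k) total)" shows "vector_form_of k h \<in> vector_forms k"
proof -
 have nz: "\<exists>j. x $ j ~= 0" if "x \<in> K" for x using that by (auto simp: K_def vec_eq_iff)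
 have "Reg (k + 2) total (%x. vector_form_of k h (x, i, i'))" for i i'
 proof (rule Reg_glue[OF openX_total])
  fix x assume "x \<in> over total"
  then have x: "x \<in> K" by simp
  then obtain j where j: "x $ j ~= 0" using nz by blast
  let ?D = "axis j"
  have fv: "Reg 0 ?D (frame_value h k j i)" for i
   unfolding frame_value_def
   by (rule Fol_rules(1)[OF h]) (simp add: hom_dom_def open_axis chart_form(1) Reg_var_power)
  have q: "Reg 1 ?D (rst ?D (peval (form_var i)))" for i by (rule Reg_form[OF open_axis homogeneous_var]) simp
  let ?t = "%z. rst ?D (%z. z $ j powi (k + 1)) z * (rst ?D (peval (form_var i')) z * frame_value h k j i z - rst ?D (peval (form_var i)) z * frame_value h k j i' z)"
  have t: "Reg (k + 2) ?D ?t"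
  proof (rule Reg_mult[OF open_axis Reg_var_power[OF open_axis subset_refl]])
   show "Reg 1 ?D (%z. rst ?D (peval (form_var i')) z * frame_value h k j i z - rst ?D (peval (form_var i)) z * frame_value h k j i' z)"
    by (intro Reg_diff[OF open_axis] Reg_mult[OF open_axis q fv]) simp_all
  qed simp
  have "\<forall>z\<in>over ?D. vector_form_of k h (z, i, i') = ?t z"
   by (auto simp: vector_form_of_eq[OF h] frame_matrix_def rst_def cone_axis)
  moreover have "x \<in> over ?D" "over ?D \<subseteq> over total" using x j by (auto simp: cone_axis)
  ultimately show "\<exists>V t. openX V & x \<in> over V & over V \<subseteq> over total & Reg (k + 2) V t & (\<forall>z\<in>over V. vector_form_of k h (z, i, i') = t z)"
   using t open_axis by (intro exI[of _ ?D] exI[of _ ?t] conjI)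
 qed (simp add: vector_form_of_def)
 moreover have "wedge_cond (grad x) x (%i i'. vector_form_of k h (x, i, i'))" if x: "x \<in> K" for x
 proof -
  obtain j where j: "x $ j ~= 0" using nz[OF x] by blast
  have xD: "x \<in> over (axis j)" using x j by (simp add: cone_axis)
  let ?w = "%i. x $ j powi (k + 1) * frame_value h k j i x"
  show ?thesis
  proof (rule wedge_cond_wedge[where w = ?w])
   show "vector_form_of k h (x, i, i') = ?w i * x $ i' - ?w i' * x $ i" for i i'
    by (simp add: vector_form_of_eq[OF h x j] frame_matrix_def algebra_simps)
   have "(\<Sum>i\<in>UNIV. grad x $ i * ?w i) = x $ j powi (k + 1) * (\<Sum>i\<in>UNIV. dF i x * frame_value h k j i x)"
    by (simp add: grad_def sum_distrib_left mult_ac)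
   then show "(\<Sum>i\<in>UNIV. grad x $ i * ?w i) = 0" by (simp add: frame_value_gradient[OF h xD])
   show "(\<Sum>i\<in>UNIV. grad x $ i * x $ i) = 0" using euler_on_K[OF x] by (simp add: grad_def mult.commute)
  qed
 qed
 ultimately show ?thesis by (simp add: vector_forms_def)
qed

abbreviation "form_at \<omega> x \<equiv> (%i j. cot.Val \<omega> (x, i, j))"
abbreviation "matrix_at P x \<equiv> (%i j. P (x, i, j))"

lemma chart_expansion_sum:
 assumes W: "openX W" "W \<subseteq> chart j l" and \<eta>: "\<eta> \<in> wedge_forms 0 W" and z: "z \<in> over W"
  and ind: "j ~= l" "a ~= j" "a ~= l" "b ~= j" "b ~= l" "a ~= b" "UNIV = {j, l, a, b}"
 shows "\<eta> (z, i) = (\<Sum>m\<in>UNIV. chart_coeff j l 0 W \<eta> m z * dwedge (coordinate j m) (z, i))"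
proof -
 have WA: "W \<subseteq> axis j" using W(2) chart_axis by blast
 have zD: "z \<in> over (axis j)" using over_mono[OF WA] z by blast
 obtain m n where i: "i = (m, n)" by (cases i)
 have j0: "dwedge (coordinate j j) (z, i) = 0"
  using zD unfolding i dwedge_coordinate_axis[OF zD] by (simp add: cdiff_def cone_axis)
 have "\<eta> (z, l, l) = 0" using wedge_condD(1)[OF wedge_formsD(2)[OF \<eta> z], of l l] by simp
 then have l0: "chart_coeff j l 0 W \<eta> l z = 0" by (simp add: chart_coeff_def rst_def)
 have d: "dwedge (rst W (coordinate j c)) (z, i) = dwedge (coordinate j c) (z, i)" for c
  by (rule dwedge_rst[OF open_axis W(1) WA Reg_coordinate z])
 have "(\<Sum>m\<in>{j, l, a, b}. chart_coeff j l 0 W \<eta> m z * dwedge (coordinate j m) (z, i)) = \<eta> (z, i)"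
  using chart_expansion[OF W \<eta> z ind, of i] ind(1-6) by (simp add: j0 l0 d)
 then show ?thesis unfolding ind(7) by simp
qed

text \<open>A form is the combination of the \<open>du\<^sub>m\<close> with its chart coefficients, and the
  resulting sum is the pairing in the chart.\<close>

lemma Fol_formula:
 assumes h: "h \<in> carrier (sec (Fol k) total)" and d: "hom_dom k V e W \<omega>" and x: "x \<in> over W"
 shows "h V e W \<omega> x = e x * pairing x (matrix_at (vector_form_of k h) x) (form_at \<omega> x)"
proof -
 have V: "openX V" "Reg (- k) V e" and W: "openX W" "W \<subseteq> V" "\<omega> \<in> carrier (sec Om W)" using d by (auto simp: hom_dom_def)
 have xK: "x \<in> K" by (rule openX_cone_subset[OF W(1) x])
 obtain j l a b where jl: "x $ j ~= 0" "dF l x ~= 0" and ind: "j ~= l" "a ~= j" "a ~= l" "b ~= j" "b ~= l" "a ~= b" "UNIV = {j, l, a, b}"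
  using good_indices[OF xK] by metis
 let ?W = "W \<inter> chart j l" and ?\<omega> = "res Om W (W \<inter> chart j l) \<omega>"
 have W': "openX ?W" "?W \<subseteq> chart j l" "?W \<subseteq> W" "?W \<subseteq> V" "?W \<subseteq> axis j"
  using W open_chart[of j l] chart_axis[of j l] by auto
 have xW: "x \<in> over ?W" using cone_Int[OF W(1) open_chart] x jl xK by (simp add: cone_chart)
 have xD: "x \<in> over (axis j)" using xK jl by (simp add: cone_axis)
 note r = cot.SP_res[OF W(1) W'(1,3) W(3)]
 note w = cot.Val_wedge[OF W'(1) r(1)]
 have 1: "h V e W \<omega> x = h V e ?W ?\<omega> x" using Fol_rules(4)[OF h d W'(1,3)] xW by (simp add: rst_def)
 have 2: "h V e ?W ?\<omega> x = e x * x $ j powi k * (\<Sum>m\<in>UNIV. chart_coeff j l 0 ?W (cot.Val ?\<omega>) m x * frame_value h k j m x)"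
  by (rule Fol_local[OF h V W'(1,4,5) Reg_chart_coeff[OF W'(1,2) w] r(1) chart_expansion_sum[OF W'(1,2) w _ ind] xW])
 have 3: "chart_coeff j l 0 ?W (cot.Val ?\<omega>) m x = form_at \<omega> x m l / dF l x * x $ j" for m
  using xW by (simp add: chart_coeff_def rst_def r(2)[OF xW])
 have 4: "x $ j powi k * (\<Sum>m\<in>UNIV. form_at \<omega> x m l / dF l x * x $ j * frame_value h k j m x)
   = (\<Sum>m\<in>UNIV. vector_form_of k h (x, m, j) * form_at \<omega> x m l) / (x $ j * dF l x)"
 proof -
  have "vector_form_of k h (x, m, j) = x $ j powi k * x $ j * x $ j * frame_value h k j m x" for m
   using jl(1) by (simp add: vector_form_of_eq[OF h xK jl(1)] frame_matrix_def frame_value_self[OF h xD] power_int_add_1)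
  then show ?thesis using jl by (simp add: sum_divide_distrib sum_distrib_left mult_ac)
 qed
 have 5: "pairing x (matrix_at (vector_form_of k h) x) (form_at \<omega> x) = (\<Sum>m\<in>UNIV. vector_form_of k h (x, m, j) * form_at \<omega> x m l) / (x $ j * dF l x)"
  by (rule pairing_eq[OF xK _ _ jl])
   (use vector_form_of_in[OF h] xK wedge_formsD(2)[OF cot.Val_wedge[OF W(1,3)] x] in "auto simp: vector_forms_def")
 show ?thesis unfolding 1 2 3 5 4[symmetric] by (simp only: mult.assoc)
qed

text \<open>The default values are those of the sheaf of homomorphisms, separately for the outer and for the inner
  family.\<close>

definition fol_of where
 "fol_of k P = (%V e. if openX V & Reg (- k) V e then (%W \<omega>. if openX W & W \<subseteq> V & \<omega> \<in> carrier (sec Om W)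
   then (%x. e x * pairing x (matrix_at P x) (form_at \<omega> x)) else undefined) else undefined)"

lemma pairing_zero: "pairing x P (%i j. 0) = 0"
 using pairing_linear(2)[of x P 0 "%i j. 0"] by simp

lemma pairing_off: "openX W ==> \<omega> \<in> carrier (sec Om W) ==> x \<notin> over W ==> pairing x P (form_at \<omega> x) = 0"
 by (simp add: cot.Val_off[of \<omega> W] pairing_zero)

lemma Reg_pairing:
 assumes P: "P \<in> vector_forms k" and V: "openX V" "Reg (- k) V e" and W: "openX W" "W \<subseteq> V" "\<omega> \<in> carrier (sec Om W)"
 shows "Reg 0 W (%x. e x * pairing x (matrix_at P x) (form_at \<omega> x))"
proof (rule Reg_glue[OF W(1)])
 fix x assume x: "x \<in> over W"
 have xK: "x \<in> K" by (rule openX_cone_subset[OF W(1) x])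
 obtain j l a b where jl: "x $ j ~= 0" "dF l x ~= 0" and "UNIV = {j, l, a, b :: 4}"
  using good_indices[OF xK] by metis
 let ?W = "W \<inter> chart j l"
 have W': "openX ?W" "?W \<subseteq> chart j l" "?W \<subseteq> W" "?W \<subseteq> V" "?W \<subseteq> axis j"
  using W open_chart[of j l] chart_axis[of j l] by auto
 have xW: "x \<in> over ?W" using cone_Int[OF W(1) open_chart] x jl xK by (simp add: cone_chart)
 have z: "z \<in> K" "z $ j ~= 0" "dF l z ~= 0" "z \<in> over W" if "z \<in> over ?W" for z
  using over_mono[OF W'(2)] over_mono[OF W'(3)] that by (auto simp: cone_chart)
 have P': "Reg (k + 2) total (%x. P (x, i, j))" "x \<in> K ==> wedge_cond (grad x) x (matrix_at P x)" for x i j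
  using P by (auto simp: vector_forms_def)
 let ?t = "%z. rst ?W e z * (\<Sum>c\<in>UNIV. rst ?W (%x. P (x, c, j)) z * rst ?W (%x. cot.Val \<omega> (x, c, l)) z) *
  (rst ?W (%z. z $ j powi (-1)) z * inverse (rst ?W (dF l) z))"
 have R1: "Reg (- k) ?W (rst ?W e)" by (rule Reg_rst[OF V(1) W'(1) over_mono[OF W'(4)] V(2)])
 have R2: "Reg (k + 2) ?W (rst ?W (%x. P (x, c, j)))" for c
  by (rule Reg_rst[OF openX_total W'(1) over_mono[OF openX_subset[OF W'(1)]] P'(1)])
 have R3: "Reg (0 + 2) ?W (rst ?W (%x. cot.Val \<omega> (x, c, l)))" for c
  by (rule Reg_rst[OF W(1) W'(1) over_mono[OF W'(3)] wedge_formsD(1)[OF cot.Val_wedge[OF W(1,3)]]])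
 have R4: "Reg 3 ?W (rst ?W (dF l))" by (rule Reg_form[OF W'(1) homogeneous_dF]) simp
 have R5: "Reg (- 3) ?W (%z. inverse (rst ?W (dF l) z))"
  by (rule Reg_inverse[OF W'(1) R4]) (use z in "auto simp: rst_def")
 have R6: "Reg (- 4) ?W (%z. rst ?W (%z. z $ j powi (-1)) z * inverse (rst ?W (dF l) z))"
  by (rule Reg_mult[OF W'(1) Reg_var_power[OF W'(1,5)] R5]) simp
 have R7: "Reg (k + 4) ?W (%z. \<Sum>c\<in>UNIV. rst ?W (%x. P (x, c, j)) z * rst ?W (%x. cot.Val \<omega> (x, c, l)) z)"
  by (rule Reg_sum[OF W'(1)], rule Reg_mult[OF W'(1) R2 R3]) simp
 have R8: "Reg 4 ?W (%z. rst ?W e z * (\<Sum>c\<in>UNIV. rst ?W (%x. P (x, c, j)) z * rst ?W (%x. cot.Val \<omega> (x, c, l)) z))"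
  by (rule Reg_mult[OF W'(1) R1 R7]) simp
 have t: "Reg 0 ?W ?t" by (rule Reg_mult[OF W'(1) R8 R6]) simp
 have "e y * pairing y (matrix_at P y) (form_at \<omega> y) = ?t y" if y: "y \<in> over ?W" for y
  using y z(2,3)[OF y] pairing_eq[OF z(1)[OF y] P'(2)[OF z(1)[OF y]] wedge_formsD(2)[OF cot.Val_wedge[OF W(1,3)] z(4)[OF y]] z(2,3)[OF y]]
  by (simp add: rst_def power_int_minus divide_inverse)
 then show "\<exists>V t. openX V & x \<in> over V & over V \<subseteq> over W & Reg 0 V t &
   (\<forall>z\<in>over V. e z * pairing z (matrix_at P z) (form_at \<omega> z) = t z)"
  using t W'(1) xW over_mono[OF W'(3)] by (intro exI[of _ ?W] exI[of _ ?t] conjI ballI)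
qed (simp add: pairing_off[OF W(1,3)])

lemma fol_of_in:
 assumes P: "P \<in> vector_forms k" shows "fol_of k P \<in> carrier (sec (Fol k) total)"
proof -
 have comp: "fol_of k P V e \<in> carrier (sec Th V)" if V: "openX V" "Reg (- k) V e" for V e
  unfolding hom_sheaf_carrier
 proof (intro conjI allI impI)
  fix W \<omega> assume n: "\<not> (openX W & W \<subseteq> V & \<omega> \<in> carrier (sec Om W))"
  show "fol_of k P V e W \<omega> = undefined" unfolding fol_of_def using V n by (simp only: simp_thms if_True if_False)
 next
  fix W assume "openX W & W \<subseteq> V"
  then have W: "openX W" "W \<subseteq> V" by auto
  have f: "fol_of k P V e W \<omega> = (%x. e x * pairing x (matrix_at P x) (form_at \<omega> x))" if "\<omega> \<in> carrier (sec Om W)" for \<omega>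
   using V W that by (simp add: fol_of_def)
  show "fol_of k P V e W \<in> module_hom (OX W) (sec Om W) (OX W)"
   unfolding module_hom_def
  proof (intro CollectI conjI allI impI)
   show "fol_of k P V e W \<in> carrier (sec Om W) \<rightarrow> carrier (OX W)"
    using Reg_pairing[OF P V W] by (auto simp: f carrier_OX)
  next
   fix \<omega> \<omega>' assume a: "\<omega> \<in> carrier (sec Om W) & \<omega>' \<in> carrier (sec Om W)"
   show "fol_of k P V e W (\<omega> \<oplus>\<^bsub>sec Om W\<^esub> \<omega>') = fol_of k P V e W \<omega> \<oplus>\<^bsub>OX W\<^esub> fol_of k P V e W \<omega>'"
    using a by (simp add: f cot.SP_add[OF W(1)] pairing_linear algebra_simps)
  next
   fix b \<omega> assume b: "b \<in> carrier (OX W) & \<omega> \<in> carrier (sec Om W)"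
   then have "Reg 0 W b" by (simp add: carrier_OX)
   then show "fol_of k P V e W (b \<odot>\<^bsub>sec Om W\<^esub> \<omega>) = b \<odot>\<^bsub>OX W\<^esub> fol_of k P V e W \<omega>"
    using b by (simp add: f cot.SP_smult[OF W(1)] pairing_linear OX_smult algebra_simps)
  qed
 next
  fix W W' \<omega> assume "(openX W & W \<subseteq> V & \<omega> \<in> carrier (sec Om W)) & openX W' & W' \<subseteq> W"
  then have W: "openX W" "W \<subseteq> V" "\<omega> \<in> carrier (sec Om W)" "openX W'" "W' \<subseteq> W" by auto
  note r = cot.SP_res[OF W(1,4,5,3)]
  have "e x * pairing x (matrix_at P x) (form_at (res Om W W' \<omega>) x) = rst W' (%x. e x * pairing x (matrix_at P x) (form_at \<omega> x)) x" for x
   using pairing_off[OF W(4) r(1), of x] by (cases "x \<in> over W'") (simp_all add: rst_def r(2))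
  then show "fol_of k P V e W' (res Om W W' \<omega>) = res (str X) W W' (fol_of k P V e W \<omega>)"
   using V W r(1) by (auto simp: fol_of_def)
 qed
 show ?thesis unfolding hom_sheaf_carrier[of "fol_of k P"]
 proof (intro conjI allI impI)
  fix V e assume "\<not> (openX V & V \<subseteq> total & e \<in> carrier (sec (twist F (- k)) V))"
  then show "fol_of k P V e = undefined" using openX_subset[of V] by (auto simp: fol_of_def)
 next
  fix V assume "openX V & V \<subseteq> total"
  then have V: "openX V" by simp
  show "fol_of k P V \<in> module_hom (OX V) (sec (twist F (- k)) V) (sec Th V)"
   unfolding module_hom_def
  proof (intro CollectI conjI allI impI)
   show "fol_of k P V \<in> carrier (sec (twist F (- k)) V) \<rightarrow> carrier (sec Th V)" using comp[OF V] by blast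
  next
   fix e e' assume "Reg (- k) V e & Reg (- k) V e'"
   then show "fol_of k P V (e \<oplus>\<^bsub>sec (twist F (- k)) V\<^esub> e') = fol_of k P V e \<oplus>\<^bsub>sec Th V\<^esub> fol_of k P V e'"
    using V Reg_add[OF V] by (auto simp: fol_of_def hom_sheaf_simps fun_eq_iff algebra_simps)
  next
   fix b e assume "b \<in> carrier (OX V) & Reg (- k) V e"
   then have b: "Reg 0 V b" "Reg (- k) V e" by (simp_all add: carrier_OX)
   have be: "Reg (- k) V (%x. b x * e x)" by (rule Reg_mult[OF V b]) simp
   have "b x * e x * pairing x (matrix_at P x) (form_at \<omega> x) = rst W b x * (e x * pairing x (matrix_at P x) (form_at \<omega> x))"
    if "openX W" "\<omega> \<in> carrier (sec Om W)" for W \<omega> x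
    using pairing_off[OF that, of x] by (cases "x \<in> over W") (simp_all add: rst_def)
   then show "fol_of k P V (b \<odot>\<^bsub>sec (twist F (- k)) V\<^esub> e) = b \<odot>\<^bsub>sec Th V\<^esub> fol_of k P V e"
    using V b be by (auto simp: fol_of_def hom_sheaf_simps OX_smult fun_eq_iff)
  qed
 next
  fix V V' e assume "(openX V & V \<subseteq> total & e \<in> carrier (sec (twist F (- k)) V)) & openX V' & V' \<subseteq> V"
  then have V: "openX V" "Reg (- k) V e" "openX V'" "V' \<subseteq> V" by auto
  have e': "Reg (- k) V' (rst V' e)" by (rule Reg_rst[OF V(1,3) over_mono[OF V(4)] V(2)])
  have "rst V' e x * pairing x (matrix_at P x) (form_at \<omega> x) = e x * pairing x (matrix_at P x) (form_at \<omega> x)"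
   if "openX W" "W \<subseteq> V'" "\<omega> \<in> carrier (sec Om W)" for W \<omega> x
   using pairing_off[OF that(1,3), of x] over_mono[OF that(2)] by (cases "x \<in> over W") (auto simp: rst_def)
  then show "fol_of k P V' (res (twist F (- k)) V V' e) = res Th V V' (fol_of k P V e)"
   using V e' by (auto simp: fol_of_def hom_sheaf_simps fun_eq_iff)
 qed
qed

lemma fol_of_vector_form:
 assumes h: "h \<in> carrier (sec (Fol k) total)" shows "fol_of k (vector_form_of k h) = h"
proof (rule Fol_ext[OF fol_of_in[OF vector_form_of_in[OF h]] h])
 fix V e W \<omega> assume d: "hom_dom k V e W \<omega>"
 then have W: "openX W" "\<omega> \<in> carrier (sec Om W)" by (auto simp: hom_dom_def)
 show "fol_of k (vector_form_of k h) V e W \<omega> = h V e W \<omega>"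
 proof
  fix x
  have "fol_of k (vector_form_of k h) V e W \<omega> x = e x * pairing x (matrix_at (vector_form_of k h) x) (form_at \<omega> x)"
   using d by (simp add: fol_of_def hom_dom_def)
  also have "\<dots> = h V e W \<omega> x"
   using Fol_formula[OF h d, of x] pairing_off[OF W, of x] Reg_off[OF W(1) Fol_rules(1)[OF h d], of x]
   by (cases "x \<in> over W") auto
  finally show "fol_of k (vector_form_of k h) V e W \<omega> x = h V e W \<omega> x" .
 qed
qed

text \<open>Pairing \<open>P\<close> with \<open>du\<^sub>c \<and> dF\<close> returns the column
  \<open>P\<^sub>c\<^sub>j\<close> up to a power of \<open>x\<^sub>j\<close>, and the cyclic relation recovers the
  matrix from this column.\<close>

lemma vector_form_of_fol:
 assumes P: "P \<in> vector_forms k" shows "vector_form_of k (fol_of k P) = P"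
proof
 fix y :: "(complex ^ 4) \<times> 4 \<times> 4"
 obtain x i i' where y: "y = (x, i, i')" by (cases y)
 show "vector_form_of k (fol_of k P) y = P y"
 proof (cases "x \<in> K")
  case False
  have "Reg (k + 2) total (%x. P (x, i, i'))" using P by (simp add: vector_forms_def)
  from Reg_off[OF openX_total this, of x] False show ?thesis by (simp add: y vector_form_of_def)
 next
  case x: True
  have w: "wedge_cond (grad x) x (matrix_at P x)" using P x by (simp add: vector_forms_def)
  obtain j l a b where jl: "x $ j ~= 0" "dF l x ~= 0" and "UNIV = {j, l, a, b :: 4}"
   using good_indices[OF x] by metis
  let ?D = "axis j"
  have xD: "x \<in> over ?D" using x jl by (simp add: cone_axis)
  note cf = chart_form(1)[OF open_axis subset_refl]
  have Pjj: "P (x, j, j) = 0" using wedge_condD(1)[OF w, of j j] by simp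
  have fv: "frame_value (fol_of k P) k j c x = x $ j powi (- k) * (P (x, c, j) / (x $ j * x $ j))" for c
  proof -
   have "frame_value (fol_of k P) k j c x = x $ j powi (- k) * pairing x (matrix_at P x) (form_at (chart_form j c ?D) x)"
    using xD open_axis cf Reg_var_power[OF open_axis subset_refl]
    by (simp add: frame_value_def fol_of_def rst_def)
   also have "pairing x (matrix_at P x) (form_at (chart_form j c ?D) x) = (\<Sum>m\<in>UNIV. P (x, m, j) * form_at (chart_form j c ?D) x m l) / (x $ j * dF l x)"
    by (rule pairing_eq[OF x w wedge_formsD(2)[OF cot.Val_wedge[OF open_axis cf] xD] jl])
   also have "(\<Sum>m\<in>UNIV. P (x, m, j) * form_at (chart_form j c ?D) x m l)
     = (\<Sum>m\<in>UNIV. dF l x / x $ j * ((if m = c then P (x, m, j) else 0) - (if m = j then x $ c / x $ j * P (x, m, j) else 0)) - cdiff j c x l * (dF m x * P (x, m, j)))"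
    unfolding chart_form_value[OF xD] dwedge_coordinate_axis[OF xD]
    by (rule sum.cong[OF refl]) (simp add: cdiff_def[of j c x m for m] diff_divide_distrib algebra_simps)
   also have "\<dots> = dF l x / x $ j * (P (x, c, j) - x $ c / x $ j * P (x, j, j)) - cdiff j c x l * (\<Sum>m\<in>UNIV. dF m x * P (x, m, j))"
    by (simp only: sum_subtractf sum_distrib_left[symmetric] sum.delta finite if_True UNIV_I)
   also have "(\<Sum>m\<in>UNIV. dF m x * P (x, m, j)) = 0" using wedge_condD(2)[OF w, of j] by (simp add: grad_def)
   finally show ?thesis using jl by (simp add: Pjj)
  qed
  have "x $ i * P (x, i', j) + x $ i' * (- P (x, i, j)) + x $ j * P (x, i, i') = 0"
   using wedge_condD(3)[OF w, of i i' j] by (simp only: wedge_condD(1)[OF w, of j i])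
  then have rel: "x $ i' * P (x, i, j) - x $ i * P (x, i', j) = x $ j * P (x, i, i')"
   by (simp add: algebra_simps)
  have "vector_form_of k (fol_of k P) y = x $ j powi (k + 1) * x $ j powi (- k) * (x $ i' * P (x, i, j) - x $ i * P (x, i', j)) / (x $ j * x $ j)"
   unfolding y vector_form_of_eq[OF fol_of_in[OF P] x jl(1)] frame_matrix_def fv by (simp add: algebra_simps diff_divide_distrib)
  also have "\<dots> = P y" unfolding rel y using jl(1) by (simp add: power_int_add_1 power_int_minus)
  finally show ?thesis .
 qed
qed

lemma pairing_linear_left: "pairing x (%i j. P i j + Q i j) M = pairing x P M + pairing x Q M" "pairing x (%i j. a * P i j) M = a * pairing x P M"
 by (simp add: pairing_def split_beta Let_def distrib_right sum.distrib add_divide_distrib)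
  (simp add: pairing_def split_beta Let_def sum_distrib_left mult_ac)

text \<open>The module operations are transported through \<open>fol_of\<close>, which also shows that the sections
  are closed under them.\<close>

lemma foliation_dim:
 assumes n: "has_dim (wedge_forms k total) n"
 shows "fin_dim_space (H0 X (foliation_sheaf X (twist F (- k))))" "h0 X (foliation_sheaf X (twist F (- k))) = n"
proof -
 let ?H = "H0 X (Fol k)" and ?M = "sec (Fol k) total"
 have dim: "has_dim (vector_forms k) n" by (rule vector_forms_dim[OF n])
 then have lin: "linear_subspace (vector_forms k)" by (simp add: has_dim_def)
 have fs: "foliation_sheaf X (twist F (- k)) = Fol k"
  by (simp add: foliation_sheaf_def tangent_sheaf_def cotangent_sheaf_def)
 have H: "carrier ?H = carrier ?M" "a \<oplus>\<^bsub>?H\<^esub> b = a \<oplus>\<^bsub>?M\<^esub> b" "\<zero>\<^bsub>?H\<^esub> = \<zero>\<^bsub>?M\<^esub>"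
   "c \<odot>\<^bsub>?H\<^esub> a = rst total (%x. c) \<odot>\<^bsub>?M\<^esub> a" for a b c
  by (simp_all add: H0_def Let_def topspace_X cst_X)
 let ?v = "vector_form_of k"
 have zero: "\<zero>\<^bsub>?M\<^esub> = fol_of k (%j. 0)"
 proof -
  have "pairing x (%i j. 0) M = 0" for x M using pairing_linear_left(2)[of x 0 "%i j. 0" M] by simp
  then show ?thesis using openX_subset by (auto simp: hom_sheaf_simps fol_of_def fun_eq_iff)
 qed
 have add: "fol_of k P \<oplus>\<^bsub>?M\<^esub> fol_of k Q = fol_of k (%j. P j + Q j)" for P Q
  using openX_subset by (auto simp: hom_sheaf_simps fol_of_def fun_eq_iff pairing_linear_left algebra_simps)
 have smult: "rst total (%x. c) \<odot>\<^bsub>?M\<^esub> fol_of k P = fol_of k (%j. c * P j)" for c P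
 proof -
  have "rst W (rst V (rst total (%x. c))) x * (e x * pairing x (matrix_at P x) (form_at \<omega> x)) = e x * (c * pairing x (matrix_at P x) (form_at \<omega> x))"
   if "openX V" "openX W" "W \<subseteq> V" "\<omega> \<in> carrier (sec Om W)" for V W \<omega> e x
   using pairing_off[OF that(2,4), of x] over_mono[OF that(3)] openX_cone_subset[OF that(2), of x]
   by (cases "x \<in> over W") (auto simp: rst_def)
  then show ?thesis using openX_subset by (auto simp: hom_sheaf_simps fol_of_def fun_eq_iff pairing_linear_left OX_smult)
 qed
 have z: "\<zero>\<^bsub>?H\<^esub> = fol_of k (%j. 0)" unfolding H by (rule zero)
 have a: "h \<oplus>\<^bsub>?H\<^esub> h' = fol_of k (%j. ?v h j + ?v h' j)" if "h \<in> carrier ?H" "h' \<in> carrier ?H" for h h'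
  using add[of "?v h" "?v h'"] that unfolding H by (simp add: fol_of_vector_form)
 have s: "c \<odot>\<^bsub>?H\<^esub> h = fol_of k (%j. c * ?v h j)" if "h \<in> carrier ?H" for c h
  using smult[of c "?v h"] that unfolding H by (simp add: fol_of_vector_form)
 have v: "?v h \<in> vector_forms k" if "h \<in> carrier ?H" for h using vector_form_of_in that unfolding H .
 have inj: "inj_on ?v (carrier ?H)" unfolding H by (rule inj_on_inverseI[where g = "fol_of k"]) (rule fol_of_vector_form)
 have im: "?v ` carrier ?H = vector_forms k"
 proof
  show "?v ` carrier ?H \<subseteq> vector_forms k" using v by blast
  show "vector_forms k \<subseteq> ?v ` carrier ?H"
  proof
   fix P assume P: "P \<in> vector_forms k"
   show "P \<in> ?v ` carrier ?H" unfolding H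
    by (rule image_eqI[where x = "fol_of k P"]) (simp_all add: vector_form_of_fol[OF P] fol_of_in[OF P])
  qed
 qed
 note L = linear_subspaceD[OF lin]
 have c1: "h \<oplus>\<^bsub>?H\<^esub> h' \<in> carrier ?H" "?v (h \<oplus>\<^bsub>?H\<^esub> h') = (%j. ?v h j + ?v h' j)" if "h \<in> carrier ?H" "h' \<in> carrier ?H" for h h'
  using fol_of_in[OF L(2)[OF v[OF that(1)] v[OF that(2)]]] vector_form_of_fol[OF L(2)[OF v[OF that(1)] v[OF that(2)]]]
  unfolding a[OF that] H(1) .
 have c0: "\<zero>\<^bsub>?H\<^esub> \<in> carrier ?H" "?v \<zero>\<^bsub>?H\<^esub> = (%j. 0)"
  using fol_of_in[OF L(1)] vector_form_of_fol[OF L(1)] unfolding z H(1) .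
 have c2: "c \<odot>\<^bsub>?H\<^esub> h \<in> carrier ?H" "?v (c \<odot>\<^bsub>?H\<^esub> h) = (%j. c * ?v h j)" if "h \<in> carrier ?H" for c h
  using fol_of_in[OF L(3)[OF v[OF that]]] vector_form_of_fol[OF L(3)[OF v[OF that]]]
  unfolding s[OF that] H(1) .
 show "fin_dim_space (H0 X (foliation_sheaf X (twist F (- k))))" "h0 X (foliation_sheaf X (twist F (- k))) = n"
  unfolding fs h0_def by (rule vectorspace_transport[OF dim inj im], (fact c1 c0 c2)+)+
qed

end

theorem theorem2p3:
  fixes F :: form and d :: nat
  assumes "smooth_hypersurface 4 F"
  defines "X \<equiv> hypersurface F"
  defines "Omega_d \<equiv> tensor_sheaf X (cotangent_sheaf X) (twist F (int d - 1))"
  defines "Fol_d \<equiv> foliation_sheaf X (twist F (1 - int d))"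
  shows "fin_dim_space (H0 X Fol_d) \<and> fin_dim_space (H0 X Omega_d) \<and>
    h0 X Fol_d = h0 X Omega_d \<and>
    int (h0 X Omega_d) =
      (if d < 3 then 0
       else if d = 3 then 6
       else if d = 4 then 20
       else if d = 5 then 45
       else 4 * (int d)\<^sup>2 - 8 * int d - 16)"
proof -
 interpret smooth_quartic F by unfold_locales (rule assms(1))
 define k where "k = int d - 1"
 have k: "1 - int d = - k" by (simp add: k_def)
 have "\<exists>n. has_dim (wedge_forms k total) n & int n =
   (if d < 3 then 0 else if d = 3 then 6 else if d = 4 then 20 else if d = 5 then 45 else 4 * (int d)\<^sup>2 - 8 * int d - 16)"
 proof (cases "d < 2")
  case True
  then have "k \<le> 0" by (simp add: k_def)
  then show ?thesis using wedge_forms_nonpos[of k] True by auto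
 next
  case False
  then have "k \<ge> 1" by (simp add: k_def)
  then obtain n where n: "has_dim (wedge_forms k total) n"
    "n + card (exponents k) + card (exponents (k - 4)) = 4 * card (exponents (k - 1))"
   using wedge_forms_dim by blast
  then have "int n = 4 * int (card (exponents (k - 1))) - int (card (exponents k)) - int (card (exponents (k - 4)))"
   by linarith
  also have "\<dots> = (if d < 3 then 0 else if d = 3 then 6 else if d = 4 then 20 else if d = 5 then 45 else 4 * (int d)\<^sup>2 - 8 * int d - 16)"
   using False unfolding card_exponents k_def by (auto simp: power2_eq_square algebra_simps)
  finally show ?thesis using n(1) by blast
 qed
 then obtain n where n: "has_dim (wedge_forms k total) n" "int n =
   (if d < 3 then 0 else if d = 3 then 6 else if d = 4 then 20 else if d = 5 then 45 else 4 * (int d)\<^sup>2 - 8 * int d - 16)"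
  by blast
 show ?thesis
  unfolding Fol_d_def Omega_d_def X_def k k_def[symmetric] tensor_dim[OF n(1)] foliation_dim[OF n(1)]
  using tensor_dim(1)[OF n(1)] foliation_dim(1)[OF n(1)] n(2) by simp
qed

end
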